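(* Let $k\ge1$, $\boldsymbol h\in\mathrm{ord}_p(\mathcal O_{\mathcal K}\setminus\{0\})^k$, $\boldsymbol d\in\mathbb Z^k$, let $(M,v_M)$ be a $\mathcal K$-Banach space and let $\mathbf J$ be an integral domain which is a finite free extension of $\mathcal O_{\mathcal K}[[X_1,\dots,X_k]]$. If $f\in\mathcal H_{\boldsymbol h}(M)\otimes_{\mathcal O_{\mathcal K}[[X_1,\dots,X_k]]}\mathbf J$ satisfies $\kappa(f)=0$ for each $\kappa\in\mathfrak X_{\mathbf J}^{[\boldsymbol d,\boldsymbol d+\lfloor\boldsymbol h\rfloor]}$, then $f=0$.
   Context: $p$ is a prime, $\mathrm{ord}_p$ is the valuation on $\mathbb C_p$ with $\mathrm{ord}_p(p)=1$, $\mathcal K\subset\mathbb C_p$ is a complete subfield with ring of integers $\mathcal O_{\mathcal K}$. A $\mathcal K$-Banach space $(M,v_M)$ is a $\mathcal K$-vector space complete for a valuation $v_M:M\to\mathbb R\cup\{+\infty\}$, i.e. $v_M(x)=+\infty\iff x=0$, $v_M(x+y)\ge\min\{v_M(x),v_M(y)\}$, $v_M(\lambda x)=\mathrm{ord}_p(\lambda)+v_M(x)$. For a finite extension $\mathcal L/\mathcal K$, $M_{\mathcal L}=M\otimes_{\mathcal K}\mathcal L$ with the tensor product valuation. $M[[X_1,\dots,X_k]]=\prod_{\boldsymbol n\in\mathbb Z_{\ge0}^k}M$, a module over $\mathcal K[[X_1,\dots,X_k]]$ in the obvious way. $\ell(n)$ is the smallest non-negative integer $m$ with $p^m>n$, $\ell(\boldsymbol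 n)=(\ell(n_i))_i$, $\langle\boldsymbol a,\boldsymbol b\rangle_k=\sum a_ib_i$, and $$\mathcal H_{\boldsymbol h}(M)=\{(m_{\boldsymbol n})_{\boldsymbol n}\in M[[X_1,\dots,X_k]]\mid\inf_{\boldsymbol n}\{v_M(m_{\boldsymbol n})+\langle\boldsymbol h,\ell(\boldsymbol n)\rangle_k\}>-\infty\}.$$ For $f=(m_{\boldsymbol n})\in\mathcal H_{\boldsymbol h}(M)$ and $\boldsymbol b\in\overline{\mathcal K}^k$ with $\mathrm{ord}_p(b_i)>0$, $f(\boldsymbol b)=\sum_{\boldsymbol n}m_{\boldsymbol n}\otimes\boldsymbol b^{\boldsymbol n}\in M_{\mathcal K(b_1,\dots,b_k)}$. $u_i$ ($1\le i\le k$) is a topological generator of $1+2p\mathbb Z_p$. For $\boldsymbol d\le\boldsymbol e$ in $\mathbb Z^k$ (componentwise), $[\boldsymbol d,\boldsymbol e]$ is the set of integer vectors between them, and $\mathfrak X_{\mathbf J}^{[\boldsymbol d,\boldsymbol e]}$ is the set of continuous $\mathcal O_{\mathcal K}$-algebra homomorphisms $\kappa:\mathbf J\to\overline{\mathcal K}$ with $\kappa(X_i)=u_i^{w_{\kappa,i}}\epsilon_{\kappa,i}-1$, $\boldsymbol w_\kappa\in[\boldsymbol d,\boldsymbol e]$, $\epsilon_{\kappa,i}\in\mu_{p^\infty}$. For $f=\sum_jf_j\otimes c_j$, $$\kappa(f)=\sum_jf_j(u_1^{w_{\kappa,1}}\epsilon_{\kappa,1}-1,\dots,u_k^{w_{\kappa,k}}\epsilon_{\kappa,k}-1)\kappa(c_j)\in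 M_{\mathcal K(\kappa(\mathbf J))}.$$ *)

theory Defs
  imports "HOL-Computational_Algebra.Polynomial" "HOL-Library.Extended_Real"
    "HOL-Library.Poly_Mapping" "HOL-Algebra.Algebra"
begin

section \<open>Valued abelian groups\<close>

definition is_valuation :: "('a, 'b) ring_scheme \<Rightarrow> ('a \<Rightarrow> ereal) \<Rightarrow> bool" where
  "is_valuation A v \<longleftrightarrow>
     (\<forall>x\<in>carrier A. v x \<noteq> - \<infinity>) \<and>
     (\<forall>x\<in>carrier A. v x = \<infinity> \<longleftrightarrow> x = \<zero>\<^bsub>A\<^esub>) \<and>
     (\<forall>x\<in>carrier A. \<forall>y\<in>carrier A. v (x \<oplus>\<^bsub>A\<^esub> y) \<ge> min (v x) (v y))"

definition val_complete :: "('a, 'b) ring_scheme \<Rightarrow> ('a \<Rightarrow> ereal) \<Rightarrow> bool" where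
  "val_complete A v \<longleftrightarrow>
     (\<forall>x. range x \<subseteq> carrier A \<longrightarrow>
        (\<forall>C::real. \<exists>N::nat. \<forall>m\<ge>N. \<forall>n\<ge>N. v (x m \<ominus>\<^bsub>A\<^esub> x n) > ereal C) \<longrightarrow>
        (\<exists>l\<in>carrier A. \<forall>C::real. \<exists>N. \<forall>n\<ge>N. v (x n \<ominus>\<^bsub>A\<^esub> l) > ereal C))"

text \<open>The sum of a (possibly infinite) family, as the limit of the net of finite partial sums.\<close>

definition val_sum :: "('a, 'b) ring_scheme \<Rightarrow> ('a \<Rightarrow> ereal) \<Rightarrow> ('i \<Rightarrow> 'a) \<Rightarrow> 'a" where
  "val_sum A v g = (THE s. s \<in> carrier A \<and>
     (\<forall>C::real. \<exists>F0. finite F0 \<and>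
        (\<forall>F. finite F \<and> F0 \<subseteq> F \<longrightarrow> v ((\<Oplus>\<^bsub>A\<^esub>i\<in>F. g i) \<ominus>\<^bsub>A\<^esub> s) > ereal C)))"


section \<open>The field of \<open>p\<close>-adic complex numbers and its subfields\<close>

text \<open>
  A subset \<open>S\<close> of a field as a record. The scalar multiplication is the multiplication, so that an
  extension of a subfield \<open>K\<close> can be used both as a ring and as a \<open>K\<close>-algebra.
\<close>

definition sub_field_of :: "'c::field set \<Rightarrow> ('c, 'c) module" where
  "sub_field_of S = \<lparr>carrier = S, monoid.mult = (*), one = 1, ring.zero = 0, ring.add = (+), smult = (*)\<rparr>"

definition val_closure :: "('c::field \<Rightarrow> ereal) \<Rightarrow> 'c set \<Rightarrow> 'c set" where
  "val_closure ordp S = {x. \<forall>C::real. \<exists>y\<in>S. ordp (x - y) > ereal C}"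

definition alg_closure_in :: "'c::field set \<Rightarrow> 'c set" where
  "alg_closure_in S = {x. \<exists>q :: 'c poly. q \<noteq> 0 \<and> (\<forall>i. Polynomial.coeff q i \<in> S) \<and> Polynomial.poly q x = 0}"

text \<open>
  \<open>is_Cp p ordp\<close>: the type \<open>'c\<close> with the valuation \<open>ordp\<close> is the completion of an algebraic closure
  of \<open>\<rat>\<^sub>p\<close>, normalised by \<open>ordp p = 1\<close>. Here \<open>\<rat>\<^sub>p\<close> is the closure of \<open>\<rat>\<close>; the normalisation forces
  \<open>ordp\<close> to be the \<open>p\<close>-adic valuation on \<open>\<rat>\<close>. Since \<open>'c\<close> is algebraically closed (as \<open>\<complex>\<^sub>p\<close> is),
  the elements algebraic over \<open>\<rat>\<^sub>p\<close> form an algebraic closure of \<open>\<rat>\<^sub>p\<close>.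
\<close>

definition is_Cp :: "nat \<Rightarrow> ('c::{alg_closed_field, field_char_0} \<Rightarrow> ereal) \<Rightarrow> bool" where
  "is_Cp p ordp \<longleftrightarrow>
     is_valuation (sub_field_of UNIV) ordp \<and>
     (\<forall>x y. ordp (x * y) = ordp x + ordp y) \<and>
     ordp (of_nat p) = 1 \<and>
     val_complete (sub_field_of UNIV) ordp \<and>
     val_closure ordp (alg_closure_in (val_closure ordp \<rat>)) = UNIV"

definition ring_of_integers :: "('c \<Rightarrow> ereal) \<Rightarrow> 'c set \<Rightarrow> 'c set" where
  "ring_of_integers ordp K = {x \<in> K. ordp x \<ge> 0}"

text \<open>\<open>u\<close> is a topological generator of \<open>1 + 2p\<int>\<^sub>p\<close>, where \<open>\<int>\<^sub>p\<close> is the closure of \<open>\<int>\<close>.\<close>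

definition top_generator :: "nat \<Rightarrow> ('c::field \<Rightarrow> ereal) \<Rightarrow> 'c \<Rightarrow> bool" where
  "top_generator p ordp u \<longleftrightarrow>
     (let U = (\<lambda>z. 1 + 2 * of_nat p * z) ` val_closure ordp \<int>
      in u \<in> U \<and> U \<subseteq> val_closure ordp (range (\<lambda>n::int. u powi n)))"

definition mu_p_inf :: "nat \<Rightarrow> 'c::field set" where
  "mu_p_inf p = {\<epsilon>. \<exists>n. \<epsilon> ^ (p ^ n) = 1}"


section \<open>Banach spaces\<close>

definition banach_space ::
  "('c::field \<Rightarrow> ereal) \<Rightarrow> 'c set \<Rightarrow> ('c, 'm) module \<Rightarrow> ('m \<Rightarrow> ereal) \<Rightarrow> bool" where
  "banach_space ordp K M v \<longleftrightarrow>
     module (sub_field_of K) M \<and> is_valuation M v \<and>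
     (\<forall>a\<in>K. \<forall>x\<in>carrier M. v (a \<odot>\<^bsub>M\<^esub> x) = ordp a + v x) \<and>
     val_complete M v"


section \<open>Tensor products\<close>

text \<open>
  For an \<open>R\<close>-module \<open>A\<close> and an \<open>R\<close>-algebra \<open>B\<close>, the tensor product \<open>A \<otimes>\<^sub>R B\<close> is the free abelian group
  on \<open>A \<times> B\<close> modulo the subgroup generated by the usual relations; it is regarded as a \<open>B\<close>-module.
  Like for every module record, the fields \<open>mult\<close> and \<open>one\<close> are irrelevant.
\<close>

definition tensor_rels ::
  "('r, 'x) ring_scheme \<Rightarrow> ('r, 'a) module \<Rightarrow> ('r, 'b) module \<Rightarrow> ('a \<times> 'b \<Rightarrow>\<^sub>0 int) set" where
  "tensor_rels R A B =
     {frag_of (a \<oplus>\<^bsub>A\<^esub> a', b) - frag_of (a, b) - frag_of (a', b) | a a' b.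
        a \<in> carrier A \<and> a' \<in> carrier A \<and> b \<in> carrier B} \<union>
     {frag_of (a, b \<oplus>\<^bsub>B\<^esub> b') - frag_of (a, b) - frag_of (a, b') | a b b'.
        a \<in> carrier A \<and> b \<in> carrier B \<and> b' \<in> carrier B} \<union>
     {frag_of (r \<odot>\<^bsub>A\<^esub> a, b) - frag_of (a, r \<odot>\<^bsub>B\<^esub> b) | r a b.
        r \<in> carrier R \<and> a \<in> carrier A \<and> b \<in> carrier B}"

definition tensor_class ::
  "('r, 'x) ring_scheme \<Rightarrow> ('r, 'a) module \<Rightarrow> ('r, 'b) module \<Rightarrow>
   ('a \<times> 'b \<Rightarrow>\<^sub>0 int) \<Rightarrow> ('a \<times> 'b \<Rightarrow>\<^sub>0 int) set" where
  "tensor_class R A B z =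
     (let F = free_Abelian_group (carrier A \<times> carrier B)
      in generate F (tensor_rels R A B) #>\<^bsub>F\<^esub> z)"

definition tensor ::
  "('r, 'x) ring_scheme \<Rightarrow> ('r, 'a) module \<Rightarrow> ('r, 'b) module \<Rightarrow>
   ('b, ('a \<times> 'b \<Rightarrow>\<^sub>0 int) set) module" where
  "tensor R A B =
     (let F = free_Abelian_group (carrier A \<times> carrier B);
          Q = F Mod generate F (tensor_rels R A B)
      in \<lparr>carrier = carrier Q, monoid.mult = undefined, one = undefined,
          ring.zero = \<one>\<^bsub>Q\<^esub>, ring.add = (\<lambda>x y. x \<otimes>\<^bsub>Q\<^esub> y),
          smult = (\<lambda>b Y. the_elem
            ((\<lambda>z. tensor_class R A B (frag_extend (\<lambda>(a, b'). frag_of (a, b \<otimes>\<^bsub>B\<^esub> b')) z)) ` Y))\<rparr>)"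

definition pure_tensor ::
  "('r, 'x) ring_scheme \<Rightarrow> ('r, 'a) module \<Rightarrow> ('r, 'b) module \<Rightarrow> 'a \<Rightarrow> 'b \<Rightarrow>
   ('a \<times> 'b \<Rightarrow>\<^sub>0 int) set" where
  "pure_tensor R A B a b = tensor_class R A B (frag_of (a, b))"

text \<open>
  The tensor product valuation: the supremum, over all ways of writing \<open>Y\<close> as a finite sum of pure
  tensors \<open>a \<otimes> b\<close>, of the minimum of \<open>v a + w b\<close>. (An element of the coset \<open>Y\<close> is such a way,
  and the infimum over its finite support is \<open>\<infinity>\<close> when the support is empty.)
\<close>

definition tensor_val ::
  "('a \<Rightarrow> ereal) \<Rightarrow> ('b \<Rightarrow> ereal) \<Rightarrow> ('a \<times> 'b \<Rightarrow>\<^sub>0 int) set \<Rightarrow> ereal" where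
  "tensor_val v w Y = (SUP z\<in>Y. INF (a, b)\<in>Poly_Mapping.keys z. v a + w b)"

abbreviation base_change ::
  "'c::field set \<Rightarrow> ('c, 'm) module \<Rightarrow> 'c set \<Rightarrow> ('c, ('m \<times> 'c \<Rightarrow>\<^sub>0 int) set) module" where
  "base_change K M L \<equiv> tensor (sub_field_of K) M (sub_field_of L)"


section \<open>Power series\<close>

text \<open>
  The variables are indexed by a finite type \<open>'n\<close>, so \<open>k = CARD('n) \<ge> 1\<close>, and multi-indices are
  functions \<open>'n \<Rightarrow> nat\<close>; order and subtraction of multi-indices are pointwise.
\<close>

definition mps_ring :: "'c::field set \<Rightarrow> (('n::finite \<Rightarrow> nat) \<Rightarrow> 'c) ring" where
  "mps_ring S =
     \<lparr>carrier = {a. range a \<subseteq> S},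
      monoid.mult = (\<lambda>a b n. \<Sum>i\<in>{..n}. a i * b (n - i)),
      one = (\<lambda>n. if n = (\<lambda>_. 0) then 1 else 0),
      ring.zero = (\<lambda>n. 0),
      ring.add = (\<lambda>a b n. a n + b n)\<rparr>"

definition mps_const :: "'c::field \<Rightarrow> ('n::finite \<Rightarrow> nat) \<Rightarrow> 'c" where
  "mps_const c = (\<lambda>n. if n = (\<lambda>_. 0) then c else 0)"

definition mps_X :: "'n::finite \<Rightarrow> ('n \<Rightarrow> nat) \<Rightarrow> 'c::field" where
  "mps_X i = (\<lambda>n. if n = (\<lambda>j. if j = i then 1 else 0) then 1 else 0)"

definition ell :: "nat \<Rightarrow> nat \<Rightarrow> nat" where
  "ell p n = (LEAST m. p ^ m > n)"

definition H_space ::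
  "nat \<Rightarrow> ('n::finite \<Rightarrow> real) \<Rightarrow> ('c::field, 'm) module \<Rightarrow> ('m \<Rightarrow> ereal) \<Rightarrow>
   (('n \<Rightarrow> nat) \<Rightarrow> 'c, ('n \<Rightarrow> nat) \<Rightarrow> 'm) module" where
  "H_space p h M v =
     \<lparr>carrier = {m. range m \<subseteq> carrier M \<and>
        (INF n. v (m n) + ereal (\<Sum>i\<in>UNIV. h i * real (ell p (n i)))) > - \<infinity>},
      monoid.mult = undefined, one = undefined,
      ring.zero = (\<lambda>n. \<zero>\<^bsub>M\<^esub>),
      ring.add = (\<lambda>m m' n. m n \<oplus>\<^bsub>M\<^esub> m' n),
      smult = (\<lambda>a m n. \<Oplus>\<^bsub>M\<^esub>i\<in>{..n}. a i \<odot>\<^bsub>M\<^esub> m (n - i))\<rparr>"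

text \<open>
  The value \<open>f(b) = \<Sum>\<^sub>n m\<^sub>n \<otimes> b\<^sup>n\<close>, formed in \<open>M\<^sub>L\<close> for any finite extension \<open>L\<close> of \<open>K\<close>
  containing all \<open>b i\<close>.
\<close>

definition mps_eval ::
  "('c::field \<Rightarrow> ereal) \<Rightarrow> 'c set \<Rightarrow> ('c, 'm) module \<Rightarrow> ('m \<Rightarrow> ereal) \<Rightarrow> 'c set \<Rightarrow>
   (('n::finite \<Rightarrow> nat) \<Rightarrow> 'm) \<Rightarrow> ('n \<Rightarrow> 'c) \<Rightarrow> ('m \<times> 'c \<Rightarrow>\<^sub>0 int) set" where
  "mps_eval ordp K M v L m b =
     val_sum (base_change K M L) (tensor_val v ordp)
       (\<lambda>n. pure_tensor (sub_field_of K) M (sub_field_of L) (m n) (\<Prod>i\<in>UNIV. b i ^ n i))"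


section \<open>Finite free extensions and arithmetic specialisations\<close>

definition finite_free :: "('r, 'x) ring_scheme \<Rightarrow> ('r, 'j) module \<Rightarrow> bool" where
  "finite_free R J \<longleftrightarrow>
     (\<exists>E. finite E \<and> E \<subseteq> carrier J \<and>
        (\<forall>x\<in>carrier J. \<exists>!a. a \<in> E \<rightarrow>\<^sub>E carrier R \<and> x = (\<Oplus>\<^bsub>J\<^esub>e\<in>E. a e \<odot>\<^bsub>J\<^esub> e)))"

text \<open>
  \<open>J\<close> carries the \<open>(p, X\<^sub>1, \<dots>, X\<^sub>k)\<close>-adic topology. For a basis of \<open>J\<close> this is the product topology,
  where the power series ring has the topology of coefficientwise \<open>p\<close>-adic convergence.
\<close>

definition pX_ideal :: "nat \<Rightarrow> (('n::finite \<Rightarrow> nat) \<Rightarrow> 'c::field, 'j) module \<Rightarrow> 'j set" where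
  "pX_ideal p J = genideal J
     (insert (mps_const (of_nat p) \<odot>\<^bsub>J\<^esub> \<one>\<^bsub>J\<^esub>) (range (\<lambda>i. mps_X i \<odot>\<^bsub>J\<^esub> \<one>\<^bsub>J\<^esub>)))"

definition pX_continuous ::
  "nat \<Rightarrow> ('c::field \<Rightarrow> ereal) \<Rightarrow> (('n::finite \<Rightarrow> nat) \<Rightarrow> 'c, 'j) module \<Rightarrow> ('j \<Rightarrow> 'c) \<Rightarrow> bool" where
  "pX_continuous p ordp J \<kappa> \<longleftrightarrow>
     (\<forall>x\<in>carrier J. \<forall>C::real. \<exists>N::nat. \<forall>y\<in>carrier J.
        y \<ominus>\<^bsub>J\<^esub> x \<in> ((\<lambda>I. ideal_prod J I (pX_ideal p J)) ^^ N) (carrier J) \<longrightarrow>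
        ordp (\<kappa> y - \<kappa> x) > ereal C)"

text \<open>The set \<open>\<XX>\<^sub>J\<close> of weights in \<open>[d, e]\<close>.\<close>

definition specialisations ::
  "nat \<Rightarrow> ('c::field \<Rightarrow> ereal) \<Rightarrow> 'c set \<Rightarrow> (('n::finite \<Rightarrow> nat) \<Rightarrow> 'c, 'j) module \<Rightarrow>
   ('n \<Rightarrow> 'c) \<Rightarrow> ('n \<Rightarrow> int) \<Rightarrow> ('n \<Rightarrow> int) \<Rightarrow> ('j \<Rightarrow> 'c) set" where
  "specialisations p ordp K J u d e =
     {\<kappa> \<in> ring_hom J (sub_field_of (alg_closure_in K)).
        (\<forall>c\<in>ring_of_integers ordp K. \<kappa> (mps_const c \<odot>\<^bsub>J\<^esub> \<one>\<^bsub>J\<^esub>) = c) \<and>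
        pX_continuous p ordp J \<kappa> \<and>
        (\<exists>w \<epsilon>. (\<forall>i. d i \<le> w i \<and> w i \<le> e i) \<and> (\<forall>i. \<epsilon> i \<in> mu_p_inf p) \<and>
           (\<forall>i. \<kappa> (mps_X i \<odot>\<^bsub>J\<^esub> \<one>\<^bsub>J\<^esub>) = u i powi w i * \<epsilon> i - 1))}"

definition value_field :: "'c::field set \<Rightarrow> ('r, 'j) module \<Rightarrow> ('j \<Rightarrow> 'c) \<Rightarrow> 'c set" where
  "value_field K J \<kappa> = generate_field (sub_field_of UNIV) (K \<union> \<kappa> ` carrier J)"

text \<open>
  \<open>\<kappa>(f) = \<Sum>\<^sub>j f\<^sub>j(b) \<kappa>(c\<^sub>j)\<close> for \<open>f = \<Sum>\<^sub>j f\<^sub>j \<otimes> c\<^sub>j\<close>, where \<open>b i = \<kappa>(X\<^sub>i) = u\<^sub>i\<^bsup>w\<^esup> \<epsilon>\<^sub>i - 1\<close>. The value is taken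
  in \<open>M\<^sub>L\<close> with \<open>L = K(\<kappa>(J))\<close> and does not depend on the representation of \<open>f\<close>.
\<close>

definition specialise ::
  "nat \<Rightarrow> ('c::field \<Rightarrow> ereal) \<Rightarrow> 'c set \<Rightarrow> ('c, 'm) module \<Rightarrow> ('m \<Rightarrow> ereal) \<Rightarrow>
   (('n::finite \<Rightarrow> nat) \<Rightarrow> 'c, 'j) module \<Rightarrow> ('n \<Rightarrow> real) \<Rightarrow> ('j \<Rightarrow> 'c) \<Rightarrow>
   ((('n \<Rightarrow> nat) \<Rightarrow> 'm) \<times> 'j \<Rightarrow>\<^sub>0 int) set \<Rightarrow> ('m \<times> 'c \<Rightarrow>\<^sub>0 int) set" where
  "specialise p ordp K M v J h \<kappa> f =
     (let R = mps_ring (ring_of_integers ordp K); H = H_space p h M v;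
          L = value_field K J \<kappa>; V = base_change K M L;
          b = (\<lambda>i. \<kappa> (mps_X i \<odot>\<^bsub>J\<^esub> \<one>\<^bsub>J\<^esub>))
      in THE y. \<exists>(r::nat) g c.
           (\<forall>j<r. g j \<in> carrier H \<and> c j \<in> carrier J) \<and>
           f = (\<Oplus>\<^bsub>tensor R H J\<^esub>j\<in>{..<r}. pure_tensor R H J (g j) (c j)) \<and>
           y = (\<Oplus>\<^bsub>V\<^esub>j\<in>{..<r}. \<kappa> (c j) \<odot>\<^bsub>V\<^esub> mps_eval ordp K M v L (g j) b))"

end

theory Submission
  imports Defs
begin

text \<open>
  Expanding in a basis \<open>E\<close> of \<open>J\<close> over the power series ring writes \<open>f\<close> as a sum of tensors
  \<open>\<phi> e \<otimes> e\<close> with \<open>\<phi> e\<close> in \<open>H\<close> (\<open>tensor_expansion\<close>), so all \<open>\<phi> e\<close> have to vanish. In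
  characteristic zero the trace form of the domain \<open>J\<close> is nondegenerate. Pairing with a trace-dual
  basis recovers each \<open>\<phi> e\<close> up to a common nonzero power series \<open>\<delta>\<close> (\<open>trace_dual_basis\<close>), and
  multiplication by \<open>\<delta>\<close> is injective on series with coefficients in \<open>M\<close>
  (\<open>conv_zero_imp_zero\<close>). It is therefore enough that for every \<open>c\<close> in \<open>J\<close> the series
  \<open>g = \<Sum>e. tr (e * c) * \<phi> e\<close> vanishes.

  Let \<open>b\<close> be a point with coordinates \<open>u\<^sub>i powi w\<^sub>i * \<epsilon>\<^sub>i - 1\<close> and weights in the given range. The
  fibre of \<open>J\<close> over \<open>b\<close> is a finite-dimensional commutative algebra over an algebraically closed
  field, and there the trace is the sum of its characters \<open>\<kappa>\<close>, with multiplicities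
  (\<open>trace_eq_sum_characters\<close>). Each of them is integral and continuous, hence a specialisation of
  \<open>J\<close> of the prescribed weight (\<open>char_specialisation\<close>). Thus \<open>g(b) = \<Sum>\<kappa>. \<kappa>(c) * \<kappa>(f) = 0\<close>
  (\<open>trace_series_vanishes\<close>), and only the case of a single series \<open>g\<close> in \<open>H\<close> remains
  (\<open>vanishing_imp_zero\<close>).

  In one variable, put \<open>P = p ^ n\<close> and let \<open>s\<close> be \<open>\<lfloor>h\<rfloor> + 1\<close>, the number of weights. The points with
  \<open>\<epsilon> ^ P = 1\<close> are the \<open>s * P\<close> distinct roots of the product \<open>Q\<close> of the polynomials
  \<open>(1 + X) ^ P - (u powi w) ^ P\<close>. Let \<open>r m j\<close>, for \<open>j < s * P\<close>, be the coefficients of the remainder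
  of \<open>X ^ m\<close> modulo \<open>Q\<close>. Vanishing of \<open>g\<close> at all roots means, by inverting a Vandermonde matrix,
  that \<open>\<Sum>m. r m j * g m = 0\<close> for every \<open>j\<close>, which expresses \<open>g j\<close> through the coefficients with
  \<open>m \<ge> s * P\<close>. Every factor of \<open>Q\<close> is small, since \<open>P choose i\<close> is divisible by \<open>p ^ (n - i)\<close>. For
  fixed \<open>j\<close> this gives \<open>r m j\<close> a valuation of at least \<open>m / P + s * n\<close> up to a constant
  (\<open>interpolation_points\<close>), whereas \<open>v (g m)\<close> is at least \<open>- h * \<ell>(m)\<close> up to a constant, and
  \<open>h * \<ell>(m) \<le> m / P + h * n\<close> up to a constant. As \<open>s > h\<close>, letting \<open>n\<close> grow shows that \<open>v (g j)\<close>
  is infinite. Several variables are treated by products of these data.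

  The values of the series lie in base changes \<open>M \<otimes> L\<close> for varying finite extensions \<open>L\<close> of \<open>K\<close>.
  Over the complete field \<open>K\<close> the \<open>K\<close>-linear functionals of \<open>L\<close> are bounded, and they separate the
  points of \<open>M \<otimes> L\<close> (\<open>Phi_determines\<close>). Every statement about such a value is therefore translated
  into statements about the elements of \<open>M\<close> that these functionals yield (\<open>mps_eval_functional\<close>,
  \<open>specialise_functional\<close>).
\<close>

section \<open>Linear algebra over a subring of an integral domain\<close>

locale subring_of =
  fixes S :: "'a::idom set"
  assumes zero_mem [simp]: "0 \<in> S" and one_mem [simp]: "1 \<in> S"
    and add_mem: "x \<in> S \<Longrightarrow> y \<in> S \<Longrightarrow> x + y \<in> S"
    and diff_mem: "x \<in> S \<Longrightarrow> y \<in> S \<Longrightarrow> x - y \<in> S"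
    and mult_mem: "x \<in> S \<Longrightarrow> y \<in> S \<Longrightarrow> x * y \<in> S"
begin

lemma uminus_mem: "x \<in> S \<Longrightarrow> - x \<in> S"
  using diff_mem[of 0 x] by simp

lemma sum_mem: "(\<And>i. i \<in> I \<Longrightarrow> f i \<in> S) \<Longrightarrow> (\<Sum>i\<in>I. f i) \<in> S"
  by (induction I rule: infinite_finite_induct) (auto intro: add_mem)

lemma prod_mem: "(\<And>i. i \<in> I \<Longrightarrow> f i \<in> S) \<Longrightarrow> (\<Prod>i\<in>I. f i) \<in> S"
  by (induction I rule: infinite_finite_induct) (auto intro: mult_mem)

lemma power_mem: "x \<in> S \<Longrightarrow> x ^ n \<in> S"
  by (induction n) (auto intro: mult_mem)

lemma of_nat_mem: "of_nat n \<in> S"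
  by (induction n) (auto intro: add_mem)

text \<open>
  Gaussian elimination without division: a pivot is cleared by cross multiplication, so the
  coefficients stay in the subring.
\<close>

lemma nontrivial_relation:
  assumes "finite E" "finite I" "card E < card I" "\<And>i e. i \<in> I \<Longrightarrow> e \<in> E \<Longrightarrow> a i e \<in> S"
  shows "\<exists>c. (\<forall>i\<in>I. c i \<in> S) \<and> (\<exists>i\<in>I. c i \<noteq> 0) \<and> (\<forall>e\<in>E. (\<Sum>i\<in>I. c i * a i e) = 0)"
  using assms
proof (induction E arbitrary: I a rule: finite_induct)
  case empty
  then have "I \<noteq> {}" by auto
  then show ?case by (intro exI[of _ "\<lambda>_. 1"]) auto
next
  case (insert x E)
  show ?case
  proof (cases "\<forall>i\<in>I. a i x = 0")
    case True
    have "card E < card I" using insert.prems insert.hyps by simp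
    then obtain c where "\<forall>i\<in>I. c i \<in> S" "\<exists>i\<in>I. c i \<noteq> 0" "\<forall>e\<in>E. (\<Sum>i\<in>I. c i * a i e) = 0"
      using insert.IH[of I a] insert.prems by blast
    with True show ?thesis by (intro exI[of _ c]) simp
  next
    case False
    then obtain k where k: "k \<in> I" "a k x \<noteq> 0" by auto
    define J where "J = I - {k}"
    define a' where "a' i e = a k x * a i e - a i x * a k e" for i e
    have J: "finite J" "k \<notin> J" "I = insert k J" using k insert.prems by (auto simp: J_def)
    have "card E < card J" using insert.prems insert.hyps J by simp
    moreover have "a' i e \<in> S" if "i \<in> J" "e \<in> E" for i e
      using that insert.prems(3) J by (auto simp: a'_def intro!: diff_mem mult_mem)
    ultimately obtain c where c: "\<forall>i\<in>J. c i \<in> S" "\<exists>i\<in>J. c i \<noteq> 0" "\<forall>e\<in>E. (\<Sum>i\<in>J. c i * a' i e) = 0"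
      using insert.IH[of J a'] J(1) by blast
    define d where "d i = (if i = k then - (\<Sum>i\<in>J. c i * a i x) else c i * a k x)" for i
    have s: "(\<Sum>i\<in>I. d i * a i e) = (\<Sum>i\<in>J. c i * a' i e)" for e
    proof -
      have "(\<Sum>i\<in>I. d i * a i e) = d k * a k e + (\<Sum>i\<in>J. d i * a i e)"
        using J by simp
      also have "(\<Sum>i\<in>J. d i * a i e) = (\<Sum>i\<in>J. c i * a k x * a i e)"
        using J(2) by (intro sum.cong) (auto simp: d_def)
      also have "d k * a k e = - (\<Sum>i\<in>J. c i * a i x * a k e)"
        by (simp add: d_def sum_distrib_right)
      finally show ?thesis
        by (simp add: a'_def algebra_simps sum_subtractf)
    qed
    have "\<forall>i\<in>I. d i \<in> S"
      using c(1) insert.prems(3) J k by (auto simp: d_def intro!: uminus_mem sum_mem mult_mem)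
    moreover have "\<exists>i\<in>I. d i \<noteq> 0" using c(2) k J by (auto simp: d_def)
    moreover have "\<forall>e\<in>insert x E. (\<Sum>i\<in>I. d i * a i e) = 0"
      using c(3) by (auto simp: s a'_def mult.commute)
    ultimately show ?thesis by (intro exI[of _ d]) blast
  qed
qed

text \<open>
  Gram-Schmidt orthogonalisation without division. The common value \<open>\<delta>\<close> collects the denominators,
  like the determinant in Cramer's rule.
\<close>

lemma dual_family:
  assumes "finite I" "finite E" "\<And>i e. i \<in> I \<Longrightarrow> e \<in> E \<Longrightarrow> a i e \<in> S"
    and indep: "\<And>c. (\<And>i. i \<in> I \<Longrightarrow> c i \<in> S) \<Longrightarrow> (\<And>e. e \<in> E \<Longrightarrow> (\<Sum>i\<in>I. c i * a i e) = 0) \<Longrightarrow> \<forall>i\<in>I. c i = 0"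
  shows "\<exists>b \<delta>. \<delta> \<in> S \<and> \<delta> \<noteq> 0 \<and> (\<forall>i\<in>I. \<forall>e\<in>E. b i e \<in> S) \<and>
    (\<forall>i\<in>I. \<forall>k\<in>I. (\<Sum>e\<in>E. a i e * b k e) = (if i = k then \<delta> else 0))"
  using assms(1,3) indep
proof (induction I rule: finite_induct)
  case empty
  show ?case by (intro exI[of _ "\<lambda>_ _. 0"] exI[of _ 1]) auto
next
  case (insert x I)
  have ind: "\<forall>i\<in>I. c i = 0" if "\<And>i. i \<in> I \<Longrightarrow> c i \<in> S" "\<And>e. e \<in> E \<Longrightarrow> (\<Sum>i\<in>I. c i * a i e) = 0" for c
  proof -
    define c' where "c' i = (if i = x then 0 else c i)" for i
    have s: "(\<Sum>i\<in>insert x I. c' i * a i e) = (\<Sum>i\<in>I. c i * a i e)" for e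
      using insert.hyps by (subst sum.insert) (auto simp: c'_def intro!: sum.cong)
    have m: "c' i \<in> S" if "i \<in> insert x I" for i
      using that \<open>\<And>i. i \<in> I \<Longrightarrow> c i \<in> S\<close> by (auto simp: c'_def)
    have "\<forall>i\<in>insert x I. c' i = 0"
      by (rule insert.prems(2)[OF m]) (auto simp only: s that(2))
    then show ?thesis using insert.hyps by (metis c'_def insert_iff)
  qed
  have "\<exists>b \<delta>. \<delta> \<in> S \<and> \<delta> \<noteq> 0 \<and> (\<forall>i\<in>I. \<forall>e\<in>E. b i e \<in> S) \<and>
    (\<forall>i\<in>I. \<forall>k\<in>I. (\<Sum>e\<in>E. a i e * b k e) = (if i = k then \<delta> else 0))"
    by (rule insert.IH) (use insert.prems(1) ind in simp_all)
  then obtain b \<delta> where b: "\<delta> \<in> S" "\<delta> \<noteq> 0" "\<And>i e. i \<in> I \<Longrightarrow> e \<in> E \<Longrightarrow> b i e \<in> S"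
    "\<And>i k. i \<in> I \<Longrightarrow> k \<in> I \<Longrightarrow> (\<Sum>e\<in>E. a i e * b k e) = (if i = k then \<delta> else 0)"
    by blast
  define q where "q i = (\<Sum>e\<in>E. a x e * b i e)" for i
  have q: "q i \<in> S" if "i \<in> I" for i
    using that b insert.prems(1) by (auto simp: q_def intro!: sum_mem mult_mem)
  \<comment> \<open>The component of the new vector that is orthogonal to the dual family built so far.\<close>
  define a' where "a' e = \<delta> * a x e - (\<Sum>i\<in>I. q i * a i e)" for e
  have "\<exists>e\<in>E. a' e \<noteq> 0"
  proof (rule ccontr)
    assume *: "\<not> ?thesis"
    define c where "c i = (if i = x then \<delta> else - q i)" for i
    have "(\<Sum>i\<in>insert x I. c i * a i e) = 0" if "e \<in> E" for e
    proof -
      have "(\<Sum>i\<in>I. c i * a i e) = (\<Sum>i\<in>I. - (q i * a i e))"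
        using insert.hyps by (intro sum.cong) (auto simp: c_def)
      then show ?thesis
        using * that insert.hyps by (simp add: c_def a'_def sum_negf)
    qed
    moreover have "c i \<in> S" if "i \<in> insert x I" for i
      using that q b by (auto simp: c_def intro: uminus_mem)
    ultimately have "c x = 0" using insert.prems(2)[of c] by blast
    then show False using b by (simp add: c_def)
  qed
  then obtain f where f: "f \<in> E" "a' f \<noteq> 0" by auto
  define n where "n e = (if e = f then \<delta> else 0) - (\<Sum>i\<in>I. a i f * b i e)" for e
  have nS: "n e \<in> S" if "e \<in> E" for e
    using that b f insert.prems(1) by (auto simp: n_def intro!: diff_mem uminus_mem sum_mem mult_mem)
  have sw: "(\<Sum>e\<in>E. y e * n e) = \<delta> * y f - (\<Sum>i\<in>I. a i f * (\<Sum>e\<in>E. y e * b i e))" for y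
  proof -
    have "(\<Sum>e\<in>E. y e * n e) = (\<Sum>e\<in>E. y e * (if e = f then \<delta> else 0)) - (\<Sum>e\<in>E. \<Sum>i\<in>I. a i f * (y e * b i e))"
      by (simp add: n_def algebra_simps sum_subtractf sum_distrib_left)
    also have "(\<Sum>e\<in>E. y e * (if e = f then \<delta> else 0)) = \<delta> * y f"
      using f assms(2) by (simp add: if_distrib mult.commute cong: if_cong)
    also have "(\<Sum>e\<in>E. \<Sum>i\<in>I. a i f * (y e * b i e)) = (\<Sum>i\<in>I. a i f * (\<Sum>e\<in>E. y e * b i e))"
      by (subst sum.swap) (simp add: sum_distrib_left)
    finally show ?thesis .
  qed
  have n1: "(\<Sum>e\<in>E. a k e * n e) = 0" if "k \<in> I" for k
  proof -
    have "(\<Sum>i\<in>I. a i f * (\<Sum>e\<in>E. a k e * b i e)) = (\<Sum>i\<in>I. if i = k then a k f * \<delta> else 0)"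
      using b(4) that by (intro sum.cong) auto
    then show ?thesis using that insert.hyps by (simp add: sw)
  qed
  have n2: "(\<Sum>e\<in>E. a x e * n e) = a' f"
    unfolding sw by (simp add: a'_def q_def mult.commute)
  define b' where "b' k e = (if k = x then \<delta> * n e else a' f * b k e - q k * n e)" for k e
  define \<delta>' where "\<delta>' = \<delta> * a' f"
  have aS: "a' f \<in> S" using q b f insert.prems(1) by (auto simp: a'_def intro!: diff_mem sum_mem mult_mem)
  have "(\<Sum>e\<in>E. a i e * b' k e) = (if i = k then \<delta>' else 0)" if "i \<in> insert x I" "k \<in> insert x I" for i k
  proof (cases "k = x")
    case True
    have "(\<Sum>e\<in>E. a i e * b' k e) = \<delta> * (\<Sum>e\<in>E. a i e * n e)"
      using True by (simp add: b'_def sum_distrib_left algebra_simps)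
    then show ?thesis using True that n1 n2 insert.hyps by (auto simp: \<delta>'_def)
  next
    case False
    have "(\<Sum>e\<in>E. a i e * b' k e) = a' f * (\<Sum>e\<in>E. a i e * b k e) - q k * (\<Sum>e\<in>E. a i e * n e)"
      using False by (simp add: b'_def sum_distrib_left algebra_simps sum_subtractf)
    then show ?thesis using False that n1 n2 insert.hyps b(4) by (auto simp: \<delta>'_def q_def)
  qed
  moreover have "\<delta>' \<in> S" "\<delta>' \<noteq> 0" using b f aS by (auto simp: \<delta>'_def intro: mult_mem)
  moreover have "b' k e \<in> S" if "k \<in> insert x I" "e \<in> E" for k e
    using that nS b aS q by (auto simp: b'_def intro!: diff_mem mult_mem)
  ultimately show ?case
    by (intro exI[of _ b'] exI[of _ \<delta>']) blast
qed

end

section \<open>Power series in several variables\<close>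

lemma finite_atMost_fun [simp, intro]: "finite {..n :: 'n::finite \<Rightarrow> nat}"
proof -
  have "{..n} = (\<Pi>\<^sub>E i\<in>UNIV. {..n i})" by (auto simp: le_fun_def PiE_def Pi_def)
  then show ?thesis by (simp add: finite_PiE)
qed

text \<open>
  Assigning distinct primes to the variables turns monomials into positive integers; by unique
  factorisation this is injective. It provides a monomial order, with which leading terms can be
  multiplied.
\<close>

lemma ex_monomial_weight:
  "\<exists>W :: ('n::finite \<Rightarrow> nat) \<Rightarrow> nat. inj W \<and> (\<forall>n. W n > 0) \<and> (\<forall>m n. W (\<lambda>i. m i + n i) = W m * W n)"
proof -
  obtain T where T: "T \<subseteq> {q::nat. Factorial_Ring.prime q}" "card T = card (UNIV :: 'n set)" "finite T"
    using infinite_arbitrarily_large[OF primes_infinite, of "card (UNIV :: 'n set)"] by metis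
  obtain q :: "'n \<Rightarrow> nat" where q: "bij_betw q UNIV T"
    using finite_same_card_bij[of "UNIV :: 'n set" T] T by auto
  have pq: "Factorial_Ring.prime (q i)" for i
    using q T by (auto simp: bij_betw_def)
  have "inj q" using q by (auto simp: bij_betw_def)
  define W where "W n = (\<Prod>i\<in>UNIV. q i ^ n i)" for n :: "'n \<Rightarrow> nat"
  have "multiplicity (q i) (W n) = n i" for i n
  proof -
    have "multiplicity (q i) (W n) = (\<Sum>j\<in>UNIV. multiplicity (q i) (q j ^ n j))"
      unfolding W_def using pq by (subst prime_elem_multiplicity_prod_distrib) (auto simp: image_iff prime_gt_0_nat)
    also have "\<dots> = (\<Sum>j\<in>UNIV. if j = i then n i else 0)"
      using pq \<open>inj q\<close>
      by (intro sum.cong) (auto simp: prime_multiplicity_other prime_elem_multiplicity_power_distrib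
          multiplicity_distinct_prime_power inj_eq)
    finally show ?thesis by simp
  qed
  then have "inj W" by (intro injI ext) metis
  moreover have "W n > 0" for n using pq by (auto simp: W_def prime_gt_0_nat intro!: prod_pos)
  moreover have "W (\<lambda>i. m i + n i) = W m * W n" for m n
    by (simp add: W_def power_add prod.distrib)
  ultimately show ?thesis by blast
qed

text \<open>
  The sum of the least elements for a monomial order can be reached in only one way, so the
  corresponding coefficient of a Cauchy product is a single product. This is how both power series
  over a domain and their action on vector-valued series are shown to have no zero divisors.
\<close>

lemma minimal_monomials:
  fixes A B :: "('n::finite \<Rightarrow> nat) set"
  assumes "A \<noteq> {}" "B \<noteq> {}"
  obtains a b where "a \<in> A" "b \<in> B"
    "\<And>i. i \<le> (\<lambda>j. a j + b j) \<Longrightarrow> i \<in> A \<Longrightarrow> (\<lambda>j. a j + b j) - i \<in> B \<Longrightarrow> i = a"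
proof -
  obtain W :: "('n \<Rightarrow> nat) \<Rightarrow> nat" where W: "inj W" "\<And>n. W n > 0" "\<And>m n. W (\<lambda>i. m i + n i) = W m * W n"
    using ex_monomial_weight by blast
  obtain a where a: "a \<in> A" "\<And>x. x \<in> A \<Longrightarrow> W a \<le> W x"
    using assms(1) ex_has_least_nat[of "\<lambda>x. x \<in> A" _ W] by blast
  obtain b where b: "b \<in> B" "\<And>x. x \<in> B \<Longrightarrow> W b \<le> W x"
    using assms(2) ex_has_least_nat[of "\<lambda>x. x \<in> B" _ W] by blast
  show thesis
  proof (rule that[OF a(1) b(1)])
    fix i assume i: "i \<le> (\<lambda>j. a j + b j)" "i \<in> A" "(\<lambda>j. a j + b j) - i \<in> B"
    have "(\<lambda>j. i j + ((\<lambda>j. a j + b j) - i) j) = (\<lambda>j. a j + b j)"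
      using i(1) by (auto simp: le_fun_def)
    then have "W i * W ((\<lambda>j. a j + b j) - i) = W a * W b"
      using W(3) by metis
    moreover have "W a \<le> W i" "W b \<le> W ((\<lambda>j. a j + b j) - i)" using a b i by auto
    ultimately have "W i = W a"
      using W(2) by (metis le_antisym mult_le_mono mult_le_cancel2 nat_le_linear)
    then show "i = a" using W(1) by (simp add: inj_eq)
  qed
qed

lemma fun_diff_cancel:
  fixes i j n :: "'n \<Rightarrow> nat"
  shows "i \<le> n \<Longrightarrow> n - (n - i) = i"
    and "n - i \<le> n"
    and "i \<le> k \<Longrightarrow> (\<lambda>l. i l + (k - i) l) = k"
    and "(\<lambda>l. i l + j l) - i = j"
    and "i \<le> k \<Longrightarrow> n - i - (k - i) = n - k"
    and "n - (\<lambda>l. i l + j l) = n - i - j"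
    and "i \<le> (\<lambda>l. i l + j l)"
    and "i \<le> n \<Longrightarrow> j \<le> n - i \<Longrightarrow> (\<lambda>l. i l + j l) \<le> n"
    and "k \<le> n \<Longrightarrow> k - i \<le> n - i"
proof -
  show "i \<le> n \<Longrightarrow> j \<le> n - i \<Longrightarrow> (\<lambda>l. i l + j l) \<le> n"
    unfolding le_fun_def minus_apply by (metis add.commute le_diff_conv2)
qed (simp_all add: le_fun_def fun_eq_iff diff_le_mono)

lemma cauchy_product_commute:
  fixes f :: "('n::finite \<Rightarrow> nat) \<Rightarrow> ('n \<Rightarrow> nat) \<Rightarrow> 'c::comm_monoid_add"
  shows "(\<Sum>i\<in>{..n}. f i (n - i)) = (\<Sum>i\<in>{..n}. f (n - i) i)"
  by (rule sum.reindex_bij_witness[of _ "\<lambda>i. n - i" "\<lambda>i. n - i"])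
     (simp_all add: fun_diff_cancel(1,2))

lemma cauchy_product_assoc:
  fixes f :: "('n::finite \<Rightarrow> nat) \<Rightarrow> ('n \<Rightarrow> nat) \<Rightarrow> ('n \<Rightarrow> nat) \<Rightarrow> 'c::comm_monoid_add"
  shows "(\<Sum>k\<in>{..n}. \<Sum>i\<in>{..k}. f i (k - i) (n - k)) = (\<Sum>i\<in>{..n}. \<Sum>j\<in>{..n - i}. f i j (n - i - j))"
proof -
  have "(\<Sum>k\<in>{..n}. \<Sum>i\<in>{..k}. f i (k - i) (n - k)) = (\<Sum>(k,i)\<in>Sigma {..n} (\<lambda>k. {..k}). f i (k - i) (n - k))"
    by (rule sum.Sigma) auto
  also have "\<dots> = (\<Sum>(i,j)\<in>Sigma {..n} (\<lambda>i. {..n - i}). f i j (n - i - j))"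
  proof (rule sum.reindex_bij_witness[of _ "\<lambda>(i,j). (\<lambda>l. i l + j l, i)" "\<lambda>(k,i). (i, k - i)"])
    fix x assume "x \<in> Sigma {..n} (\<lambda>k. {..k})"
    then obtain k i where x: "x = (k, i)" "k \<le> n" "i \<le> k" by auto
    show "(case case x of (k, i) \<Rightarrow> (i, k - i) of (i, j) \<Rightarrow> (\<lambda>l. i l + j l, i)) = x"
      using x fun_diff_cancel(3)[of i k] by simp
    show "(case x of (k, i) \<Rightarrow> (i, k - i)) \<in> Sigma {..n} (\<lambda>i. {..n - i})"
      using x fun_diff_cancel(9)[of k n i] order_trans[of i k n] by simp
    show "(case case x of (k, i) \<Rightarrow> (i, k - i) of (i, j) \<Rightarrow> f i j (n - i - j)) =
        (case x of (k, i) \<Rightarrow> f i (k - i) (n - k))"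
      using x fun_diff_cancel(5)[of i k n] by simp
  next
    fix x assume "x \<in> Sigma {..n} (\<lambda>i. {..n - i})"
    then obtain i j where x: "x = (i, j)" "i \<le> n" "j \<le> n - i" by auto
    show "(case case x of (i, j) \<Rightarrow> (\<lambda>l. i l + j l, i) of (k, i) \<Rightarrow> (i, k - i)) = x"
      using x fun_diff_cancel(4)[of i j] by simp
    show "(case x of (i, j) \<Rightarrow> (\<lambda>l. i l + j l, i)) \<in> Sigma {..n} (\<lambda>k. {..k})"
      using x fun_diff_cancel(8)[of i n j] fun_diff_cancel(7)[of i j] by simp
  qed
  also have "\<dots> = (\<Sum>i\<in>{..n}. \<Sum>j\<in>{..n - i}. f i j (n - i - j))"
    by (rule sum.Sigma[symmetric]) auto
  finally show ?thesis .
qed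

text \<open>
  Power series form a type of their own, so that they are an instance of the class of integral
  domains and the linear algebra above applies to subrings of them.
\<close>

typedef (overloaded) ('n, 'c) mps = "UNIV :: (('n::finite \<Rightarrow> nat) \<Rightarrow> 'c::idom) set"
  morphisms mcoeff Mps ..

lemma mcoeff_Mps [simp]: "mcoeff (Mps f) = f" by (simp add: Mps_inverse)
lemma Mps_mcoeff [simp]: "Mps (mcoeff f) = f" by (simp add: mcoeff_inverse)
lemma mps_eqI: "(\<And>n. mcoeff f n = mcoeff g n) \<Longrightarrow> f = g"
  using mcoeff_inject by blast

instantiation mps :: (finite, idom) comm_ring_1
begin

definition "0 = Mps (\<lambda>n. 0)"
definition "1 = Mps (\<lambda>n. if n = (\<lambda>_. 0) then 1 else 0)"
definition "f + g = Mps (\<lambda>n. mcoeff f n + mcoeff g n)"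
definition "f - g = Mps (\<lambda>n. mcoeff f n - mcoeff g n)"
definition "- f = Mps (\<lambda>n. - mcoeff f n)"
definition "f * g = Mps (\<lambda>n. \<Sum>i\<in>{..n}. mcoeff f i * mcoeff g (n - i))"

lemma mcoeff_simps [simp]:
  "mcoeff (0 :: ('a,'b) mps) n = 0"
  "mcoeff (1 :: ('a,'b) mps) n = (if n = (\<lambda>_. 0) then 1 else 0)"
  "mcoeff (f + g :: ('a,'b) mps) n = mcoeff f n + mcoeff g n"
  "mcoeff (f - g :: ('a,'b) mps) n = mcoeff f n - mcoeff g n"
  "mcoeff (- f :: ('a,'b) mps) n = - mcoeff f n"
  by (simp_all add: zero_mps_def one_mps_def plus_mps_def minus_mps_def uminus_mps_def)

lemma mcoeff_mult: "mcoeff (f * g :: ('a,'b) mps) n = (\<Sum>i\<in>{..n}. mcoeff f i * mcoeff g (n - i))"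
  by (simp add: times_mps_def)

instance
proof
  fix a b c :: "('a, 'b) mps"
  show "a * b * c = a * (b * c)"
  proof (rule mps_eqI)
    fix n
    have "mcoeff (a * b * c) n =
        (\<Sum>k\<in>{..n}. \<Sum>i\<in>{..k}. mcoeff a i * mcoeff b (k - i) * mcoeff c (n - k))"
      by (simp only: mcoeff_mult sum_distrib_right)
    also have "\<dots> = (\<Sum>i\<in>{..n}. \<Sum>j\<in>{..n - i}. mcoeff a i * mcoeff b j * mcoeff c (n - i - j))"
      by (rule cauchy_product_assoc[of "\<lambda>i j k. mcoeff a i * mcoeff b j * mcoeff c k"])
    also have "\<dots> = mcoeff (a * (b * c)) n"
      by (simp only: mcoeff_mult sum_distrib_left mult.assoc)
    finally show "mcoeff (a * b * c) n = mcoeff (a * (b * c)) n" .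
  qed
  show "a * b = b * a"
  proof (rule mps_eqI)
    fix n
    show "mcoeff (a * b) n = mcoeff (b * a) n"
      unfolding mcoeff_mult
      by (subst cauchy_product_commute[of "\<lambda>i j. mcoeff a i * mcoeff b j"]) (rule sum.cong[OF refl mult.commute])
  qed
  show "1 * a = a"
  proof (rule mps_eqI)
    fix n
    have "mcoeff (1 * a) n = (\<Sum>i\<in>{..n}. if i = (\<lambda>_. 0) then mcoeff a n else 0)"
      unfolding mcoeff_mult by (rule sum.cong) (auto simp: fun_diff_def)
    also have "\<dots> = mcoeff a n" by (subst sum.delta) (auto simp: le_fun_def)
    finally show "mcoeff (1 * a) n = mcoeff a n" .
  qed
  show "(a + b) * c = a * c + b * c"
    by (intro mps_eqI) (simp add: mcoeff_mult distrib_right sum.distrib)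
  have "mcoeff (0 :: ('a,'b) mps) (\<lambda>_. 0) \<noteq> mcoeff 1 (\<lambda>_. 0)" by simp
  then show "(0 :: ('a,'b) mps) \<noteq> 1" by metis
  show "a + b + c = a + (b + c)" "a + b = b + a" "0 + a = a" "- a + a = 0" "a - b = a + - b"
    by (rule mps_eqI, simp)+
qed

end

instance mps :: (finite, idom) idom
proof
  fix f g :: "('a, 'b) mps"
  assume "f \<noteq> 0" "g \<noteq> 0"
  then have "{n. mcoeff f n \<noteq> 0} \<noteq> {}" "{n. mcoeff g n \<noteq> 0} \<noteq> {}"
    using mps_eqI[of f 0] mps_eqI[of g 0] by auto
  from minimal_monomials[OF this] obtain a b where ab: "mcoeff f a \<noteq> 0" "mcoeff g b \<noteq> 0"
    "\<And>i. i \<le> (\<lambda>j. a j + b j) \<Longrightarrow> mcoeff f i \<noteq> 0 \<Longrightarrow> mcoeff g ((\<lambda>j. a j + b j) - i) \<noteq> 0 \<Longrightarrow> i = a"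
    by (auto simp del: minus_apply)
  let ?n = "\<lambda>j. a j + b j"
  have [simp]: "?n - a = b" by (auto simp: fun_eq_iff)
  have "mcoeff (f * g) ?n = (\<Sum>i\<in>{..?n}. if i = a then mcoeff f a * mcoeff g b else 0)"
    unfolding mcoeff_mult using ab(3) by (intro sum.cong) auto
  also have "\<dots> = mcoeff f a * mcoeff g b" by (subst sum.delta) (auto simp: le_fun_def)
  finally have "mcoeff (f * g) ?n \<noteq> 0" using ab by simp
  then show "f * g \<noteq> 0" by (metis mcoeff_simps(1))
qed

section \<open>The valuation\<close>

lemma cring_sub_field_of:
  fixes K :: "'c::field set"
  assumes "subring_of K"
  shows "cring (sub_field_of K)"
proof -
  interpret subring_of K by fact
  have "\<exists>y\<in>K. y + x = 0" if "x \<in> K" for x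
    using that by (intro bexI[of _ "- x"]) (auto intro: uminus_mem)
  then show ?thesis
    by (intro cringI abelian_groupI comm_monoidI)
       (auto simp: sub_field_of_def algebra_simps intro: add_mem mult_mem)
qed

lemma sub_field_of_simps [simp]:
  "carrier (sub_field_of K) = K" "x \<otimes>\<^bsub>sub_field_of K\<^esub> y = x * y" "x \<oplus>\<^bsub>sub_field_of K\<^esub> y = x + y"
  "\<one>\<^bsub>sub_field_of K\<^esub> = 1" "\<zero>\<^bsub>sub_field_of K\<^esub> = 0" "x \<odot>\<^bsub>sub_field_of K\<^esub> y = x * y"
  by (simp_all add: sub_field_of_def)

lemma sub_field_of_inv:
  assumes "subring_of K" "x \<in> K"
  shows "\<ominus>\<^bsub>sub_field_of K\<^esub> x = - x"
proof -
  interpret subring_of K by fact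
  interpret R: cring "sub_field_of K" by (rule cring_sub_field_of) fact
  show ?thesis
    using assms uminus_mem by (intro R.minus_equality) auto
qed

lemma sub_field_of_minus:
  assumes "subring_of K" "x \<in> K" "y \<in> K"
  shows "x \<ominus>\<^bsub>sub_field_of K\<^esub> y = x - y"
  using assms by (simp add: a_minus_def sub_field_of_inv)

lemma sub_field_of_finsum:
  assumes "subring_of K" "\<And>i. i \<in> F \<Longrightarrow> g i \<in> K"
  shows "(\<Oplus>\<^bsub>sub_field_of K\<^esub>i\<in>F. g i) = (\<Sum>i\<in>F. g i)"
proof -
  interpret R: cring "sub_field_of K" by (rule cring_sub_field_of) fact
  show ?thesis using assms(2)
    by (induction F rule: infinite_finite_induct) (auto simp: Pi_def)
qed

lemma subring_of_UNIV: "subring_of UNIV"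
  by unfold_locales auto

locale valued_field =
  fixes p :: nat and ordp :: "'c::{alg_closed_field, field_char_0} \<Rightarrow> ereal"
  assumes prime_p: "Factorial_Ring.prime p" and Cp: "is_Cp p ordp"
begin

lemma ord_mult: "ordp (x * y) = ordp x + ordp y"
  and ord_p: "ordp (of_nat p) = 1"
  and ord_not_minf: "ordp x \<noteq> - \<infinity>"
  and ord_inf_iff: "ordp x = \<infinity> \<longleftrightarrow> x = 0"
  and ord_add: "min (ordp x) (ordp y) \<le> ordp (x + y)"
  using Cp by (auto simp: is_Cp_def is_valuation_def)

lemma ord_0 [simp]: "ordp 0 = \<infinity>"
  by (simp add: ord_inf_iff)

lemma ord_finite: "x \<noteq> 0 \<Longrightarrow> \<exists>r. ordp x = ereal r"
  using ord_inf_iff[of x] ord_not_minf[of x] by (cases "ordp x") auto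

lemma ord_1 [simp]: "ordp 1 = 0"
  using ord_mult[of 1 1] ord_finite[of 1] by (auto simp: zero_ereal_def)

lemma ord_uminus [simp]: "ordp (- x) = ordp x"
proof -
  obtain r where "ordp (- 1) = ereal r" using ord_finite[of "- 1"] by auto
  moreover have "ordp (- 1) + ordp (- 1) = 0" using ord_mult[of "- 1" "- 1"] by simp
  ultimately have "ordp (- 1) = 0" by (simp add: zero_ereal_def)
  then show ?thesis using ord_mult[of "- 1" x] by simp
qed

lemma ge_add: "ereal t \<le> ordp x \<Longrightarrow> ereal t \<le> ordp y \<Longrightarrow> ereal t \<le> ordp (x + y)"
  using ord_add[of x y] by (meson min.boundedI order_trans)

lemma ge_diff: "ereal t \<le> ordp x \<Longrightarrow> ereal t \<le> ordp y \<Longrightarrow> ereal t \<le> ordp (x - y)"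
  using ge_add[of t x "- y"] by simp

lemma ge_mult: "ereal t \<le> ordp x \<Longrightarrow> ereal s \<le> ordp y \<Longrightarrow> ereal (t + s) \<le> ordp (x * y)"
  unfolding ord_mult plus_ereal.simps(1)[symmetric] by (rule add_mono)

lemma ge_mult0: "ereal t \<le> ordp x \<Longrightarrow> 0 \<le> ordp y \<Longrightarrow> ereal t \<le> ordp (x * y)"
  using ge_mult[of t x 0 y] by (simp add: zero_ereal_def)

lemma ge_sum: "(\<And>i. i \<in> I \<Longrightarrow> ereal t \<le> ordp (f i)) \<Longrightarrow> ereal t \<le> ordp (\<Sum>i\<in>I. f i)"
  by (induction I rule: infinite_finite_induct) (auto intro: ge_add)

lemma ge_prod: "(\<And>i. i \<in> I \<Longrightarrow> ereal (t i) \<le> ordp (f i)) \<Longrightarrow> ereal (\<Sum>i\<in>I. t i) \<le> ordp (\<Prod>i\<in>I. f i)"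
  by (induction I rule: infinite_finite_induct) (auto intro: ge_mult)

lemma ge_power: "ereal t \<le> ordp x \<Longrightarrow> ereal (real n * t) \<le> ordp (x ^ n)"
  using ge_prod[of "{..<n}" "\<lambda>_. t" "\<lambda>_. x"] by (simp add: prod_constant)

lemma ge_of_nat: "0 \<le> ordp (of_nat n)"
proof (induction n)
  case (Suc n)
  then show ?case using ge_add[of 0 1 "of_nat n"] by (simp add: zero_ereal_def)
qed auto

lemma ge_of_int: "0 \<le> ordp (of_int n)"
  using ge_of_nat[of "nat \<bar>n\<bar>"] by (cases "n \<ge> 0") auto

lemma ord_power_eq: "ordp x = ereal r \<Longrightarrow> ordp (x ^ n) = ereal (real n * r)"
  by (induction n) (auto simp: ord_mult algebra_simps zero_ereal_def)

lemma ord_inverse: "ordp x = ereal r \<Longrightarrow> ordp (inverse x) = ereal (- r)"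
proof -
  assume r: "ordp x = ereal r"
  then have "x \<noteq> 0" by auto
  then obtain s where s: "ordp (inverse x) = ereal s" using ord_finite[of "inverse x"] by auto
  have "ordp x + ordp (inverse x) = 0" using ord_mult[of x "inverse x"] \<open>x \<noteq> 0\<close> by simp
  then show ?thesis using r s by (simp add: zero_ereal_def)
qed

lemma finite_ord_bound:
  assumes "finite A"
  obtains D where "D \<ge> 0" "\<And>x. x \<in> A \<Longrightarrow> ereal (- D) \<le> ordp (f x)"
proof -
  have "\<exists>D\<ge>0. \<forall>x\<in>A. ereal (- D) \<le> ordp (f x)"
    using assms
  proof (induction A rule: finite_induct)
    case (insert x A)
    then obtain D where D: "D \<ge> 0" "\<forall>x\<in>A. ereal (- D) \<le> ordp (f x)" by auto
    obtain r where r: "ereal r \<le> ordp (f x)"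
      by (cases "ordp (f x)") (use ord_not_minf[of "f x"] in auto)
    have "ereal (- max D (- r)) \<le> ordp (f x)"
      by (rule order_trans[OF _ r]) (unfold ereal_less_eq, linarith)
    moreover have "\<forall>y\<in>A. ereal (- max D (- r)) \<le> ordp (f y)"
    proof
      fix y assume "y \<in> A"
      then have "ereal (- D) \<le> ordp (f y)" using D(2) by blast
      moreover have "ereal (- max D (- r)) \<le> ereal (- D)"
        unfolding ereal_less_eq by linarith
      ultimately show "ereal (- max D (- r)) \<le> ordp (f y)" by (rule order_trans[rotated])
    qed
    moreover have "max D (- r) \<ge> 0" using D(1) by linarith
    ultimately show ?case by (intro exI[of _ "max D (- r)"]) blast
  qed auto
  then show thesis using that by blast
qed

lemma all_ge_imp_zero:
  assumes "\<And>C::real. ereal C \<le> ordp x"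
  shows "x = 0"
  using ord_finite[of x] assms[of "real_of_ereal (ordp x) + 1"] by (cases "x = 0") auto

end

section \<open>Finite-dimensional spaces over a complete subfield\<close>

definition fdspan :: "'c::field set \<Rightarrow> 'c set \<Rightarrow> 'c set" where
  "fdspan K B = {\<Sum>b\<in>B. a b * b | a. \<forall>b\<in>B. a b \<in> K}"

definition kindep :: "'c::field set \<Rightarrow> 'c set \<Rightarrow> bool" where
  "kindep K B \<longleftrightarrow> (\<forall>a. (\<forall>b\<in>B. a b \<in> K) \<longrightarrow> (\<Sum>b\<in>B. a b * b) = 0 \<longrightarrow> (\<forall>b\<in>B. a b = 0))"

definition ksubspace :: "'c::field set \<Rightarrow> 'c set \<Rightarrow> bool" where
  "ksubspace K V \<longleftrightarrow> 0 \<in> V \<and> (\<forall>x\<in>V. \<forall>y\<in>V. x + y \<in> V) \<and> (\<forall>a\<in>K. \<forall>x\<in>V. a * x \<in> V)"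

definition klinear :: "'c::field set \<Rightarrow> 'c set \<Rightarrow> ('c \<Rightarrow> 'c) \<Rightarrow> bool" where
  "klinear K V \<phi> \<longleftrightarrow> (\<forall>x\<in>V. \<phi> x \<in> K) \<and> (\<forall>x\<in>V. \<forall>y\<in>V. \<phi> (x + y) = \<phi> x + \<phi> y) \<and>
     (\<forall>a\<in>K. \<forall>x\<in>V. \<phi> (a * x) = a * \<phi> x)"

text \<open>
  Inside a field, the subalgebras of finite dimension over \<open>K\<close> are its finite extensions.
\<close>

definition fdalg :: "'c::field set \<Rightarrow> 'c set \<Rightarrow> bool" where
  "fdalg K L \<longleftrightarrow> (\<exists>B. finite B \<and> L = fdspan K B) \<and> 1 \<in> L \<and> (\<forall>x\<in>L. \<forall>y\<in>L. x * y \<in> L)"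

locale subfield_of = subring_of K for K :: "'c::field set" +
  assumes inverse_mem: "x \<in> K \<Longrightarrow> inverse x \<in> K"
begin

lemma ksubspace_sum:
  "ksubspace K V \<Longrightarrow> (\<And>i. i \<in> I \<Longrightarrow> f i \<in> V) \<Longrightarrow> (\<Sum>i\<in>I. f i) \<in> V"
  by (induction I rule: infinite_finite_induct) (auto simp: ksubspace_def)

lemma ksubspace_fdspan: "ksubspace K (fdspan K B)"
proof -
  have "0 \<in> fdspan K B"
    unfolding fdspan_def by (auto intro!: exI[of _ "\<lambda>_. 0"])
  moreover have "x + y \<in> fdspan K B" if "x \<in> fdspan K B" "y \<in> fdspan K B" for x y
  proof -
    from that obtain a c where "x = (\<Sum>b\<in>B. a b * b)" "y = (\<Sum>b\<in>B. c b * b)"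
      "\<forall>b\<in>B. a b \<in> K" "\<forall>b\<in>B. c b \<in> K" unfolding fdspan_def by auto
    then show ?thesis
      unfolding fdspan_def
      by (auto simp: sum.distrib distrib_right intro!: exI[of _ "\<lambda>b. a b + c b"] add_mem)
  qed
  moreover have "s * x \<in> fdspan K B" if "x \<in> fdspan K B" "s \<in> K" for x s
  proof -
    from that obtain a where "x = (\<Sum>b\<in>B. a b * b)" "\<forall>b\<in>B. a b \<in> K" unfolding fdspan_def by auto
    then show ?thesis using that
      unfolding fdspan_def
      by (auto simp: sum_distrib_left mult.assoc intro!: exI[of _ "\<lambda>b. s * a b"] mult_mem)
  qed
  ultimately show ?thesis by (auto simp: ksubspace_def)
qed

lemma fdspan_least: "ksubspace K V \<Longrightarrow> B \<subseteq> V \<Longrightarrow> fdspan K B \<subseteq> V"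
  by (auto simp: fdspan_def ksubspace_def intro!: ksubspace_sum)

lemma fdspan_superset:
  assumes "finite B" shows "B \<subseteq> fdspan K B"
proof
  fix x assume x: "x \<in> B"
  have "x = (\<Sum>b\<in>B. (if b = x then 1 else 0) * b)"
    using assms x by (simp add: if_distrib[of "\<lambda>z. z * _"] cong: if_cong)
  then show "x \<in> fdspan K B"
    unfolding fdspan_def by (auto intro!: exI[of _ "\<lambda>b. if b = x then 1 else 0"])
qed

lemma fdspan_mult:
  assumes "finite A" "finite B" "x \<in> fdspan K A" "y \<in> fdspan K B"
  shows "x * y \<in> fdspan K ((\<lambda>(a, b). a * b) ` (A \<times> B))"
proof -
  let ?V = "fdspan K ((\<lambda>(a, b). a * b) ` (A \<times> B))"
  have V: "ksubspace K ?V" by (rule ksubspace_fdspan)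
  obtain f g where fg: "x = (\<Sum>a\<in>A. f a * a)" "y = (\<Sum>b\<in>B. g b * b)"
    "\<forall>a\<in>A. f a \<in> K" "\<forall>b\<in>B. g b \<in> K" using assms unfolding fdspan_def by auto
  have "x * y = (\<Sum>a\<in>A. \<Sum>b\<in>B. (f a * g b) * (a * b))"
    by (simp add: fg(1,2) sum_product algebra_simps)
  also have "\<dots> \<in> ?V"
  proof (intro ksubspace_sum[OF V])
    fix a b assume ab: "a \<in> A" "b \<in> B"
    then have "a * b \<in> ?V" using fdspan_superset[of "(\<lambda>(a, b). a * b) ` (A \<times> B)"] assms by force
    moreover have "f a * g b \<in> K" using ab fg by (auto intro: mult_mem)
    ultimately show "f a * g b * (a * b) \<in> ?V" using V by (simp add: ksubspace_def)
  qed
  finally show ?thesis .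
qed

lemma fdspan_insert_indep:
  assumes "finite B" "kindep K B" "x \<notin> fdspan K B"
  shows "kindep K (insert x B)"
  unfolding kindep_def
proof (intro allI impI)
  fix a assume a: "\<forall>b\<in>insert x B. a b \<in> K" "(\<Sum>b\<in>insert x B. a b * b) = 0"
  have xB: "x \<notin> B" using assms fdspan_superset by blast
  have s: "a x * x + (\<Sum>b\<in>B. a b * b) = 0" using a(2) assms(1) xB by simp
  have "a x = 0"
  proof (rule ccontr)
    assume nz: "a x \<noteq> 0"
    have "x = (\<Sum>b\<in>B. (- inverse (a x) * a b) * b)"
    proof -
      have "(\<Sum>b\<in>B. (- inverse (a x) * a b) * b) = - inverse (a x) * (\<Sum>b\<in>B. a b * b)"
        by (simp add: sum_distrib_left mult.assoc)
      also have "(\<Sum>b\<in>B. a b * b) = - (a x * x)" using s by (simp add: eq_neg_iff_add_eq_0 add.commute)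
      finally show ?thesis using nz by simp
    qed
    moreover have "\<forall>b\<in>B. - inverse (a x) * a b \<in> K"
      using a(1) by (auto intro!: uminus_mem mult_mem inverse_mem simp: mult_minus_left)
    ultimately have "x \<in> fdspan K B" unfolding fdspan_def by (auto intro!: exI[of _ "\<lambda>b. - inverse (a x) * a b"])
    then show False using assms by simp
  qed
  then show "\<forall>b\<in>insert x B. a b = 0" using s a(1) assms(2) unfolding kindep_def by auto
qed

text \<open>
  Steinitz's theorem: with more than \<open>card B\<close> vectors, the coordinate rows admit a nontrivial
  relation.
\<close>

lemma kindep_card_le:
  assumes "finite B" "finite A" "kindep K A" "A \<subseteq> fdspan K B"
  shows "card A \<le> card B"
proof (rule ccontr)
  assume c: "\<not> card A \<le> card B"
  have "\<forall>x\<in>A. \<exists>f. x = (\<Sum>b\<in>B. f b * b) \<and> (\<forall>b\<in>B. f b \<in> K)"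
    using assms(4) unfolding fdspan_def by blast
  then obtain f where f: "\<And>x. x \<in> A \<Longrightarrow> x = (\<Sum>b\<in>B. f x b * b)" "\<And>x b. x \<in> A \<Longrightarrow> b \<in> B \<Longrightarrow> f x b \<in> K"
    by metis
  obtain c where c: "\<forall>i\<in>A. c i \<in> K" "\<exists>i\<in>A. c i \<noteq> 0" "\<forall>e\<in>B. (\<Sum>i\<in>A. c i * f i e) = 0"
    using nontrivial_relation[of B A f] assms c f by auto
  have "(\<Sum>x\<in>A. c x * x) = (\<Sum>x\<in>A. c x * (\<Sum>b\<in>B. f x b * b))"
    using f(1) by (intro sum.cong) auto
  also have "\<dots> = (\<Sum>b\<in>B. (\<Sum>x\<in>A. c x * f x b) * b)"
    by (simp add: sum_distrib_left sum_distrib_right mult.assoc) (rule sum.swap)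
  also have "\<dots> = 0" using c(3) by simp
  finally show False using assms(3) c(1,2) unfolding kindep_def by blast
qed

text \<open>
  An independent subset of \<open>V\<close> of maximal size, which exists as \<open>card B\<close> bounds the size, must
  span \<open>V\<close>.
\<close>

lemma ksubspace_basis:
  assumes "finite B" "ksubspace K V" "V \<subseteq> fdspan K B"
  obtains A where "finite A" "A \<subseteq> V" "kindep K A" "fdspan K A = V"
proof -
  let ?P = "\<lambda>A. finite A \<and> A \<subseteq> V \<and> kindep K A"
  have "?P {}" by (auto simp: kindep_def)
  moreover have "\<forall>A. ?P A \<longrightarrow> card A < Suc (card B)"
    using kindep_card_le[OF assms(1)] assms(3) by (meson le_imp_less_Suc subset_trans)
  ultimately obtain A where A: "?P A" "\<forall>A'. ?P A' \<longrightarrow> card A' \<le> card A"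
    using ex_has_greatest_nat[of ?P "{}" card "Suc (card B)"] by blast
  have "V \<subseteq> fdspan K A"
  proof
    fix x assume x: "x \<in> V"
    show "x \<in> fdspan K A"
    proof (rule ccontr)
      assume n: "x \<notin> fdspan K A"
      then have "?P (insert x A)" using A x fdspan_insert_indep by auto
      then have "card (insert x A) \<le> card A" using A(2) by blast
      moreover have "x \<notin> A" using n A(1) fdspan_superset by blast
      ultimately show False using A(1) by simp
    qed
  qed
  with A fdspan_least[OF assms(2), of A] that show thesis by blast
qed

lemma kindep_coords:
  assumes "finite B" "kindep K B" 
  obtains co where "\<And>b. b \<in> B \<Longrightarrow> klinear K (fdspan K B) (co b)"
    "\<And>x. x \<in> fdspan K B \<Longrightarrow> x = (\<Sum>b\<in>B. co b x * b)"
    "\<And>b b'. b \<in> B \<Longrightarrow> b' \<in> B \<Longrightarrow> co b b' = (if b = b' then 1 else 0)"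
proof -
  have uniq: "a b = c b"
    if "(\<Sum>b\<in>B. a b * b) = (\<Sum>b\<in>B. c b * b)" "\<forall>b\<in>B. a b \<in> K" "\<forall>b\<in>B. c b \<in> K" "b \<in> B" for a c b
  proof -
    have "(\<Sum>b\<in>B. (a b - c b) * b) = 0" using that(1) by (simp add: left_diff_distrib sum_subtractf)
    moreover have "\<forall>b\<in>B. a b - c b \<in> K" using that by (auto intro: diff_mem)
    ultimately have "a b - c b = 0"
      using assms(2)[unfolded kindep_def, rule_format, of "\<lambda>b. a b - c b"] that(4) by blast
    then show ?thesis by simp
  qed
  define f where "f x = (SOME f. x = (\<Sum>b\<in>B. f b * b) \<and> (\<forall>b\<in>B. f b \<in> K))" for x
  have "\<forall>x\<in>fdspan K B. x = (\<Sum>b\<in>B. f x b * b) \<and> (\<forall>b\<in>B. f x b \<in> K)"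
  proof
    fix x assume "x \<in> fdspan K B"
    then have "\<exists>f. x = (\<Sum>b\<in>B. f b * b) \<and> (\<forall>b\<in>B. f b \<in> K)" unfolding fdspan_def by blast
    then show "x = (\<Sum>b\<in>B. f x b * b) \<and> (\<forall>b\<in>B. f x b \<in> K)" unfolding f_def by (rule someI_ex)
  qed
  then have f: "\<And>x. x \<in> fdspan K B \<Longrightarrow> x = (\<Sum>b\<in>B. f x b * b)"
      "\<And>x b. x \<in> fdspan K B \<Longrightarrow> b \<in> B \<Longrightarrow> f x b \<in> K"
    by blast+
  note V = ksubspace_fdspan[of B, unfolded ksubspace_def]
  have "klinear K (fdspan K B) (\<lambda>x. f x b)" if b: "b \<in> B" for b
    unfolding klinear_def
  proof (intro conjI ballI)
    fix x y assume xy: "x \<in> fdspan K B" "y \<in> fdspan K B"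
    show "f (x + y) b = f x b + f y b"
    proof (rule uniq[of "f (x + y)" "\<lambda>b. f x b + f y b", OF _ _ _ b])
      have "(\<Sum>b\<in>B. f (x + y) b * b) = x + y" by (rule f(1)[symmetric]) (use V xy in blast)
      also have "\<dots> = (\<Sum>b\<in>B. f x b * b) + (\<Sum>b\<in>B. f y b * b)"
        by (intro arg_cong2[where f = "(+)"] f(1) xy)
      finally show "(\<Sum>b\<in>B. f (x + y) b * b) = (\<Sum>b\<in>B. (f x b + f y b) * b)"
        by (simp add: distrib_right sum.distrib)
    qed (use f xy V in \<open>auto intro: add_mem\<close>)
  next
    fix s x assume sx: "s \<in> K" "x \<in> fdspan K B"
    show "f (s * x) b = s * f x b"
    proof (rule uniq[of "f (s * x)" "\<lambda>b. s * f x b", OF _ _ _ b])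
      have "(\<Sum>b\<in>B. f (s * x) b * b) = s * x" by (rule f(1)[symmetric]) (use V sx in blast)
      also have "\<dots> = s * (\<Sum>b\<in>B. f x b * b)"
        by (intro arg_cong2[where f = "(*)"] f(1) sx refl)
      finally show "(\<Sum>b\<in>B. f (s * x) b * b) = (\<Sum>b\<in>B. (s * f x b) * b)"
        by (simp add: sum_distrib_left mult.assoc)
    qed (use f sx V in \<open>auto intro: mult_mem\<close>)
  qed (use f b in auto)
  moreover have "f b' b = (if b = b' then 1 else 0)" if "b \<in> B" "b' \<in> B" for b b'
  proof (rule uniq[of "f b'" "\<lambda>b. if b = b' then 1 else 0"])
    have "b' \<in> fdspan K B" using fdspan_superset assms that by blast
    then show "(\<Sum>b\<in>B. f b' b * b) = (\<Sum>b\<in>B. (if b = b' then 1 else 0) * b)" "\<forall>b\<in>B. f b' b \<in> K"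
      using f(1)[symmetric, of b'] f(2) that assms(1)
      by (auto simp: if_distrib[of "\<lambda>z. z * _"] cong: if_cong)
  qed (use that in auto)
  ultimately show thesis using that[of "\<lambda>b x. f x b"] f(1) by blast
qed

lemma klinear_sum:
  assumes "ksubspace K V" "klinear K V \<phi>" "\<And>i. i \<in> I \<Longrightarrow> f i \<in> V"
  shows "\<phi> (\<Sum>i\<in>I. f i) = (\<Sum>i\<in>I. \<phi> (f i))"
proof -
  have z: "\<phi> 0 = 0"
    using assms(1,2) unfolding klinear_def ksubspace_def by (metis mult_zero_left zero_mem)
  show ?thesis using assms(3)
  proof (induction I rule: infinite_finite_induct)
    case (insert x F)
    then have "(\<Sum>i\<in>F. f i) \<in> V" by (intro ksubspace_sum[OF assms(1)]) simp
    then show ?case using insert assms(2) by (simp add: klinear_def)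
  qed (use z in auto)
qed

end

lemma ereal_diff_le:
  "ereal t \<le> ereal r + z \<Longrightarrow> \<not> ereal C \<le> z \<Longrightarrow> ereal (t - C) \<le> ereal r"
  by (cases z) auto

locale complete_subfield = valued_field p ordp + subfield_of K
  for p and ordp :: "'c::{alg_closed_field, field_char_0} \<Rightarrow> ereal" and K :: "'c set" +
  assumes complete: "val_complete (sub_field_of K) ordp"
begin

lemma K_subring: "subring_of K" by unfold_locales

lemma K_complete:
  assumes "\<And>n. x n \<in> K" "\<And>C::real. \<exists>N::nat. \<forall>m\<ge>N. \<forall>n\<ge>N. ereal C \<le> ordp (x m - x n)"
  obtains l where "l \<in> K" "\<And>C::real. \<exists>N. \<forall>n\<ge>N. ereal C \<le> ordp (x n - l)"
proof -
  have "\<exists>N. \<forall>m\<ge>N. \<forall>n\<ge>N. ereal C < ordp (x m \<ominus>\<^bsub>sub_field_of K\<^esub> x n)" for C :: real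
  proof -
    obtain N where N: "\<forall>m\<ge>N. \<forall>n\<ge>N. ereal (C + 1) \<le> ordp (x m - x n)" using assms(2) by blast
    have "ereal C < ordp (x m \<ominus>\<^bsub>sub_field_of K\<^esub> x n)" if "m \<ge> N" "n \<ge> N" for m n
    proof -
      have "ereal C < ereal (C + 1)" by simp
      also have "\<dots> \<le> ordp (x m - x n)" using N that by blast
      finally show ?thesis by (simp add: sub_field_of_minus[OF K_subring assms(1) assms(1)])
    qed
    then show ?thesis by blast
  qed
  moreover have "range x \<subseteq> carrier (sub_field_of K)" using assms(1) by auto
  ultimately obtain l where l: "l \<in> K"
    "\<forall>C::real. \<exists>N. \<forall>n\<ge>N. ereal C < ordp (x n \<ominus>\<^bsub>sub_field_of K\<^esub> l)"
    using complete unfolding val_complete_def by (metis sub_field_of_simps(1))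
  show thesis
  proof (rule that[OF l(1)])
    fix C :: real
    from l(2) obtain N where "\<forall>n\<ge>N. ereal C < ordp (x n \<ominus>\<^bsub>sub_field_of K\<^esub> l)" by blast
    then show "\<exists>N. \<forall>n\<ge>N. ereal C \<le> ordp (x n - l)"
      unfolding sub_field_of_minus[OF K_subring assms(1) l(1)] by (meson less_imp_le)
  qed
qed

text \<open>
  One half of the equivalence of norms on a finite-dimensional space: passing to coordinates
  lowers the valuation by at most \<open>D\<close>.
\<close>

definition coord_bound :: "'c set \<Rightarrow> real \<Rightarrow> bool" where
  "coord_bound B D \<longleftrightarrow> (\<forall>a t. (\<forall>b\<in>B. a b \<in> K) \<longrightarrow> ereal t \<le> ordp (\<Sum>b\<in>B. a b * b) \<longrightarrow>
     (\<forall>b\<in>B. ereal (t - D) \<le> ordp (a b)))"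

text \<open>
  The coordinates of a sequence of approximations to \<open>x\<close> are Cauchy; their limits in \<open>K\<close> are
  coordinates of \<open>x\<close>.
\<close>

lemma closed_if_coord_bound:
  assumes B: "finite B" "coord_bound B D"
    and x: "\<And>C::real. \<exists>w\<in>fdspan K B. ereal C \<le> ordp (x - w)"
  shows "x \<in> fdspan K B"
proof -
  have "\<exists>a. (\<forall>b\<in>B. a b \<in> K) \<and> ereal (real n) \<le> ordp (x - (\<Sum>b\<in>B. a b * b))" for n :: nat
    using x[of "real n"] unfolding fdspan_def by blast
  then obtain a where a: "\<And>n b. b \<in> B \<Longrightarrow> a n b \<in> K"
    "\<And>n::nat. ereal (real n) \<le> ordp (x - (\<Sum>b\<in>B. a n b * b))"
    by metis
  have d: "ereal (real N - D) \<le> ordp (a m b - a n b)" if "m \<ge> N" "n \<ge> N" "b \<in> B" for N m n b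
  proof -
    have "ereal (real N) \<le> ordp (x - (\<Sum>b\<in>B. a n b * b))" "ereal (real N) \<le> ordp (x - (\<Sum>b\<in>B. a m b * b))"
      using a(2)[of n] a(2)[of m] that by (meson ereal_less_eq(3) of_nat_mono order_trans)+
    from ge_diff[OF this] have "ereal (real N) \<le> ordp (\<Sum>b\<in>B. (a m b - a n b) * b)"
      by (simp add: left_diff_distrib sum_subtractf)
    moreover have "\<forall>b\<in>B. a m b - a n b \<in> K" using a(1) by (auto intro: diff_mem)
    ultimately show ?thesis
      using B(2)[unfolded coord_bound_def, rule_format, of "\<lambda>b. a m b - a n b" "real N" b] that(3) by blast
  qed
  have "\<exists>l. l \<in> K \<and> (\<forall>C::real. \<exists>N. \<forall>n\<ge>N. ereal C \<le> ordp (a n b - l))" if b: "b \<in> B" for b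
  proof (rule K_complete[of "\<lambda>n. a n b"])
    fix C :: real
    obtain N :: nat where "C + D \<le> real N" using real_arch_simple by blast
    then have "ereal C \<le> ereal (real N - D)" by simp
    then show "\<exists>N. \<forall>m\<ge>N. \<forall>n\<ge>N. ereal C \<le> ordp (a m b - a n b)"
      using d[OF _ _ b, of N] by (meson order_trans)
  qed (use a b in auto)
  then obtain l where l: "\<And>b. b \<in> B \<Longrightarrow> l b \<in> K"
    "\<And>b C. b \<in> B \<Longrightarrow> \<exists>N. \<forall>n\<ge>N. ereal C \<le> ordp (a n b - l b)"
    by metis
  obtain D' where D': "D' \<ge> 0" "\<And>b. b \<in> B \<Longrightarrow> ereal (- D') \<le> ordp b"
    using finite_ord_bound[OF B(1), of "\<lambda>b. b"] by blast
  have "x - (\<Sum>b\<in>B. l b * b) = 0"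
  proof (rule all_ge_imp_zero)
    fix C :: real
    define N where "N b = (SOME N. \<forall>n\<ge>N. ereal (C + D') \<le> ordp (a n b - l b))" for b
    have N: "\<forall>n\<ge>N b. ereal (C + D') \<le> ordp (a n b - l b)" if "b \<in> B" for b
      unfolding N_def by (rule someI_ex) (rule l(2)[OF that])
    obtain N0 :: nat where N0: "C \<le> real N0" using real_arch_simple by blast
    define n where "n = N0 + (\<Sum>b\<in>B. N b)"
    have nN: "N b \<le> n" if "b \<in> B" for b
      using member_le_sum[OF that, of N] B(1) by (simp add: n_def)
    have "N0 \<le> n" by (simp add: n_def)
    then have "ereal C \<le> ereal (real n)" using N0 by simp
    then have 1: "ereal C \<le> ordp (x - (\<Sum>b\<in>B. a n b * b))" using a(2)[of n] by (rule order_trans)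
    have 2: "ereal C \<le> ordp (\<Sum>b\<in>B. (a n b - l b) * b)"
    proof (rule ge_sum)
      fix b assume b: "b \<in> B"
      have "ereal (C + D' + - D') \<le> ordp ((a n b - l b) * b)"
        by (rule ge_mult) (use N nN D' b in blast)+
      then show "ereal C \<le> ordp ((a n b - l b) * b)" by simp
    qed
    have "x - (\<Sum>b\<in>B. l b * b) = (x - (\<Sum>b\<in>B. a n b * b)) + (\<Sum>b\<in>B. (a n b - l b) * b)"
      by (simp add: left_diff_distrib sum_subtractf)
    then show "ereal C \<le> ordp (x - (\<Sum>b\<in>B. l b * b))" using ge_add[OF 1 2] by (simp only:)
  qed
  then have "x = (\<Sum>b\<in>B. l b * b)" by simp
  then show ?thesis using l(1) unfolding fdspan_def by blast
qed

text \<open>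
  Induction on the basis. The span of the previous vectors is closed, so the new vector has a
  positive distance from it, and this distance bounds the new coordinate.
\<close>

lemma kindep_coord_bound:
  assumes "finite B" "kindep K B"
  shows "\<exists>D. coord_bound B D"
  using assms
proof (induction B rule: finite_induct)
  case empty
  show ?case by (auto simp: coord_bound_def)
next
  case (insert x B)
  have x: "x \<notin> fdspan K B"
  proof
    assume "x \<in> fdspan K B"
    then obtain a where a: "\<forall>b\<in>B. a b \<in> K" "x = (\<Sum>b\<in>B. a b * b)" unfolding fdspan_def by blast
    define c where "c b = (if b = x then - 1 else a b)" for b
    have "(\<Sum>b\<in>B. c b * b) = (\<Sum>b\<in>B. a b * b)"
      using insert.hyps by (intro sum.cong) (auto simp: c_def)
    then have "(\<Sum>b\<in>insert x B. c b * b) = c x * x + (\<Sum>b\<in>B. a b * b)"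
      using insert.hyps by simp
    then have "(\<Sum>b\<in>insert x B. c b * b) = 0" using a(2) by (simp add: c_def)
    moreover have "\<forall>b\<in>insert x B. c b \<in> K" using a by (auto simp: c_def uminus_mem)
    ultimately have "c x = 0" using insert.prems[unfolded kindep_def, rule_format, of c x] by blast
    then show False by (simp add: c_def)
  qed
  have "kindep K B"
    unfolding kindep_def
  proof (intro allI impI)
    fix a assume a: "\<forall>b\<in>B. a b \<in> K" "(\<Sum>b\<in>B. a b * b) = 0"
    define c where "c b = (if b = x then 0 else a b)" for b
    have "(\<Sum>b\<in>B. c b * b) = (\<Sum>b\<in>B. a b * b)"
      using insert.hyps by (intro sum.cong) (auto simp: c_def)
    then have "(\<Sum>b\<in>insert x B. c b * b) = 0" using insert.hyps a(2) by (simp add: c_def)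
    moreover have "\<forall>b\<in>insert x B. c b \<in> K" using a by (auto simp: c_def)
    ultimately have "\<forall>b\<in>insert x B. c b = 0"
      using insert.prems[unfolded kindep_def, rule_format, of c] by blast
    then show "\<forall>b\<in>B. a b = 0" using insert.hyps by (auto simp: c_def split: if_splits)
  qed
  then obtain D where D: "coord_bound B D" using insert.IH by blast
  have "\<exists>C::real. \<forall>w\<in>fdspan K B. \<not> ereal C \<le> ordp (x - w)"
    using closed_if_coord_bound[OF insert.hyps(1) D] x by blast
  then obtain C :: real where C: "\<And>w. w \<in> fdspan K B \<Longrightarrow> \<not> ereal C \<le> ordp (x - w)" by blast
  obtain D1 where D1: "D1 \<ge> 0" "ereal (- D1) \<le> ordp x"
    using finite_ord_bound[of "{x}" "\<lambda>b. b"] by blast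
  have "coord_bound (insert x B) (\<bar>C\<bar> + D1 + \<bar>D\<bar>)"
    unfolding coord_bound_def
  proof (intro allI impI)
    fix a t assume a: "\<forall>b\<in>insert x B. a b \<in> K" "ereal t \<le> ordp (\<Sum>b\<in>insert x B. a b * b)"
    let ?s = "\<Sum>b\<in>B. a b * b"
    have t: "ereal t \<le> ordp (a x * x + ?s)" using a(2) insert.hyps by simp
    have ax: "ereal (t - C) \<le> ordp (a x)"
    proof (cases "a x = 0")
      case False
      then obtain r where r: "ordp (a x) = ereal r" using ord_finite by blast
      let ?w = "- inverse (a x) * ?s"
      have "?s \<in> fdspan K B" using a(1) unfolding fdspan_def by blast
      then have "?w \<in> fdspan K B"
        using ksubspace_fdspan[of B] a(1) unfolding ksubspace_def
        by (meson inverse_mem uminus_mem insertI1)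
      then have nC: "\<not> ereal C \<le> ordp (x - ?w)" by (rule C)
      have eq: "a x * x + ?s = a x * (x - ?w)" using False by (simp add: algebra_simps)
      have "ereal t \<le> ereal r + ordp (x - ?w)" using t unfolding eq ord_mult r .
      then show ?thesis using nC unfolding r by (rule ereal_diff_le)
    qed simp
    have "ereal (t - C + - D1) \<le> ordp (a x * x)" by (rule ge_mult[OF ax D1(2)])
    then have 1: "ereal (t - \<bar>C\<bar> - D1) \<le> ordp (a x * x)"
      by (rule order_trans[rotated]) simp
    have 2: "ereal (t - \<bar>C\<bar> - D1) \<le> ordp (a x * x + ?s)"
      using t by (rule order_trans[rotated]) (use D1 in simp)
    have "ereal (t - \<bar>C\<bar> - D1) \<le> ordp ?s" using ge_diff[OF 2 1] by simp
    then have b: "\<forall>b\<in>B. ereal (t - \<bar>C\<bar> - D1 - D) \<le> ordp (a b)"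
      using D[unfolded coord_bound_def, rule_format, of a "t - \<bar>C\<bar> - D1"] a(1) by blast
    show "\<forall>b\<in>insert x B. ereal (t - (\<bar>C\<bar> + D1 + \<bar>D\<bar>)) \<le> ordp (a b)"
    proof
      fix b assume "b \<in> insert x B"
      then consider "b = x" | "b \<in> B" by blast
      then show "ereal (t - (\<bar>C\<bar> + D1 + \<bar>D\<bar>)) \<le> ordp (a b)"
      proof cases
        case 1
        show ?thesis unfolding 1 using ax by (rule order_trans[rotated]) (use D1 in simp)
      next
        case 2
        with b have "ereal (t - \<bar>C\<bar> - D1 - D) \<le> ordp (a b)" by blast
        then show ?thesis by (rule order_trans[rotated]) simp
      qed
    qed
  qed
  then show ?case by blast
qed

lemma fdspan_basis:
  assumes "finite B"
  obtains A where "finite A" "kindep K A" "fdspan K A = fdspan K B"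
  using ksubspace_basis[OF assms ksubspace_fdspan order_refl] by metis

lemma fdspan_closed:
  assumes "finite B" "\<And>C::real. \<exists>w\<in>fdspan K B. ereal C \<le> ordp (x - w)"
  shows "x \<in> fdspan K B"
proof -
  obtain A where A: "finite A" "kindep K A" "fdspan K A = fdspan K B" using fdspan_basis assms(1) by metis
  obtain D where "coord_bound A D" using kindep_coord_bound A by blast
  from closed_if_coord_bound[OF A(1) this, of x] assms(2) A(3) show ?thesis by simp
qed

lemma klinear_bounded:
  assumes "finite B" "klinear K (fdspan K B) \<phi>"
  obtains D where "D \<ge> 0" "\<And>x t. x \<in> fdspan K B \<Longrightarrow> ereal t \<le> ordp x \<Longrightarrow> ereal (t - D) \<le> ordp (\<phi> x)"
proof -
  obtain A where A: "finite A" "kindep K A" "fdspan K A = fdspan K B" using fdspan_basis assms(1) by metis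
  obtain D where D: "coord_bound A D" using kindep_coord_bound A by blast
  obtain E where E: "E \<ge> 0" "\<And>b. b \<in> A \<Longrightarrow> ereal (- E) \<le> ordp (\<phi> b)"
    using finite_ord_bound[OF A(1), of \<phi>] by blast
  have V: "ksubspace K (fdspan K B)" by (rule ksubspace_fdspan)
  have AV: "A \<subseteq> fdspan K B" using A fdspan_superset by blast
  show thesis
  proof (rule that[of "\<bar>D\<bar> + E"])
    fix x t assume x: "x \<in> fdspan K B" "ereal t \<le> ordp x"
    then obtain a where a: "\<forall>b\<in>A. a b \<in> K" "x = (\<Sum>b\<in>A. a b * b)"
      unfolding A(3)[symmetric] unfolding fdspan_def by blast
    have ab: "\<forall>b\<in>A. ereal (t - D) \<le> ordp (a b)"
      using D[unfolded coord_bound_def, rule_format, of a t] a x(2) by blast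
    have "\<phi> x = (\<Sum>b\<in>A. \<phi> (a b * b))"
      unfolding a(2) by (rule klinear_sum[OF V assms(2)]) (use a AV V in \<open>auto simp: ksubspace_def\<close>)
    also have "\<dots> = (\<Sum>b\<in>A. a b * \<phi> b)"
      by (rule sum.cong) (use a AV assms(2) in \<open>auto simp: klinear_def\<close>)
    finally have \<phi>: "\<phi> x = (\<Sum>b\<in>A. a b * \<phi> b)" .
    have "ereal (t - D + - E) \<le> ordp (\<phi> x)"
      unfolding \<phi> by (rule ge_sum, rule ge_mult) (use ab E in blast)+
    then show "ereal (t - (\<bar>D\<bar> + E)) \<le> ordp (\<phi> x)"
      by (rule order_trans[rotated]) simp
  qed (use E in simp)
qed

end

section \<open>Finite extensions\<close>

context subfield_of
begin

lemma fdalg_ksubspace: "fdalg K L \<Longrightarrow> ksubspace K L"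
  unfolding fdalg_def using ksubspace_fdspan by blast

lemma fdalg_superset: "fdalg K L \<Longrightarrow> K \<subseteq> L"
  using fdalg_ksubspace[of L] unfolding fdalg_def ksubspace_def by (metis mult.right_neutral subsetI)

lemma fdalg_K: "fdalg K K"
proof -
  have "K = fdspan K {1}" unfolding fdspan_def by auto
  then show ?thesis unfolding fdalg_def using mult_mem one_mem finite.emptyI finite.insertI by metis
qed

text \<open>
  Multiplication by \<open>x\<close> maps a basis to an independent family of the same size, whose span
  therefore contains \<open>1\<close>.
\<close>

lemma fdalg_inverse:
  assumes L: "fdalg K L" and x: "x \<in> L"
  shows "inverse x \<in> L"
proof (cases "x = 0")
  case False
  from L obtain B where B: "finite B" "L = fdspan K B" unfolding fdalg_def by blast
  obtain A where A: "finite A" "A \<subseteq> L" "kindep K A" "fdspan K A = L"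
    using ksubspace_basis[OF B(1) fdalg_ksubspace[OF L]] B by blast
  let ?A = "(*) x ` A"
  have inj: "inj_on ((*) x) A" using False by (auto simp: inj_on_def)
  have s: "(\<Sum>b\<in>?A. a b * b) = x * (\<Sum>b\<in>A. a (x * b) * b)" for a
    by (subst sum.reindex[OF inj]) (simp add: sum_distrib_left mult.left_commute)
  have ind: "kindep K ?A"
    unfolding kindep_def
  proof (intro allI impI)
    fix a assume a: "\<forall>b\<in>?A. a b \<in> K" "(\<Sum>b\<in>?A. a b * b) = 0"
    then have "(\<Sum>b\<in>A. a (x * b) * b) = 0" using False unfolding s by simp
    moreover have "\<forall>b\<in>A. a (x * b) \<in> K" using a(1) by blast
    ultimately have "\<forall>b\<in>A. a (x * b) = 0"
      using A(3)[unfolded kindep_def, rule_format, of "\<lambda>b. a (x * b)"] by blast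
    then show "\<forall>b\<in>?A. a b = 0" by blast
  qed
  have AL: "?A \<subseteq> L" using A(2) x L unfolding fdalg_def by blast
  have "1 \<in> fdspan K ?A"
  proof (rule ccontr)
    assume n: "1 \<notin> fdspan K ?A"
    have "1 \<notin> ?A" using n fdspan_superset[of ?A] A(1) by blast
    then have "card (insert 1 ?A) = Suc (card A)" using A(1) inj by (simp add: card_image)
    moreover have "card (insert 1 ?A) \<le> card A"
    proof (rule kindep_card_le[OF A(1)])
      show "kindep K (insert 1 ?A)" by (rule fdspan_insert_indep) (use A ind n in auto)
      show "insert 1 ?A \<subseteq> fdspan K A" using AL L A(4) unfolding fdalg_def by blast
    qed (use A in simp)
    ultimately show False by simp
  qed
  then obtain a where a: "\<forall>b\<in>?A. a b \<in> K" "1 = x * (\<Sum>b\<in>A. a (x * b) * b)"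
    unfolding fdspan_def s[symmetric] by blast
  have "(\<Sum>b\<in>A. a (x * b) * b) \<in> L"
    unfolding A(4)[symmetric] fdspan_def using a(1) by (auto intro!: exI[of _ "\<lambda>b. a (x * b)"])
  moreover have "inverse x = (\<Sum>b\<in>A. a (x * b) * b)"
    using a(2) by (metis inverse_unique)
  ultimately show ?thesis by simp
qed (use fdalg_ksubspace[OF L] in \<open>simp add: ksubspace_def\<close>)

lemma fdalg_subring: "fdalg K L \<Longrightarrow> subring_of L"
proof -
  assume L: "fdalg K L"
  note V = fdalg_ksubspace[OF L, unfolded ksubspace_def]
  have "- y \<in> L" if "y \<in> L" for y using V that uminus_mem[OF one_mem] by (metis mult_minus1)
  then have "x - y \<in> L" if "x \<in> L" "y \<in> L" for x y using V that by (metis diff_conv_add_uminus)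
  then show "subring_of L" using V L unfolding fdalg_def by unfold_locales blast+
qed

lemma fdalg_power: "fdalg K L \<Longrightarrow> x \<in> L \<Longrightarrow> x ^ n \<in> L"
  by (induction n) (auto simp: fdalg_def)

text \<open>
  The powers of \<open>x\<close> up to the size of a spanning set are linearly dependent.
\<close>

lemma fdalg_algebraic:
  assumes L: "fdalg K L"
  shows "L \<subseteq> alg_closure_in K"
proof
  fix x assume x: "x \<in> L"
  from L obtain B where B: "finite B" "L = fdspan K B" unfolding fdalg_def by blast
  have "\<exists>f. x ^ i = (\<Sum>b\<in>B. f b * b) \<and> (\<forall>b\<in>B. f b \<in> K)" for i :: nat
    using fdalg_power[OF L x, of i] unfolding B(2) fdspan_def by blast
  then obtain f where f: "\<And>i. x ^ i = (\<Sum>b\<in>B. f i b * b)" "\<And>i b. b \<in> B \<Longrightarrow> f i b \<in> K"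
    by metis
  obtain c where c: "\<forall>i\<in>{..card B}. c i \<in> K" "\<exists>i\<in>{..card B}. c i \<noteq> 0"
    "\<forall>e\<in>B. (\<Sum>i\<in>{..card B}. c i * f i e) = 0"
    using nontrivial_relation[of B "{..card B}" f] B f by auto
  define q where "q = (\<Sum>i\<in>{..card B}. Polynomial.monom (c i) i)"
  have cq: "Polynomial.coeff q n = (if n \<le> card B then c n else 0)" for n
    by (simp add: q_def coeff_sum if_distrib cong: if_cong)
  have "Polynomial.poly q x = (\<Sum>i\<in>{..card B}. c i * (\<Sum>b\<in>B. f i b * b))"
    by (simp add: q_def poly_sum poly_monom f(1)[symmetric])
  also have "\<dots> = (\<Sum>b\<in>B. (\<Sum>i\<in>{..card B}. c i * f i b) * b)"
    by (simp add: sum_distrib_left sum_distrib_right mult.assoc) (rule sum.swap)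
  also have "\<dots> = 0" using c(3) by simp
  finally have "Polynomial.poly q x = 0" .
  moreover have "q \<noteq> 0" using c(2) cq by (metis atMost_iff coeff_0)
  ultimately show "x \<in> alg_closure_in K"
    unfolding alg_closure_in_def using cq c(1) by (auto intro!: exI[of _ q])
qed

text \<open>
  The ring \<open>L[x]\<close> is spanned by the products of a spanning set of \<open>L\<close> with the powers of \<open>x\<close> below
  the degree of a polynomial that annihilates \<open>x\<close>.
\<close>

lemma fdalg_adjoin:
  assumes L: "fdalg K L" and x: "x \<in> alg_closure_in K"
  obtains L' where "fdalg K L'" "L \<subseteq> L'" "x \<in> L'"
proof -
  from x obtain q where q: "q \<noteq> 0" "\<And>i. Polynomial.coeff q i \<in> K" "Polynomial.poly q x = 0"
    unfolding alg_closure_in_def by blast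
  define d where "d = Polynomial.degree q"
  define P where "P = (\<lambda>i. x ^ i) ` {..<d}"
  have fP: "finite P" by (simp add: P_def)
  have V: "ksubspace K (fdspan K P)" by (rule ksubspace_fdspan)
  have lead: "Polynomial.coeff q d \<noteq> 0" using q(1) by (simp add: d_def)
  have xd: "x ^ d = (\<Sum>i<d. (- Polynomial.coeff q i / Polynomial.coeff q d) * x ^ i)"
  proof -
    have "0 = (\<Sum>i\<le>d. Polynomial.coeff q i * x ^ i)" using q(3) by (simp add: poly_altdef d_def)
    also have "\<dots> = (\<Sum>i<d. Polynomial.coeff q i * x ^ i) + Polynomial.coeff q d * x ^ d"
      by (simp add: lessThan_Suc_atMost[symmetric])
    finally have "x ^ d = - (\<Sum>i<d. Polynomial.coeff q i * x ^ i) / Polynomial.coeff q d"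
      using lead by (simp add: field_simps eq_neg_iff_add_eq_0)
    then show ?thesis by (simp add: sum_divide_distrib sum_negf)
  qed
  have pw: "x ^ n \<in> fdspan K P" for n
  proof (induction n rule: less_induct)
    case (less n)
    show ?case
    proof (cases "n < d")
      case True
      then show ?thesis using fdspan_superset[OF fP] by (auto simp: P_def)
    next
      case False
      have "x ^ n = x ^ (n - d) * x ^ d" using False by (simp flip: power_add)
      also have "\<dots> = (\<Sum>i<d. (- Polynomial.coeff q i / Polynomial.coeff q d) * x ^ (n - d + i))"
        unfolding xd by (simp add: sum_distrib_left power_add mult.left_commute)
      also have "\<dots> \<in> fdspan K P"
      proof (rule ksubspace_sum[OF V])
        fix i assume "i \<in> {..<d}"
        then have "x ^ (n - d + i) \<in> fdspan K P" using less.IH[of "n - d + i"] False by simp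
        moreover have "- Polynomial.coeff q i / Polynomial.coeff q d \<in> K"
          using q(2) by (simp add: divide_inverse mult_mem uminus_mem inverse_mem)
        ultimately show "- Polynomial.coeff q i / Polynomial.coeff q d * x ^ (n - d + i) \<in> fdspan K P"
          using V unfolding ksubspace_def by blast
      qed
      finally show ?thesis .
    qed
  qed
  from L obtain A where A: "finite A" "L = fdspan K A" unfolding fdalg_def by blast
  define G where "G = (\<lambda>(a, b). a * b) ` (A \<times> P)"
  have fG: "finite G" using A fP by (simp add: G_def)
  define L' where "L' = fdspan K G"
  have V': "ksubspace K L'" unfolding L'_def by (rule ksubspace_fdspan)
  have mem: "l * x ^ n \<in> L'" if "l \<in> L" for l n
    unfolding L'_def G_def by (rule fdspan_mult) (use that A fP pw in auto)
  have "L \<subseteq> L'" using mem[of _ 0] by auto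
  moreover have "x \<in> L'" using mem[of 1 1] L unfolding fdalg_def by auto
  moreover have "fdalg K L'"
    unfolding fdalg_def
  proof (intro conjI ballI)
    show "\<exists>B. finite B \<and> L' = fdspan K B" using fG L'_def by blast
    show "1 \<in> L'" using mem[of 1 0] L unfolding fdalg_def by auto
    fix y z assume yz: "y \<in> L'" "z \<in> L'"
    have "y * z \<in> fdspan K ((\<lambda>(a, b). a * b) ` (G \<times> G))"
      by (rule fdspan_mult[OF fG fG]) (use yz L'_def in auto)
    moreover have "fdspan K ((\<lambda>(a, b). a * b) ` (G \<times> G)) \<subseteq> L'"
    proof (rule fdspan_least[OF V'], rule subsetI)
      fix w assume "w \<in> (\<lambda>(a, b). a * b) ` (G \<times> G)"
      then obtain a b i j where w: "w = (a * x ^ i) * (b * x ^ j)" "a \<in> A" "b \<in> A"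
        unfolding G_def P_def by auto
      have "a \<in> L" "b \<in> L" using w A fdspan_superset by auto
      then have "a * b \<in> L" using L unfolding fdalg_def by blast
      then have "(a * b) * x ^ (i + j) \<in> L'" by (rule mem)
      then show "w \<in> L'" using w(1) by (simp add: power_add mult_ac)
    qed
    ultimately show "y * z \<in> L'" by blast
  qed
  ultimately show thesis using that by blast
qed

lemma fdalg_finite_subset:
  assumes "finite F" "F \<subseteq> alg_closure_in K"
  obtains L where "fdalg K L" "F \<subseteq> L"
proof -
  have "\<exists>L. fdalg K L \<and> F \<subseteq> L" using assms
  proof (induction F rule: finite_induct)
    case empty
    then show ?case using fdalg_K by blast
  next
    case (insert x F)
    then obtain L where L: "fdalg K L" "F \<subseteq> L" by blast
    obtain L' where "fdalg K L'" "L \<subseteq> L'" "x \<in> L'" using fdalg_adjoin[OF L(1)] insert.prems by blast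
    then show ?case using L by blast
  qed
  then show thesis using that by blast
qed

text \<open>
  The generated field is a \<open>K\<close>-subspace of \<open>L\<close>, hence has finite dimension.
\<close>

lemma fdalg_generate_field:
  assumes L: "fdalg K L" and S: "S \<subseteq> L"
  defines "V \<equiv> generate_field (sub_field_of UNIV) (K \<union> S)"
  shows "fdalg K V" "K \<subseteq> V" "S \<subseteq> V" "V \<subseteq> L"
proof -
  interpret LL: subring_of L by (rule fdalg_subring[OF L])
  have inv: "inv\<^bsub>sub_field_of UNIV\<^esub> h = inverse h" if "h \<noteq> 0" for h :: 'c
  proof -
    interpret R: cring "sub_field_of (UNIV :: 'c set)" by (rule cring_sub_field_of[OF subring_of_UNIV])
    show ?thesis using that by (intro R.comm_inv_char) auto
  qed
  show VL: "V \<subseteq> L"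
  proof
    fix x assume "x \<in> V"
    then show "x \<in> L" unfolding V_def
    proof (induction rule: generate_field.induct)
      case (incl h)
      then show ?case using S fdalg_superset[OF L] by blast
    next
      case (m_inv h)
      then show ?case using fdalg_inverse[OF L] inv by simp
    qed (auto simp: sub_field_of_inv[OF subring_of_UNIV] intro: LL.uminus_mem LL.add_mem LL.mult_mem)
  qed
  show KV: "K \<subseteq> V" and "S \<subseteq> V" unfolding V_def using generate_field.incl by (metis Un_iff subsetI)+
  have add: "x + y \<in> V" "x * y \<in> V" if "x \<in> V" "y \<in> V" for x y
    using that generate_field.eng_add[of x "sub_field_of UNIV" _ y]
      generate_field.eng_mult[of x "sub_field_of UNIV" _ y] unfolding V_def by simp_all
  have "ksubspace K V" using add KV zero_mem unfolding ksubspace_def by blast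
  moreover obtain B where "finite B" "L = fdspan K B" using L unfolding fdalg_def by blast
  ultimately obtain A where "finite A" "fdspan K A = V" using ksubspace_basis VL by metis
  then show "fdalg K V" unfolding fdalg_def using add KV one_mem by blast
qed

end

section \<open>Summation in Banach spaces\<close>

locale valued_module = complete_subfield p ordp K
  for p and ordp :: "'c::{alg_closed_field, field_char_0} \<Rightarrow> ereal" and K :: "'c set" +
  fixes M :: "('c, 'm) module" (structure) and v :: "'m \<Rightarrow> ereal"
  assumes banach: "banach_space ordp K M v"
begin

sublocale Mod: module "sub_field_of K" M
  using banach by (simp add: banach_space_def)

lemma v_0 [simp]: "v \<zero> = \<infinity>"
  using banach Mod.M.zero_closed unfolding banach_space_def is_valuation_def by blast

lemma v_smult: "a \<in> K \<Longrightarrow> x \<in> carrier M \<Longrightarrow> v (a \<odot> x) = ordp a + v x"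
  using banach unfolding banach_space_def by blast

lemma v_ge_add:
  "x \<in> carrier M \<Longrightarrow> y \<in> carrier M \<Longrightarrow> ereal t \<le> v x \<Longrightarrow> ereal t \<le> v y \<Longrightarrow> ereal t \<le> v (x \<oplus> y)"
  using banach unfolding banach_space_def is_valuation_def by (meson min.boundedI order_trans)

lemma v_ge_smult:
  assumes "a \<in> K" "x \<in> carrier M" "ereal s \<le> ordp a" "ereal t \<le> v x"
  shows "ereal (s + t) \<le> v (a \<odot> x)"
  unfolding v_smult[OF assms(1,2)] plus_ereal.simps(1)[symmetric] by (rule add_mono) fact+

lemma v_uminus: "x \<in> carrier M \<Longrightarrow> v (\<ominus> x) = v x"
proof -
  assume x: "x \<in> carrier M"
  have "\<ominus> x = (\<ominus>\<^bsub>sub_field_of K\<^esub> \<one>\<^bsub>sub_field_of K\<^esub>) \<odot> x"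
    using Mod.smult_l_minus[of "\<one>\<^bsub>sub_field_of K\<^esub>" x] x Mod.smult_one[of x] by simp
  also have "\<dots> = (- 1) \<odot> x" by (simp add: sub_field_of_inv[OF K_subring])
  finally show ?thesis using v_smult[of "- 1" x] x uminus_mem[OF one_mem] by simp
qed

lemma v_ge_minus:
  "x \<in> carrier M \<Longrightarrow> y \<in> carrier M \<Longrightarrow> ereal t \<le> v x \<Longrightarrow> ereal t \<le> v y \<Longrightarrow> ereal t \<le> v (x \<ominus> y)"
  by (simp add: a_minus_def v_ge_add v_uminus)

lemma v_ge_finsum:
  assumes "\<And>i. i \<in> F \<Longrightarrow> g i \<in> carrier M" "\<And>i. i \<in> F \<Longrightarrow> ereal t \<le> v (g i)"
  shows "ereal t \<le> v (\<Oplus>i\<in>F. g i)"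
  using assms
proof (induction F rule: infinite_finite_induct)
  case (insert x F)
  then show ?case by (simp add: v_ge_add Pi_def Mod.M.finsum_closed)
qed auto

lemma v_all_ge_zero:
  assumes "x \<in> carrier M" "\<And>C::real. ereal C \<le> v x"
  shows "x = \<zero>"
proof -
  have "v x = \<infinity>" using assms(2) by (rule ereal_top)
  then show ?thesis using banach assms(1) unfolding banach_space_def is_valuation_def by blast
qed

lemma minus_add_minus:
  assumes "x \<in> carrier M" "y \<in> carrier M" "z \<in> carrier M"
  shows "x \<ominus> z = (x \<ominus> y) \<oplus> (y \<ominus> z)"
proof -
  have "(x \<ominus> y) \<oplus> (y \<ominus> z) = x \<oplus> ((\<ominus> y \<oplus> y) \<oplus> \<ominus> z)"
    using assms by (simp add: a_minus_def Mod.M.a_assoc)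
  then show ?thesis using assms by (simp add: a_minus_def Mod.M.l_neg)
qed

lemma v_ge_triangle:
  assumes "x \<in> carrier M" "y \<in> carrier M" "z \<in> carrier M"
    "ereal t \<le> v (x \<ominus> y)" "ereal t \<le> v (y \<ominus> z)"
  shows "ereal t \<le> v (x \<ominus> z)"
  using assms by (subst minus_add_minus[of x y z]) (auto intro: v_ge_add)

lemma minus_swap: "x \<in> carrier M \<Longrightarrow> y \<in> carrier M \<Longrightarrow> x \<ominus> y = \<ominus> (y \<ominus> x)"
  by (simp add: a_minus_def Mod.M.minus_add Mod.M.a_comm)

lemma v_minus_swap: "x \<in> carrier M \<Longrightarrow> y \<in> carrier M \<Longrightarrow> v (x \<ominus> y) = v (y \<ominus> x)"
  by (subst minus_swap) (auto simp: v_uminus)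

lemma minus_eq_zero:
  assumes "x \<in> carrier M" "y \<in> carrier M" "x \<ominus> y = \<zero>"
  shows "x = y"
proof -
  have "x = x \<ominus> \<zero>" using assms by (simp add: a_minus_def)
  also have "\<dots> = (x \<ominus> y) \<oplus> (y \<ominus> \<zero>)" by (rule minus_add_minus) (use assms in auto)
  also have "\<dots> = y" using assms by (simp add: a_minus_def)
  finally show ?thesis .
qed

lemma add_minus_add:
  assumes "a \<in> carrier M" "b \<in> carrier M" "c \<in> carrier M" "d \<in> carrier M"
  shows "(a \<oplus> b) \<ominus> (c \<oplus> d) = (a \<ominus> c) \<oplus> (b \<ominus> d)"
  using assms by (simp add: a_minus_def Mod.M.minus_add Mod.M.a_ac)

lemma smult_minus:
  assumes "a \<in> K" "x \<in> carrier M" "y \<in> carrier M"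
  shows "a \<odot> x \<ominus> a \<odot> y = a \<odot> (x \<ominus> y)"
  using assms by (simp add: a_minus_def Mod.smult_r_distr Mod.smult_r_minus)

lemma finsum_diff_subset:
  assumes "finite F" "F0 \<subseteq> F" "\<And>i. g i \<in> carrier M"
  shows "(\<Oplus>i\<in>F. g i) \<ominus> (\<Oplus>i\<in>F0. g i) = (\<Oplus>i\<in>F - F0. g i)"
proof -
  have "(\<Oplus>i\<in>F0 \<union> (F - F0). g i) = (\<Oplus>i\<in>F0. g i) \<oplus> (\<Oplus>i\<in>F - F0. g i)"
    by (rule Mod.M.finsum_Un_disjoint) (use assms in \<open>auto intro: finite_subset\<close>)
  moreover have "F0 \<union> (F - F0) = F" using assms(2) by blast
  ultimately have e': "(\<Oplus>i\<in>F. g i) = (\<Oplus>i\<in>F0. g i) \<oplus> (\<Oplus>i\<in>F - F0. g i)"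
    by metis
  have c: "(\<Oplus>i\<in>F0. g i) \<in> carrier M" "(\<Oplus>i\<in>F - F0. g i) \<in> carrier M"
    using assms(3) by (simp_all add: Mod.M.finsum_closed Pi_def)
  have e: "(\<Oplus>i\<in>F. g i) = (\<Oplus>i\<in>F - F0. g i) \<oplus> (\<Oplus>i\<in>F0. g i)"
    unfolding e' by (rule Mod.M.a_comm[OF c])
  show ?thesis unfolding e a_minus_def
    using c by (simp add: Mod.M.a_assoc Mod.M.r_neg)
qed

text \<open>
  The property that \<open>val_sum\<close> selects, as a relation with a limit that may vary.
\<close>

definition has_vsum :: "('i \<Rightarrow> 'm) \<Rightarrow> 'm \<Rightarrow> bool" where
  "has_vsum g s \<longleftrightarrow> s \<in> carrier M \<and> (\<forall>C::real. \<exists>F0. finite F0 \<and>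
     (\<forall>F. finite F \<and> F0 \<subseteq> F \<longrightarrow> ereal C \<le> v ((\<Oplus>i\<in>F. g i) \<ominus> s)))"

lemma has_vsumD:
  assumes "has_vsum g s"
  obtains F0 where "finite F0" "\<And>F. finite F \<Longrightarrow> F0 \<subseteq> F \<Longrightarrow> ereal C \<le> v ((\<Oplus>i\<in>F. g i) \<ominus> s)"
proof -
  have "\<exists>F0. finite F0 \<and> (\<forall>F. finite F \<and> F0 \<subseteq> F \<longrightarrow> ereal C \<le> v ((\<Oplus>i\<in>F. g i) \<ominus> s))"
    using assms unfolding has_vsum_def by (elim conjE allE[of _ C])
  then obtain F0 where F0: "finite F0"
    "\<forall>F. finite F \<and> F0 \<subseteq> F \<longrightarrow> ereal C \<le> v ((\<Oplus>i\<in>F. g i) \<ominus> s)"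
    by (elim exE conjE)
  show thesis by (rule that[OF F0(1)]) (use F0(2) in simp)
qed

lemma has_vsum_closed: "has_vsum g s \<Longrightarrow> s \<in> carrier M"
  unfolding has_vsum_def by blast

lemma has_vsum_unique:
  assumes "has_vsum g s" "has_vsum g t" "\<And>i. g i \<in> carrier M"
  shows "s = t"
proof (rule minus_eq_zero[OF _ _ v_all_ge_zero])
  show st: "s \<in> carrier M" "t \<in> carrier M" using assms has_vsum_closed by blast+
  show "s \<ominus> t \<in> carrier M" using st by simp
  fix C :: real
  obtain F1 where F1: "finite F1" "\<And>F. finite F \<Longrightarrow> F1 \<subseteq> F \<Longrightarrow> ereal C \<le> v ((\<Oplus>i\<in>F. g i) \<ominus> s)"
    by (rule has_vsumD[OF assms(1), where C = "C"]) (rule that)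
  obtain F2 where F2: "finite F2" "\<And>F. finite F \<Longrightarrow> F2 \<subseteq> F \<Longrightarrow> ereal C \<le> v ((\<Oplus>i\<in>F. g i) \<ominus> t)"
    by (rule has_vsumD[OF assms(2), where C = "C"]) (rule that)
  let ?S = "\<Oplus>i\<in>F1 \<union> F2. g i"
  have S: "?S \<in> carrier M" using assms(3) by (simp add: Mod.M.finsum_closed Pi_def)
  show "ereal C \<le> v (s \<ominus> t)"
  proof (rule v_ge_triangle[OF st(1) S st(2)])
    show "ereal C \<le> v (s \<ominus> ?S)"
      using F1(2)[of "F1 \<union> F2"] F1(1) F2(1) by (simp add: v_minus_swap[OF st(1) S])
    show "ereal C \<le> v (?S \<ominus> t)" using F2(2)[of "F1 \<union> F2"] F1(1) F2(1) by simp
  qed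
qed

lemma has_vsum_bound:
  assumes "has_vsum g s" "\<And>i. g i \<in> carrier M" "\<And>i. ereal C \<le> v (g i)"
  shows "ereal C \<le> v s"
proof -
  obtain F where "finite F" and F': "\<And>A. finite A \<Longrightarrow> F \<subseteq> A \<Longrightarrow> ereal C \<le> v ((\<Oplus>i\<in>A. g i) \<ominus> s)"
    by (rule has_vsumD[OF assms(1), where C = "C"]) (rule that)
  then have F: "finite F" "ereal C \<le> v ((\<Oplus>i\<in>F. g i) \<ominus> s)" by simp_all
  let ?S = "\<Oplus>i\<in>F. g i"
  have s: "s \<in> carrier M" using assms(1) by (rule has_vsum_closed)
  have S: "?S \<in> carrier M" using assms(2) by (simp add: Mod.M.finsum_closed Pi_def)
  have "ereal C \<le> v ?S" by (rule v_ge_finsum) (use assms in auto)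
  then have "ereal C \<le> v (\<zero> \<ominus> ?S)" using S by (simp add: a_minus_def v_uminus)
  then have "ereal C \<le> v (\<zero> \<ominus> s)" by (intro v_ge_triangle[OF _ S s _ F(2)]) auto
  then show ?thesis using s by (simp add: a_minus_def v_uminus)
qed

lemma M_complete:
  assumes "\<And>n. x n \<in> carrier M"
    "\<And>C::real. \<exists>N::nat. \<forall>m\<ge>N. \<forall>n\<ge>N. ereal C \<le> v (x m \<ominus> x n)"
  obtains l where "l \<in> carrier M" "\<And>C::real. \<exists>N. \<forall>n\<ge>N. ereal C \<le> v (x n \<ominus> l)"
proof -
  have "\<exists>N. \<forall>m\<ge>N. \<forall>n\<ge>N. ereal C < v (x m \<ominus> x n)" for C :: real
  proof -
    obtain N where N: "\<forall>m\<ge>N. \<forall>n\<ge>N. ereal (C + 1) \<le> v (x m \<ominus> x n)" using assms(2) by blast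
    have "ereal C < v (x m \<ominus> x n)" if "m \<ge> N" "n \<ge> N" for m n
      using N that less_le_trans[of "ereal C" "ereal (C + 1)"] by simp
    then show ?thesis by blast
  qed
  moreover have "range x \<subseteq> carrier M" using assms(1) by blast
  ultimately obtain l where l: "l \<in> carrier M" "\<forall>C::real. \<exists>N. \<forall>n\<ge>N. ereal C < v (x n \<ominus> l)"
    using banach unfolding banach_space_def val_complete_def by blast
  then show thesis using that less_imp_le by meson
qed

definition vsummable :: "('i \<Rightarrow> 'm) \<Rightarrow> bool" where
  "vsummable g \<longleftrightarrow> (\<forall>i. g i \<in> carrier M) \<and> (\<forall>C::real. finite {i. \<not> ereal C \<le> v (g i)})"

text \<open>
  By the ultrametric inequality, summing only the terms of valuation below \<open>n\<close> makes an error of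
  valuation at least \<open>n\<close>; these sums form a Cauchy sequence.
\<close>

lemma vsummable_has_vsum:
  assumes "vsummable g"
  shows "\<exists>s. has_vsum g s"
proof -
  have g: "\<And>i. g i \<in> carrier M" and fin: "\<And>C::real. finite {i. \<not> ereal C \<le> v (g i)}"
    using assms by (auto simp: vsummable_def)
  define F where "F n = {i. \<not> ereal (real n) \<le> v (g i)}" for n :: nat
  have F: "finite (F n)" for n unfolding F_def by (rule fin)
  define x where "x n = (\<Oplus>i\<in>F n. g i)" for n
  have cl: "(\<Oplus>i\<in>A. g i) \<in> carrier M" for A using g by (simp add: Mod.M.finsum_closed Pi_def)
  have tail: "ereal (real n) \<le> v ((\<Oplus>i\<in>A. g i) \<ominus> x n)" if "finite A" "F n \<subseteq> A" for n A
    unfolding x_def finsum_diff_subset[of A "F n" g, OF that g]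
    by (rule v_ge_finsum) (use g in \<open>auto simp: F_def\<close>)
  have mono: "F n \<subseteq> F m" if "n \<le> m" for n m
  proof
    fix i assume i: "i \<in> F n"
    have "ereal (real n) \<le> ereal (real m)" using that by simp
    then show "i \<in> F m" using i unfolding F_def by (blast intro: order_trans)
  qed
  have cau: "\<exists>N. \<forall>m\<ge>N. \<forall>n\<ge>N. ereal C \<le> v (x m \<ominus> x n)" for C :: real
  proof -
    obtain N :: nat where N: "C \<le> real N" using real_arch_simple by blast
    have 1: "ereal C \<le> v (x m \<ominus> x N)" if "m \<ge> N" for m
      using tail[OF F mono[OF that]] N order_trans[of "ereal C" "ereal (real N)"]
      unfolding x_def by simp
    have "ereal C \<le> v (x m \<ominus> x n)" if "m \<ge> N" "n \<ge> N" for m n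
    proof (rule v_ge_triangle[of _ "x N"])
      show "ereal C \<le> v (x N \<ominus> x n)"
        using 1[OF that(2)] v_minus_swap[of "x n" "x N"] cl unfolding x_def by simp
    qed (use 1 that cl in \<open>auto simp: x_def\<close>)
    then show ?thesis by blast
  qed
  obtain l where l: "l \<in> carrier M" "\<And>C::real. \<exists>N. \<forall>n\<ge>N. ereal C \<le> v (x n \<ominus> l)"
    by (rule M_complete[of x]) (use cl cau in \<open>auto simp: x_def\<close>)
  have "\<exists>F0. finite F0 \<and> (\<forall>A. finite A \<and> F0 \<subseteq> A \<longrightarrow> ereal C \<le> v ((\<Oplus>i\<in>A. g i) \<ominus> l))" for C :: real
  proof -
    obtain N where N: "\<forall>n\<ge>N. ereal C \<le> v (x n \<ominus> l)" using l(2) by blast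
    obtain N' :: nat where N': "C \<le> real N'" using real_arch_simple by blast
    define n where "n = max N N'"
    have "C \<le> real n" using N' by (simp add: n_def)
    have "ereal C \<le> v ((\<Oplus>i\<in>A. g i) \<ominus> l)" if A: "finite A" "F n \<subseteq> A" for A
    proof (rule v_ge_triangle[of _ "x n"])
      show "ereal C \<le> v ((\<Oplus>i\<in>A. g i) \<ominus> x n)"
        using tail[OF A] \<open>C \<le> real n\<close> order_trans[of "ereal C" "ereal (real n)"] by simp
      show "ereal C \<le> v (x n \<ominus> l)" using N by (simp add: n_def)
    qed (use cl l in \<open>auto simp: x_def\<close>)
    then show ?thesis using F by blast
  qed
  then show ?thesis unfolding has_vsum_def using l(1) by blast
qed

definition vsum :: "('i \<Rightarrow> 'm) \<Rightarrow> 'm" where "vsum g = (THE s. has_vsum g s)"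

lemma vsum_eqI: "has_vsum g s \<Longrightarrow> (\<And>i. g i \<in> carrier M) \<Longrightarrow> vsum g = s"
  unfolding vsum_def by (rule the_equality) (auto intro: has_vsum_unique)

lemma has_vsum_vsum: "vsummable g \<Longrightarrow> has_vsum g (vsum g)"
  using vsummable_has_vsum[of g] vsum_eqI[of g] unfolding vsummable_def by metis

lemma has_vsum_add:
  assumes "has_vsum f s" "has_vsum g t" "\<And>i. f i \<in> carrier M" "\<And>i. g i \<in> carrier M"
  shows "has_vsum (\<lambda>i. f i \<oplus> g i) (s \<oplus> t)"
  unfolding has_vsum_def
proof (intro conjI allI)
  have st: "s \<in> carrier M" "t \<in> carrier M" using assms has_vsum_closed by blast+
  show "s \<oplus> t \<in> carrier M" using st by simp
  fix C :: real
  obtain F1 where F1: "finite F1" "\<And>F. finite F \<Longrightarrow> F1 \<subseteq> F \<Longrightarrow> ereal C \<le> v ((\<Oplus>i\<in>F. f i) \<ominus> s)"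
    by (rule has_vsumD[OF assms(1), where C = "C"]) (rule that)
  obtain F2 where F2: "finite F2" "\<And>F. finite F \<Longrightarrow> F2 \<subseteq> F \<Longrightarrow> ereal C \<le> v ((\<Oplus>i\<in>F. g i) \<ominus> t)"
    by (rule has_vsumD[OF assms(2), where C = "C"]) (rule that)
  have "ereal C \<le> v ((\<Oplus>i\<in>F. f i \<oplus> g i) \<ominus> (s \<oplus> t))"
    if F: "finite F" "F1 \<union> F2 \<subseteq> F" for F
  proof -
    have c: "(\<Oplus>i\<in>F. f i) \<in> carrier M" "(\<Oplus>i\<in>F. g i) \<in> carrier M"
      using assms(3,4) by (simp_all add: Mod.M.finsum_closed Pi_def)
    have "(\<Oplus>i\<in>F. f i \<oplus> g i) = (\<Oplus>i\<in>F. f i) \<oplus> (\<Oplus>i\<in>F. g i)"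
      using assms(3,4) by (intro Mod.M.finsum_addf) auto
    then show ?thesis
      using F1(2)[OF F(1)] F2(2)[OF F(1)] F(2) c st by (simp add: add_minus_add v_ge_add)
  qed
  then show "\<exists>F0. finite F0 \<and> (\<forall>F. finite F \<and> F0 \<subseteq> F \<longrightarrow>
      ereal C \<le> v ((\<Oplus>i\<in>F. f i \<oplus> g i) \<ominus> (s \<oplus> t)))"
    using F1(1) F2(1) by (intro exI[of _ "F1 \<union> F2"]) simp
qed

lemma has_vsum_smult:
  assumes "has_vsum g s" "a \<in> K" "\<And>i. g i \<in> carrier M"
  shows "has_vsum (\<lambda>i. a \<odot> g i) (a \<odot> s)"
  unfolding has_vsum_def
proof (intro conjI allI)
  have s: "s \<in> carrier M" using assms has_vsum_closed by blast
  show "a \<odot> s \<in> carrier M" using s assms by simp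
  fix C :: real
  obtain D where D: "ereal (- D) \<le> ordp a" using finite_ord_bound[of "{a}" "\<lambda>x. x"] by blast
  obtain F0 where F0: "finite F0" "\<And>F. finite F \<Longrightarrow> F0 \<subseteq> F \<Longrightarrow> ereal (C + D) \<le> v ((\<Oplus>i\<in>F. g i) \<ominus> s)"
    by (rule has_vsumD[OF assms(1), where C = "(C + D)"]) (rule that)
  have "ereal C \<le> v ((\<Oplus>i\<in>F. a \<odot> g i) \<ominus> a \<odot> s)" if F: "finite F" "F0 \<subseteq> F" for F
  proof -
    have c: "(\<Oplus>i\<in>F. g i) \<in> carrier M" using assms(3) by (simp add: Mod.M.finsum_closed Pi_def)
    have "(\<Oplus>i\<in>F. a \<odot> g i) = a \<odot> (\<Oplus>i\<in>F. g i)"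
      using Mod.finsum_smult_ldistr[OF F(1), of a g] assms by auto
    then have "(\<Oplus>i\<in>F. a \<odot> g i) \<ominus> a \<odot> s = a \<odot> ((\<Oplus>i\<in>F. g i) \<ominus> s)"
      using smult_minus c s assms(2) by simp
    moreover have "ereal (- D + (C + D)) \<le> v (a \<odot> ((\<Oplus>i\<in>F. g i) \<ominus> s))"
      by (rule v_ge_smult) (use assms(2) c s D F0(2)[OF F] in auto)
    ultimately show ?thesis by simp
  qed
  then show "\<exists>F0. finite F0 \<and> (\<forall>F. finite F \<and> F0 \<subseteq> F \<longrightarrow>
      ereal C \<le> v ((\<Oplus>i\<in>F. a \<odot> g i) \<ominus> a \<odot> s))"
    using F0(1) by (intro exI[of _ F0]) simp
qed

lemma has_vsum_zero: "has_vsum (\<lambda>i. \<zero>) \<zero>"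
  unfolding has_vsum_def by (auto simp: a_minus_def v_uminus intro!: exI[of _ "{}"])

lemma has_vsum_reindex:
  assumes "has_vsum (\<lambda>i. g (h i)) s" "inj h" "\<And>i. g i \<in> carrier M" "\<And>j. j \<notin> range h \<Longrightarrow> g j = \<zero>"
  shows "has_vsum g s"
  unfolding has_vsum_def
proof (intro conjI allI)
  show "s \<in> carrier M" using assms(1) has_vsum_closed by blast
  fix C :: real
  obtain F0 where F0: "finite F0" "\<And>F. finite F \<Longrightarrow> F0 \<subseteq> F \<Longrightarrow> ereal C \<le> v ((\<Oplus>i\<in>F. g (h i)) \<ominus> s)"
    by (rule has_vsumD[OF assms(1), where C = "C"]) (rule that)
  have "ereal C \<le> v ((\<Oplus>i\<in>F. g i) \<ominus> s)" if F: "finite F" "h ` F0 \<subseteq> F" for F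
  proof -
    let ?G = "h -` F"
    have G: "finite ?G" "F0 \<subseteq> ?G" using F assms(2) by (auto intro: finite_vimageI)
    have "(\<Oplus>i\<in>F. g i) = (\<Oplus>i\<in>h ` ?G. g i)"
      by (rule Mod.M.add.finprod_mono_neutral_cong_right) (use F assms(3,4) in auto)
    also have "\<dots> = (\<Oplus>i\<in>?G. g (h i))"
      by (rule Mod.M.finsum_reindex) (use assms in \<open>auto intro: inj_on_subset\<close>)
    finally show ?thesis using F0(2)[OF G] by simp
  qed
  then show "\<exists>F0. finite F0 \<and> (\<forall>F. finite F \<and> F0 \<subseteq> F \<longrightarrow> ereal C \<le> v ((\<Oplus>i\<in>F. g i) \<ominus> s))"
    using F0(1) by (intro exI[of _ "h ` F0"]) simp
qed

end

section \<open>Logarithmic growth and evaluation of power series\<close>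

definition msize :: "('n::finite \<Rightarrow> nat) \<Rightarrow> nat" where "msize n = (\<Sum>i\<in>UNIV. n i)"

definition mon :: "('n::finite \<Rightarrow> 'c::field) \<Rightarrow> ('n \<Rightarrow> nat) \<Rightarrow> 'c" where
  "mon b n = (\<Prod>i\<in>UNIV. b i ^ n i)"

definition hell :: "nat \<Rightarrow> ('n::finite \<Rightarrow> real) \<Rightarrow> ('n \<Rightarrow> nat) \<Rightarrow> real" where
  "hell p h n = (\<Sum>i\<in>UNIV. h i * real (ell p (n i)))"

lemma mon_add: "mon b (\<lambda>i. m i + n i) = mon b m * mon b n"
  by (simp add: mon_def power_add prod.distrib)

lemma mon_0 [simp]: "mon b (\<lambda>_. 0) = 1"
  by (simp add: mon_def)

lemma finite_msize_less: "finite {n :: 'n::finite \<Rightarrow> nat. msize n < N}"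
proof (rule finite_subset)
  show "{n :: 'n \<Rightarrow> nat. msize n < N} \<subseteq> {..(\<lambda>_. N)}"
  proof
    fix n :: "'n \<Rightarrow> nat" assume "n \<in> {n. msize n < N}"
    then have "n i \<le> N" for i
      using member_le_sum[of i UNIV n] by (simp add: msize_def)
    then show "n \<in> {..(\<lambda>_. N)}" by (simp add: le_fun_def)
  qed
qed simp

lemma ell_props:
  assumes "p \<ge> 2"
  shows "n < p ^ ell p n" and "n < p ^ m \<Longrightarrow> ell p n \<le> m"
    and "n \<le> n' \<Longrightarrow> ell p n \<le> ell p n'" and "ell p n = Suc t \<Longrightarrow> p ^ t \<le> n"
proof -
  have ex: "n < p ^ n" for n
  proof -
    have "n < 2 ^ n" by (rule less_exp)
    also have "\<dots> \<le> p ^ n" using assms by (rule power_mono) simp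
    finally show ?thesis .
  qed
  show 1: "n < p ^ ell p n" for n
    unfolding ell_def by (rule LeastI[of "\<lambda>m. n < p ^ m", OF ex])
  show 2: "n < p ^ m \<Longrightarrow> ell p n \<le> m" for n m unfolding ell_def by (rule Least_le)
  show "n \<le> n' \<Longrightarrow> ell p n \<le> ell p n'" using 1[of n'] by (intro 2) simp
  show "ell p n = Suc t \<Longrightarrow> p ^ t \<le> n" using 2[of n t] by linarith
qed

text \<open>
  \<open>2 ^ t\<close> dominates a quadratic polynomial in \<open>t\<close>.
\<close>

lemma linear_le_power2:
  fixes \<epsilon> :: real
  assumes "\<epsilon> > 0"
  obtains c where "c \<ge> 0" "\<And>t. real t \<le> \<epsilon> * 2 ^ t + c"
proof -
  have sq: "real t * (real t - 1) \<le> 2 * 2 ^ t" for t :: nat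
  proof (induction t)
    case (Suc t)
    have "real t \<le> 2 ^ t" using less_exp[of t] by (metis less_imp_le of_nat_le_iff of_nat_numeral of_nat_power)
    moreover have "real (Suc t) * (real (Suc t) - 1) = real t * (real t - 1) + 2 * real t"
      by (simp add: algebra_simps)
    ultimately show ?case using Suc unfolding power_Suc by linarith
  qed simp
  show thesis
  proof (rule that[of "2 / \<epsilon> + 1"])
    fix t :: nat
    show "real t \<le> \<epsilon> * 2 ^ t + (2 / \<epsilon> + 1)"
    proof (cases "real t - 1 \<ge> 2 / \<epsilon>")
      case True
      have "real t * (2 / \<epsilon>) \<le> real t * (real t - 1)" using True by (intro mult_left_mono) auto
      also have "\<dots> \<le> 2 * 2 ^ t" by (rule sq)
      finally have "real t \<le> \<epsilon> * 2 ^ t" using assms by (simp add: field_simps)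
      moreover have "2 / \<epsilon> \<ge> 0" using assms by simp
      ultimately show ?thesis by linarith
    next
      case False
      moreover have "\<epsilon> * 2 ^ t \<ge> 0" using assms by simp
      ultimately show ?thesis by linarith
    qed
  qed (use assms in simp)
qed

text \<open>
  \<open>\<ell>\<close> is logarithmic, as \<open>p ^ t \<le> m\<close> when \<open>\<ell>(m) = t + 1\<close>; so it is dominated by every linear
  function.
\<close>

lemma ell_growth:
  fixes \<epsilon> :: real
  assumes "p \<ge> 2" "\<epsilon> > 0"
  obtains c where "c \<ge> 0" "\<And>m. real (ell p m) \<le> \<epsilon> * real m + c"
proof -
  obtain c where c: "c \<ge> 0" "\<And>t. real t \<le> \<epsilon> * 2 ^ t + c" using linear_le_power2[OF assms(2)] by blast
  have "real (ell p m) \<le> \<epsilon> * real m + (c + 1)" for m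
  proof (cases "ell p m")
    case 0
    then show ?thesis using c assms by simp
  next
    case (Suc t)
    have "(2::nat) ^ t \<le> p ^ t" using assms by (intro power_mono) auto
    also have "\<dots> \<le> m" using ell_props(4)[OF assms(1) Suc] .
    finally have "(2::real) ^ t \<le> real m" by (metis of_nat_le_iff of_nat_numeral of_nat_power)
    then have "\<epsilon> * 2 ^ t \<le> \<epsilon> * real m" using assms by simp
    then show ?thesis using c(2)[of t] Suc by simp
  qed
  then show thesis using that[of "c + 1"] c(1) by simp
qed

lemma hell_growth:
  fixes \<epsilon> :: real and h :: "'n::finite \<Rightarrow> real"
  assumes "p \<ge> 2" "\<epsilon> > 0" "\<And>i. h i \<ge> 0"
  obtains c where "\<And>n. hell p h n \<le> \<epsilon> * real (msize n) + c"
proof -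
  have "\<exists>c. \<forall>m. h i * real (ell p m) \<le> \<epsilon> * real m + c" for i
  proof (cases "h i = 0")
    case True
    then show ?thesis using assms(2) by (intro exI[of _ 0]) simp
  next
    case False
    then have hi: "h i > 0" using assms(3)[of i] by simp
    have "\<epsilon> / h i > 0" using hi assms(2) by simp
    obtain c where c: "c \<ge> 0" "\<And>m. real (ell p m) \<le> \<epsilon> / h i * real m + c"
      by (rule ell_growth[OF assms(1) \<open>\<epsilon> / h i > 0\<close>]) (rule that)
    have "h i * real (ell p m) \<le> \<epsilon> * real m + h i * c" for m
      using mult_left_mono[OF c(2)[of m], of "h i"] hi by (simp add: algebra_simps)
    then show ?thesis by blast
  qed
  then obtain c where c: "\<And>i m. h i * real (ell p m) \<le> \<epsilon> * real m + c i" by metis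
  show thesis
  proof (rule that)
    fix n :: "'n \<Rightarrow> nat"
    have "hell p h n \<le> (\<Sum>i\<in>UNIV. \<epsilon> * real (n i) + c i)" unfolding hell_def by (rule sum_mono) (rule c)
    then show "hell p h n \<le> \<epsilon> * real (msize n) + (\<Sum>i\<in>UNIV. c i)"
      by (simp add: sum.distrib sum_distrib_left msize_def)
  qed
qed

lemma hell_mono: "p \<ge> 2 \<Longrightarrow> (\<And>i. h i \<ge> 0) \<Longrightarrow> m \<le> n \<Longrightarrow> hell p h m \<le> hell p h n"
  unfolding hell_def by (intro sum_mono mult_left_mono) (auto simp: le_fun_def intro: ell_props(3))

lemma ereal_le_add_iff: "ereal C \<le> x + ereal r \<longleftrightarrow> ereal (C - r) \<le> x"
  by (cases x) auto

context valued_module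
begin

lemma p_ge_2: "p \<ge> 2" using prime_p by (rule prime_ge_2_nat)

text \<open>
  The growth condition with its constant, which has to be common to whole families in the
  estimates below.
\<close>

definition in_H :: "('n::finite \<Rightarrow> real) \<Rightarrow> real \<Rightarrow> (('n \<Rightarrow> nat) \<Rightarrow> 'm) \<Rightarrow> bool" where
  "in_H h C g \<longleftrightarrow> (\<forall>n. g n \<in> carrier M \<and> ereal (C - hell p h n) \<le> v (g n))"

lemma H_space_iff: "g \<in> carrier (H_space p h M v) \<longleftrightarrow> (\<exists>C. in_H h C g)"
proof
  assume "g \<in> carrier (H_space p h M v)"
  then have g: "\<And>n. g n \<in> carrier M" "- \<infinity> < (INF n. v (g n) + ereal (hell p h n))"
    by (auto simp: H_space_def hell_def)
  obtain C where C: "ereal C < (INF n. v (g n) + ereal (hell p h n))"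
    using ereal_dense2[OF g(2)] by blast
  have "ereal C \<le> v (g n) + ereal (hell p h n)" for n
    using C INF_lower[of n UNIV "\<lambda>n. v (g n) + ereal (hell p h n)"] by simp
  then show "\<exists>C. in_H h C g" unfolding in_H_def ereal_le_add_iff using g(1) by blast
next
  assume "\<exists>C. in_H h C g"
  then obtain C where C: "in_H h C g" by blast
  have "ereal C \<le> (INF n. v (g n) + ereal (hell p h n))"
    by (rule INF_greatest) (use C in \<open>simp add: in_H_def ereal_le_add_iff\<close>)
  then have "- \<infinity> < (INF n. v (g n) + ereal (hell p h n))"
    by (rule less_le_trans[rotated]) simp
  then show "g \<in> carrier (H_space p h M v)"
    using C by (auto simp: H_space_def hell_def in_H_def)
qed

definition conv :: "(('n::finite \<Rightarrow> nat) \<Rightarrow> 'c) \<Rightarrow> (('n \<Rightarrow> nat) \<Rightarrow> 'm) \<Rightarrow> ('n \<Rightarrow> nat) \<Rightarrow> 'm" where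
  "conv a m n = (\<Oplus>i\<in>{..n}. a i \<odot> m (n - i))"

lemma H_space_simps:
  "a \<odot>\<^bsub>H_space p h M v\<^esub> g = conv a g" "g \<oplus>\<^bsub>H_space p h M v\<^esub> g' = (\<lambda>n. g n \<oplus> g' n)"
  "\<zero>\<^bsub>H_space p h M v\<^esub> = (\<lambda>n. \<zero>)"
  by (simp_all add: H_space_def conv_def fun_eq_iff)

lemma in_H_add: "in_H h C g \<Longrightarrow> in_H h C' g' \<Longrightarrow> in_H h (min C C') (\<lambda>n. g n \<oplus> g' n)"
  unfolding in_H_def
proof (intro allI conjI)
  fix n
  assume a: "\<forall>n. g n \<in> carrier M \<and> ereal (C - hell p h n) \<le> v (g n)"
    "\<forall>n. g' n \<in> carrier M \<and> ereal (C' - hell p h n) \<le> v (g' n)"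
  show "g n \<oplus> g' n \<in> carrier M" using a by simp
  have "ereal (min C C' - hell p h n) \<le> ereal (C - hell p h n)"
    "ereal (min C C' - hell p h n) \<le> ereal (C' - hell p h n)" by simp_all
  then show "ereal (min C C' - hell p h n) \<le> v (g n \<oplus> g' n)"
    using a by (intro v_ge_add) (blast intro: order_trans)+
qed

lemma conv_closed:
  "(\<And>n. a n \<in> K) \<Longrightarrow> (\<And>n. g n \<in> carrier M) \<Longrightarrow> conv a g n \<in> carrier M"
  unfolding conv_def by (rule Mod.M.finsum_closed) auto

text \<open>
  Since \<open>\<ell>\<close> is monotone, an integral power series acts without worsening the constant.
\<close>

lemma in_H_conv:
  assumes "\<And>i. h i \<ge> 0" "\<And>n. a n \<in> K" "\<And>n. 0 \<le> ordp (a n)" "in_H h C g"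
  shows "in_H h C (conv a g)"
  unfolding in_H_def
proof (intro allI conjI)
  fix n
  have g: "\<And>n. g n \<in> carrier M" "\<And>n. ereal (C - hell p h n) \<le> v (g n)" using assms(4) by (auto simp: in_H_def)
  show "conv a g n \<in> carrier M" using assms g by (intro conv_closed)
  show "ereal (C - hell p h n) \<le> v (conv a g n)"
    unfolding conv_def
  proof (rule v_ge_finsum)
    fix i assume "i \<in> {..n}"
    have "hell p h (n - i) \<le> hell p h n"
      by (rule hell_mono[OF p_ge_2 assms(1)]) (simp add: le_fun_def)
    then have "ereal (C - hell p h n) \<le> ereal (C - hell p h (n - i))" by simp
    also have "\<dots> \<le> v (g (n - i))" by (rule g)
    finally have "ereal (0 + (C - hell p h n)) \<le> v (a i \<odot> g (n - i))"
      by (intro v_ge_smult) (use assms g in \<open>auto simp: zero_ereal_def[symmetric]\<close>)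
    then show "ereal (C - hell p h n) \<le> v (a i \<odot> g (n - i))" by simp
  qed (use assms g in auto)
qed

lemma conv_add_left:
  assumes "\<And>n. a n \<in> K" "\<And>n. a' n \<in> K" "\<And>n. g n \<in> carrier M"
  shows "conv (\<lambda>n. a n + a' n) g n = conv a g n \<oplus> conv a' g n"
proof -
  have "conv (\<lambda>n. a n + a' n) g n = (\<Oplus>i\<in>{..n}. a i \<odot> g (n - i) \<oplus> a' i \<odot> g (n - i))"
    unfolding conv_def using assms Mod.smult_l_distr
    by (intro Mod.M.finsum_cong') (auto simp: Pi_def)
  also have "\<dots> = conv a g n \<oplus> conv a' g n"
    unfolding conv_def using assms by (intro Mod.M.finsum_addf) auto
  finally show ?thesis .
qed

lemma conv_monomial:
  assumes "c \<in> K" "\<And>n. g n \<in> carrier M"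
  shows "conv (\<lambda>n. if n = \<alpha> then c else 0) g n = (if \<alpha> \<le> n then c \<odot> g (n - \<alpha>) else \<zero>)"
proof -
  have "conv (\<lambda>n. if n = \<alpha> then c else 0) g n = (\<Oplus>i\<in>{..n}. if \<alpha> = i then c \<odot> g (n - i) else \<zero>)"
    unfolding conv_def using assms Mod.smult_l_null by (intro Mod.M.finsum_cong') auto
  also have "\<dots> = (if \<alpha> \<le> n then c \<odot> g (n - \<alpha>) else \<zero>)"
  proof (cases "\<alpha> \<le> n")
    case True
    then show ?thesis using assms
      by (subst Mod.M.finsum_singleton[of \<alpha> "{..n}" "\<lambda>i. c \<odot> g (n - i)"]) auto
  next
    case False
    then have "(\<Oplus>i\<in>{..n}. if \<alpha> = i then c \<odot> g (n - i) else \<zero>) = (\<Oplus>i\<in>{..n}. \<zero>)"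
      by (intro Mod.M.finsum_cong') auto
    then show ?thesis using False by simp
  qed
  finally show ?thesis .
qed

end

locale eval_point = valued_module p ordp K M v
  for p and ordp :: "'c::{alg_closed_field, field_char_0} \<Rightarrow> ereal" and K :: "'c set"
    and M :: "('c, 'm) module" (structure) and v :: "'m \<Rightarrow> ereal" +
  fixes h :: "'n::finite \<Rightarrow> real" and L :: "'c set" and b :: "'n \<Rightarrow> 'c" and \<beta> :: real
  assumes h_nonneg: "\<And>i. h i \<ge> 0" and L: "fdalg K L" and b_L: "\<And>i. b i \<in> L"
    and \<beta>_pos: "\<beta> > 0" and b_ord: "\<And>i. ereal \<beta> \<le> ordp (b i)"
begin

sublocale LL: subring_of L by (rule fdalg_subring[OF L])

lemma mon_L: "mon b n \<in> L"
  unfolding mon_def by (intro LL.prod_mem LL.power_mem b_L)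

lemma mon_ord: "ereal (\<beta> * real (msize n)) \<le> ordp (mon b n)"
proof -
  have "ereal (\<Sum>i\<in>UNIV. real (n i) * \<beta>) \<le> ordp (mon b n)"
    unfolding mon_def by (intro ge_prod ge_power b_ord)
  then show ?thesis by (simp add: msize_def sum_distrib_left mult.commute)
qed

lemma K_sub_L: "K \<subseteq> L" by (rule fdalg_superset[OF L])

lemma klinear_mult: "klinear K L \<mu> \<Longrightarrow> w \<in> L \<Longrightarrow> klinear K L (\<lambda>x. \<mu> (w * x))"
  unfolding klinear_def
  using LL.mult_mem LL.add_mem K_sub_L by (auto simp: distrib_left mult.left_commute subset_iff)

lemma klinear_add: "klinear K L \<mu> \<Longrightarrow> klinear K L \<nu> \<Longrightarrow> klinear K L (\<lambda>x. \<mu> x + \<nu> x)"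
  unfolding klinear_def by (auto simp: distrib_left add_ac intro: add_mem)

lemma klinear_K: "klinear K L \<mu> \<Longrightarrow> x \<in> L \<Longrightarrow> \<mu> x \<in> K"
  unfolding klinear_def by blast

text \<open>
  The value \<open>g(b)\<close> lies in \<open>M \<otimes> L\<close>. Applying a \<open>K\<close>-linear functional \<open>\<mu>\<close> of \<open>L\<close> to the second
  factor yields an element of \<open>M\<close>; as \<open>L\<close> has finite dimension, these elements determine the
  value. In this form only sums in \<open>M\<close> occur.
\<close>

definition Ev :: "('c \<Rightarrow> 'c) \<Rightarrow> (('n \<Rightarrow> nat) \<Rightarrow> 'm) \<Rightarrow> 'm" where
  "Ev \<mu> g = vsum (\<lambda>n. \<mu> (mon b n) \<odot> g n)"

lemma term_closed: "klinear K L \<mu> \<Longrightarrow> g n \<in> carrier M \<Longrightarrow> \<mu> (mon b n) \<odot> g n \<in> carrier M"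
  using klinear_K mon_L by simp

text \<open>
  The monomials in \<open>b\<close> decay linearly, while the coefficients of \<open>g\<close> grow at most logarithmically;
  half of the linear decay absorbs this growth. The constant is uniform in \<open>g\<close> and \<open>w\<close>.
\<close>

lemma decay:
  assumes "klinear K L \<mu>"
  obtains D where "\<And>g w t n. in_H h C g \<Longrightarrow> w \<in> L \<Longrightarrow> ereal t \<le> ordp w \<Longrightarrow>
    ereal (t + \<beta> / 2 * real (msize n) - D) \<le> v (\<mu> (w * mon b n) \<odot> g n)"
proof -
  obtain B where B: "finite B" "L = fdspan K B" using L unfolding fdalg_def by blast
  obtain D where D: "\<And>x t. x \<in> L \<Longrightarrow> ereal t \<le> ordp x \<Longrightarrow> ereal (t - D) \<le> ordp (\<mu> x)"
    using klinear_bounded[OF B(1), of \<mu>] assms unfolding B(2) by blast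
  obtain c where c: "\<And>n. hell p h n \<le> \<beta> / 2 * real (msize n) + c"
    using hell_growth[OF p_ge_2, of "\<beta> / 2" h] \<beta>_pos h_nonneg by auto
  show thesis
  proof (rule that)
    fix g w t n assume a: "in_H h C g" "w \<in> L" "ereal t \<le> ordp w"
    have wL: "w * mon b n \<in> L" using a(2) mon_L by (rule LL.mult_mem)
    have 1: "ereal (t + \<beta> * real (msize n) - D) \<le> ordp (\<mu> (w * mon b n))"
      using D[OF wL] ge_mult[OF a(3) mon_ord] by simp
    have "ereal ((t + \<beta> * real (msize n) - D) + (C - hell p h n)) \<le> v (\<mu> (w * mon b n) \<odot> g n)"
      by (rule v_ge_smult) (use 1 a(1) klinear_K[OF assms wL] in \<open>auto simp: in_H_def\<close>)
    moreover have "t + \<beta> / 2 * real (msize n) - (D + c - C) \<le> (t + \<beta> * real (msize n) - D) + (C - hell p h n)"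
      using c[of n] by simp
    ultimately show "ereal (t + \<beta> / 2 * real (msize n) - (D + c - C)) \<le> v (\<mu> (w * mon b n) \<odot> g n)"
      by (meson ereal_less_eq(3) order_trans)
  qed
qed

lemma terms_summable:
  assumes "klinear K L \<mu>" "in_H h C g"
  shows "vsummable (\<lambda>n. \<mu> (mon b n) \<odot> g n)"
  unfolding vsummable_def
proof (intro conjI allI)
  fix n show "\<mu> (mon b n) \<odot> g n \<in> carrier M" using assms by (intro term_closed) (auto simp: in_H_def)
next
  fix Z :: real
  obtain D where D: "\<And>g w t n. in_H h C g \<Longrightarrow> w \<in> L \<Longrightarrow> ereal t \<le> ordp w \<Longrightarrow>
    ereal (t + \<beta> / 2 * real (msize n) - D) \<le> v (\<mu> (w * mon b n) \<odot> g n)"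
    by (rule decay[OF assms(1), of C]) (rule that)
  have b2: "0 < \<beta> / 2" using \<beta>_pos by simp
  obtain N :: nat where N: "Z + D < real N * (\<beta> / 2)" using reals_Archimedean3[OF b2] by blast
  have "{n. \<not> ereal Z \<le> v (\<mu> (mon b n) \<odot> g n)} \<subseteq> {n. msize n < N}"
  proof (rule subsetI, rule ccontr)
    fix n assume n: "n \<in> {n. \<not> ereal Z \<le> v (\<mu> (mon b n) \<odot> g n)}" "n \<notin> {n. msize n < N}"
    then have "real N * (\<beta> / 2) \<le> real (msize n) * (\<beta> / 2)" using \<beta>_pos by simp
    then have "Z + D \<le> \<beta> / 2 * real (msize n)" using N by (simp add: mult.commute)
    then have "ereal Z \<le> ereal (0 + \<beta> / 2 * real (msize n) - D)" by simp
    also have "\<dots> \<le> v (\<mu> (1 * mon b n) \<odot> g n)"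
      by (rule D[OF assms(2)]) (auto simp: zero_ereal_def[symmetric])
    finally show False using n(1) by simp
  qed
  then show "finite {n. \<not> ereal Z \<le> v (\<mu> (mon b n) \<odot> g n)}"
    by (rule finite_subset) (rule finite_msize_less)
qed

lemma has_vsum_Ev:
  "klinear K L \<mu> \<Longrightarrow> in_H h C g \<Longrightarrow> has_vsum (\<lambda>n. \<mu> (mon b n) \<odot> g n) (Ev \<mu> g)"
  unfolding Ev_def by (rule has_vsum_vsum[OF terms_summable])

lemma Ev_closed: "klinear K L \<mu> \<Longrightarrow> in_H h C g \<Longrightarrow> Ev \<mu> g \<in> carrier M"
  using has_vsum_Ev has_vsum_closed by blast

lemma Ev_eqI:
  "has_vsum (\<lambda>n. \<mu> (mon b n) \<odot> g n) s \<Longrightarrow> klinear K L \<mu> \<Longrightarrow> (\<And>n. g n \<in> carrier M) \<Longrightarrow> Ev \<mu> g = s"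
  unfolding Ev_def by (rule vsum_eqI) (auto intro: term_closed)

lemma Ev_add:
  assumes "klinear K L \<mu>" "in_H h C g" "in_H h C' g'"
  shows "Ev \<mu> (\<lambda>n. g n \<oplus> g' n) = Ev \<mu> g \<oplus> Ev \<mu> g'"
proof (rule Ev_eqI)
  have c: "\<And>n. g n \<in> carrier M" "\<And>n. g' n \<in> carrier M" using assms by (auto simp: in_H_def)
  have "has_vsum (\<lambda>n. \<mu> (mon b n) \<odot> g n \<oplus> \<mu> (mon b n) \<odot> g' n) (Ev \<mu> g \<oplus> Ev \<mu> g')"
    using assms c by (intro has_vsum_add has_vsum_Ev term_closed)
  then show "has_vsum (\<lambda>n. \<mu> (mon b n) \<odot> (g n \<oplus> g' n)) (Ev \<mu> g \<oplus> Ev \<mu> g')"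
    using c klinear_K[OF assms(1) mon_L] by (simp add: Mod.smult_r_distr)
qed (use assms in \<open>auto simp: in_H_def\<close>)

lemma Ev_add_functional:
  assumes "klinear K L \<mu>" "klinear K L \<nu>" "in_H h C g"
  shows "Ev (\<lambda>x. \<mu> x + \<nu> x) g = Ev \<mu> g \<oplus> Ev \<nu> g"
proof (rule Ev_eqI)
  have c: "\<And>n. g n \<in> carrier M" using assms by (auto simp: in_H_def)
  have "has_vsum (\<lambda>n. \<mu> (mon b n) \<odot> g n \<oplus> \<nu> (mon b n) \<odot> g n) (Ev \<mu> g \<oplus> Ev \<nu> g)"
    using assms c by (intro has_vsum_add has_vsum_Ev term_closed)
  then show "has_vsum (\<lambda>n. (\<mu> (mon b n) + \<nu> (mon b n)) \<odot> g n) (Ev \<mu> g \<oplus> Ev \<nu> g)"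
    using c klinear_K[OF assms(1) mon_L] klinear_K[OF assms(2) mon_L] Mod.smult_l_distr by simp
qed (use assms klinear_add in \<open>auto simp: in_H_def\<close>)

lemma Ev_bound:
  assumes "klinear K L \<mu>"
  obtains D where "\<And>g w t. in_H h C g \<Longrightarrow> w \<in> L \<Longrightarrow> ereal t \<le> ordp w \<Longrightarrow>
    ereal (t - D) \<le> v (Ev (\<lambda>x. \<mu> (w * x)) g)"
proof -
  obtain D where D: "\<And>g w t n. in_H h C g \<Longrightarrow> w \<in> L \<Longrightarrow> ereal t \<le> ordp w \<Longrightarrow>
    ereal (t + \<beta> / 2 * real (msize n) - D) \<le> v (\<mu> (w * mon b n) \<odot> g n)"
    by (rule decay[OF assms(1), of C]) (rule that)
  show thesis
  proof (rule that)
    fix g w t assume a: "in_H h C g" "w \<in> L" "ereal t \<le> ordp w"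
    note k = klinear_mult[OF assms a(2)]
    show "ereal (t - D) \<le> v (Ev (\<lambda>x. \<mu> (w * x)) g)"
    proof (rule has_vsum_bound[OF has_vsum_Ev[OF k a(1)]])
      fix n
      show "\<mu> (w * mon b n) \<odot> g n \<in> carrier M" using term_closed[OF k] a(1) by (auto simp: in_H_def)
      have "ereal (t - D) \<le> ereal (t + \<beta> / 2 * real (msize n) - D)" using \<beta>_pos by simp
      also have "\<dots> \<le> v (\<mu> (w * mon b n) \<odot> g n)" by (rule D[OF a])
      finally show "ereal (t - D) \<le> v (\<mu> (w * mon b n) \<odot> g n)" .
    qed
  qed
qed

text \<open>
  Multiplication by a monomial shifts the coefficients, so the sum is only reindexed.
\<close>

lemma has_vsum_monomial:
  assumes "klinear K L \<mu>" "in_H h C g" "c \<in> K"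
  shows "has_vsum (\<lambda>n. \<mu> (mon b n) \<odot> conv (\<lambda>n. if n = \<alpha> then c else 0) g n)
    (Ev (\<lambda>x. \<mu> ((c * mon b \<alpha>) * x)) g)"
proof -
  have g: "\<And>n. g n \<in> carrier M" using assms by (auto simp: in_H_def)
  have cL: "c * mon b \<alpha> \<in> L" using assms(3) K_sub_L mon_L by (blast intro: LL.mult_mem)
  let ?f = "\<lambda>n. \<mu> (mon b n) \<odot> conv (\<lambda>n. if n = \<alpha> then c else 0) g n"
  let ?s = "\<lambda>m l. \<alpha> l + m l"
  have ml: "\<mu> (c * x) = c * \<mu> x" if "x \<in> L" for x using assms(1,3) that unfolding klinear_def by blast
  have e: "?f (?s m) = \<mu> ((c * mon b \<alpha>) * mon b m) \<odot> g m" for m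
  proof -
    have "mon b \<alpha> * mon b m \<in> L" using mon_L by (blast intro: LL.mult_mem)
    then have "\<mu> ((c * mon b \<alpha>) * mon b m) = \<mu> (mon b \<alpha> * mon b m) * c"
      using ml[of "mon b \<alpha> * mon b m"] by (simp only: mult.assoc[of c] mult.commute[of _ c])
    moreover have "\<mu> (mon b \<alpha> * mon b m) \<in> K" using klinear_K[OF assms(1)] \<open>mon b \<alpha> * mon b m \<in> L\<close> by blast
    ultimately show ?thesis
      using assms(3) g conv_monomial[where g = g, OF assms(3) g, of \<alpha>] fun_diff_cancel(4,7)[of \<alpha> m] Mod.smult_assoc1
      by (simp add: mon_add)
  qed
  show ?thesis
  proof (rule has_vsum_reindex[of _ "\<lambda>m. ?s m"])
    show "has_vsum (\<lambda>m. ?f (?s m)) (Ev (\<lambda>x. \<mu> ((c * mon b \<alpha>) * x)) g)"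
      unfolding e by (rule has_vsum_Ev[OF klinear_mult[OF assms(1) cL] assms(2)])
    show "inj (\<lambda>m. ?s m)" by (auto simp: inj_def fun_eq_iff)
    show "?f n \<in> carrier M" for n
      by (rule term_closed[OF assms(1)], rule conv_closed) (use g assms(3) in auto)
    fix j assume j: "j \<notin> range (\<lambda>m. ?s m)"
    have "\<not> \<alpha> \<le> j"
    proof
      assume "\<alpha> \<le> j"
      then have "j = ?s (j - \<alpha>)" by (simp only: fun_diff_cancel(3))
      then show False using j by blast
    qed
    then show "?f j = \<zero>"
      using conv_monomial[where g = g, OF assms(3) g, of \<alpha>] klinear_K[OF assms(1) mon_L] by simp
  qed
qed

lemma has_vsum_polynomial:
  assumes "klinear K L \<mu>" "in_H h C g" "\<And>n. r n \<in> K" "finite A"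
  shows "has_vsum (\<lambda>n. \<mu> (mon b n) \<odot> conv (\<lambda>n. if n \<in> A then r n else 0) g n)
    (Ev (\<lambda>x. \<mu> ((\<Sum>n\<in>A. r n * mon b n) * x)) g)"
  using assms(4)
proof (induction A rule: finite_induct)
  case empty
  have g: "\<And>n. g n \<in> carrier M" using assms by (auto simp: in_H_def)
  have z: "\<mu> 0 = 0" using assms(1) zero_mem LL.zero_mem unfolding klinear_def by (metis mult_zero_left)
  have c0: "conv (\<lambda>n. 0) g n = \<zero>" for n
    unfolding conv_def using g Mod.smult_l_null by (simp cong: Mod.M.finsum_cong)
  have "Ev (\<lambda>x. \<mu> 0) g = \<zero>"
  proof (rule Ev_eqI)
    show "has_vsum (\<lambda>n. \<mu> 0 \<odot> g n) \<zero>"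
      unfolding z using g Mod.smult_l_null has_vsum_zero by simp
    show "klinear K L (\<lambda>x. \<mu> 0)" unfolding klinear_def z by simp
  qed (rule g)
  moreover have "has_vsum (\<lambda>n. \<mu> (mon b n) \<odot> conv (\<lambda>n. 0) g n) \<zero>"
    unfolding c0 using klinear_K[OF assms(1) mon_L] has_vsum_zero by simp
  ultimately show ?case by simp
next
  case (insert \<alpha> A)
  have g: "\<And>n. g n \<in> carrier M" using assms by (auto simp: in_H_def)
  let ?rA = "\<lambda>n. if n \<in> A then r n else 0" and ?m = "\<lambda>n. if n = \<alpha> then r \<alpha> else 0"
  let ?P = "\<Sum>n\<in>A. r n * mon b n"
  have PL: "?P \<in> L" using assms(3) K_sub_L mon_L by (intro LL.sum_mem LL.mult_mem) auto
  have mL: "r \<alpha> * mon b \<alpha> \<in> L" using assms(3) K_sub_L mon_L by (intro LL.mult_mem) auto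
  have rs: "(\<lambda>n. if n \<in> insert \<alpha> A then r n else 0) = (\<lambda>n. ?m n + ?rA n)"
    using insert.hyps by auto
  have cl: "conv ?m g n \<in> carrier M" "conv ?rA g n \<in> carrier M" for n
    by (rule conv_closed; use g assms(3) in simp)+
  have ca: "conv (\<lambda>n. ?m n + ?rA n) g n = conv ?m g n \<oplus> conv ?rA g n" for n
    by (rule conv_add_left) (use g assms(3) in auto)
  have k1: "klinear K L (\<lambda>x. \<mu> ((r \<alpha> * mon b \<alpha>) * x))" and k2: "klinear K L (\<lambda>x. \<mu> (?P * x))"
    using klinear_mult assms(1) mL PL by blast+
  have \<mu>a: "\<mu> (x + y) = \<mu> x + \<mu> y" if "x \<in> L" "y \<in> L" for x y
    using assms(1) that unfolding klinear_def by blast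
  have "Ev (\<lambda>x. \<mu> ((\<Sum>n\<in>insert \<alpha> A. r n * mon b n) * x)) g =
      Ev (\<lambda>x. \<mu> ((r \<alpha> * mon b \<alpha>) * x) + \<mu> (?P * x)) g"
    unfolding Ev_def using insert.hyps mL PL mon_L LL.mult_mem
    by (simp add: distrib_right \<mu>a)
  also have "\<dots> = Ev (\<lambda>x. \<mu> ((r \<alpha> * mon b \<alpha>) * x)) g \<oplus> Ev (\<lambda>x. \<mu> (?P * x)) g"
    by (rule Ev_add_functional[OF k1 k2 assms(2)])
  finally have e: "Ev (\<lambda>x. \<mu> ((\<Sum>n\<in>insert \<alpha> A. r n * mon b n) * x)) g = \<dots>" .
  have "has_vsum (\<lambda>n. \<mu> (mon b n) \<odot> conv ?m g n \<oplus> \<mu> (mon b n) \<odot> conv ?rA g n)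
     (Ev (\<lambda>x. \<mu> ((r \<alpha> * mon b \<alpha>) * x)) g \<oplus> Ev (\<lambda>x. \<mu> (?P * x)) g)"
    by (intro has_vsum_add has_vsum_monomial[OF assms(1,2,3)] insert.IH term_closed[OF assms(1)] cl)
  then show ?case
    unfolding e rs ca using cl klinear_K[OF assms(1) mon_L] by (simp add: Mod.smult_r_distr)
qed

text \<open>
  Evaluation is multiplicative: multiplying \<open>g\<close> by an integral series \<open>r\<close> multiplies its value by
  \<open>z = r(b)\<close>. This is clear for polynomials \<open>r\<close>. Cutting \<open>r\<close> off at a high degree changes both
  sides by terms of high valuation, by the uniformity of the constants in \<open>decay\<close> and \<open>Ev_bound\<close>.
\<close>

theorem Ev_conv:
  assumes \<mu>: "klinear K L \<mu>" and g: "in_H h C g"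
    and r: "\<And>n. r n \<in> K" "\<And>n. 0 \<le> ordp (r n)" and z: "z \<in> L"
    and lim: "\<And>N::nat. ereal (\<beta> * real N) \<le> ordp (z - (\<Sum>n | msize n < N. r n * mon b n))"
  shows "Ev \<mu> (conv r g) = Ev (\<lambda>x. \<mu> (z * x)) g"
proof (rule minus_eq_zero[OF _ _ v_all_ge_zero])
  have gc: "\<And>n. g n \<in> carrier M" using g by (auto simp: in_H_def)
  have rg: "in_H h C (conv r g)" by (rule in_H_conv[OF h_nonneg r g])
  note kz = klinear_mult[OF \<mu> z]
  show c1: "Ev \<mu> (conv r g) \<in> carrier M" and c2: "Ev (\<lambda>x. \<mu> (z * x)) g \<in> carrier M"
    by (rule Ev_closed[OF \<mu> rg], rule Ev_closed[OF kz g])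
  then show "Ev \<mu> (conv r g) \<ominus> Ev (\<lambda>x. \<mu> (z * x)) g \<in> carrier M" by simp
  obtain D where D: "\<And>g w t n. in_H h C g \<Longrightarrow> w \<in> L \<Longrightarrow> ereal t \<le> ordp w \<Longrightarrow>
    ereal (t + \<beta> / 2 * real (msize n) - D) \<le> v (\<mu> (w * mon b n) \<odot> g n)"
    by (rule decay[OF \<mu>, of C]) (rule that)
  obtain D' where D': "\<And>g w t. in_H h C g \<Longrightarrow> w \<in> L \<Longrightarrow> ereal t \<le> ordp w \<Longrightarrow>
    ereal (t - D') \<le> v (Ev (\<lambda>x. \<mu> (w * x)) g)"
    by (rule Ev_bound[OF \<mu>, of C]) (rule that)
  fix Z :: real
  have b2: "0 < \<beta> / 2" using \<beta>_pos by simp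
  obtain N :: nat where "Z + \<bar>D\<bar> + \<bar>D'\<bar> < real N * (\<beta> / 2)" using reals_Archimedean3[OF b2] by blast
  then have N: "Z + \<bar>D\<bar> + \<bar>D'\<bar> \<le> \<beta> / 2 * real N" by (simp add: mult.commute)
  define A where "A = {n :: 'n \<Rightarrow> nat. msize n < N}"
  have fA: "finite A" unfolding A_def by (rule finite_msize_less)
  define P where "P = (\<Sum>n\<in>A. r n * mon b n)"
  have PL: "P \<in> L" unfolding P_def using r K_sub_L mon_L by (intro LL.sum_mem LL.mult_mem) auto
  let ?rA = "\<lambda>n. if n \<in> A then r n else 0" and ?rT = "\<lambda>n. if n \<in> A then 0 else r n"
  have rT: "in_H h C (conv ?rT g)" by (rule in_H_conv[OF h_nonneg _ _ g]) (use r in auto)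
  have rA: "in_H h C (conv ?rA g)" by (rule in_H_conv[OF h_nonneg _ _ g]) (use r in auto)
  have EvA: "Ev \<mu> (conv ?rA g) = Ev (\<lambda>x. \<mu> (P * x)) g"
    unfolding P_def by (rule Ev_eqI[OF has_vsum_polynomial[OF \<mu> g r(1) fA] \<mu>]) (use rA in \<open>auto simp: in_H_def\<close>)
  have rs: "r = (\<lambda>n. ?rA n + ?rT n)" by auto
  have "conv r g = (\<lambda>n. conv ?rA g n \<oplus> conv ?rT g n)"
    by (subst rs, rule ext, rule conv_add_left) (use gc r in auto)
  then have E1: "Ev \<mu> (conv r g) = Ev (\<lambda>x. \<mu> (P * x)) g \<oplus> Ev \<mu> (conv ?rT g)"
    using Ev_add[OF \<mu> rA rT] EvA by simp
  have zPL: "z - P \<in> L" using z PL by (rule LL.diff_mem)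
  note k1 = klinear_mult[OF \<mu> PL] and k2 = klinear_mult[OF \<mu> zPL]
  have \<mu>a: "\<mu> (x + y) = \<mu> x + \<mu> y" if "x \<in> L" "y \<in> L" for x y
    using \<mu> that unfolding klinear_def by blast
  have "\<mu> (z * x) = \<mu> (P * x) + \<mu> ((z - P) * x)" if "x \<in> L" for x
  proof -
    have "z * x = P * x + (z - P) * x" by (simp add: algebra_simps)
    then show ?thesis using \<mu>a[of "P * x" "(z - P) * x"] LL.mult_mem PL zPL that by metis
  qed
  then have "Ev (\<lambda>x. \<mu> (z * x)) g = Ev (\<lambda>x. \<mu> (P * x) + \<mu> ((z - P) * x)) g"
    unfolding Ev_def using mon_L by simp
  then have E2: "Ev (\<lambda>x. \<mu> (z * x)) g = Ev (\<lambda>x. \<mu> (P * x)) g \<oplus> Ev (\<lambda>x. \<mu> ((z - P) * x)) g"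
    using Ev_add_functional[OF k1 k2 g] by simp
  have small1: "ereal Z \<le> v (Ev \<mu> (conv ?rT g))"
  proof (rule has_vsum_bound[OF has_vsum_Ev[OF \<mu> rT]])
    fix n
    show "\<mu> (mon b n) \<odot> conv ?rT g n \<in> carrier M" using term_closed[OF \<mu>] rT by (auto simp: in_H_def)
    show "ereal Z \<le> v (\<mu> (mon b n) \<odot> conv ?rT g n)"
    proof (cases "n \<in> A")
      case True
      have "i \<in> A" if "i \<le> n" for i
      proof -
        have "msize i \<le> msize n" unfolding msize_def using that by (intro sum_mono) (auto simp: le_fun_def)
        then show ?thesis using True by (simp add: A_def)
      qed
      then have "conv ?rT g n = (\<Oplus>i\<in>{..n}. \<zero>)"
        unfolding conv_def using gc Mod.smult_l_null by (intro Mod.M.finsum_cong') auto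
      then show ?thesis using klinear_K[OF \<mu> mon_L] by simp
    next
      case False
      then have "real N \<le> real (msize n)" by (simp add: A_def)
      then have "\<beta> / 2 * real N \<le> \<beta> / 2 * real (msize n)" using \<beta>_pos by simp
      then have "ereal Z \<le> ereal (0 + \<beta> / 2 * real (msize n) - D)" using N by simp
      also have "\<dots> \<le> v (\<mu> (1 * mon b n) \<odot> conv ?rT g n)"
        by (rule D[OF rT]) (auto simp: zero_ereal_def[symmetric])
      finally show ?thesis by simp
    qed
  qed
  have small2: "ereal Z \<le> v (Ev (\<lambda>x. \<mu> ((z - P) * x)) g)"
  proof -
    have "ereal (\<beta> * real N) \<le> ordp (z - P)" using lim[of N] by (simp add: P_def A_def)
    from D'[OF g zPL this] have "ereal (\<beta> * real N - D') \<le> v (Ev (\<lambda>x. \<mu> ((z - P) * x)) g)" .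
    moreover have "Z \<le> \<beta> * real N - D'"
    proof -
      have "\<beta> * real N = \<beta> / 2 * real N + \<beta> / 2 * real N" by simp
      moreover have "\<beta> / 2 * real N \<ge> 0" using \<beta>_pos by simp
      ultimately show ?thesis using N by linarith
    qed
    ultimately show ?thesis by (meson ereal_less_eq(3) order_trans)
  qed
  have c: "Ev (\<lambda>x. \<mu> (P * x)) g \<in> carrier M" "Ev \<mu> (conv ?rT g) \<in> carrier M"
    "Ev (\<lambda>x. \<mu> ((z - P) * x)) g \<in> carrier M"
    using Ev_closed k1 k2 \<mu> g rT by blast+
  show "ereal Z \<le> v (Ev \<mu> (conv r g) \<ominus> Ev (\<lambda>x. \<mu> (z * x)) g)"
    unfolding E1 E2 using c small1 small2
    by (subst add_minus_add) (auto simp: a_minus_def Mod.M.r_neg v_ge_add v_uminus)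
qed

end

section \<open>Tensor products\<close>

lemma frag_keys_induct [consumes 1, case_names zero diff of]:
  assumes "Poly_Mapping.keys x \<subseteq> S" "P 0"
    "\<And>x y. Poly_Mapping.keys x \<subseteq> S \<Longrightarrow> Poly_Mapping.keys y \<subseteq> S \<Longrightarrow> P x \<Longrightarrow> P y \<Longrightarrow> P (x - y)"
    "\<And>a b. (a, b) \<in> S \<Longrightarrow> P (frag_of (a, b))"
  shows "P x"
  using assms(1,2,3)
proof (rule free_Abelian_group_induct)
  fix s assume "s \<in> S"
  then show "P (frag_of s)" using assms(4) by (cases s) simp
qed

lemma tensor_rels_intros:
  "a \<in> carrier A \<Longrightarrow> a' \<in> carrier A \<Longrightarrow> b \<in> carrier B \<Longrightarrow>
    frag_of (a \<oplus>\<^bsub>A\<^esub> a', b) - frag_of (a, b) - frag_of (a', b) \<in> tensor_rels R A B"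
  "a \<in> carrier A \<Longrightarrow> b \<in> carrier B \<Longrightarrow> b' \<in> carrier B \<Longrightarrow>
    frag_of (a, b \<oplus>\<^bsub>B\<^esub> b') - frag_of (a, b) - frag_of (a, b') \<in> tensor_rels R A B"
  "r \<in> carrier R \<Longrightarrow> a \<in> carrier A \<Longrightarrow> b \<in> carrier B \<Longrightarrow>
    frag_of (r \<odot>\<^bsub>A\<^esub> a, b) - frag_of (a, r \<odot>\<^bsub>B\<^esub> b) \<in> tensor_rels R A B"
  unfolding tensor_rels_def by blast+

lemma tensor_rels_cases:
  assumes "x \<in> tensor_rels R A B"
  obtains (left) a a' b where "x = frag_of (a \<oplus>\<^bsub>A\<^esub> a', b) - frag_of (a, b) - frag_of (a', b)"
      "a \<in> carrier A" "a' \<in> carrier A" "b \<in> carrier B"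
    | (right) a b b' where "x = frag_of (a, b \<oplus>\<^bsub>B\<^esub> b') - frag_of (a, b) - frag_of (a, b')"
      "a \<in> carrier A" "b \<in> carrier B" "b' \<in> carrier B"
    | (balanced) r a b where "x = frag_of (r \<odot>\<^bsub>A\<^esub> a, b) - frag_of (a, r \<odot>\<^bsub>B\<^esub> b)"
      "r \<in> carrier R" "a \<in> carrier A" "b \<in> carrier B"
  using assms unfolding tensor_rels_def by (elim UnE CollectE exE conjE) (assumption | rule that)+

text \<open>
  Closure under the operations is all that is required of \<open>A\<close> and \<open>B\<close>: it places the relations in
  the free abelian group on \<open>carrier A \<times> carrier B\<close>.
\<close>

locale tensor_pair =
  fixes R :: "('r, 'x) ring_scheme" and A :: "('r, 'a) module" and B :: "('r, 'b) module"
  assumes A_add: "a \<in> carrier A \<Longrightarrow> a' \<in> carrier A \<Longrightarrow> a \<oplus>\<^bsub>A\<^esub> a' \<in> carrier A"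
    and A_smult: "r \<in> carrier R \<Longrightarrow> a \<in> carrier A \<Longrightarrow> r \<odot>\<^bsub>A\<^esub> a \<in> carrier A"
    and B_add: "b \<in> carrier B \<Longrightarrow> b' \<in> carrier B \<Longrightarrow> b \<oplus>\<^bsub>B\<^esub> b' \<in> carrier B"
    and B_smult: "r \<in> carrier R \<Longrightarrow> b \<in> carrier B \<Longrightarrow> r \<odot>\<^bsub>B\<^esub> b \<in> carrier B"
begin

abbreviation "F \<equiv> free_Abelian_group (carrier A \<times> carrier B)"
abbreviation "N \<equiv> generate F (tensor_rels R A B)"
abbreviation "T \<equiv> tensor R A B"
abbreviation cls :: "('a \<times> 'b \<Rightarrow>\<^sub>0 int) \<Rightarrow> ('a \<times> 'b \<Rightarrow>\<^sub>0 int) set" where "cls \<equiv> tensor_class R A B"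
abbreviation pt :: "'a \<Rightarrow> 'b \<Rightarrow> ('a \<times> 'b \<Rightarrow>\<^sub>0 int) set" where "pt \<equiv> pure_tensor R A B"

sublocale F: comm_group F by (rule abelian_free_Abelian_group)

lemma F_diff: "x \<in> carrier F \<Longrightarrow> y \<in> carrier F \<Longrightarrow> x - y \<in> carrier F"
  using keys_diff[of x y] by auto

lemma F_add: "x \<in> carrier F \<Longrightarrow> y \<in> carrier F \<Longrightarrow> x + y \<in> carrier F"
  using keys_add[of x y] by auto

lemma F_of: "a \<in> carrier A \<Longrightarrow> b \<in> carrier B \<Longrightarrow> frag_of (a, b) \<in> carrier F"
  by simp

lemma rels_F: "tensor_rels R A B \<subseteq> carrier F"
  unfolding tensor_rels_def using A_add A_smult B_add B_smult
  by (intro Un_least subsetI) (auto simp del: carrier_free_Abelian_group_iff intro!: F_diff F_of)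

lemma N_subgroup: "subgroup N F" by (rule F.generate_is_subgroup[OF rels_F])

lemma N_F: "N \<subseteq> carrier F" by (rule F.generate_incl[OF rels_F])

lemma N_0: "0 \<in> N" using subgroup.one_closed[OF N_subgroup] by simp

lemma N_add: "x \<in> N \<Longrightarrow> y \<in> N \<Longrightarrow> x + y \<in> N"
  using subgroup.m_closed[OF N_subgroup, of x y] by simp

lemma N_uminus: "x \<in> N \<Longrightarrow> - x \<in> N"
  using subgroup.m_inv_closed[OF N_subgroup, of x] N_F by force

lemma N_diff: "x \<in> N \<Longrightarrow> y \<in> N \<Longrightarrow> x - y \<in> N"
  using N_add[of x "- y"] N_uminus by simp

lemma cls_def: "cls z = (\<lambda>x. x + z) ` N"
  by (auto simp: tensor_class_def Let_def r_coset_def)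

lemma cls_mem: "y \<in> cls z \<longleftrightarrow> y - z \<in> N"
  unfolding cls_def by (force simp: image_iff algebra_simps)

lemma cls_self: "z \<in> cls z" by (simp add: cls_mem N_0)

lemma cls_eqI: "y - z \<in> N \<Longrightarrow> cls y = cls z"
proof -
  assume a: "y - z \<in> N"
  have "x - y \<in> N \<longleftrightarrow> x - z \<in> N" for x
  proof -
    have e: "x - z = (x - y) + (y - z)" "x - y = (x - z) - (y - z)" by simp_all
    show ?thesis using N_add[OF _ a, of "x - y"] N_diff[OF _ a, of "x - z"] e by metis
  qed
  then show ?thesis by (auto simp: cls_mem)
qed

lemma carrier_T: "carrier T = cls ` carrier F"
  by (auto simp: tensor_def Let_def FactGroup_def RCOSETS_def tensor_class_def)

lemma zero_T: "\<zero>\<^bsub>T\<^esub> = cls 0"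
  by (simp add: tensor_def Let_def FactGroup_def cls_def)

lemma add_T: "cls x \<oplus>\<^bsub>T\<^esub> cls y = cls (x + y)"
proof -
  have "cls x \<oplus>\<^bsub>T\<^esub> cls y = (\<Union>a\<in>cls x. \<Union>b\<in>cls y. {a + b})"
    by (simp add: tensor_def Let_def FactGroup_def set_mult_def)
  also have "\<dots> = cls (x + y)"
  proof (intro subset_antisym subsetI)
    fix z assume "z \<in> (\<Union>a\<in>cls x. \<Union>b\<in>cls y. {a + b})"
    then obtain a b where ab: "z = a + b" "a - x \<in> N" "b - y \<in> N" by (auto simp: cls_mem)
    have "z - (x + y) = (a - x) + (b - y)" by (simp add: ab(1))
    then show "z \<in> cls (x + y)" using N_add[OF ab(2,3)] by (simp only: cls_mem)
  next
    fix z assume "z \<in> cls (x + y)"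
    then have "(z - y) \<in> cls x" by (simp add: cls_mem algebra_simps)
    moreover have "z = (z - y) + y" by simp
    ultimately show "z \<in> (\<Union>a\<in>cls x. \<Union>b\<in>cls y. {a + b})" using cls_self by blast
  qed
  finally show ?thesis .
qed

lemma T_cases:
  assumes "Y \<in> carrier T" obtains z where "z \<in> carrier F" "Y = cls z"
  using assms carrier_T by auto

lemma cls_T: "z \<in> carrier F \<Longrightarrow> cls z \<in> carrier T"
  using carrier_T by auto

lemma T_group: "abelian_group T"
proof (rule abelian_groupI)
  fix x y z assume "x \<in> carrier T" "y \<in> carrier T" "z \<in> carrier T"
  then obtain a b c where abc: "a \<in> carrier F" "b \<in> carrier F" "c \<in> carrier F" "x = cls a" "y = cls b" "z = cls c"
    by (metis T_cases)
  show "x \<oplus>\<^bsub>T\<^esub> y \<in> carrier T" unfolding abc add_T by (intro cls_T F_add abc)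
  show "x \<oplus>\<^bsub>T\<^esub> y \<oplus>\<^bsub>T\<^esub> z = x \<oplus>\<^bsub>T\<^esub> (y \<oplus>\<^bsub>T\<^esub> z)" unfolding abc add_T by (simp add: add.assoc)
  show "x \<oplus>\<^bsub>T\<^esub> y = y \<oplus>\<^bsub>T\<^esub> x" unfolding abc add_T by (simp add: add.commute)
  show "\<zero>\<^bsub>T\<^esub> \<oplus>\<^bsub>T\<^esub> x = x" unfolding abc zero_T add_T by simp
  have "- a \<in> carrier F" using abc(1) by simp
  then show "\<exists>y\<in>carrier T. y \<oplus>\<^bsub>T\<^esub> x = \<zero>\<^bsub>T\<^esub>"
    by (intro bexI[of _ "cls (- a)"]) (auto simp: abc(4) add_T zero_T intro: cls_T)
next
  show "\<zero>\<^bsub>T\<^esub> \<in> carrier T" unfolding zero_T by (rule cls_T) simp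
qed

sublocale T: abelian_group T by (rule T_group)

lemma minus_T: "x \<in> carrier F \<Longrightarrow> y \<in> carrier F \<Longrightarrow> cls x \<ominus>\<^bsub>T\<^esub> cls y = cls (x - y)"
proof -
  assume a: "x \<in> carrier F" "y \<in> carrier F"
  have "- y \<in> carrier F" using a(2) by simp
  then have "\<ominus>\<^bsub>T\<^esub> cls y = cls (- y)"
    using a by (intro T.minus_equality) (auto simp: add_T zero_T intro: cls_T)
  then show ?thesis by (simp add: a_minus_def add_T)
qed

lemma pt_closed: "a \<in> carrier A \<Longrightarrow> b \<in> carrier B \<Longrightarrow> pt a b \<in> carrier T"
  unfolding pure_tensor_def by (intro cls_T F_of)

lemma pt_add_left:
  assumes "a \<in> carrier A" "a' \<in> carrier A" "b \<in> carrier B"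
  shows "pt (a \<oplus>\<^bsub>A\<^esub> a') b = pt a b \<oplus>\<^bsub>T\<^esub> pt a' b"
proof -
  have "frag_of (a \<oplus>\<^bsub>A\<^esub> a', b) - frag_of (a, b) - frag_of (a', b) \<in> N"
    by (rule generate.incl) (use assms in \<open>auto simp: tensor_rels_def\<close>)
  then show ?thesis unfolding pure_tensor_def add_T by (intro cls_eqI) (simp add: algebra_simps)
qed

lemma pt_add_right:
  assumes "a \<in> carrier A" "b \<in> carrier B" "b' \<in> carrier B"
  shows "pt a (b \<oplus>\<^bsub>B\<^esub> b') = pt a b \<oplus>\<^bsub>T\<^esub> pt a b'"
proof -
  have "frag_of (a, b \<oplus>\<^bsub>B\<^esub> b') - frag_of (a, b) - frag_of (a, b') \<in> N"
    by (rule generate.incl) (use assms in \<open>auto simp: tensor_rels_def\<close>)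
  then show ?thesis unfolding pure_tensor_def add_T by (intro cls_eqI) (simp add: algebra_simps)
qed

lemma pt_balanced:
  assumes "r \<in> carrier R" "a \<in> carrier A" "b \<in> carrier B"
  shows "pt (r \<odot>\<^bsub>A\<^esub> a) b = pt a (r \<odot>\<^bsub>B\<^esub> b)"
proof -
  have "frag_of (r \<odot>\<^bsub>A\<^esub> a, b) - frag_of (a, r \<odot>\<^bsub>B\<^esub> b) \<in> N"
    by (rule generate.incl) (use assms in \<open>auto simp: tensor_rels_def\<close>)
  then show ?thesis unfolding pure_tensor_def by (rule cls_eqI)
qed

lemma T_induct [consumes 1, case_names zero minus pure]:
  assumes "Y \<in> carrier T" "P \<zero>\<^bsub>T\<^esub>"
    "\<And>x y. x \<in> carrier T \<Longrightarrow> y \<in> carrier T \<Longrightarrow> P x \<Longrightarrow> P y \<Longrightarrow> P (x \<ominus>\<^bsub>T\<^esub> y)"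
    "\<And>a b. a \<in> carrier A \<Longrightarrow> b \<in> carrier B \<Longrightarrow> P (pt a b)"
  shows "P Y"
proof -
  obtain z where z: "z \<in> carrier F" "Y = cls z" using assms(1) by (rule T_cases)
  have "Poly_Mapping.keys z \<subseteq> carrier A \<times> carrier B" using z(1) by simp
  then have "P (cls z)"
  proof (induction z rule: frag_keys_induct)
    case zero
    then show ?case using assms(2) zero_T by simp
  next
    case (diff x y)
    then have "P (cls x \<ominus>\<^bsub>T\<^esub> cls y)" by (intro assms(3) cls_T) auto
    then show ?case using diff by (simp add: minus_T)
  next
    case (of a b)
    then show ?case using assms(4) unfolding pure_tensor_def by auto
  qed
  then show ?thesis using z by simp
qed

lemma pure_sum:
  assumes neg: "\<And>b. b \<in> carrier B \<Longrightarrow> \<exists>b'\<in>carrier B. \<forall>a\<in>carrier A. pt a b' = \<ominus>\<^bsub>T\<^esub> pt a b"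
    and Y: "Y \<in> carrier T"
  shows "\<exists>(r::nat) g c. (\<forall>j<r. g j \<in> carrier A \<and> c j \<in> carrier B) \<and>
    Y = (\<Oplus>\<^bsub>T\<^esub>j\<in>{..<r}. pt (g j) (c j))"
  using Y
proof (induction rule: T_induct)
  case zero
  show ?case by (rule exI[of _ 0]) simp
next
  case (pure a b)
  then show ?case
    by (intro exI[of _ 1] exI[of _ "\<lambda>_. a"] exI[of _ "\<lambda>_. b"]) (simp add: pt_closed lessThan_Suc)
next
  case (minus x y)
  obtain r :: nat and g c where 1: "\<forall>j<r. g j \<in> carrier A \<and> c j \<in> carrier B"
    "x = (\<Oplus>\<^bsub>T\<^esub>j\<in>{..<r}. pt (g j) (c j))" using minus(3) by (elim exE conjE)
  obtain r' :: nat and g' c' where 2: "\<forall>j<r'. g' j \<in> carrier A \<and> c' j \<in> carrier B"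
    "y = (\<Oplus>\<^bsub>T\<^esub>j\<in>{..<r'}. pt (g' j) (c' j))" using minus(4) by (elim exE conjE)
  define d where "d j = (SOME b'. b' \<in> carrier B \<and> (\<forall>a\<in>carrier A. pt a b' = \<ominus>\<^bsub>T\<^esub> pt a (c' j)))" for j
  have d: "d j \<in> carrier B \<and> (\<forall>a\<in>carrier A. pt a (d j) = \<ominus>\<^bsub>T\<^esub> pt a (c' j))" if "j < r'" for j
    unfolding d_def by (rule someI_ex) (use neg[of "c' j"] 2(1) that in blast)
  define G where "G j = (if j < r then g j else g' (j - r))" for j
  define E where "E j = (if j < r then c j else d (j - r))" for j
  have cl: "\<forall>j<r + r'. G j \<in> carrier A \<and> E j \<in> carrier B"
    using 1 2 d by (auto simp: G_def E_def)
  have "(\<Oplus>\<^bsub>T\<^esub>j\<in>{..<r + k}. pt (G j) (E j)) = x \<ominus>\<^bsub>T\<^esub> (\<Oplus>\<^bsub>T\<^esub>j\<in>{..<k}. pt (g' j) (c' j))" if "k \<le> r'" for k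
    using that
  proof (induction k)
    case 0
    have "(\<Oplus>\<^bsub>T\<^esub>j\<in>{..<r}. pt (G j) (E j)) = x"
      unfolding 1(2) by (rule T.finsum_cong') (use 1 in \<open>auto simp: G_def E_def pt_closed\<close>)
    then show ?case using minus(1) by (simp add: a_minus_def)
  next
    case (Suc k)
    let ?S = "\<Oplus>\<^bsub>T\<^esub>j\<in>{..<k}. pt (g' j) (c' j)"
    have S: "?S \<in> carrier T" using Suc.prems 2(1) by (intro T.finsum_closed) (auto simp: pt_closed)
    have p: "pt (g' k) (c' k) \<in> carrier T" using Suc.prems 2(1) by (auto simp: pt_closed)
    have "(\<Oplus>\<^bsub>T\<^esub>j\<in>{..<r + Suc k}. pt (G j) (E j)) = pt (G (r + k)) (E (r + k)) \<oplus>\<^bsub>T\<^esub> (\<Oplus>\<^bsub>T\<^esub>j\<in>{..<r + k}. pt (G j) (E j))"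
      unfolding add_Suc_right lessThan_Suc using cl Suc.prems
      by (intro T.finsum_insert) (auto simp: pt_closed)
    also have "\<dots> = \<ominus>\<^bsub>T\<^esub> pt (g' k) (c' k) \<oplus>\<^bsub>T\<^esub> (x \<ominus>\<^bsub>T\<^esub> ?S)"
      using Suc d[of k] 2(1) by (simp add: G_def E_def)
    also have "\<dots> = x \<ominus>\<^bsub>T\<^esub> (pt (g' k) (c' k) \<oplus>\<^bsub>T\<^esub> ?S)"
      using S p minus(1) by (simp add: a_minus_def T.minus_add T.a_ac)
    also have "pt (g' k) (c' k) \<oplus>\<^bsub>T\<^esub> ?S = (\<Oplus>\<^bsub>T\<^esub>j\<in>{..<Suc k}. pt (g' j) (c' j))"
      unfolding lessThan_Suc using 2(1) Suc.prems by (intro T.finsum_insert[symmetric]) (auto simp: pt_closed)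
    finally show ?case .
  qed
  from this[of r'] have "x \<ominus>\<^bsub>T\<^esub> y = (\<Oplus>\<^bsub>T\<^esub>j\<in>{..<r + r'}. pt (G j) (E j))" using 2(2) by simp
  then show ?case using cl by blast
qed

text \<open>
  The universal property. The last conclusion transports bounds along it: a property that is
  closed under subtraction and holds for the images of all pairs in a representative \<open>z\<close> holds for
  the image of the class of \<open>z\<close>. Applied to a lower bound for \<open>v\<close>, it controls the tensor product
  valuation.
\<close>

lemma lift:
  fixes G :: "('g, 'z) ring_scheme"
  assumes G: "abelian_group G"
    and cl: "\<And>a b. a \<in> carrier A \<Longrightarrow> b \<in> carrier B \<Longrightarrow> \<phi> a b \<in> carrier G"
    and add1: "\<And>a a' b. a \<in> carrier A \<Longrightarrow> a' \<in> carrier A \<Longrightarrow> b \<in> carrier B \<Longrightarrow> \<phi> (a \<oplus>\<^bsub>A\<^esub> a') b = \<phi> a b \<oplus>\<^bsub>G\<^esub> \<phi> a' b"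
    and add2: "\<And>a b b'. a \<in> carrier A \<Longrightarrow> b \<in> carrier B \<Longrightarrow> b' \<in> carrier B \<Longrightarrow> \<phi> a (b \<oplus>\<^bsub>B\<^esub> b') = \<phi> a b \<oplus>\<^bsub>G\<^esub> \<phi> a b'"
    and bal: "\<And>r a b. r \<in> carrier R \<Longrightarrow> a \<in> carrier A \<Longrightarrow> b \<in> carrier B \<Longrightarrow> \<phi> (r \<odot>\<^bsub>A\<^esub> a) b = \<phi> a (r \<odot>\<^bsub>B\<^esub> b)"
  obtains \<Phi> where "\<And>Y. Y \<in> carrier T \<Longrightarrow> \<Phi> Y \<in> carrier G"
    "\<And>Y Z. Y \<in> carrier T \<Longrightarrow> Z \<in> carrier T \<Longrightarrow> \<Phi> (Y \<oplus>\<^bsub>T\<^esub> Z) = \<Phi> Y \<oplus>\<^bsub>G\<^esub> \<Phi> Z"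
    "\<And>a b. a \<in> carrier A \<Longrightarrow> b \<in> carrier B \<Longrightarrow> \<Phi> (pt a b) = \<phi> a b"
    "\<And>z P. z \<in> carrier F \<Longrightarrow> P \<zero>\<^bsub>G\<^esub> \<Longrightarrow>
       (\<And>x y. x \<in> carrier G \<Longrightarrow> y \<in> carrier G \<Longrightarrow> P x \<Longrightarrow> P y \<Longrightarrow> P (x \<ominus>\<^bsub>G\<^esub> y)) \<Longrightarrow>
       (\<And>a b. (a, b) \<in> Poly_Mapping.keys z \<Longrightarrow> P (\<phi> a b)) \<Longrightarrow> P (\<Phi> (cls z))"
proof -
  interpret G: abelian_group G by fact
  have "(\<lambda>(a, b). \<phi> a b) ` (carrier A \<times> carrier B) \<subseteq> carrier (add_monoid G)" using cl by auto
  then obtain h where h: "h \<in> hom F (add_monoid G)"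
    "\<And>x. x \<in> carrier A \<times> carrier B \<Longrightarrow> h (frag_of x) = (\<lambda>(a, b). \<phi> a b) x"
    by (rule comm_group.free_Abelian_group_universal[OF G.a_comm_group]) (rule that)
  have hc: "h x \<in> carrier G" if "x \<in> carrier F" for x using h(1) that unfolding hom_def by auto
  have ha: "h (x + y) = h x \<oplus>\<^bsub>G\<^esub> h y" if "x \<in> carrier F" "y \<in> carrier F" for x y
    using h(1) that unfolding hom_def by auto
  have h0: "h 0 = \<zero>\<^bsub>G\<^esub>"
  proof -
    have "h 0 \<oplus>\<^bsub>G\<^esub> h 0 = h 0 \<oplus>\<^bsub>G\<^esub> \<zero>\<^bsub>G\<^esub>" using ha[of 0 0] hc[of 0] by simp
    then show ?thesis using hc[of 0] by (subst (asm) G.add.l_cancel) auto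
  qed
  have hd: "h (x - y) = h x \<ominus>\<^bsub>G\<^esub> h y" if "x \<in> carrier F" "y \<in> carrier F" for x y
  proof -
    have "h (x - y) \<oplus>\<^bsub>G\<^esub> h y = h x" using ha[OF F_diff[OF that] that(2)] by simp
    moreover have "h (x - y) = (h (x - y) \<oplus>\<^bsub>G\<^esub> h y) \<ominus>\<^bsub>G\<^esub> h y"
      using hc[OF F_diff[OF that]] hc[OF that(2)] by (simp add: a_minus_def G.a_assoc G.r_neg)
    ultimately show ?thesis by simp
  qed
  have hf: "h (frag_of (a, b)) = \<phi> a b" if "a \<in> carrier A" "b \<in> carrier B" for a b
    using h(2)[of "(a, b)"] that by simp
  have gz: "x \<oplus>\<^bsub>G\<^esub> y \<ominus>\<^bsub>G\<^esub> x \<ominus>\<^bsub>G\<^esub> y = \<zero>\<^bsub>G\<^esub>" if "x \<in> carrier G" "y \<in> carrier G" for x y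
  proof -
    have "x \<oplus>\<^bsub>G\<^esub> y \<ominus>\<^bsub>G\<^esub> x = y" using that
      by (simp add: a_minus_def G.a_comm[of x y] G.a_assoc G.r_neg)
    then show ?thesis using that by (simp add: a_minus_def G.r_neg)
  qed
  have rel: "h x = \<zero>\<^bsub>G\<^esub>" if "x \<in> tensor_rels R A B" for x
  proof -
    from that show ?thesis
    proof (cases rule: tensor_rels_cases)
      case (left a a' b)
      have "h x = \<phi> (a \<oplus>\<^bsub>A\<^esub> a') b \<ominus>\<^bsub>G\<^esub> \<phi> a b \<ominus>\<^bsub>G\<^esub> \<phi> a' b"
        unfolding left(1) using left A_add by (simp only: hd hf F_of F_diff)
      then show ?thesis using left add1 cl gz by simp
    next
      case (right a b b')
      have "h x = \<phi> a (b \<oplus>\<^bsub>B\<^esub> b') \<ominus>\<^bsub>G\<^esub> \<phi> a b \<ominus>\<^bsub>G\<^esub> \<phi> a b'"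
        unfolding right(1) using right B_add by (simp only: hd hf F_of F_diff)
      then show ?thesis using right add2 cl gz by simp
    next
      case (balanced r a b)
      have "h x = \<phi> (r \<odot>\<^bsub>A\<^esub> a) b \<ominus>\<^bsub>G\<^esub> \<phi> a (r \<odot>\<^bsub>B\<^esub> b)"
        unfolding balanced(1) using balanced A_smult B_smult by (simp only: hd hf F_of F_diff)
      then show ?thesis using balanced bal cl B_smult by (simp add: a_minus_def G.r_neg)
    qed
  qed
  have hN: "h x = \<zero>\<^bsub>G\<^esub>" if "x \<in> N" for x
    using that
  proof (induction rule: generate.induct)
    case one
    then show ?case using h0 by simp
  next
    case (incl x)
    then show ?case by (rule rel)
  next
    case (inv x)
    then have "x \<in> carrier F" using rels_F by blast
    then have "h (0 - x) = h 0 \<ominus>\<^bsub>G\<^esub> h x" by (intro hd) auto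
    then show ?case using rel[OF inv] h0 \<open>x \<in> carrier F\<close> by (simp add: a_minus_def)
  next
    case (eng x y)
    then have "x \<in> carrier F" "y \<in> carrier F" using N_F by blast+
    then show ?case using eng ha by simp
  qed
  define \<Phi> where "\<Phi> Y = h (SOME z. z \<in> carrier F \<and> Y = cls z)" for Y
  have \<Phi>: "\<Phi> (cls z) = h z" if z: "z \<in> carrier F" for z
  proof -
    define y where "y = (SOME y. y \<in> carrier F \<and> cls z = cls y)"
    have y: "y \<in> carrier F \<and> cls z = cls y" unfolding y_def by (rule someI[of _ z]) (use z in auto)
    then have "z - y \<in> N" using cls_self[of z] by (simp add: cls_mem)
    then have "h z \<ominus>\<^bsub>G\<^esub> h y = \<zero>\<^bsub>G\<^esub>" using hN hd y z by metis
    then have hzy: "h z = h y"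
    proof -
      assume a: "h z \<ominus>\<^bsub>G\<^esub> h y = \<zero>\<^bsub>G\<^esub>"
      have "h z = (h z \<ominus>\<^bsub>G\<^esub> h y) \<oplus>\<^bsub>G\<^esub> h y"
        using hc z y by (simp add: a_minus_def G.a_assoc G.l_neg)
      then show ?thesis using a hc y by simp
    qed
    have "\<Phi> (cls z) = h y" by (simp only: \<Phi>_def y_def)
    then show ?thesis by (simp only: hzy)
  qed
  show thesis
  proof (rule that[of \<Phi>])
    fix Y assume "Y \<in> carrier T"
    then show "\<Phi> Y \<in> carrier G" by (rule T_cases) (simp add: \<Phi> hc del: carrier_free_Abelian_group_iff)
  next
    fix Y Z assume "Y \<in> carrier T" "Z \<in> carrier T"
    then obtain y z where "y \<in> carrier F" "Y = cls y" "z \<in> carrier F" "Z = cls z" by (metis T_cases)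
    then show "\<Phi> (Y \<oplus>\<^bsub>T\<^esub> Z) = \<Phi> Y \<oplus>\<^bsub>G\<^esub> \<Phi> Z"
      using \<Phi> ha F_add by (simp add: add_T del: carrier_free_Abelian_group_iff)
  next
    fix a b assume "a \<in> carrier A" "b \<in> carrier B"
    then show "\<Phi> (pt a b) = \<phi> a b" unfolding pure_tensor_def using \<Phi>[OF F_of] hf by simp
  next
    fix z P
    assume z: "z \<in> carrier F" and P: "P \<zero>\<^bsub>G\<^esub>"
      "\<And>x y. x \<in> carrier G \<Longrightarrow> y \<in> carrier G \<Longrightarrow> P x \<Longrightarrow> P y \<Longrightarrow> P (x \<ominus>\<^bsub>G\<^esub> y)"
      "\<And>a b. (a, b) \<in> Poly_Mapping.keys z \<Longrightarrow> P (\<phi> a b)"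
    let ?S = "Poly_Mapping.keys z"
    have SF: "?S \<subseteq> carrier A \<times> carrier B" using z by simp
    have "Poly_Mapping.keys z \<subseteq> ?S" by simp
    then have "z \<in> carrier F \<and> P (h z)"
    proof (induction z rule: frag_keys_induct)
      case zero
      then show ?case using P(1) h0 by simp
    next
      case (diff x y)
      then show ?case using P(2) hd hc F_diff by (simp del: carrier_free_Abelian_group_iff)
    next
      case (of a b)
      then show ?case using P(3)[of a b] SF hf[of a b] by auto
    qed
    then show "P (\<Phi> (cls z))" using \<Phi>[OF z] by simp
  qed
qed

end

locale tensor_algebra = tensor_pair R A B
  for R :: "('r, 'x) ring_scheme" and A :: "('r, 'a) module" and B :: "('r, 'b) module" +
  assumes B_mult: "b \<in> carrier B \<Longrightarrow> c \<in> carrier B \<Longrightarrow> b \<otimes>\<^bsub>B\<^esub> c \<in> carrier B"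
    and B_distr: "b \<in> carrier B \<Longrightarrow> c \<in> carrier B \<Longrightarrow> c' \<in> carrier B \<Longrightarrow>
      b \<otimes>\<^bsub>B\<^esub> (c \<oplus>\<^bsub>B\<^esub> c') = b \<otimes>\<^bsub>B\<^esub> c \<oplus>\<^bsub>B\<^esub> b \<otimes>\<^bsub>B\<^esub> c'"
    and B_assoc: "r \<in> carrier R \<Longrightarrow> b \<in> carrier B \<Longrightarrow> c \<in> carrier B \<Longrightarrow>
      b \<otimes>\<^bsub>B\<^esub> (r \<odot>\<^bsub>B\<^esub> c) = r \<odot>\<^bsub>B\<^esub> (b \<otimes>\<^bsub>B\<^esub> c)"
begin

abbreviation ext :: "'b \<Rightarrow> ('a \<times> 'b \<Rightarrow>\<^sub>0 int) \<Rightarrow> ('a \<times> 'b \<Rightarrow>\<^sub>0 int)" where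
  "ext b \<equiv> frag_extend (\<lambda>(a, b'). frag_of (a, b \<otimes>\<^bsub>B\<^esub> b'))"

lemma ext_F:
  assumes b: "b \<in> carrier B" and z: "z \<in> carrier F"
  shows "ext b z \<in> carrier F"
proof -
  have "Poly_Mapping.keys z \<subseteq> carrier A \<times> carrier B" using z by simp
  then show ?thesis
  proof (induction z rule: frag_keys_induct)
    case zero
    then show ?case by simp
  next
    case (diff x y)
    then show ?case unfolding frag_extend_diff by (intro F_diff)
  next
    case (of a c)
    then show ?case using b B_mult by simp
  qed
qed

lemma ext_N:
  assumes b: "b \<in> carrier B" and "z \<in> N"
  shows "ext b z \<in> N"
proof -
  have rel: "ext b x \<in> N" if x: "x \<in> tensor_rels R A B" for x
  proof (rule generate.incl)
    show "ext b x \<in> tensor_rels R A B"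
      using x
    proof (cases rule: tensor_rels_cases)
      case (left a a' c)
      have "ext b x = frag_of (a \<oplus>\<^bsub>A\<^esub> a', b \<otimes>\<^bsub>B\<^esub> c) - frag_of (a, b \<otimes>\<^bsub>B\<^esub> c) - frag_of (a', b \<otimes>\<^bsub>B\<^esub> c)"
        unfolding left(1) frag_extend_diff by simp
      then show ?thesis using left b B_mult tensor_rels_intros(1) by metis
    next
      case (right a c c')
      have "ext b x = frag_of (a, b \<otimes>\<^bsub>B\<^esub> c \<oplus>\<^bsub>B\<^esub> b \<otimes>\<^bsub>B\<^esub> c') - frag_of (a, b \<otimes>\<^bsub>B\<^esub> c) - frag_of (a, b \<otimes>\<^bsub>B\<^esub> c')"
        unfolding right(1) frag_extend_diff using right b by (simp add: B_distr)
      then show ?thesis using right b B_mult tensor_rels_intros(2) by metis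
    next
      case (balanced r a c)
      have "ext b x = frag_of (r \<odot>\<^bsub>A\<^esub> a, b \<otimes>\<^bsub>B\<^esub> c) - frag_of (a, r \<odot>\<^bsub>B\<^esub> (b \<otimes>\<^bsub>B\<^esub> c))"
        unfolding balanced(1) frag_extend_diff using balanced b by (simp add: B_assoc)
      then show ?thesis using balanced b B_mult tensor_rels_intros(3) by metis
    qed
  qed
  show ?thesis using assms(2)
  proof (induction rule: generate.induct)
    case one
    then show ?case using N_0 by simp
  next
    case (incl x)
    then show ?case by (rule rel)
  next
    case (inv x)
    have "x \<in> carrier F" using inv rels_F by blast
    then show ?case using N_uminus[OF rel[OF inv]] by (simp add: frag_extend_minus)
  next
    case (eng x y)
    then show ?case using N_add by (simp add: frag_extend_add)
  qed
qed

lemma smult_cls: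
  assumes b: "b \<in> carrier B" and z: "z \<in> carrier F"
  shows "b \<odot>\<^bsub>T\<^esub> cls z = cls (ext b z)"
proof -
  have "(\<lambda>z. cls (ext b z)) ` cls z = {cls (ext b z)}"
  proof -
    have "cls (ext b y) = cls (ext b z)" if "y \<in> cls z" for y
    proof (rule cls_eqI)
      show "ext b y - ext b z \<in> N"
        using ext_N[OF b, of "y - z"] that by (simp add: cls_mem frag_extend_diff)
    qed
    then show ?thesis using cls_self[of z] by blast
  qed
  moreover have "b \<odot>\<^bsub>T\<^esub> cls z = the_elem ((\<lambda>z. cls (ext b z)) ` cls z)"
    by (simp only: tensor_def Let_def module.simps)
  ultimately show ?thesis by (simp only: the_elem_eq)
qed

lemma smult_closed: "b \<in> carrier B \<Longrightarrow> Y \<in> carrier T \<Longrightarrow> b \<odot>\<^bsub>T\<^esub> Y \<in> carrier T"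
proof (erule T_cases)
  fix z assume "b \<in> carrier B" "z \<in> carrier F" "Y = cls z"
  then show "b \<odot>\<^bsub>T\<^esub> Y \<in> carrier T" using smult_cls cls_T ext_F by metis
qed

lemma smult_pt: "b \<in> carrier B \<Longrightarrow> a \<in> carrier A \<Longrightarrow> c \<in> carrier B \<Longrightarrow> b \<odot>\<^bsub>T\<^esub> pt a c = pt a (b \<otimes>\<^bsub>B\<^esub> c)"
  unfolding pure_tensor_def by (subst smult_cls) (simp_all add: F_of)

lemma smult_minus:
  assumes "b \<in> carrier B" "x \<in> carrier T" "y \<in> carrier T"
  shows "b \<odot>\<^bsub>T\<^esub> (x \<ominus>\<^bsub>T\<^esub> y) = b \<odot>\<^bsub>T\<^esub> x \<ominus>\<^bsub>T\<^esub> b \<odot>\<^bsub>T\<^esub> y"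
proof -
  obtain a c where ac: "a \<in> carrier F" "x = cls a" "c \<in> carrier F" "y = cls c" using assms by (metis T_cases)
  note ext = ext_F[OF assms(1) ac(1)] ext_F[OF assms(1) ac(3)]
  show ?thesis
    unfolding ac(2,4) minus_T[OF ac(1,3)] smult_cls[OF assms(1) ac(1)] smult_cls[OF assms(1) ac(3)]
      smult_cls[OF assms(1) F_diff[OF ac(1,3)]] minus_T[OF ext] frag_extend_diff ..
qed

end

section \<open>Values in the base change of a Banach space\<close>

lemma (in abelian_group) finsum_minus:
  assumes "f \<in> A \<rightarrow> carrier G" "g \<in> A \<rightarrow> carrier G"
  shows "(\<Oplus>i\<in>A. f i \<ominus> g i) = (\<Oplus>i\<in>A. f i) \<ominus> (\<Oplus>i\<in>A. g i)"
proof -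
  have "(\<Oplus>i\<in>A. f i) = (\<Oplus>i\<in>A. (f i \<ominus> g i) \<oplus> g i)"
    using assms by (intro finsum_cong') (auto simp: a_minus_def a_assoc l_neg Pi_def)
  also have "\<dots> = (\<Oplus>i\<in>A. f i \<ominus> g i) \<oplus> (\<Oplus>i\<in>A. g i)"
    using assms by (intro finsum_addf) (auto simp: Pi_def)
  finally have e: "(\<Oplus>i\<in>A. f i) = (\<Oplus>i\<in>A. f i \<ominus> g i) \<oplus> (\<Oplus>i\<in>A. g i)" .
  have "(\<Oplus>i\<in>A. f i \<ominus> g i) \<in> carrier G" "(\<Oplus>i\<in>A. g i) \<in> carrier G"
    using assms by (auto intro!: finsum_closed simp: Pi_def)
  then show ?thesis unfolding e by (simp add: a_minus_def a_assoc r_neg)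
qed

lemma (in abelian_group) double_eq_self:
  assumes "x \<in> carrier G" "x \<oplus> x = x"
  shows "x = \<zero>"
proof -
  have "x \<oplus> \<ominus> x = \<zero>" using assms(1) by (rule r_neg)
  moreover have "x \<oplus> \<ominus> x = x \<oplus> (x \<oplus> \<ominus> x)"
    using assms by (subst a_assoc[symmetric]) simp_all
  ultimately show ?thesis using assms(1) by simp
qed

context eval_point
begin

sublocale V: tensor_algebra "sub_field_of K" M "sub_field_of L"
  using K_sub_L by unfold_locales (auto simp: algebra_simps intro: LL.add_mem LL.mult_mem)

abbreviation "V \<equiv> base_change K M L"

text \<open>
  The characteristic properties of the map \<open>id \<otimes> \<mu>\<close> from \<open>M \<otimes> L\<close> to \<open>M\<close>; by the last one it can be
  estimated on any representative.
\<close>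

definition is_Phi :: "('c \<Rightarrow> 'c) \<Rightarrow> (('m \<times> 'c \<Rightarrow>\<^sub>0 int) set \<Rightarrow> 'm) \<Rightarrow> bool" where
  "is_Phi \<mu> \<Phi> \<longleftrightarrow> (\<forall>Y\<in>carrier V. \<Phi> Y \<in> carrier M) \<and>
     (\<forall>Y\<in>carrier V. \<forall>Z\<in>carrier V. \<Phi> (Y \<oplus>\<^bsub>V\<^esub> Z) = \<Phi> Y \<oplus> \<Phi> Z) \<and>
     (\<forall>m\<in>carrier M. \<forall>l\<in>L. \<Phi> (V.pt m l) = \<mu> l \<odot> m) \<and>
     (\<forall>z\<in>carrier V.F. \<forall>t. (\<forall>(a, l)\<in>Poly_Mapping.keys z. ereal t \<le> v (\<mu> l \<odot> a)) \<longrightarrow>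
        ereal t \<le> v (\<Phi> (V.cls z)))"

definition Phi :: "('c \<Rightarrow> 'c) \<Rightarrow> ('m \<times> 'c \<Rightarrow>\<^sub>0 int) set \<Rightarrow> 'm" where
  "Phi \<mu> = (SOME \<Phi>. is_Phi \<mu> \<Phi>)"

lemma is_Phi_Phi:
  assumes \<mu>: "klinear K L \<mu>"
  shows "is_Phi \<mu> (Phi \<mu>)"
proof -
  have add: "\<mu> (x + y) = \<mu> x + \<mu> y" if "x \<in> L" "y \<in> L" for x y
    using \<mu> that unfolding klinear_def by blast
  have sm: "\<mu> (a * x) = a * \<mu> x" if "a \<in> K" "x \<in> L" for a x
    using \<mu> that unfolding klinear_def by blast
  note kK = klinear_K[OF \<mu>]
  obtain \<Phi> where \<Phi>: "\<And>Y. Y \<in> carrier V \<Longrightarrow> \<Phi> Y \<in> carrier M"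
    "\<And>Y Z. Y \<in> carrier V \<Longrightarrow> Z \<in> carrier V \<Longrightarrow> \<Phi> (Y \<oplus>\<^bsub>V\<^esub> Z) = \<Phi> Y \<oplus> \<Phi> Z"
    "\<And>a b. a \<in> carrier M \<Longrightarrow> b \<in> carrier (sub_field_of L) \<Longrightarrow> \<Phi> (V.pt a b) = \<mu> b \<odot> a"
    "\<And>z P. z \<in> carrier V.F \<Longrightarrow> P \<zero> \<Longrightarrow>
       (\<And>x y. x \<in> carrier M \<Longrightarrow> y \<in> carrier M \<Longrightarrow> P x \<Longrightarrow> P y \<Longrightarrow> P (x \<ominus> y)) \<Longrightarrow>
       (\<And>a b. (a, b) \<in> Poly_Mapping.keys z \<Longrightarrow> P (\<mu> b \<odot> a)) \<Longrightarrow> P (\<Phi> (V.cls z))"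
  proof (rule V.lift[of M "\<lambda>m l. \<mu> l \<odot> m"])
    show "abelian_group M" by (rule Mod.M.abelian_group_axioms)
    fix r a l assume r: "r \<in> carrier (sub_field_of K)" "a \<in> carrier M" "l \<in> carrier (sub_field_of L)"
    then have "\<mu> (r * l) = r * \<mu> l" using sm by simp
    also have "\<dots> = \<mu> l * r" by (rule mult.commute)
    finally have "\<mu> (r * l) = \<mu> l * r" .
    moreover have "(\<mu> l * r) \<odot> a = \<mu> l \<odot> (r \<odot> a)"
      using Mod.smult_assoc1[of "\<mu> l" r a] r kK by simp
    ultimately show "\<mu> l \<odot> (r \<odot> a) = \<mu> (r \<odot>\<^bsub>sub_field_of L\<^esub> l) \<odot> a" by simp
  next
    fix a l l' assume l: "a \<in> carrier M" "l \<in> carrier (sub_field_of L)" "l' \<in> carrier (sub_field_of L)"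
    then show "\<mu> (l \<oplus>\<^bsub>sub_field_of L\<^esub> l') \<odot> a = \<mu> l \<odot> a \<oplus> \<mu> l' \<odot> a"
      using Mod.smult_l_distr[of "\<mu> l" "\<mu> l'" a] kK add by simp
  qed (use kK in \<open>auto simp: Mod.smult_r_distr\<close>)
  have "is_Phi \<mu> \<Phi>"
    unfolding is_Phi_def
  proof (intro conjI ballI allI impI)
    fix z t assume z: "z \<in> carrier V.F" "\<forall>(a, l)\<in>Poly_Mapping.keys z. ereal t \<le> v (\<mu> l \<odot> a)"
    show "ereal t \<le> v (\<Phi> (V.cls z))"
      by (rule \<Phi>(4)[of z "\<lambda>x. ereal t \<le> v x", OF z(1)]) (use z(2) v_ge_minus in auto)
  qed (use \<Phi> in auto)
  then show ?thesis unfolding Phi_def by (rule someI[of "is_Phi \<mu>"])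
qed

context
  fixes \<mu> assumes \<mu>: "klinear K L \<mu>"
begin

lemma Phi_closed: "Y \<in> carrier V \<Longrightarrow> Phi \<mu> Y \<in> carrier M"
  and Phi_add: "Y \<in> carrier V \<Longrightarrow> Z \<in> carrier V \<Longrightarrow> Phi \<mu> (Y \<oplus>\<^bsub>V\<^esub> Z) = Phi \<mu> Y \<oplus> Phi \<mu> Z"
  and Phi_pt: "m \<in> carrier M \<Longrightarrow> l \<in> L \<Longrightarrow> Phi \<mu> (V.pt m l) = \<mu> l \<odot> m"
  using is_Phi_Phi[OF \<mu>] unfolding is_Phi_def by blast+

lemma Phi_zero: "Phi \<mu> \<zero>\<^bsub>V\<^esub> = \<zero>"
proof -
  have "Phi \<mu> (\<zero>\<^bsub>V\<^esub> \<oplus>\<^bsub>V\<^esub> \<zero>\<^bsub>V\<^esub>) = Phi \<mu> \<zero>\<^bsub>V\<^esub> \<oplus> Phi \<mu> \<zero>\<^bsub>V\<^esub>"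
    by (rule Phi_add) simp_all
  then show ?thesis using Phi_closed[of "\<zero>\<^bsub>V\<^esub>"] by (intro Mod.M.double_eq_self) simp_all
qed

lemma Phi_minus:
  assumes "Y \<in> carrier V" "Z \<in> carrier V"
  shows "Phi \<mu> (Y \<ominus>\<^bsub>V\<^esub> Z) = Phi \<mu> Y \<ominus> Phi \<mu> Z"
proof -
  have c: "Phi \<mu> (Y \<ominus>\<^bsub>V\<^esub> Z) \<in> carrier M" "Phi \<mu> Z \<in> carrier M" using assms by (simp_all add: Phi_closed)
  have "Y = (Y \<ominus>\<^bsub>V\<^esub> Z) \<oplus>\<^bsub>V\<^esub> Z" using assms by (simp add: a_minus_def V.T.a_assoc V.T.l_neg)
  moreover have "Phi \<mu> ((Y \<ominus>\<^bsub>V\<^esub> Z) \<oplus>\<^bsub>V\<^esub> Z) = Phi \<mu> (Y \<ominus>\<^bsub>V\<^esub> Z) \<oplus> Phi \<mu> Z"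
    by (rule Phi_add) (use assms in auto)
  ultimately have e: "Phi \<mu> Y = Phi \<mu> (Y \<ominus>\<^bsub>V\<^esub> Z) \<oplus> Phi \<mu> Z" by metis
  show ?thesis unfolding e using c by (simp add: a_minus_def Mod.M.a_assoc Mod.M.r_neg)
qed

lemma Phi_finsum:
  assumes "\<And>i. i \<in> I \<Longrightarrow> f i \<in> carrier V"
  shows "Phi \<mu> (\<Oplus>\<^bsub>V\<^esub>i\<in>I. f i) = (\<Oplus>i\<in>I. Phi \<mu> (f i))"
  using assms
proof (induction I rule: infinite_finite_induct)
  case (insert x I)
  have "(\<Oplus>\<^bsub>V\<^esub>i\<in>insert x I. f i) = f x \<oplus>\<^bsub>V\<^esub> (\<Oplus>\<^bsub>V\<^esub>i\<in>I. f i)"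
    using insert by (intro V.T.finsum_insert) auto
  moreover have "(\<Oplus>\<^bsub>V\<^esub>i\<in>I. f i) \<in> carrier V" using insert.prems by (intro V.T.finsum_closed) auto
  moreover have "(\<Oplus>i\<in>insert x I. Phi \<mu> (f i)) = Phi \<mu> (f x) \<oplus> (\<Oplus>i\<in>I. Phi \<mu> (f i))"
    using insert Phi_closed by (intro Mod.M.finsum_insert) auto
  ultimately show ?case using insert by (simp add: Phi_add)
qed (simp_all add: Phi_zero)

text \<open>
  A functional on \<open>L\<close> is bounded, and the supremum in \<open>tensor_val\<close> is nearly attained by some
  representative.
\<close>

lemma Phi_bounded:
  obtains D where "\<And>Y t. Y \<in> carrier V \<Longrightarrow> ereal t < tensor_val v ordp Y \<Longrightarrow> ereal (t - D) \<le> v (Phi \<mu> Y)"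
proof -
  obtain B where B: "finite B" "L = fdspan K B" using L unfolding fdalg_def by blast
  obtain D where D: "\<And>x t. x \<in> L \<Longrightarrow> ereal t \<le> ordp x \<Longrightarrow> ereal (t - D) \<le> ordp (\<mu> x)"
    using klinear_bounded[OF B(1), of \<mu>] \<mu> unfolding B(2) by blast
  have z0: "\<mu> 0 = 0" using \<mu> zero_mem LL.zero_mem unfolding klinear_def by (metis mult_zero_left)
  show thesis
  proof (rule that)
    fix Y t assume Y: "Y \<in> carrier V" "ereal t < tensor_val v ordp Y"
    obtain z where z: "z \<in> Y" "ereal t < (INF (a, l)\<in>Poly_Mapping.keys z. v a + ordp l)"
      using Y(2) unfolding tensor_val_def less_SUP_iff by blast
    obtain y where y: "y \<in> carrier V.F" "Y = V.cls y" using Y(1) by (rule V.T_cases)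
    have zy: "z - y \<in> V.N" using z(1) y(2) by (simp only: V.cls_mem)
    have "z - y \<in> carrier V.F" using V.N_F zy by (rule subsetD)
    from V.F_add[OF this y(1)] have zF: "z \<in> carrier V.F" by (simp only: diff_add_cancel)
    have Yz: "Y = V.cls z" using V.cls_eqI[OF zy] y(2) by simp
    have "\<forall>(a, l)\<in>Poly_Mapping.keys z. ereal (t - D) \<le> v (\<mu> l \<odot> a)"
    proof (intro ballI, clarify)
      fix a l assume al: "(a, l) \<in> Poly_Mapping.keys z"
      have aM: "a \<in> carrier M" and lL: "l \<in> L" using al zF by auto
      have "(INF (a, l)\<in>Poly_Mapping.keys z. v a + ordp l) \<le> v a + ordp l"
        using al by (intro INF_lower2[of "(a, l)"]) auto
      then have t: "ereal t \<le> v a + ordp l" using z(2) by simp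
      show "ereal (t - D) \<le> v (\<mu> l \<odot> a)"
      proof (cases "l = 0")
        case True
        have "\<mu> l \<odot> a = \<zero>" using True z0 Mod.smult_l_null[OF aM] by simp
        then show ?thesis by simp
      next
        case False
        then obtain s where s: "ordp l = ereal s" using ord_finite by blast
        have "ereal (t - s) \<le> v a" using t unfolding s by (simp only: ereal_le_add_iff)
        moreover have "ereal (s - D) \<le> ordp (\<mu> l)" using D[OF lL, of s] s by simp
        ultimately have "ereal ((s - D) + (t - s)) \<le> v (\<mu> l \<odot> a)"
          by (intro v_ge_smult klinear_K[OF \<mu> lL] aM)
        then show ?thesis by simp
      qed
    qed
    then show "ereal (t - D) \<le> v (Phi \<mu> Y)"
      using is_Phi_Phi[OF \<mu>] zF unfolding Yz is_Phi_def by blast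
  qed
qed

end

lemma Phi_smult:
  assumes \<mu>: "klinear K L \<mu>" and w: "w \<in> L" and Y: "Y \<in> carrier V"
  shows "Phi \<mu> (w \<odot>\<^bsub>V\<^esub> Y) = Phi (\<lambda>x. \<mu> (w * x)) Y"
  using Y
proof (induction rule: V.T_induct)
  case zero
  have "w \<odot>\<^bsub>V\<^esub> \<zero>\<^bsub>V\<^esub> = \<zero>\<^bsub>V\<^esub>"
    using V.smult_minus[of w "\<zero>\<^bsub>V\<^esub>" "\<zero>\<^bsub>V\<^esub>"] w V.smult_closed[of w "\<zero>\<^bsub>V\<^esub>"]
    by (simp add: a_minus_def V.T.r_neg)
  then show ?case using Phi_zero[OF \<mu>] Phi_zero[OF klinear_mult[OF \<mu> w]] by simp
next
  case (minus x y)
  then show ?case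
    using w V.smult_minus[of w x y] V.smult_closed[of w x] V.smult_closed[of w y]
      Phi_minus[OF \<mu>] Phi_minus[OF klinear_mult[OF \<mu> w]] by simp
next
  case (pure a l)
  then show ?case
    using w Phi_pt[OF \<mu>, of a "w * l"] Phi_pt[OF klinear_mult[OF \<mu> w], of a l] LL.mult_mem
    by (simp add: V.smult_pt)
qed

definition coords :: "'c set \<Rightarrow> ('c \<Rightarrow> 'c \<Rightarrow> 'c) \<Rightarrow> bool" where
  "coords A co \<longleftrightarrow> finite A \<and> A \<subseteq> L \<and> (\<forall>l\<in>A. klinear K L (co l)) \<and>
     (\<forall>x\<in>L. x = (\<Sum>l\<in>A. co l x * l)) \<and> (\<forall>l\<in>A. \<forall>l'\<in>A. co l l' = (if l = l' then 1 else 0))"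

lemma ex_coords: "\<exists>A co. coords A co"
proof -
  obtain B where B: "finite B" "L = fdspan K B" using L unfolding fdalg_def by blast
  obtain A where A: "finite A" "kindep K A" "fdspan K A = L" using fdspan_basis[OF B(1)] B(2) by metis
  obtain co where "\<And>b. b \<in> A \<Longrightarrow> klinear K (fdspan K A) (co b)"
    "\<And>x. x \<in> fdspan K A \<Longrightarrow> x = (\<Sum>b\<in>A. co b x * b)"
    "\<And>b b'. b \<in> A \<Longrightarrow> b' \<in> A \<Longrightarrow> co b b' = (if b = b' then 1 else 0)"
    by (rule kindep_coords[OF A(1,2)]) (rule that)
  then show ?thesis
    using A fdspan_superset[OF A(1)] unfolding coords_def by (intro exI[of _ A] exI[of _ co]) auto
qed

lemma pt_zero: "l \<in> L \<Longrightarrow> V.pt \<zero> l = \<zero>\<^bsub>V\<^esub>"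
proof -
  assume l: "l \<in> L"
  have c: "V.pt \<zero> l \<in> carrier V" using l by (intro V.pt_closed) auto
  have "V.pt (\<zero> \<oplus> \<zero>) l = V.pt \<zero> l \<oplus>\<^bsub>V\<^esub> V.pt \<zero> l"
    by (rule V.pt_add_left) (use l in auto)
  then show ?thesis using c by (intro V.T.double_eq_self) simp_all
qed

lemma pt_minus:
  assumes "x \<in> carrier M" "y \<in> carrier M" "l \<in> L"
  shows "V.pt (x \<ominus> y) l = V.pt x l \<ominus>\<^bsub>V\<^esub> V.pt y l"
proof -
  have c: "V.pt (x \<ominus> y) l \<in> carrier V" "V.pt y l \<in> carrier V" using assms by (auto intro: V.pt_closed)
  have "x = (x \<ominus> y) \<oplus> y" using assms by (simp add: a_minus_def Mod.M.a_assoc Mod.M.l_neg)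
  moreover have "V.pt ((x \<ominus> y) \<oplus> y) l = V.pt (x \<ominus> y) l \<oplus>\<^bsub>V\<^esub> V.pt y l"
    by (rule V.pt_add_left) (use assms in auto)
  ultimately have e: "V.pt x l = V.pt (x \<ominus> y) l \<oplus>\<^bsub>V\<^esub> V.pt y l" by metis
  show ?thesis unfolding e using c by (simp add: a_minus_def V.T.a_assoc V.T.r_neg)
qed

lemma pt_sum_right:
  assumes "m \<in> carrier M" "finite A" "\<And>l. l \<in> A \<Longrightarrow> f l \<in> L"
  shows "V.pt m (\<Sum>l\<in>A. f l) = (\<Oplus>\<^bsub>V\<^esub>l\<in>A. V.pt m (f l))"
  using assms(2,3)
proof (induction A rule: finite_induct)
  case empty
  have c: "V.pt m 0 \<in> carrier V" using assms by (intro V.pt_closed) auto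
  have "V.pt m (0 \<oplus>\<^bsub>sub_field_of L\<^esub> 0) = V.pt m 0 \<oplus>\<^bsub>V\<^esub> V.pt m 0"
    by (rule V.pt_add_right) (use assms in auto)
  then have "V.pt m 0 = \<zero>\<^bsub>V\<^esub>" using c by (intro V.T.double_eq_self) simp_all
  then show ?case by simp
next
  case (insert x A)
  have "(\<Oplus>\<^bsub>V\<^esub>l\<in>insert x A. V.pt m (f l)) = V.pt m (f x) \<oplus>\<^bsub>V\<^esub> (\<Oplus>\<^bsub>V\<^esub>l\<in>A. V.pt m (f l))"
    using insert assms(1) by (intro V.T.finsum_insert) (auto intro: V.pt_closed)
  moreover have "(\<Sum>l\<in>A. f l) \<in> L" using insert.prems by (intro LL.sum_mem) auto
  ultimately show ?case
    using insert assms(1) V.pt_add_right[of m "f x" "\<Sum>l\<in>A. f l"] by simp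
qed

lemma coords_expand:
  assumes co: "coords A co" and Y: "Y \<in> carrier V"
  shows "Y = (\<Oplus>\<^bsub>V\<^esub>l\<in>A. V.pt (Phi (co l) Y) l)"
proof -
  have A: "finite A" "\<And>l. l \<in> A \<Longrightarrow> l \<in> L" "\<And>l. l \<in> A \<Longrightarrow> klinear K L (co l)"
    "\<And>x. x \<in> L \<Longrightarrow> x = (\<Sum>l\<in>A. co l x * l)" using co unfolding coords_def by blast+
  show ?thesis using Y
  proof (induction rule: V.T_induct)
    case zero
    have "(\<Oplus>\<^bsub>V\<^esub>l\<in>A. V.pt (Phi (co l) \<zero>\<^bsub>V\<^esub>) l) = (\<Oplus>\<^bsub>V\<^esub>l\<in>A. \<zero>\<^bsub>V\<^esub>)"
      by (rule V.T.finsum_cong') (use A Phi_zero pt_zero in auto)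
    then show ?case by simp
  next
    case (minus x y)
    have "(\<Oplus>\<^bsub>V\<^esub>l\<in>A. V.pt (Phi (co l) (x \<ominus>\<^bsub>V\<^esub> y)) l) =
        (\<Oplus>\<^bsub>V\<^esub>l\<in>A. V.pt (Phi (co l) x) l \<ominus>\<^bsub>V\<^esub> V.pt (Phi (co l) y) l)"
      by (rule V.T.finsum_cong')
        (use A minus(1,2) Phi_minus Phi_closed pt_minus in \<open>auto intro!: V.pt_closed V.T.minus_closed\<close>)
    also have "\<dots> = (\<Oplus>\<^bsub>V\<^esub>l\<in>A. V.pt (Phi (co l) x) l) \<ominus>\<^bsub>V\<^esub> (\<Oplus>\<^bsub>V\<^esub>l\<in>A. V.pt (Phi (co l) y) l)"
      by (rule V.T.finsum_minus) (use A minus(1,2) Phi_closed in \<open>auto intro!: V.pt_closed\<close>)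
    also have "\<dots> = x \<ominus>\<^bsub>V\<^esub> y" by (simp only: minus(3,4)[symmetric])
    finally show ?case by (rule sym)
  next
    case (pure m x)
    then have m: "m \<in> carrier M" and x: "x \<in> L" by simp_all
    have cK: "co l x \<in> K" if "l \<in> A" for l using klinear_K[OF A(3)[OF that] x] .
    have "V.pt m x = V.pt m (\<Sum>l\<in>A. co l x * l)" using A(4)[OF x] by simp
    also have "\<dots> = (\<Oplus>\<^bsub>V\<^esub>l\<in>A. V.pt m (co l x * l))"
      by (rule pt_sum_right[OF m A(1)]) (use A cK K_sub_L LL.mult_mem in blast)
    also have "\<dots> = (\<Oplus>\<^bsub>V\<^esub>l\<in>A. V.pt (Phi (co l) (V.pt m x)) l)"
    proof (rule V.T.finsum_cong')
      show "A = A" ..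
      show "(\<lambda>l. V.pt (Phi (co l) (V.pt m x)) l) \<in> A \<rightarrow> carrier V"
        using A m x cK by (auto simp: Phi_pt intro!: V.pt_closed)
      fix l assume l: "l \<in> A"
      have "Phi (co l) (V.pt m x) = co l x \<odot> m" by (rule Phi_pt[OF A(3)[OF l] m x])
      then show "V.pt m (co l x * l) = V.pt (Phi (co l) (V.pt m x)) l"
        using V.pt_balanced[of "co l x" m l] cK[OF l] A(2)[OF l] m by simp
    qed
    finally show ?case .
  qed
qed

text \<open>
  The coordinate functionals of a basis \<open>A\<close> of \<open>L\<close> suffice: \<open>Y\<close> is the sum of the tensors
  \<open>Phi (co l) Y \<otimes> l\<close> for \<open>l\<close> in \<open>A\<close>.
\<close>

lemma Phi_determines:
  assumes "Y \<in> carrier V" "Z \<in> carrier V" "\<And>\<mu>. klinear K L \<mu> \<Longrightarrow> Phi \<mu> Y = Phi \<mu> Z"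
  shows "Y = Z"
proof -
  obtain A co where co: "coords A co" using ex_coords by blast
  have "(\<Oplus>\<^bsub>V\<^esub>l\<in>A. V.pt (Phi (co l) Y) l) = (\<Oplus>\<^bsub>V\<^esub>l\<in>A. V.pt (Phi (co l) Z) l)"
    by (rule V.T.finsum_cong')
      (use co assms Phi_closed in \<open>auto simp: coords_def intro!: V.pt_closed\<close>)
  then show ?thesis using coords_expand[OF co assms(1)] coords_expand[OF co assms(2)] by simp
qed

text \<open>
  The expansion of \<open>Y\<close> in a basis of \<open>L\<close> is one of the representations over which \<open>tensor_val\<close>
  takes the supremum.
\<close>

lemma tensor_val_ge:
  assumes co: "coords A co" and Y: "Y \<in> carrier V"
    and t: "\<And>l. l \<in> A \<Longrightarrow> ereal t \<le> v (Phi (co l) Y) + ordp l"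
  shows "ereal t \<le> tensor_val v ordp Y"
proof -
  have A: "finite A" "\<And>l. l \<in> A \<Longrightarrow> l \<in> L" "\<And>l. l \<in> A \<Longrightarrow> klinear K L (co l)"
    using co unfolding coords_def by blast+
  let ?fr = "\<lambda>l. frag_of (Phi (co l) Y, l)"
  have fr: "?fr l \<in> carrier V.F" if "l \<in> A" for l
    using that A Phi_closed Y by (intro V.F_of) auto
  have sumF: "(\<Sum>l\<in>A'. ?fr l) \<in> carrier V.F \<and> V.cls (\<Sum>l\<in>A'. ?fr l) = (\<Oplus>\<^bsub>V\<^esub>l\<in>A'. V.pt (Phi (co l) Y) l)"
    if "A' \<subseteq> A" for A'
    using finite_subset[OF that A(1)] that
  proof (induction A' rule: finite_induct)
    case empty
    then show ?case by (simp add: V.zero_T)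
  next
    case (insert x A')
    have "(\<Oplus>\<^bsub>V\<^esub>l\<in>insert x A'. V.pt (Phi (co l) Y) l) =
        V.pt (Phi (co x) Y) x \<oplus>\<^bsub>V\<^esub> (\<Oplus>\<^bsub>V\<^esub>l\<in>A'. V.pt (Phi (co l) Y) l)"
      using insert A Y Phi_closed by (intro V.T.finsum_insert) (auto intro!: V.pt_closed)
    also have "\<dots> = V.cls (?fr x) \<oplus>\<^bsub>V\<^esub> V.cls (\<Sum>l\<in>A'. ?fr l)"
      using insert.IH insert.prems by (simp only: pure_tensor_def insert_subset simp_thms)
    also have "\<dots> = V.cls (?fr x + (\<Sum>l\<in>A'. ?fr l))" by (rule V.add_T)
    also have "?fr x + (\<Sum>l\<in>A'. ?fr l) = (\<Sum>l\<in>insert x A'. ?fr l)"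
      by (rule sum.insert[OF insert.hyps, symmetric])
    finally have "V.cls (\<Sum>l\<in>insert x A'. ?fr l) = (\<Oplus>\<^bsub>V\<^esub>l\<in>insert x A'. V.pt (Phi (co l) Y) l)"
      by (rule sym)
    moreover have "?fr x + (\<Sum>l\<in>A'. ?fr l) \<in> carrier V.F"
      by (rule V.F_add[OF fr]) (use insert in blast)+
    ultimately show ?case by (simp only: sum.insert[OF insert.hyps] simp_thms)
  qed
  define z where "z = (\<Sum>l\<in>A. ?fr l)"
  have Yz: "Y = V.cls z" using sumF[of A] coords_expand[OF co Y] by (simp add: z_def)
  have "Poly_Mapping.keys z \<subseteq> (\<Union>l\<in>A. Poly_Mapping.keys (?fr l))" unfolding z_def by (rule keys_sum)
  then have keys: "Poly_Mapping.keys z \<subseteq> (\<lambda>l. (Phi (co l) Y, l)) ` A" by auto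
  have "ereal t \<le> (INF (a, l)\<in>Poly_Mapping.keys z. v a + ordp l)"
  proof (rule INF_greatest)
    fix x assume "x \<in> Poly_Mapping.keys z"
    then obtain l where "l \<in> A" "x = (Phi (co l) Y, l)" using keys by blast
    then show "ereal t \<le> (case x of (a, l) \<Rightarrow> v a + ordp l)" using t by simp
  qed
  also have "\<dots> \<le> tensor_val v ordp Y"
    unfolding tensor_val_def by (rule SUP_upper) (simp only: Yz V.cls_self)
  finally show ?thesis .
qed

text \<open>
  The limit defining \<open>g(b)\<close> exists because its coordinates in a basis of \<open>L\<close> are known in advance:
  they are \<open>Ev (co l) g\<close>. It is unique since bounded functionals map it to limits in \<open>M\<close>.
\<close>

theorem mps_eval_functional:
  assumes g: "in_H h C g"
  shows "mps_eval ordp K M v L g b \<in> carrier V"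
    and "klinear K L \<mu> \<Longrightarrow> Phi \<mu> (mps_eval ordp K M v L g b) = Ev \<mu> g"
proof -
  have gM: "\<And>n. g n \<in> carrier M" using g by (auto simp: in_H_def)
  let ?f = "\<lambda>n. V.pt (g n) (mon b n)"
  have fV: "?f n \<in> carrier V" for n using gM mon_L by (intro V.pt_closed) auto
  define S where "S F = (\<Oplus>\<^bsub>V\<^esub>n\<in>F. ?f n)" for F
  have SV: "S F \<in> carrier V" for F unfolding S_def using fV by (intro V.T.finsum_closed) auto
  let ?P = "\<lambda>s. s \<in> carrier V \<and> (\<forall>C::real. \<exists>F0. finite F0 \<and>
        (\<forall>F. finite F \<and> F0 \<subseteq> F \<longrightarrow> tensor_val v ordp (S F \<ominus>\<^bsub>V\<^esub> s) > ereal C))"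
  have PhiS: "Phi \<mu> (S F) = (\<Oplus>n\<in>F. \<mu> (mon b n) \<odot> g n)" if \<mu>: "klinear K L \<mu>" for F \<mu>
    unfolding S_def Phi_finsum[OF \<mu> fV]
    by (rule Mod.M.finsum_cong') (use \<mu> gM mon_L klinear_K in \<open>auto simp: Phi_pt\<close>)
  have val: "Phi \<mu> s = Ev \<mu> g" if s: "?P s" and \<mu>: "klinear K L \<mu>" for s \<mu>
  proof (rule Ev_eqI[symmetric, OF _ \<mu> gM])
    obtain D where D: "\<And>Y t. Y \<in> carrier V \<Longrightarrow> ereal t < tensor_val v ordp Y \<Longrightarrow> ereal (t - D) \<le> v (Phi \<mu> Y)"
      by (rule Phi_bounded[OF \<mu>]) (rule that)
    show "has_vsum (\<lambda>n. \<mu> (mon b n) \<odot> g n) (Phi \<mu> s)"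
      unfolding has_vsum_def
    proof (intro conjI allI)
      show "Phi \<mu> s \<in> carrier M" using s Phi_closed[OF \<mu>] by blast
      fix C :: real
      obtain F0 where F0: "finite F0" "\<forall>F. finite F \<and> F0 \<subseteq> F \<longrightarrow> tensor_val v ordp (S F \<ominus>\<^bsub>V\<^esub> s) > ereal (C + D)"
        using s by blast
      have "ereal C \<le> v ((\<Oplus>n\<in>F. \<mu> (mon b n) \<odot> g n) \<ominus> Phi \<mu> s)"
        if F: "finite F" "F0 \<subseteq> F" for F
      proof -
        have "ereal (C + D - D) \<le> v (Phi \<mu> (S F \<ominus>\<^bsub>V\<^esub> s))"
          by (rule D) (use F0 F SV s in auto)
        then show ?thesis using Phi_minus[OF \<mu> SV, of s] s PhiS[OF \<mu>] by simp
      qed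
      then show "\<exists>F0. finite F0 \<and> (\<forall>F. finite F \<and> F0 \<subseteq> F \<longrightarrow>
          ereal C \<le> v ((\<Oplus>n\<in>F. \<mu> (mon b n) \<odot> g n) \<ominus> Phi \<mu> s))"
        using F0(1) by (intro exI[of _ F0]) simp
    qed
  qed
  obtain A co where co: "coords A co" using ex_coords by blast
  have A: "finite A" "\<And>l. l \<in> A \<Longrightarrow> l \<in> L" "\<And>l. l \<in> A \<Longrightarrow> klinear K L (co l)"
    "\<And>l l'. l \<in> A \<Longrightarrow> l' \<in> A \<Longrightarrow> co l l' = (if l = l' then 1 else 0)"
    using co unfolding coords_def by blast+
  define y where "y = (\<Oplus>\<^bsub>V\<^esub>l\<in>A. V.pt (Ev (co l) g) l)"
  have Evc: "Ev (co l) g \<in> carrier M" if "l \<in> A" for l by (rule Ev_closed[OF A(3)[OF that] g])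
  have pV: "V.pt (Ev (co l) g) l \<in> carrier V" if "l \<in> A" for l using Evc A that by (intro V.pt_closed) auto
  have yV: "y \<in> carrier V" unfolding y_def using pV by (intro V.T.finsum_closed) auto
  have Phiy: "Phi (co l) y = Ev (co l) g" if l: "l \<in> A" for l
  proof -
    have "Phi (co l) y = (\<Oplus>l'\<in>A. Phi (co l) (V.pt (Ev (co l') g) l'))"
      unfolding y_def by (rule Phi_finsum[OF A(3)[OF l] pV])
    also have "\<dots> = (\<Oplus>l'\<in>A. if l = l' then Ev (co l') g else \<zero>)"
    proof (rule Mod.M.finsum_cong')
      fix l' assume l': "l' \<in> A"
      have "Phi (co l) (V.pt (Ev (co l') g) l') = co l l' \<odot> Ev (co l') g"
        by (rule Phi_pt[OF A(3)[OF l] Evc[OF l'] A(2)[OF l']])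
      then show "Phi (co l) (V.pt (Ev (co l') g) l') = (if l = l' then Ev (co l') g else \<zero>)"
        using A(4)[OF l l'] Mod.smult_one[OF Evc[OF l']] Mod.smult_l_null[OF Evc[OF l']] by simp
    qed (use Evc in auto)
    also have "\<dots> = Ev (co l) g"
      by (rule Mod.M.finsum_singleton) (use l A Evc in auto)
    finally show ?thesis .
  qed
  have Py: "?P y"
  proof (intro conjI allI yV)
    fix C :: real
    obtain D where D: "\<And>l. l \<in> A \<Longrightarrow> ereal (- D) \<le> ordp l"
      using finite_ord_bound[OF A(1), of "\<lambda>l. l"] by blast
    have "\<exists>F0. finite F0 \<and> (\<forall>F. finite F \<longrightarrow> F0 \<subseteq> F \<longrightarrow> ereal (C + 1 + D) \<le>
        v ((\<Oplus>n\<in>F. co l (mon b n) \<odot> g n) \<ominus> Ev (co l) g))" if "l \<in> A" for l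
      by (rule has_vsumD[OF has_vsum_Ev[OF A(3)[OF that] g], where C = "C + 1 + D"]) blast
    then obtain F0 where F0: "\<And>l. l \<in> A \<Longrightarrow> finite (F0 l)"
      "\<And>l F. l \<in> A \<Longrightarrow> finite F \<Longrightarrow> F0 l \<subseteq> F \<Longrightarrow> ereal (C + 1 + D) \<le>
        v ((\<Oplus>n\<in>F. co l (mon b n) \<odot> g n) \<ominus> Ev (co l) g)"
      by metis
    have "tensor_val v ordp (S F \<ominus>\<^bsub>V\<^esub> y) > ereal C" if F: "finite F" "(\<Union>l\<in>A. F0 l) \<subseteq> F" for F
    proof -
      have "ereal (C + 1) \<le> tensor_val v ordp (S F \<ominus>\<^bsub>V\<^esub> y)"
      proof (rule tensor_val_ge[OF co])
        show "S F \<ominus>\<^bsub>V\<^esub> y \<in> carrier V" using SV yV by (rule V.T.minus_closed)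
        fix l assume l: "l \<in> A"
        have "Phi (co l) (S F \<ominus>\<^bsub>V\<^esub> y) = (\<Oplus>n\<in>F. co l (mon b n) \<odot> g n) \<ominus> Ev (co l) g"
          using Phi_minus[OF A(3)[OF l] SV yV] PhiS[OF A(3)[OF l]] Phiy[OF l] by simp
        then have "ereal (C + 1 + D) \<le> v (Phi (co l) (S F \<ominus>\<^bsub>V\<^esub> y))"
          using F0(2)[OF l F(1)] F(2) l by auto
        then have "ereal (C + 1 + D) + ereal (- D) \<le> v (Phi (co l) (S F \<ominus>\<^bsub>V\<^esub> y)) + ordp l"
          using D[OF l] by (rule add_mono)
        then show "ereal (C + 1) \<le> v (Phi (co l) (S F \<ominus>\<^bsub>V\<^esub> y)) + ordp l" by simp
      qed
      then show ?thesis by (rule less_le_trans[rotated]) simp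
    qed
    then show "\<exists>F0. finite F0 \<and> (\<forall>F. finite F \<and> F0 \<subseteq> F \<longrightarrow> tensor_val v ordp (S F \<ominus>\<^bsub>V\<^esub> y) > ereal C)"
      using A(1) F0(1) by (intro exI[of _ "\<Union>l\<in>A. F0 l"]) simp
  qed
  have "mps_eval ordp K M v L g b = (THE s. ?P s)"
    unfolding mps_eval_def val_sum_def S_def mon_def ..
  also have "\<dots> = y"
  proof (rule the_equality)
    fix s assume s: "?P s"
    show "s = y"
    proof (rule Phi_determines)
      show "s \<in> carrier V" using s by (rule conjunct1)
      show "Phi \<mu> s = Phi \<mu> y" if "klinear K L \<mu>" for \<mu>
        using val[OF s that] val[OF Py that] by (rule trans[OF _ sym])
    qed (rule yV)
  qed (rule Py)
  finally have e: "mps_eval ordp K M v L g b = y" .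
  show "mps_eval ordp K M v L g b \<in> carrier V" unfolding e by (rule yV)
  show "klinear K L \<mu> \<Longrightarrow> Phi \<mu> (mps_eval ordp K M v L g b) = Ev \<mu> g" unfolding e by (rule val[OF Py])
qed

end

section \<open>Specialisations as functionals\<close>

context eval_point
begin

lemma Ev_cong: "(\<And>x. x \<in> L \<Longrightarrow> \<mu> x = \<nu> x) \<Longrightarrow> Ev \<mu> g = Ev \<nu> g"
  unfolding Ev_def using mon_L by simp

end

text \<open>
  A specialisation, described by those properties which the evaluation of tensors uses; \<open>ev\<close>
  stands for the evaluation of integral power series at \<open>b\<close>.
\<close>

locale spec_point = eval_point p ordp K M v h L b \<beta>
  for p and ordp :: "'c::{alg_closed_field, field_char_0} \<Rightarrow> ereal" and K :: "'c set"
    and M :: "('c, 'm) module" (structure) and v :: "'m \<Rightarrow> ereal"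
    and h :: "'n::finite \<Rightarrow> real" and L :: "'c set" and b :: "'n \<Rightarrow> 'c" and \<beta> :: real +
  fixes J :: "(('n \<Rightarrow> nat) \<Rightarrow> 'c, 'j) module" and \<kappa> :: "'j \<Rightarrow> 'c" and ev :: "(('n \<Rightarrow> nat) \<Rightarrow> 'c) \<Rightarrow> 'c"
  assumes J_group: "abelian_group J"
    and J_smult: "r \<in> carrier (mps_ring (ring_of_integers ordp K)) \<Longrightarrow> c \<in> carrier J \<Longrightarrow> r \<odot>\<^bsub>J\<^esub> c \<in> carrier J"
    and \<kappa>_L: "c \<in> carrier J \<Longrightarrow> \<kappa> c \<in> L"
    and \<kappa>_add: "c \<in> carrier J \<Longrightarrow> c' \<in> carrier J \<Longrightarrow> \<kappa> (c \<oplus>\<^bsub>J\<^esub> c') = \<kappa> c + \<kappa> c'"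
    and \<kappa>_smult: "r \<in> carrier (mps_ring (ring_of_integers ordp K)) \<Longrightarrow> c \<in> carrier J \<Longrightarrow> \<kappa> (r \<odot>\<^bsub>J\<^esub> c) = ev r * \<kappa> c"
    and ev_L: "r \<in> carrier (mps_ring (ring_of_integers ordp K)) \<Longrightarrow> ev r \<in> L"
    and ev_lim: "r \<in> carrier (mps_ring (ring_of_integers ordp K)) \<Longrightarrow>
      ereal (\<beta> * real N) \<le> ordp (ev r - (\<Sum>n | msize n < N. r n * mon b n))"
    and L_eq: "L = value_field K J \<kappa>"
    and b_eq: "b = (\<lambda>i. \<kappa> (mps_X i \<odot>\<^bsub>J\<^esub> \<one>\<^bsub>J\<^esub>))"
begin

abbreviation "RR \<equiv> mps_ring (ring_of_integers ordp K)"
abbreviation "HH \<equiv> H_space p h M v"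

lemma RR_iff: "r \<in> carrier RR \<longleftrightarrow> (\<forall>n. r n \<in> K \<and> 0 \<le> ordp (r n))"
  by (auto simp: mps_ring_def ring_of_integers_def)

sublocale JJ: abelian_group J by (rule J_group)

sublocale TJ: tensor_pair RR HH J
proof
  show "a \<oplus>\<^bsub>HH\<^esub> a' \<in> carrier HH" if "a \<in> carrier HH" "a' \<in> carrier HH" for a a'
    using that in_H_add unfolding H_space_iff H_space_simps by blast
  show "r \<odot>\<^bsub>HH\<^esub> a \<in> carrier HH" if "r \<in> carrier RR" "a \<in> carrier HH" for r a
    using that in_H_conv[where h = h and a = r and g = a, OF h_nonneg]
    unfolding H_space_iff H_space_simps RR_iff by blast
qed (auto intro: J_smult)

text \<open>
  The additive map on the tensor product which sends \<open>g \<otimes> c\<close> to the image of \<open>\<kappa>(c) * g(b)\<close> under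
  \<open>id \<otimes> \<mu>\<close>.
\<close>

definition is_Theta :: "('c \<Rightarrow> 'c) \<Rightarrow> (((('n \<Rightarrow> nat) \<Rightarrow> 'm) \<times> 'j \<Rightarrow>\<^sub>0 int) set \<Rightarrow> 'm) \<Rightarrow> bool" where
  "is_Theta \<mu> \<Theta> \<longleftrightarrow> (\<forall>Y\<in>carrier TJ.T. \<Theta> Y \<in> carrier M) \<and>
     (\<forall>Y\<in>carrier TJ.T. \<forall>Z\<in>carrier TJ.T. \<Theta> (Y \<oplus>\<^bsub>TJ.T\<^esub> Z) = \<Theta> Y \<oplus> \<Theta> Z) \<and>
     (\<forall>g\<in>carrier HH. \<forall>c\<in>carrier J. \<Theta> (TJ.pt g c) = Ev (\<lambda>x. \<mu> (\<kappa> c * x)) g)"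

lemma ex_Theta:
  assumes \<mu>: "klinear K L \<mu>"
  shows "\<exists>\<Theta>. is_Theta \<mu> \<Theta>"
proof -
  note km = klinear_mult[OF \<mu> \<kappa>_L]
  have \<mu>a: "\<mu> (x + y) = \<mu> x + \<mu> y" if "x \<in> L" "y \<in> L" for x y
    using \<mu> that unfolding klinear_def by blast
  obtain \<Theta> where "\<And>Y. Y \<in> carrier TJ.T \<Longrightarrow> \<Theta> Y \<in> carrier M"
    "\<And>Y Z. Y \<in> carrier TJ.T \<Longrightarrow> Z \<in> carrier TJ.T \<Longrightarrow> \<Theta> (Y \<oplus>\<^bsub>TJ.T\<^esub> Z) = \<Theta> Y \<oplus> \<Theta> Z"
    "\<And>a b. a \<in> carrier HH \<Longrightarrow> b \<in> carrier J \<Longrightarrow> \<Theta> (TJ.pt a b) = Ev (\<lambda>x. \<mu> (\<kappa> b * x)) a"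
  proof (rule TJ.lift[of M "\<lambda>g c. Ev (\<lambda>x. \<mu> (\<kappa> c * x)) g"])
    show "abelian_group M" by (rule Mod.M.abelian_group_axioms)
    fix g c assume gc: "g \<in> carrier HH" "c \<in> carrier J"
    then obtain C where C: "in_H h C g" unfolding H_space_iff by blast
    show "Ev (\<lambda>x. \<mu> (\<kappa> c * x)) g \<in> carrier M" by (rule Ev_closed[OF km[OF gc(2)] C])
    {
      fix g' assume "g' \<in> carrier HH"
      then obtain C' where C': "in_H h C' g'" unfolding H_space_iff by blast
      show "Ev (\<lambda>x. \<mu> (\<kappa> c * x)) (g \<oplus>\<^bsub>HH\<^esub> g') =
          Ev (\<lambda>x. \<mu> (\<kappa> c * x)) g \<oplus> Ev (\<lambda>x. \<mu> (\<kappa> c * x)) g'"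
        unfolding H_space_simps by (rule Ev_add[OF km[OF gc(2)] C C'])
    next
      fix c' assume c': "c' \<in> carrier J"
      have "Ev (\<lambda>x. \<mu> (\<kappa> (c \<oplus>\<^bsub>J\<^esub> c') * x)) g = Ev (\<lambda>x. \<mu> (\<kappa> c * x) + \<mu> (\<kappa> c' * x)) g"
        using gc c' \<kappa>_L LL.mult_mem by (intro Ev_cong) (simp add: \<kappa>_add distrib_right \<mu>a)
      also have "\<dots> = Ev (\<lambda>x. \<mu> (\<kappa> c * x)) g \<oplus> Ev (\<lambda>x. \<mu> (\<kappa> c' * x)) g"
        by (rule Ev_add_functional[OF km[OF gc(2)] km[OF c'] C])
      finally show "Ev (\<lambda>x. \<mu> (\<kappa> (c \<oplus>\<^bsub>J\<^esub> c') * x)) g = \<dots>" .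
    next
      fix r :: "('n \<Rightarrow> nat) \<Rightarrow> 'c" assume r: "r \<in> carrier RR"
      have "Ev (\<lambda>x. \<mu> (\<kappa> c * x)) (conv r g) = Ev (\<lambda>x. \<mu> (\<kappa> c * (ev r * x))) g"
        by (rule Ev_conv[OF km[OF gc(2)] C _ _ ev_L[OF r] ev_lim[OF r]]) (use r in \<open>auto simp: RR_iff\<close>)
      then show "Ev (\<lambda>x. \<mu> (\<kappa> c * x)) (r \<odot>\<^bsub>HH\<^esub> g) = Ev (\<lambda>x. \<mu> (\<kappa> (r \<odot>\<^bsub>J\<^esub> c) * x)) g"
        unfolding H_space_simps \<kappa>_smult[OF r gc(2)] by (simp add: mult.left_commute mult.assoc)
    }
  qed (rule that)
  then show ?thesis unfolding is_Theta_def by blast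
qed

lemma Theta_zero:
  assumes "is_Theta \<mu> \<Theta>"
  shows "\<Theta> \<zero>\<^bsub>TJ.T\<^esub> = \<zero>"
proof -
  have "\<Theta> (\<zero>\<^bsub>TJ.T\<^esub> \<oplus>\<^bsub>TJ.T\<^esub> \<zero>\<^bsub>TJ.T\<^esub>) = \<Theta> \<zero>\<^bsub>TJ.T\<^esub> \<oplus> \<Theta> \<zero>\<^bsub>TJ.T\<^esub>" "\<Theta> \<zero>\<^bsub>TJ.T\<^esub> \<in> carrier M"
    using assms TJ.T.zero_closed unfolding is_Theta_def by blast+
  then show ?thesis by (intro Mod.M.double_eq_self) simp_all
qed

lemma Theta_finsum:
  assumes \<Theta>: "is_Theta \<mu> \<Theta>" and f: "\<And>i. i \<in> I \<Longrightarrow> f i \<in> carrier TJ.T"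
  shows "\<Theta> (\<Oplus>\<^bsub>TJ.T\<^esub>i\<in>I. f i) = (\<Oplus>i\<in>I. \<Theta> (f i))"
  using f
proof (induction I rule: infinite_finite_induct)
  case (insert x I)
  have "(\<Oplus>\<^bsub>TJ.T\<^esub>i\<in>insert x I. f i) = f x \<oplus>\<^bsub>TJ.T\<^esub> (\<Oplus>\<^bsub>TJ.T\<^esub>i\<in>I. f i)"
    using insert by (intro TJ.T.finsum_insert) auto
  moreover have "(\<Oplus>\<^bsub>TJ.T\<^esub>i\<in>I. f i) \<in> carrier TJ.T" using insert.prems by (intro TJ.T.finsum_closed) auto
  moreover have "(\<Oplus>i\<in>insert x I. \<Theta> (f i)) = \<Theta> (f x) \<oplus> (\<Oplus>i\<in>I. \<Theta> (f i))"
    using insert \<Theta> unfolding is_Theta_def by (intro Mod.M.finsum_insert) auto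
  moreover have "\<Theta> (f x \<oplus>\<^bsub>TJ.T\<^esub> Y) = \<Theta> (f x) \<oplus> \<Theta> Y" if "Y \<in> carrier TJ.T" for Y
    using insert.prems \<Theta> that unfolding is_Theta_def by blast
  ultimately show ?case using insert.IH insert.prems by simp
qed (simp_all add: Theta_zero[OF \<Theta>])

lemma TJ_pt_zero: "g \<in> carrier HH \<Longrightarrow> TJ.pt g \<zero>\<^bsub>J\<^esub> = \<zero>\<^bsub>TJ.T\<^esub>"
proof -
  assume g: "g \<in> carrier HH"
  have "TJ.pt g (\<zero>\<^bsub>J\<^esub> \<oplus>\<^bsub>J\<^esub> \<zero>\<^bsub>J\<^esub>) = TJ.pt g \<zero>\<^bsub>J\<^esub> \<oplus>\<^bsub>TJ.T\<^esub> TJ.pt g \<zero>\<^bsub>J\<^esub>"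
    by (rule TJ.pt_add_right) (use g in auto)
  then show ?thesis using g by (intro TJ.T.double_eq_self) (simp_all add: TJ.pt_closed)
qed

lemma TJ_pure_sum:
  assumes "Y \<in> carrier TJ.T"
  shows "\<exists>(r::nat) g c. (\<forall>j<r. g j \<in> carrier HH \<and> c j \<in> carrier J) \<and>
    Y = (\<Oplus>\<^bsub>TJ.T\<^esub>j\<in>{..<r}. TJ.pt (g j) (c j))"
proof (rule TJ.pure_sum[OF _ assms])
  fix c assume c: "c \<in> carrier J"
  have "TJ.pt a (\<ominus>\<^bsub>J\<^esub> c) = \<ominus>\<^bsub>TJ.T\<^esub> TJ.pt a c" if a: "a \<in> carrier HH" for a
  proof (rule TJ.T.minus_equality[symmetric])
    have "TJ.pt a (\<ominus>\<^bsub>J\<^esub> c \<oplus>\<^bsub>J\<^esub> c) = TJ.pt a (\<ominus>\<^bsub>J\<^esub> c) \<oplus>\<^bsub>TJ.T\<^esub> TJ.pt a c"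
      by (rule TJ.pt_add_right) (use a c in auto)
    then show "TJ.pt a (\<ominus>\<^bsub>J\<^esub> c) \<oplus>\<^bsub>TJ.T\<^esub> TJ.pt a c = \<zero>\<^bsub>TJ.T\<^esub>"
      using TJ_pt_zero[OF a] JJ.l_neg[OF c] by simp
  qed (use a c in \<open>auto intro: TJ.pt_closed\<close>)
  then show "\<exists>b'\<in>carrier J. \<forall>a\<in>carrier HH. TJ.pt a b' = \<ominus>\<^bsub>TJ.T\<^esub> TJ.pt a c"
    using c JJ.a_inv_closed by blast
qed

text \<open>
  The formula defining \<open>\<kappa>(f)\<close> is independent of the representation of \<open>f\<close>: its image under every
  functional is the value at \<open>f\<close> of a map defined on the tensor product, and functionals separate
  points.
\<close>

theorem specialise_functional:
  assumes f: "f \<in> carrier TJ.T"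
  shows "specialise p ordp K M v J h \<kappa> f \<in> carrier V"
    and "klinear K L \<mu> \<Longrightarrow> is_Theta \<mu> \<Theta> \<Longrightarrow> Phi \<mu> (specialise p ordp K M v J h \<kappa> f) = \<Theta> f"
proof -
  let ?P = "\<lambda>y. \<exists>(r::nat) g c.
           (\<forall>j<r. g j \<in> carrier HH \<and> c j \<in> carrier J) \<and>
           f = (\<Oplus>\<^bsub>TJ.T\<^esub>j\<in>{..<r}. TJ.pt (g j) (c j)) \<and>
           y = (\<Oplus>\<^bsub>V\<^esub>j\<in>{..<r}. \<kappa> (c j) \<odot>\<^bsub>V\<^esub> mps_eval ordp K M v L (g j) b)"
  have spec: "specialise p ordp K M v J h \<kappa> f = (THE y. ?P y)"
    by (simp only: specialise_def Let_def L_eq[symmetric] b_eq[symmetric])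
  have main: "y \<in> carrier V \<and> (\<forall>\<mu> \<Theta>. klinear K L \<mu> \<longrightarrow> is_Theta \<mu> \<Theta> \<longrightarrow> Phi \<mu> y = \<Theta> f)" if "?P y" for y
  proof -
    from that obtain r :: nat and g c where gc: "\<forall>j<r. g j \<in> carrier HH \<and> c j \<in> carrier J"
      "f = (\<Oplus>\<^bsub>TJ.T\<^esub>j\<in>{..<r}. TJ.pt (g j) (c j))"
      "y = (\<Oplus>\<^bsub>V\<^esub>j\<in>{..<r}. \<kappa> (c j) \<odot>\<^bsub>V\<^esub> mps_eval ordp K M v L (g j) b)" by (elim exE conjE)
    have ev: "mps_eval ordp K M v L (g j) b \<in> carrier V"
      "klinear K L \<mu> \<Longrightarrow> Phi \<mu> (mps_eval ordp K M v L (g j) b) = Ev \<mu> (g j)" if "j < r" for j \<mu>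
    proof -
      have "g j \<in> carrier HH" using gc(1) that by simp
      then obtain C where C: "in_H h C (g j)" unfolding H_space_iff by (rule exE)
      show "mps_eval ordp K M v L (g j) b \<in> carrier V" by (rule mps_eval_functional(1)[OF C])
      show "klinear K L \<mu> \<Longrightarrow> Phi \<mu> (mps_eval ordp K M v L (g j) b) = Ev \<mu> (g j)"
        by (rule mps_eval_functional(2)[OF C])
    qed
    have tV: "\<kappa> (c j) \<odot>\<^bsub>V\<^esub> mps_eval ordp K M v L (g j) b \<in> carrier V" if "j < r" for j
      using that gc(1) ev(1) \<kappa>_L by (intro V.smult_closed) auto
    have "Phi \<mu> y = \<Theta> f" if \<mu>: "klinear K L \<mu>" and \<Theta>: "is_Theta \<mu> \<Theta>" for \<mu> \<Theta>
    proof -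
      have "Phi \<mu> y = (\<Oplus>j\<in>{..<r}. Phi \<mu> (\<kappa> (c j) \<odot>\<^bsub>V\<^esub> mps_eval ordp K M v L (g j) b))"
        unfolding gc(3) by (rule Phi_finsum[OF \<mu>]) (use tV in auto)
      also have "\<dots> = (\<Oplus>j\<in>{..<r}. \<Theta> (TJ.pt (g j) (c j)))"
      proof (rule Mod.M.finsum_cong')
        fix j assume "j \<in> {..<r}"
        then have j: "j < r" "g j \<in> carrier HH" "c j \<in> carrier J" using gc(1) by auto
        note k = klinear_mult[OF \<mu> \<kappa>_L[OF j(3)]]
        have "Phi \<mu> (\<kappa> (c j) \<odot>\<^bsub>V\<^esub> mps_eval ordp K M v L (g j) b) =
            Phi (\<lambda>x. \<mu> (\<kappa> (c j) * x)) (mps_eval ordp K M v L (g j) b)"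
          by (rule Phi_smult[OF \<mu> \<kappa>_L[OF j(3)] ev(1)[OF j(1)]])
        also have "\<dots> = Ev (\<lambda>x. \<mu> (\<kappa> (c j) * x)) (g j)" by (rule ev(2)[OF j(1) k])
        also have "\<dots> = \<Theta> (TJ.pt (g j) (c j))" using \<Theta> j unfolding is_Theta_def by simp
        finally show "Phi \<mu> (\<kappa> (c j) \<odot>\<^bsub>V\<^esub> mps_eval ordp K M v L (g j) b) = \<Theta> (TJ.pt (g j) (c j))" .
      next
        show "(\<lambda>j. \<Theta> (TJ.pt (g j) (c j))) \<in> {..<r} \<rightarrow> carrier M"
          using gc(1) \<Theta> TJ.pt_closed unfolding is_Theta_def by auto
      qed simp
      also have "\<dots> = \<Theta> f" unfolding gc(2)
        by (rule Theta_finsum[OF \<Theta>, symmetric]) (use gc(1) in \<open>auto intro: TJ.pt_closed\<close>)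
      finally show ?thesis .
    qed
    moreover have "y \<in> carrier V" unfolding gc(3) using tV by (intro V.T.finsum_closed) auto
    ultimately show ?thesis by blast
  qed
  obtain r :: nat and g c where "(\<forall>j<r. g j \<in> carrier HH \<and> c j \<in> carrier J)"
    "f = (\<Oplus>\<^bsub>TJ.T\<^esub>j\<in>{..<r}. TJ.pt (g j) (c j))" using TJ_pure_sum[OF f] by (elim exE conjE)
  then have ex: "?P (\<Oplus>\<^bsub>V\<^esub>j\<in>{..<r}. \<kappa> (c j) \<odot>\<^bsub>V\<^esub> mps_eval ordp K M v L (g j) b)" by blast
  have uniq: "y = z" if y: "?P y" and z: "?P z" for y z
  proof (rule Phi_determines)
    show "y \<in> carrier V" "z \<in> carrier V" using main[OF y] main[OF z] by blast+
    show "Phi \<mu> y = Phi \<mu> z" if \<mu>: "klinear K L \<mu>" for \<mu>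
    proof -
      obtain \<Theta> where \<Theta>: "is_Theta \<mu> \<Theta>" using ex_Theta[OF \<mu>] by blast
      have "Phi \<mu> y = \<Theta> f" "Phi \<mu> z = \<Theta> f" using main[OF y] main[OF z] \<mu> \<Theta> by blast+
      then show ?thesis by simp
    qed
  qed
  have "?P (THE y. ?P y)" by (rule theI[of ?P, OF ex]) (rule uniq[OF _ ex])
  from main[OF this] show "specialise p ordp K M v J h \<kappa> f \<in> carrier V"
    "klinear K L \<mu> \<Longrightarrow> is_Theta \<mu> \<Theta> \<Longrightarrow> Phi \<mu> (specialise p ordp K M v J h \<kappa> f) = \<Theta> f"
    unfolding spec by blast+
qed

corollary specialise_zero_imp:
  assumes E: "finite E" "E \<subseteq> carrier J" and \<phi>: "\<And>e. e \<in> E \<Longrightarrow> \<phi> e \<in> carrier HH"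
    and f: "f = (\<Oplus>\<^bsub>TJ.T\<^esub>e\<in>E. TJ.pt (\<phi> e) e)"
    and zero: "specialise p ordp K M v J h \<kappa> f = \<zero>\<^bsub>V\<^esub>"
    and \<mu>: "klinear K L \<mu>"
  shows "(\<Oplus>e\<in>E. Ev (\<lambda>x. \<mu> (\<kappa> e * x)) (\<phi> e)) = \<zero>"
proof -
  obtain \<Theta> where \<Theta>: "is_Theta \<mu> \<Theta>" using ex_Theta[OF \<mu>] by blast
  have pt: "TJ.pt (\<phi> e) e \<in> carrier TJ.T" if "e \<in> E" for e using that E \<phi> by (intro TJ.pt_closed) auto
  have "(\<Oplus>e\<in>E. Ev (\<lambda>x. \<mu> (\<kappa> e * x)) (\<phi> e)) = (\<Oplus>e\<in>E. \<Theta> (TJ.pt (\<phi> e) e))"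
    by (rule Mod.M.finsum_cong') (use \<Theta> E \<phi> pt in \<open>auto simp: is_Theta_def\<close>)
  also have "\<dots> = \<Theta> f" unfolding f by (rule Theta_finsum[OF \<Theta> pt, symmetric])
  also have "\<dots> = Phi \<mu> \<zero>\<^bsub>V\<^esub>"
  proof -
    have "f \<in> carrier TJ.T" unfolding f using pt by (intro TJ.T.finsum_closed) auto
    from specialise_functional(2)[OF this \<mu> \<Theta>] show ?thesis unfolding zero by (rule sym)
  qed
  also have "\<dots> = \<zero>" by (rule Phi_zero[OF \<mu>])
  finally show ?thesis .
qed

end

section \<open>Characters of finite-dimensional commutative algebras\<close>

text \<open>
  Vectors with entries indexed by a finite set \<open>E\<close> are represented by functions on the whole type;
  the subspaces modulo which one calculates contain all functions vanishing on \<open>E\<close>.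
\<close>

definition lin_sub :: "('j \<Rightarrow> 'c::field) set \<Rightarrow> bool" where
  "lin_sub W \<longleftrightarrow> (\<lambda>_. 0) \<in> W \<and> (\<forall>x\<in>W. \<forall>y\<in>W. (\<lambda>f. x f + y f) \<in> W) \<and> (\<forall>c. \<forall>x\<in>W. (\<lambda>f. c * x f) \<in> W)"

lemma lin_sub_add: "lin_sub W \<Longrightarrow> x \<in> W \<Longrightarrow> y \<in> W \<Longrightarrow> (\<lambda>f. x f + y f) \<in> W"
  and lin_sub_scale: "lin_sub W \<Longrightarrow> x \<in> W \<Longrightarrow> (\<lambda>f. c * x f) \<in> W"
  and lin_sub_zero: "lin_sub W \<Longrightarrow> (\<lambda>_. 0) \<in> W"
  unfolding lin_sub_def by blast+

lemma lin_sub_diff: "lin_sub W \<Longrightarrow> x \<in> W \<Longrightarrow> y \<in> W \<Longrightarrow> (\<lambda>f. x f - y f) \<in> W"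
  using lin_sub_add[of W x "\<lambda>f. - 1 * y f"] lin_sub_scale[of W y "- 1"] by simp

lemma lin_sub_sum:
  assumes "lin_sub W" "\<And>i. i \<in> I \<Longrightarrow> x i \<in> W"
  shows "(\<lambda>f. \<Sum>i\<in>I. c i * x i f) \<in> W"
  using assms(2)
proof (induction I rule: infinite_finite_induct)
  case (insert i I)
  then have "(\<lambda>f. c i * x i f) \<in> W" "(\<lambda>f. \<Sum>i\<in>I. c i * x i f) \<in> W"
    using lin_sub_scale[OF assms(1)] by auto
  from lin_sub_add[OF assms(1) this] insert.hyps show ?case by simp
qed (simp_all add: lin_sub_zero[OF assms(1)])

lemma lin_sub_scale_cancel:
  assumes "lin_sub W" "(\<lambda>f. c * x f) \<in> W" "x \<notin> W"
  shows "c = 0"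
proof (rule ccontr)
  assume "c \<noteq> 0"
  then have "(\<lambda>f. inverse c * (c * x f)) = x" by (auto simp: mult.assoc[symmetric])
  then show False using lin_sub_scale[OF assms(1,2), of "inverse c"] assms(3) by simp
qed

definition lin_op :: "(('j \<Rightarrow> 'c::field) \<Rightarrow> ('j \<Rightarrow> 'c)) \<Rightarrow> bool" where
  "lin_op T \<longleftrightarrow> (\<forall>x y. T (\<lambda>f. x f + y f) = (\<lambda>f. T x f + T y f)) \<and> (\<forall>c x. T (\<lambda>f. c * x f) = (\<lambda>f. c * T x f))"

lemma lin_op_sum:
  assumes "lin_op T"
  shows "T (\<lambda>f. \<Sum>i\<in>I. c i * x i f) = (\<lambda>f. \<Sum>i\<in>I. c i * T (x i) f)"
proof (induction I rule: infinite_finite_induct)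
  case (insert i I)
  have "T (\<lambda>f. \<Sum>i\<in>insert i I. c i * x i f) = T (\<lambda>f. c i * x i f + (\<Sum>i\<in>I. c i * x i f))"
    using insert.hyps by simp
  also have "\<dots> = (\<lambda>f. c i * T (x i) f + (\<Sum>i\<in>I. c i * T (x i) f))"
    using assms insert.IH unfolding lin_op_def by simp
  finally show ?case using insert.hyps by simp
next
  case empty
  have "T (\<lambda>f. 0 * x undefined f) = (\<lambda>f. 0 * T (x undefined) f)" using assms unfolding lin_op_def by blast
  then show ?case by simp
next
  case (infinite I)
  have "T (\<lambda>f. 0 * x undefined f) = (\<lambda>f. 0 * T (x undefined) f)" using assms unfolding lin_op_def by blast
  then show ?case using infinite by simp
qed

lemma lin_op_diff: "lin_op T \<Longrightarrow> T (\<lambda>f. x f - c * y f) = (\<lambda>f. T x f - c * T y f)"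
proof -
  assume T: "lin_op T"
  have "T (\<lambda>f. x f + (- c) * y f) = (\<lambda>f. T x f + (- c) * T y f)"
    using T unfolding lin_op_def by metis
  then show ?thesis by simp
qed

text \<open>
  For a root \<open>c\<close> of \<open>q\<close>, with \<open>q = (X - c) * r\<close>, the vector \<open>r(T) y\<close> is an eigenvector modulo \<open>W\<close>
  unless it lies in \<open>W\<close>; in that case \<open>r\<close> takes the place of \<open>q\<close>.
\<close>

lemma eigenvector_modulo_poly:
  fixes T :: "('j \<Rightarrow> 'c::alg_closed_field) \<Rightarrow> ('j \<Rightarrow> 'c)"
  assumes T: "lin_op T" and W: "lin_sub W" and U: "lin_sub U" "\<And>x. x \<in> U \<Longrightarrow> T x \<in> U"
  shows "q \<noteq> 0 \<Longrightarrow> y \<in> U \<Longrightarrow> y \<notin> W \<Longrightarrow>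
    (\<lambda>f. \<Sum>i\<le>Polynomial.degree q. Polynomial.coeff q i * (T ^^ i) y f) \<in> W \<Longrightarrow>
    \<exists>z c. z \<in> U \<and> z \<notin> W \<and> (\<lambda>f. T z f - c * z f) \<in> W"
proof (induction "Polynomial.degree q" arbitrary: q)
  case 0
  then have "Polynomial.coeff q 0 = 0"
    by (intro lin_sub_scale_cancel[OF W, of _ y]) (simp_all add: 0(1)[symmetric])
  moreover have "Polynomial.coeff q (Polynomial.degree q) \<noteq> 0" using 0(2) by simp
  ultimately have False using 0(1) by simp
  then show ?case ..
next
  case (Suc d)
  obtain c where c: "Polynomial.poly q c = 0" using alg_closed_imp_poly_has_root[of q] Suc(2) by force
  then obtain r where r: "q = [:- c, 1:] * r" unfolding poly_eq_0_iff_dvd dvd_def by blast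
  have r0: "r \<noteq> 0" using Suc.prems(1) r by auto
  have "Polynomial.degree q = Suc (Polynomial.degree r)"
    unfolding r using r0 by (subst degree_mult_eq) auto
  then have dr: "Polynomial.degree r = d" using Suc(2) by simp
  define z where "z = (\<lambda>f. \<Sum>i\<le>d. Polynomial.coeff r i * (T ^^ i) y f)"
  show ?case
  proof (cases "z \<in> W")
    case True
    then show ?thesis using Suc(1)[OF dr[symmetric] r0 Suc.prems(2,3)] unfolding z_def dr by blast
  next
    case False
    have Ty: "(T ^^ i) y \<in> U" for i by (induction i) (use U(2) Suc.prems(2) in auto)
    have zU: "z \<in> U" unfolding z_def by (rule lin_sub_sum[OF U(1) Ty])
    have Tz: "T z = (\<lambda>f. \<Sum>i\<le>d. Polynomial.coeff r i * (T ^^ Suc i) y f)"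
      unfolding z_def lin_op_sum[OF T] by simp
    have "(\<lambda>f. \<Sum>i\<le>Polynomial.degree q. Polynomial.coeff q i * (T ^^ i) y f) = (\<lambda>f. T z f - c * z f)"
    proof
      fix f
      have dq: "Polynomial.degree q = Suc d" using Suc(2) by simp
      have cq: "Polynomial.coeff q 0 = - c * Polynomial.coeff r 0"
        "Polynomial.coeff q (Suc i) = Polynomial.coeff r i - c * Polynomial.coeff r (Suc i)" for i
        unfolding r by (simp_all add: coeff_pCons)
      have rd: "Polynomial.coeff r (Suc d) = 0" by (simp add: coeff_eq_0 dr)
      let ?a = "\<lambda>i. Polynomial.coeff r i" and ?t = "\<lambda>i. (T ^^ i) y f"
      have "(\<Sum>i\<le>Suc d. Polynomial.coeff q i * ?t i) =
          - c * ?a 0 * ?t 0 + (\<Sum>i\<le>d. (?a i - c * ?a (Suc i)) * ?t (Suc i))"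
        by (simp only: sum.atMost_Suc_shift cq)
      also have "\<dots> = (\<Sum>i\<le>d. ?a i * ?t (Suc i)) - c * (?a 0 * ?t 0 + (\<Sum>i\<le>d. ?a (Suc i) * ?t (Suc i)))"
        by (simp add: algebra_simps sum_subtractf sum_distrib_left)
      also have "?a 0 * ?t 0 + (\<Sum>i\<le>d. ?a (Suc i) * ?t (Suc i)) = (\<Sum>i\<le>Suc d. ?a i * ?t i)"
        by (simp only: sum.atMost_Suc_shift)
      also have "\<dots> = (\<Sum>i\<le>d. ?a i * ?t i)" using rd by simp
      finally show "(\<Sum>i\<le>Polynomial.degree q. Polynomial.coeff q i * ?t i) = T z f - c * z f"
        unfolding dq Tz by (simp only: z_def)
    qed
    then have "(\<lambda>f. T z f - c * z f) \<in> W" using Suc.prems(4) by simp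
    then show ?thesis using zU False by blast
  qed
qed

lemma eigenvector_modulo:
  fixes T :: "('j \<Rightarrow> 'c::alg_closed_field) \<Rightarrow> ('j \<Rightarrow> 'c)"
  assumes T: "lin_op T" and W: "lin_sub W" and U: "lin_sub U" "\<And>x. x \<in> U \<Longrightarrow> T x \<in> U"
    and E: "finite E" "\<And>x. (\<And>f. f \<in> E \<Longrightarrow> x f = 0) \<Longrightarrow> x \<in> W"
    and y: "y \<in> U" "y \<notin> W"
  shows "\<exists>z c. z \<in> U \<and> z \<notin> W \<and> (\<lambda>f. T z f - c * z f) \<in> W"
proof -
  interpret S: subring_of "UNIV :: 'c set" by (rule subring_of_UNIV)
  let ?I = "{..card E}"
  have "\<exists>c. (\<forall>i\<in>?I. c i \<in> UNIV) \<and> (\<exists>i\<in>?I. c i \<noteq> 0) \<and> (\<forall>e\<in>E. (\<Sum>i\<in>?I. c i * (T ^^ i) y e) = 0)"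
    by (rule S.nontrivial_relation[OF E(1)]) auto
  then obtain c where c: "\<exists>i\<in>?I. c i \<noteq> 0" "\<forall>e\<in>E. (\<Sum>i\<in>?I. c i * (T ^^ i) y e) = 0" by blast
  define q where "q = (\<Sum>i\<in>?I. Polynomial.monom (c i) i)"
  have cq: "Polynomial.coeff q n = (if n \<le> card E then c n else 0)" for n
    by (simp add: q_def coeff_sum if_distrib cong: if_cong)
  have q0: "q \<noteq> 0"
  proof
    assume "q = 0"
    then have "Polynomial.coeff q n = 0" for n by simp
    then show False using c(1) cq by (metis atMost_iff)
  qed
  have dq: "Polynomial.degree q \<le> card E" by (rule degree_le) (simp add: cq)
  have "(\<Sum>i\<le>Polynomial.degree q. Polynomial.coeff q i * (T ^^ i) y f) = (\<Sum>i\<in>?I. c i * (T ^^ i) y f)" for f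
  proof -
    have "(\<Sum>i\<le>Polynomial.degree q. Polynomial.coeff q i * (T ^^ i) y f) = (\<Sum>i\<in>?I. Polynomial.coeff q i * (T ^^ i) y f)"
      using dq by (intro sum.mono_neutral_left) (auto simp: coeff_eq_0)
    also have "\<dots> = (\<Sum>i\<in>?I. c i * (T ^^ i) y f)" by (intro sum.cong) (auto simp: cq)
    finally show ?thesis .
  qed
  then have "(\<lambda>f. \<Sum>i\<le>Polynomial.degree q. Polynomial.coeff q i * (T ^^ i) y f) \<in> W"
    using c(2) by (intro E(2)) simp
  note q = this
  show ?thesis by (rule eigenvector_modulo_poly[OF T W U(1) _ q0 y q]) (rule U(2))
qed

text \<open>
  A commutative algebra with basis \<open>E\<close>, given by its multiplication table \<open>\<gamma>\<close> and the coordinates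
  \<open>u\<close> of its unit.
\<close>

locale structure_constants =
  fixes E :: "'j set" and \<gamma> :: "'j \<Rightarrow> 'j \<Rightarrow> 'j \<Rightarrow> 'c::alg_closed_field" and u :: "'j \<Rightarrow> 'c"
  assumes E: "finite E"
    and comm: "e1 \<in> E \<Longrightarrow> e2 \<in> E \<Longrightarrow> f \<in> E \<Longrightarrow> \<gamma> e1 e2 f = \<gamma> e2 e1 f"
    and assoc: "e1 \<in> E \<Longrightarrow> e2 \<in> E \<Longrightarrow> e3 \<in> E \<Longrightarrow> f \<in> E \<Longrightarrow>
      (\<Sum>g\<in>E. \<gamma> e2 e3 g * \<gamma> e1 g f) = (\<Sum>g\<in>E. \<gamma> e1 e2 g * \<gamma> g e3 f)"
    and unit: "e \<in> E \<Longrightarrow> f \<in> E \<Longrightarrow> (\<Sum>g\<in>E. u g * \<gamma> g e f) = (if e = f then 1 else 0)"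
begin

text \<open>
  Multiplication by the basis element \<open>e\<close>, on coordinate vectors.
\<close>

definition T :: "'j \<Rightarrow> ('j \<Rightarrow> 'c) \<Rightarrow> 'j \<Rightarrow> 'c" where
  "T e x f = (if f \<in> E then \<Sum>g\<in>E. x g * \<gamma> e g f else 0)"

lemma lin_op_T: "lin_op (T e)"
  unfolding lin_op_def T_def by (auto simp: fun_eq_iff distrib_right sum.distrib sum_distrib_left mult.assoc)

lemma T_mult:
  assumes "e1 \<in> E" "e2 \<in> E"
  shows "T e1 (T e2 x) = (\<lambda>f. \<Sum>g\<in>E. \<gamma> e1 e2 g * T g x f)"
proof
  fix f
  show "T e1 (T e2 x) f = (\<Sum>g\<in>E. \<gamma> e1 e2 g * T g x f)"
  proof (cases "f \<in> E")
    case True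
    have "T e1 (T e2 x) f = (\<Sum>g\<in>E. (\<Sum>e3\<in>E. x e3 * \<gamma> e2 e3 g) * \<gamma> e1 g f)"
      using True by (simp add: T_def)
    also have "\<dots> = (\<Sum>e3\<in>E. x e3 * (\<Sum>g\<in>E. \<gamma> e2 e3 g * \<gamma> e1 g f))"
      unfolding sum_distrib_left sum_distrib_right by (subst sum.swap) (simp add: mult.assoc)
    also have "\<dots> = (\<Sum>e3\<in>E. x e3 * (\<Sum>g\<in>E. \<gamma> e1 e2 g * \<gamma> g e3 f))"
      using assoc assms True by simp
    also have "\<dots> = (\<Sum>g\<in>E. \<gamma> e1 e2 g * (\<Sum>e3\<in>E. x e3 * \<gamma> g e3 f))"
      unfolding sum_distrib_left by (subst sum.swap) (simp add: mult.left_commute)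
    finally show ?thesis using True by (simp add: T_def)
  qed (simp add: T_def)
qed

lemma T_commute: "e1 \<in> E \<Longrightarrow> e2 \<in> E \<Longrightarrow> T e1 (T e2 x) = T e2 (T e1 x)"
  unfolding T_mult by (simp add: comm cong: sum.cong)

lemma T_unit: "f \<in> E \<Longrightarrow> (\<Sum>g\<in>E. u g * T g x f) = x f"
proof -
  assume f: "f \<in> E"
  have "(\<Sum>g\<in>E. u g * T g x f) = (\<Sum>g\<in>E. \<Sum>e\<in>E. u g * (x e * \<gamma> g e f))"
    using f by (simp add: T_def sum_distrib_left)
  also have "\<dots> = (\<Sum>e\<in>E. x e * (\<Sum>g\<in>E. u g * \<gamma> g e f))"
    by (subst sum.swap) (simp add: sum_distrib_left mult.left_commute)
  also have "\<dots> = (\<Sum>e\<in>E. if e = f then x e else 0)"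
    using f unit by (intro sum.cong) auto
  also have "\<dots> = x f" using f E by simp
  finally show ?thesis .
qed

definition span_of :: "nat \<Rightarrow> (nat \<Rightarrow> 'j \<Rightarrow> 'c) \<Rightarrow> ('j \<Rightarrow> 'c) set" where
  "span_of m w = {x. \<exists>c. \<forall>f\<in>E. x f = (\<Sum>i<m. c i * w i f)}"

lemma lin_sub_span_of: "lin_sub (span_of m w)"
  unfolding lin_sub_def
proof (intro conjI ballI allI)
  show "(\<lambda>_. 0) \<in> span_of m w" unfolding span_of_def by (auto intro!: exI[of _ "\<lambda>_. 0"])
next
  fix x y assume "x \<in> span_of m w" "y \<in> span_of m w"
  then obtain c d where "\<forall>f\<in>E. x f = (\<Sum>i<m. c i * w i f)" "\<forall>f\<in>E. y f = (\<Sum>i<m. d i * w i f)"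
    unfolding span_of_def by blast
  then show "(\<lambda>f. x f + y f) \<in> span_of m w"
    unfolding span_of_def by (auto simp: distrib_right sum.distrib intro!: exI[of _ "\<lambda>i. c i + d i"])
next
  fix s x assume "x \<in> span_of m w"
  then obtain c where "\<forall>f\<in>E. x f = (\<Sum>i<m. c i * w i f)" unfolding span_of_def by blast
  then show "(\<lambda>f. s * x f) \<in> span_of m w"
    unfolding span_of_def by (auto simp: sum_distrib_left mult.assoc intro!: exI[of _ "\<lambda>i. s * c i"])
qed

lemma span_of_null: "(\<And>f. f \<in> E \<Longrightarrow> x f = 0) \<Longrightarrow> x \<in> span_of m w"
  unfolding span_of_def by (auto intro!: exI[of _ "\<lambda>_. 0"])

lemma span_of_base: "i < m \<Longrightarrow> w i \<in> span_of m w"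
  unfolding span_of_def
  by (auto simp: if_distrib[of "\<lambda>z. z * _"] cong: if_cong intro!: exI[of _ "\<lambda>j. if j = i then 1 else 0"])

lemma span_of_mono: "m \<le> n \<Longrightarrow> span_of m w \<subseteq> span_of n w"
proof
  fix x assume mn: "m \<le> n" and "x \<in> span_of m w"
  then obtain c where c: "\<forall>f\<in>E. x f = (\<Sum>i<m. c i * w i f)" unfolding span_of_def by blast
  have "(\<Sum>i<n. (if i < m then c i else 0) * w i f) = (\<Sum>i<m. c i * w i f)" for f
    using mn by (intro sum.mono_neutral_cong_right) auto
  then show "x \<in> span_of n w" using c unfolding span_of_def
    by (auto intro!: exI[of _ "\<lambda>i. if i < m then c i else 0"])
qed

lemma span_of_cong: "(\<And>i. i < m \<Longrightarrow> w i = w' i) \<Longrightarrow> span_of m w = span_of m w'"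
  unfolding span_of_def by simp

text \<open>
  Each \<open>w i\<close> is an eigenvector of all multiplications modulo the span of the previous vectors,
  with eigenvalues \<open>\<chi> i e\<close>. With respect to such vectors, all multiplications are triangular.
\<close>

definition flag :: "nat \<Rightarrow> (nat \<Rightarrow> 'j \<Rightarrow> 'c) \<Rightarrow> (nat \<Rightarrow> 'j \<Rightarrow> 'c) \<Rightarrow> bool" where
  "flag m w \<chi> \<longleftrightarrow> (\<forall>i<m. w i \<notin> span_of i w \<and> (\<forall>e\<in>E. (\<lambda>f. T e (w i) f - \<chi> i e * w i f) \<in> span_of i w))"

lemma flag_invariant:
  assumes "flag m w \<chi>" "e \<in> E" "x \<in> span_of m w"
  shows "T e x \<in> span_of m w"
proof -
  have b: "T e (w i) \<in> span_of m w" if i: "i < m" for i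
  proof -
    have "(\<lambda>f. T e (w i) f - \<chi> i e * w i f) \<in> span_of m w"
      using assms(1,2) i span_of_mono[of i m w] unfolding flag_def by auto
    moreover have "(\<lambda>f. \<chi> i e * w i f) \<in> span_of m w"
      by (rule lin_sub_scale[OF lin_sub_span_of span_of_base[of i m w]]) (rule i)
    ultimately show ?thesis
      using lin_sub_add[OF lin_sub_span_of[of m w]] by fastforce
  qed
  obtain c where c: "\<forall>f\<in>E. x f = (\<Sum>i<m. c i * w i f)" using assms(3) unfolding span_of_def by blast
  have "T e x = T e (\<lambda>f. \<Sum>i<m. c i * w i f)" unfolding T_def using c by (auto simp: fun_eq_iff)
  also have "\<dots> = (\<lambda>f. \<Sum>i<m. c i * T e (w i) f)" by (rule lin_op_sum[OF lin_op_T])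
  also have "\<dots> \<in> span_of m w" by (rule lin_sub_sum[OF lin_sub_span_of b]) simp
  finally show ?thesis .
qed

lemma flag_indep:
  assumes "flag m w \<chi>" "\<And>f. f \<in> E \<Longrightarrow> (\<Sum>i<m. c i * w i f) = 0"
  shows "\<forall>i<m. c i = 0"
  using assms
proof (induction m)
  case (Suc m)
  have w: "w m \<notin> span_of m w" using Suc.prems(1) unfolding flag_def by blast
  have "(\<lambda>f. c m * w m f) \<in> span_of m w"
    unfolding span_of_def
  proof (intro CollectI exI[of _ "\<lambda>i. - c i"] ballI)
    fix f assume "f \<in> E"
    then have "(\<Sum>i<m. c i * w i f) + c m * w m f = 0" using Suc.prems(2) by simp
    then show "c m * w m f = (\<Sum>i<m. - c i * w i f)" by (simp add: sum_negf eq_neg_iff_add_eq_0 add.commute)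
  qed
  then have cm: "c m = 0" by (rule lin_sub_scale_cancel[OF lin_sub_span_of _ w])
  have "flag m w \<chi>" using Suc.prems(1) unfolding flag_def by simp
  then have "\<forall>i<m. c i = 0" by (rule Suc.IH) (use Suc.prems(2) cm in simp)
  then show ?case using cm less_Suc_eq by auto
qed simp

lemma flag_length: "flag m w \<chi> \<Longrightarrow> m \<le> card E"
proof (rule ccontr)
  assume fl: "flag m w \<chi>" and m: "\<not> m \<le> card E"
  interpret S: subring_of "UNIV :: 'c set" by (rule subring_of_UNIV)
  have "\<exists>c. (\<forall>i\<in>{..<m}. c i \<in> UNIV) \<and> (\<exists>i\<in>{..<m}. c i \<noteq> 0) \<and> (\<forall>e\<in>E. (\<Sum>i\<in>{..<m}. c i * w i e) = 0)"
    by (rule S.nontrivial_relation[OF E]) (use m in auto)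
  then obtain c where "\<exists>i\<in>{..<m}. c i \<noteq> 0" "\<forall>e\<in>E. (\<Sum>i\<in>{..<m}. c i * w i e) = 0" by blast
  then show False using flag_indep[OF fl, of c] by auto
qed

text \<open>
  The multiplications commute, so the simultaneous eigenspace modulo \<open>W\<close> of some of them is stable
  under the next one, which has an eigenvector in it.
\<close>

lemma common_eigenvector_modulo:
  assumes fl: "flag m w \<chi>" and x: "x \<notin> span_of m w"
  shows "\<exists>z c. z \<notin> span_of m w \<and> (\<forall>e\<in>E. (\<lambda>f. T e z f - c e * z f) \<in> span_of m w)"
proof -
  let ?W = "span_of m w"
  have W: "lin_sub ?W" by (rule lin_sub_span_of)
  have "\<exists>z c. z \<notin> ?W \<and> (\<forall>e\<in>F. (\<lambda>f. T e z f - c e * z f) \<in> ?W)" if "F \<subseteq> E" for F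
    using finite_subset[OF that E] that
  proof (induction F rule: finite_induct)
    case empty
    then show ?case using x by blast
  next
    case (insert e0 F)
    then obtain z c where z: "z \<notin> ?W" "\<forall>e\<in>F. (\<lambda>f. T e z f - c e * z f) \<in> ?W" by blast
    define U where "U = {x. \<forall>e\<in>F. (\<lambda>f. T e x f - c e * x f) \<in> ?W}"
    have U: "lin_sub U"
      unfolding lin_sub_def
    proof (intro conjI ballI allI)
      have "T e (\<lambda>_. 0) = (\<lambda>_. 0)" for e by (auto simp: T_def fun_eq_iff)
      then show "(\<lambda>_. 0) \<in> U" unfolding U_def using lin_sub_zero[OF W] by simp
    next
      fix x y assume xy: "x \<in> U" "y \<in> U"
      have "(\<lambda>f. T e (\<lambda>f. x f + y f) f - c e * (x f + y f)) =
          (\<lambda>f. (T e x f - c e * x f) + (T e y f - c e * y f))" for e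
        using lin_op_T[of e] unfolding lin_op_def by (simp add: algebra_simps)
      then show "(\<lambda>f. x f + y f) \<in> U" unfolding U_def using xy lin_sub_add[OF W] by (simp add: U_def)
    next
      fix s x assume x: "x \<in> U"
      have "(\<lambda>f. T e (\<lambda>f. s * x f) f - c e * (s * x f)) = (\<lambda>f. s * (T e x f - c e * x f))" for e
        using lin_op_T[of e] unfolding lin_op_def by (simp add: algebra_simps)
      then show "(\<lambda>f. s * x f) \<in> U" unfolding U_def using x lin_sub_scale[OF W] by (simp add: U_def)
    qed
    have TU: "T e0 x \<in> U" if x: "x \<in> U" for x
      unfolding U_def
    proof (intro CollectI ballI)
      fix e assume e: "e \<in> F"
      have "(\<lambda>f. T e (T e0 x) f - c e * T e0 x f) = T e0 (\<lambda>f. T e x f - c e * x f)"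
        using T_commute[of e e0 x] e insert.prems by (subst lin_op_diff[OF lin_op_T]) auto
      also have "\<dots> \<in> ?W"
        by (rule flag_invariant[OF fl]) (use insert.prems x e in \<open>auto simp: U_def\<close>)
      finally show "(\<lambda>f. T e (T e0 x) f - c e * T e0 x f) \<in> ?W" .
    qed
    have "z \<in> U" using z unfolding U_def by blast
    from eigenvector_modulo[OF lin_op_T W U TU E span_of_null this z(1)]
    obtain y d where y: "y \<in> U" "y \<notin> ?W" "(\<lambda>f. T e0 y f - d * y f) \<in> ?W" by blast
    have "\<forall>e\<in>insert e0 F. (\<lambda>f. T e y f - (c(e0 := d)) e * y f) \<in> ?W"
      using y insert.hyps unfolding U_def by auto
    then show ?case using y(2) by blast
  qed
  from this[OF subset_refl] show ?thesis .
qed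

text \<open>
  Both identities hold for the operators applied to \<open>w i\<close>. Modulo the previous vectors every
  operator acts on \<open>w i\<close> as a scalar, and \<open>w i\<close> is not zero.
\<close>

lemma flag_character:
  assumes fl: "flag m w \<chi>" and i: "i < m"
  shows "e1 \<in> E \<Longrightarrow> e2 \<in> E \<Longrightarrow> \<chi> i e1 * \<chi> i e2 = (\<Sum>g\<in>E. \<gamma> e1 e2 g * \<chi> i g)"
    and "(\<Sum>g\<in>E. u g * \<chi> i g) = 1"
proof -
  let ?W = "span_of i w"
  have W: "lin_sub ?W" by (rule lin_sub_span_of)
  have wW: "w i \<notin> ?W" and ev: "\<And>e. e \<in> E \<Longrightarrow> (\<lambda>f. T e (w i) f - \<chi> i e * w i f) \<in> ?W"
    using fl i unfolding flag_def by blast+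
  have fi: "flag i w \<chi>" using fl i unfolding flag_def by simp
  {
    assume e: "e1 \<in> E" "e2 \<in> E"
    let ?d = "\<lambda>e f. T e (w i) f - \<chi> i e * w i f"
    have 1: "T e1 (?d e2) \<in> ?W" by (rule flag_invariant[OF fi e(1) ev[OF e(2)]])
    have 2: "(\<lambda>f. \<chi> i e2 * ?d e1 f) \<in> ?W" by (rule lin_sub_scale[OF W ev[OF e(1)]])
    have 3: "(\<lambda>f. \<Sum>g\<in>E. \<gamma> e1 e2 g * ?d g f) \<in> ?W" by (rule lin_sub_sum[OF W ev])
    have "(\<lambda>f. (T e1 (?d e2) f + \<chi> i e2 * ?d e1 f) - (\<Sum>g\<in>E. \<gamma> e1 e2 g * ?d g f)) \<in> ?W"
      by (rule lin_sub_diff[OF W lin_sub_add[OF W 1 2] 3])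
    also have "(\<lambda>f. (T e1 (?d e2) f + \<chi> i e2 * ?d e1 f) - (\<Sum>g\<in>E. \<gamma> e1 e2 g * ?d g f)) =
        (\<lambda>f. ((\<Sum>g\<in>E. \<gamma> e1 e2 g * \<chi> i g) - \<chi> i e1 * \<chi> i e2) * w i f)"
      unfolding lin_op_diff[OF lin_op_T] T_mult[OF e]
      by (simp add: algebra_simps sum_subtractf sum_distrib_left)
    finally have "(\<Sum>g\<in>E. \<gamma> e1 e2 g * \<chi> i g) - \<chi> i e1 * \<chi> i e2 = 0"
      by (rule lin_sub_scale_cancel[OF W _ wW])
    then show "\<chi> i e1 * \<chi> i e2 = (\<Sum>g\<in>E. \<gamma> e1 e2 g * \<chi> i g)" by simp
  }
  have 3: "(\<lambda>f. \<Sum>g\<in>E. u g * (T g (w i) f - \<chi> i g * w i f)) \<in> ?W" by (rule lin_sub_sum[OF W ev])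
  have n: "(\<lambda>f. w i f - (\<Sum>g\<in>E. u g * T g (w i) f)) \<in> ?W"
    by (rule span_of_null) (simp add: T_unit)
  have "(\<lambda>f. (\<Sum>g\<in>E. u g * (T g (w i) f - \<chi> i g * w i f)) + (w i f - (\<Sum>g\<in>E. u g * T g (w i) f))) \<in> ?W"
    by (rule lin_sub_add[OF W 3 n])
  also have "(\<lambda>f. (\<Sum>g\<in>E. u g * (T g (w i) f - \<chi> i g * w i f)) + (w i f - (\<Sum>g\<in>E. u g * T g (w i) f))) =
      (\<lambda>f. (1 - (\<Sum>g\<in>E. u g * \<chi> i g)) * w i f)"
    by (simp add: algebra_simps sum_subtractf sum_distrib_left)
  finally have "1 - (\<Sum>g\<in>E. u g * \<chi> i g) = 0" by (rule lin_sub_scale_cancel[OF W _ wW])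
  then show "(\<Sum>g\<in>E. u g * \<chi> i g) = 1" by simp
qed

text \<open>
  A flag of maximal length is a basis, by \<open>common_eigenvector_modulo\<close>. In this basis the
  multiplications are triangular with the characters \<open>\<chi> i\<close> on the diagonal.
\<close>

theorem trace_eq_sum_characters:
  obtains m :: nat and \<chi> where
    "\<And>i e1 e2. i < m \<Longrightarrow> e1 \<in> E \<Longrightarrow> e2 \<in> E \<Longrightarrow> \<chi> i e1 * \<chi> i e2 = (\<Sum>g\<in>E. \<gamma> e1 e2 g * \<chi> i g)"
    "\<And>i. i < m \<Longrightarrow> (\<Sum>g\<in>E. u g * \<chi> i g) = 1"
    "\<And>e. e \<in> E \<Longrightarrow> (\<Sum>f\<in>E. \<gamma> e f f) = (\<Sum>i<m. \<chi> i e)"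
proof -
  let ?Q = "\<lambda>m. \<exists>w \<chi>. flag m w \<chi>"
  have Q0: "?Q 0" by (simp add: flag_def)
  have Qb: "\<forall>m. ?Q m \<longrightarrow> m \<le> card E" using flag_length by blast
  obtain m where m: "?Q m" "\<And>k. ?Q k \<Longrightarrow> k \<le> m"
  proof (rule that)
    show "?Q (Greatest ?Q)" by (rule GreatestI_nat[of ?Q, OF Q0]) (use Qb in blast)
    show "k \<le> Greatest ?Q" if "?Q k" for k
      by (rule Greatest_le_nat[of ?Q k "card E", OF that]) (use Qb in blast)
  qed
  from m(1) obtain w \<chi> where fl: "flag m w \<chi>" by blast
  have full: "x \<in> span_of m w" for x
  proof (rule ccontr)
    assume "x \<notin> span_of m w"
    from common_eigenvector_modulo[OF fl this]
    obtain z c where z: "z \<notin> span_of m w" "\<forall>e\<in>E. (\<lambda>f. T e z f - c e * z f) \<in> span_of m w" by blast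
    have sp: "span_of i (w(m := z)) = span_of i w" if "i \<le> m" for i
      by (rule span_of_cong) (use that in auto)
    have "flag (Suc m) (w(m := z)) (\<chi>(m := c))"
      unfolding flag_def
    proof (intro allI impI)
      fix i assume "i < Suc m"
      then consider "i = m" | "i < m" by linarith
      then show "(w(m := z)) i \<notin> span_of i (w(m := z)) \<and>
          (\<forall>e\<in>E. (\<lambda>f. T e ((w(m := z)) i) f - (\<chi>(m := c)) i e * (w(m := z)) i f) \<in> span_of i (w(m := z)))"
      proof cases
        case 1
        then show ?thesis using z sp[of m] by simp
      next
        case 2
        then show ?thesis using fl sp[of i] unfolding flag_def by simp
      qed
    qed
    then have "Suc m \<le> m" by (intro m(2)) blast
    then show False by simp
  qed
  interpret S: subring_of "UNIV :: 'c set" by (rule subring_of_UNIV)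
  have "\<exists>b \<delta>. \<delta> \<in> UNIV \<and> \<delta> \<noteq> 0 \<and> (\<forall>i\<in>{..<m}. \<forall>e\<in>E. b i e \<in> UNIV) \<and>
    (\<forall>i\<in>{..<m}. \<forall>k\<in>{..<m}. (\<Sum>e\<in>E. w i e * b k e) = (if i = k then \<delta> else 0))"
    by (rule S.dual_family[OF _ E]) (use flag_indep[OF fl] in auto)
  then obtain b \<delta> where \<delta>: "\<delta> \<noteq> 0"
    and b: "\<And>i k. i < m \<Longrightarrow> k < m \<Longrightarrow> (\<Sum>e\<in>E. w i e * b k e) = (if i = k then \<delta> else 0)" by auto
  define pr where "pr k x = (\<Sum>e\<in>E. x e * b k e) / \<delta>" for k and x :: "'j \<Rightarrow> 'c"
  have pr_span: "x f = (\<Sum>i<m. pr i x * w i f)" if f: "f \<in> E" for x f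
  proof -
    obtain c where c: "\<forall>f\<in>E. x f = (\<Sum>i<m. c i * w i f)" using full[of x] unfolding span_of_def by blast
    have "pr k x = c k" if k: "k < m" for k
    proof -
      have "(\<Sum>e\<in>E. x e * b k e) = (\<Sum>e\<in>E. \<Sum>i<m. c i * (w i e * b k e))"
        using c by (intro sum.cong) (simp_all add: sum_distrib_right mult.assoc)
      also have "\<dots> = (\<Sum>i<m. c i * (\<Sum>e\<in>E. w i e * b k e))"
        by (subst sum.swap) (simp add: sum_distrib_left)
      also have "\<dots> = (\<Sum>i<m. if i = k then c k * \<delta> else 0)" using b k by (intro sum.cong) auto
      also have "\<dots> = c k * \<delta>" using k by simp
      finally show ?thesis using \<delta> by (simp add: pr_def)
    qed
    then show ?thesis using c f by simp
  qed
  have pr_low: "pr i x = 0" if x: "x \<in> span_of i w" and i: "i < m" for i x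
  proof -
    obtain c where c: "\<forall>f\<in>E. x f = (\<Sum>j<i. c j * w j f)" using x unfolding span_of_def by blast
    have "(\<Sum>e\<in>E. x e * b i e) = (\<Sum>e\<in>E. \<Sum>j<i. c j * (w j e * b i e))"
      using c by (intro sum.cong) (simp_all add: sum_distrib_right mult.assoc)
    also have "\<dots> = (\<Sum>j<i. c j * (\<Sum>e\<in>E. w j e * b i e))"
      by (subst sum.swap) (simp add: sum_distrib_left)
    also have "\<dots> = 0" using b i by (intro sum.neutral) auto
    finally show ?thesis by (simp add: pr_def)
  qed
  have pr_T: "pr i (T e (w i)) = \<chi> i e" if e: "e \<in> E" and i: "i < m" for e i
  proof -
    have "pr i (\<lambda>f. T e (w i) f - \<chi> i e * w i f) = 0"
      by (rule pr_low[OF _ i]) (use fl e i in \<open>auto simp: flag_def\<close>)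
    moreover have "pr i (\<lambda>f. T e (w i) f - \<chi> i e * w i f) = pr i (T e (w i)) - \<chi> i e * pr i (w i)"
      by (simp add: pr_def left_diff_distrib sum_subtractf diff_divide_distrib sum_distrib_left mult.assoc)
    moreover have "pr i (w i) = 1" using b[OF i i] \<delta> by (simp add: pr_def)
    ultimately show ?thesis by simp
  qed
  have "(\<Sum>f\<in>E. \<gamma> e f f) = (\<Sum>i<m. \<chi> i e)" if e: "e \<in> E" for e
  proof -
    define ee where "ee f g = (if g = f then 1 else 0 :: 'c)" for f g :: 'j
    have Tee: "T e (ee f) g = \<gamma> e f g" if "f \<in> E" "g \<in> E" for f g
      using that E by (simp add: T_def ee_def if_distrib[of "\<lambda>z. z * _"] cong: if_cong)
    have pree: "pr i (ee f) = b i f / \<delta>" if "f \<in> E" for i f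
      using that E by (simp add: pr_def ee_def if_distrib[of "\<lambda>z. z * _"] cong: if_cong)
    have "\<gamma> e f f = (\<Sum>i<m. pr i (ee f) * T e (w i) f)" if f: "f \<in> E" for f
    proof -
      have "T e (ee f) = T e (\<lambda>g. \<Sum>i<m. pr i (ee f) * w i g)"
        unfolding T_def using pr_span[of _ "ee f"] by (auto simp: fun_eq_iff)
      also have "\<dots> = (\<lambda>g. \<Sum>i<m. pr i (ee f) * T e (w i) g)" by (rule lin_op_sum[OF lin_op_T])
      finally show ?thesis using Tee[OF f f] by simp
    qed
    then have "(\<Sum>f\<in>E. \<gamma> e f f) = (\<Sum>f\<in>E. \<Sum>i<m. b i f / \<delta> * T e (w i) f)"
      using pree by (intro sum.cong) simp_all
    also have "\<dots> = (\<Sum>i<m. pr i (T e (w i)))"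
      by (subst sum.swap) (simp add: pr_def sum_divide_distrib mult.commute)
    also have "\<dots> = (\<Sum>i<m. \<chi> i e)" using pr_T[OF e] by simp
    finally show ?thesis .
  qed
  then show thesis using that[of m \<chi>] flag_character[OF fl] by blast
qed

end

section \<open>Evaluation of integral power series\<close>

locale valued_point = valued_field p ordp for p and ordp :: "'c::{alg_closed_field, field_char_0} \<Rightarrow> ereal" +
  fixes b :: "'n::finite \<Rightarrow> 'c" and \<beta> :: real
  assumes \<beta>_pos: "\<beta> > 0" and b_ord: "\<And>i. ereal \<beta> \<le> ordp (b i)"
begin

lemma subfield_UNIV: "subfield_of (UNIV :: 'c set)"
  by unfold_locales auto

lemma banach_UNIV: "banach_space ordp UNIV (sub_field_of UNIV) ordp"
proof -
  interpret R: cring "sub_field_of (UNIV :: 'c set)" by (rule cring_sub_field_of[OF subring_of_UNIV])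
  have "module (sub_field_of (UNIV :: 'c set)) (sub_field_of UNIV)"
    by (rule moduleI) (auto simp: algebra_simps R.is_cring R.abelian_group_axioms)
  then show ?thesis using Cp unfolding banach_space_def is_Cp_def by auto
qed

sublocale C: eval_point p ordp UNIV "sub_field_of UNIV" ordp "\<lambda>_. 0" UNIV b \<beta>
proof -
  interpret U: subfield_of "UNIV :: 'c set" by (rule subfield_UNIV)
  have "val_complete (sub_field_of UNIV) ordp" using Cp unfolding is_Cp_def by blast
  then show "eval_point p ordp UNIV (sub_field_of UNIV) ordp (\<lambda>_. 0) UNIV b \<beta>"
    by unfold_locales (use banach_UNIV U.fdalg_K \<beta>_pos b_ord in auto)
qed

definition integral_series :: "(('n \<Rightarrow> nat) \<Rightarrow> 'c) \<Rightarrow> bool" where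
  "integral_series r \<longleftrightarrow> (\<forall>n. 0 \<le> ordp (r n))"

text \<open>
  Integral power series are the case \<open>K = M = \<complex>\<^sub>p\<close> and \<open>h = 0\<close> of the series treated above.
\<close>

definition evb :: "(('n \<Rightarrow> nat) \<Rightarrow> 'c) \<Rightarrow> 'c" where "evb r = C.Ev (\<lambda>x. x) r"

lemma klinear_id: "klinear UNIV UNIV (\<lambda>x::'c. x)" by (simp add: klinear_def)

lemma integral_in_H: "integral_series r \<Longrightarrow> C.in_H (\<lambda>_::'n. 0) 0 r"
  by (simp add: integral_series_def C.in_H_def hell_def zero_ereal_def)

lemma evb_lim:
  assumes r: "integral_series r"
  shows "ereal (\<beta> * real N) \<le> ordp (evb r - (\<Sum>n | msize n < N. r n * mon b n))"
proof -
  let ?A = "{n :: 'n \<Rightarrow> nat. msize n < N}"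
  note hv = C.has_vsum_Ev[OF klinear_id integral_in_H[OF r], folded evb_def]
  obtain F0 where F0: "finite F0" "\<And>F. finite F \<Longrightarrow> F0 \<subseteq> F \<Longrightarrow> ereal (\<beta> * real N) \<le>
      ordp ((\<Oplus>\<^bsub>sub_field_of UNIV\<^esub>n\<in>F. mon b n \<odot>\<^bsub>sub_field_of UNIV\<^esub> r n) \<ominus>\<^bsub>sub_field_of UNIV\<^esub> evb r)"
    by (rule C.has_vsumD[OF hv, where C = "\<beta> * real N"]) (rule that)
  let ?F = "F0 \<union> ?A"
  have fF: "finite ?F" using F0(1) finite_msize_less by blast
  have 1: "ereal (\<beta> * real N) \<le> ordp ((\<Sum>n\<in>?F. mon b n * r n) - evb r)"
    using F0(2)[OF fF] by (simp add: sub_field_of_finsum[OF subring_of_UNIV] sub_field_of_minus[OF subring_of_UNIV])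
  have "ereal (\<beta> * real N) \<le> ordp (\<Sum>n\<in>?F - ?A. mon b n * r n)"
  proof (rule ge_sum)
    fix n assume "n \<in> ?F - ?A"
    then have "\<beta> * real N \<le> \<beta> * real (msize n)" using \<beta>_pos by simp
    then have "ereal (\<beta> * real N) \<le> ordp (mon b n)" using C.mon_ord[of n] by (meson ereal_less_eq(3) order_trans)
    then show "ereal (\<beta> * real N) \<le> ordp (mon b n * r n)"
      by (rule ge_mult0) (use r in \<open>simp add: integral_series_def\<close>)
  qed
  from ge_diff[OF this 1]
  have "ereal (\<beta> * real N) \<le> ordp ((\<Sum>n\<in>?F - ?A. mon b n * r n) - ((\<Sum>n\<in>?F. mon b n * r n) - evb r))" .
  also have "(\<Sum>n\<in>?F. mon b n * r n) = (\<Sum>n\<in>?F - ?A. mon b n * r n) + (\<Sum>n\<in>?A. mon b n * r n)"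
    by (rule sum.subset_diff) (use fF in auto)
  finally show ?thesis by (simp add: mult.commute)
qed

lemma evb_ord: "integral_series r \<Longrightarrow> 0 \<le> ordp (evb r)"
  using evb_lim[of r 0] by (simp add: zero_ereal_def)

lemma evb_polynomial:
  assumes r: "integral_series r" and N: "\<And>n. msize n \<ge> N \<Longrightarrow> r n = 0"
  shows "evb r = (\<Sum>n | msize n < N. r n * mon b n)"
proof -
  have "evb r - (\<Sum>n | msize n < N. r n * mon b n) = 0"
  proof (rule all_ge_imp_zero)
    fix C :: real
    obtain k :: nat where k: "C < real k * \<beta>" using reals_Archimedean3[OF \<beta>_pos] by blast
    have "(\<Sum>n | msize n < N + k. r n * mon b n) = (\<Sum>n | msize n < N. r n * mon b n)"
      by (rule sum.mono_neutral_right) (use N finite_msize_less in auto)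
    then have "ereal (\<beta> * real (N + k)) \<le> ordp (evb r - (\<Sum>n | msize n < N. r n * mon b n))"
      using evb_lim[OF r, of "N + k"] by simp
    moreover have "C \<le> \<beta> * real (N + k)"
    proof -
      have "real k * \<beta> \<le> \<beta> * real (N + k)" using \<beta>_pos by (simp add: algebra_simps)
      then show ?thesis using k by linarith
    qed
    ultimately show "ereal C \<le> ordp (evb r - (\<Sum>n | msize n < N. r n * mon b n))"
      by (meson ereal_less_eq(3) order_trans)
  qed
  then show ?thesis by simp
qed

lemma evb_const: "0 \<le> ordp c \<Longrightarrow> evb (mps_const c) = c"
proof -
  assume c: "0 \<le> ordp c"
  have z: "{n :: 'n \<Rightarrow> nat. msize n < 1} = {\<lambda>_. 0}" by (auto simp: msize_def)
  have "evb (mps_const c) = (\<Sum>n | msize n < 1. mps_const c n * mon b n)"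
    by (rule evb_polynomial) (use c in \<open>auto simp: integral_series_def mps_const_def msize_def\<close>)
  then show ?thesis unfolding z by (simp add: mps_const_def)
qed

lemma evb_X: "evb (mps_X i) = b i"
proof -
  let ?d = "\<lambda>j. if j = i then 1 else 0 :: nat"
  have d: "msize ?d = 1" by (simp add: msize_def)
  have "evb (mps_X i) = (\<Sum>n | msize n < 2. mps_X i n * mon b n)"
    by (rule evb_polynomial) (auto simp: integral_series_def mps_X_def d)
  also have "\<dots> = (\<Sum>n | msize n < 2. if n = ?d then mon b ?d else 0)"
    by (rule sum.cong) (auto simp: mps_X_def)
  also have "\<dots> = mon b ?d" using finite_msize_less[of 2] d by (subst sum.delta) auto
  also have "\<dots> = b i" by (simp add: mon_def if_distrib[of "\<lambda>k. b _ ^ k"] cong: if_cong)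
  finally show ?thesis .
qed

lemma evb_add: "integral_series r \<Longrightarrow> integral_series s \<Longrightarrow> evb (\<lambda>n. r n + s n) = evb r + evb s"
  using C.Ev_add[OF klinear_id integral_in_H integral_in_H, of r s] by (simp add: evb_def)

lemma conv_UNIV: "C.conv r s n = (\<Sum>i\<in>{..n}. r i * s (n - i))"
  unfolding C.conv_def by (simp add: sub_field_of_finsum[OF subring_of_UNIV])

lemma evb_mult:
  assumes r: "integral_series r" and s: "integral_series s"
  shows "evb (\<lambda>n. \<Sum>i\<in>{..n}. r i * s (n - i)) = evb r * evb s"
proof -
  have "evb (C.conv r s) = C.Ev (\<lambda>x. evb r * x) s"
    unfolding evb_def
    by (rule C.Ev_conv[OF klinear_id integral_in_H[OF s]])
      (use r evb_lim[OF r] in \<open>auto simp: integral_series_def evb_def\<close>)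
  also have "\<dots> = evb r * evb s"
  proof (rule C.Ev_eqI)
    have "C.has_vsum (\<lambda>n. evb r \<odot>\<^bsub>sub_field_of UNIV\<^esub> (mon b n \<odot>\<^bsub>sub_field_of UNIV\<^esub> s n)) (evb r \<odot>\<^bsub>sub_field_of UNIV\<^esub> evb s)"
      by (rule C.has_vsum_smult) (use C.has_vsum_Ev[OF klinear_id integral_in_H[OF s]] in \<open>auto simp: evb_def\<close>)
    then show "C.has_vsum (\<lambda>n. (evb r * mon b n) \<odot>\<^bsub>sub_field_of UNIV\<^esub> s n) (evb r * evb s)"
      by (simp add: mult.assoc)
    show "klinear UNIV UNIV ((*) (evb r))" by (simp add: klinear_def algebra_simps)
  qed simp
  finally show ?thesis unfolding conv_UNIV[abs_def] .
qed

end

section \<open>Finite free algebras over a ring of power series\<close>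

locale free_algebra = complete_subfield p ordp K
  for p and ordp :: "'c::{alg_closed_field, field_char_0} \<Rightarrow> ereal" and K :: "'c set" +
  fixes J :: "(('n::finite \<Rightarrow> nat) \<Rightarrow> 'c, 'j) module" and E :: "'j set"
  assumes alg: "Module.algebra (mps_ring (ring_of_integers ordp K)) J"
    and dom: "domain J" and finE: "finite E" and E_J: "E \<subseteq> carrier J"
    and rep: "\<And>x. x \<in> carrier J \<Longrightarrow>
      \<exists>!a. a \<in> E \<rightarrow>\<^sub>E carrier (mps_ring (ring_of_integers ordp K)) \<and> x = (\<Oplus>\<^bsub>J\<^esub>e\<in>E. a e \<odot>\<^bsub>J\<^esub> e)"
begin

abbreviation "OK \<equiv> ring_of_integers ordp K"
abbreviation "RR \<equiv> mps_ring OK :: (('n \<Rightarrow> nat) \<Rightarrow> 'c) ring"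

sublocale Jd: domain J by (rule dom)
sublocale Jm: module RR J using alg by (simp add: Module.algebra_def)

lemma smult_mult: "r \<in> carrier RR \<Longrightarrow> x \<in> carrier J \<Longrightarrow> y \<in> carrier J \<Longrightarrow> (r \<odot>\<^bsub>J\<^esub> x) \<otimes>\<^bsub>J\<^esub> y = r \<odot>\<^bsub>J\<^esub> (x \<otimes>\<^bsub>J\<^esub> y)"
  using algebra.smult_assoc2[OF alg] by blast

definition S :: "('n, 'c) mps set" where "S = {x. \<forall>n. mcoeff x n \<in> OK}"

lemma OK_iff: "a \<in> OK \<longleftrightarrow> a \<in> K \<and> 0 \<le> ordp a" by (simp add: ring_of_integers_def)

lemma OK_subring: "subring_of OK"
proof
  show "x + y \<in> OK" if "x \<in> OK" "y \<in> OK" for x y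
    using that add_mem ge_add[of 0 x y] by (simp add: OK_iff zero_ereal_def)
  show "x - y \<in> OK" if "x \<in> OK" "y \<in> OK" for x y
    using that diff_mem ge_diff[of 0 x y] by (simp add: OK_iff zero_ereal_def)
  show "x * y \<in> OK" if "x \<in> OK" "y \<in> OK" for x y
    using that mult_mem ge_mult[of 0 x 0 y] by (simp add: OK_iff zero_ereal_def)
qed (simp_all add: OK_iff)

sublocale O: subring_of OK by (rule OK_subring)

sublocale S: subring_of S
  by unfold_locales
    (auto simp: S_def mcoeff_mult intro: O.add_mem O.diff_mem O.mult_mem intro!: O.sum_mem)

lemma carrier_RR: "r \<in> carrier RR \<longleftrightarrow> Mps r \<in> S"
  by (auto simp: mps_ring_def S_def)

lemma mcoeff_RR: "x \<in> S \<Longrightarrow> mcoeff x \<in> carrier RR"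
  by (simp add: carrier_RR)

lemma mcoeff_ring_ops:
  "mcoeff (x + y) = mcoeff x \<oplus>\<^bsub>RR\<^esub> mcoeff y" "mcoeff (x * y) = mcoeff x \<otimes>\<^bsub>RR\<^esub> mcoeff y"
  "mcoeff 0 = \<zero>\<^bsub>RR\<^esub>" "mcoeff 1 = \<one>\<^bsub>RR\<^esub>"
  by (simp_all add: mps_ring_def fun_eq_iff mcoeff_mult)

abbreviation sm :: "('n, 'c) mps \<Rightarrow> 'j \<Rightarrow> 'j" where "sm x j \<equiv> mcoeff x \<odot>\<^bsub>J\<^esub> j"

lemma sm_closed: "x \<in> S \<Longrightarrow> j \<in> carrier J \<Longrightarrow> sm x j \<in> carrier J"
  by (simp add: mcoeff_RR)

lemma sm_add: "x \<in> S \<Longrightarrow> y \<in> S \<Longrightarrow> j \<in> carrier J \<Longrightarrow> sm (x + y) j = sm x j \<oplus>\<^bsub>J\<^esub> sm y j"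
  unfolding mcoeff_ring_ops by (simp add: mcoeff_RR Jm.smult_l_distr)

lemma sm_mult: "x \<in> S \<Longrightarrow> y \<in> S \<Longrightarrow> j \<in> carrier J \<Longrightarrow> sm (x * y) j = sm x (sm y j)"
  unfolding mcoeff_ring_ops by (simp add: mcoeff_RR Jm.smult_assoc1)

lemma sm_0: "j \<in> carrier J \<Longrightarrow> sm 0 j = \<zero>\<^bsub>J\<^esub>"
  unfolding mcoeff_ring_ops by (rule Jm.smult_l_null)

lemma sm_1: "j \<in> carrier J \<Longrightarrow> sm 1 j = j"
  unfolding mcoeff_ring_ops by (rule Jm.smult_one)

definition comb :: "('j \<Rightarrow> ('n, 'c) mps) \<Rightarrow> 'j" where
  "comb c = (\<Oplus>\<^bsub>J\<^esub>e\<in>E. sm (c e) e)"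

definition cd :: "'j \<Rightarrow> 'j \<Rightarrow> ('n, 'c) mps" where
  "cd x e = Mps ((THE a. a \<in> E \<rightarrow>\<^sub>E carrier RR \<and> x = (\<Oplus>\<^bsub>J\<^esub>e\<in>E. a e \<odot>\<^bsub>J\<^esub> e)) e)"

lemma comb_closed: "(\<And>e. e \<in> E \<Longrightarrow> c e \<in> S) \<Longrightarrow> comb c \<in> carrier J"
  unfolding comb_def using E_J sm_closed by (intro Jd.finsum_closed) auto

lemma cd_props:
  assumes x: "x \<in> carrier J"
  shows "e \<in> E \<Longrightarrow> cd x e \<in> S" and "x = comb (cd x)"
proof -
  let ?P = "\<lambda>a. a \<in> E \<rightarrow>\<^sub>E carrier RR \<and> x = (\<Oplus>\<^bsub>J\<^esub>e\<in>E. a e \<odot>\<^bsub>J\<^esub> e)"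
  have P: "?P (THE a. ?P a)" by (rule theI'[OF rep[OF x]])
  then show "e \<in> E \<Longrightarrow> cd x e \<in> S" unfolding cd_def carrier_RR[symmetric] by (blast dest: PiE_mem)
  show "x = comb (cd x)" unfolding comb_def cd_def mcoeff_Mps using P by (rule conjunct2)
qed

lemma cd_unique:
  assumes c: "\<And>e. e \<in> E \<Longrightarrow> c e \<in> S" and e: "e \<in> E"
  shows "cd (comb c) e = c e"
proof -
  let ?x = "comb c"
  let ?P = "\<lambda>a. a \<in> E \<rightarrow>\<^sub>E carrier RR \<and> ?x = (\<Oplus>\<^bsub>J\<^esub>e\<in>E. a e \<odot>\<^bsub>J\<^esub> e)"
  let ?a = "\<lambda>e\<in>E. mcoeff (c e)"
  have x: "?x \<in> carrier J" by (rule comb_closed[OF c])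
  have "?P ?a"
  proof
    show "?a \<in> E \<rightarrow>\<^sub>E carrier RR" using c mcoeff_RR by auto
    show "?x = (\<Oplus>\<^bsub>J\<^esub>e\<in>E. ?a e \<odot>\<^bsub>J\<^esub> e)"
      unfolding comb_def by (rule Jd.finsum_cong') (use c sm_closed E_J in auto)
  qed
  then have "(THE a. ?P a) = ?a" by (rule the1_equality[OF rep[OF x]])
  then show ?thesis using e by (simp add: cd_def)
qed

lemma cd_eqI:
  assumes "x = comb c" "\<And>e. e \<in> E \<Longrightarrow> c e \<in> S" "e \<in> E"
  shows "cd x e = c e"
  unfolding assms(1) by (rule cd_unique) fact+

lemma cd_inject: "x \<in> carrier J \<Longrightarrow> y \<in> carrier J \<Longrightarrow> (\<And>e. e \<in> E \<Longrightarrow> cd x e = cd y e) \<Longrightarrow> x = y"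
proof -
  assume x: "x \<in> carrier J" and y: "y \<in> carrier J" and e: "\<And>e. e \<in> E \<Longrightarrow> cd x e = cd y e"
  have "comb (cd x) = comb (cd y)"
    unfolding comb_def by (rule Jd.finsum_cong') (use e cd_props[OF y] sm_closed E_J in auto)
  then show ?thesis using cd_props(2)[OF x] cd_props(2)[OF y] by simp
qed

lemma cd_add:
  assumes "x \<in> carrier J" "y \<in> carrier J" "e \<in> E"
  shows "cd (x \<oplus>\<^bsub>J\<^esub> y) e = cd x e + cd y e"
proof (rule cd_eqI[OF _ _ assms(3)])
  have "comb (\<lambda>e. cd x e + cd y e) = (\<Oplus>\<^bsub>J\<^esub>e\<in>E. sm (cd x e) e \<oplus>\<^bsub>J\<^esub> sm (cd y e) e)"
    unfolding comb_def
    by (rule Jd.finsum_cong') (use cd_props assms sm_closed sm_add E_J in auto)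
  also have "\<dots> = comb (cd x) \<oplus>\<^bsub>J\<^esub> comb (cd y)"
    unfolding comb_def by (rule Jd.finsum_addf) (use cd_props assms sm_closed E_J in auto)
  also have "\<dots> = x \<oplus>\<^bsub>J\<^esub> y" using cd_props(2) assms by metis
  finally show "x \<oplus>\<^bsub>J\<^esub> y = comb (\<lambda>e. cd x e + cd y e)" by (rule sym)
qed (use cd_props assms S.add_mem in auto)

lemma cd_sm:
  assumes "r \<in> S" "x \<in> carrier J" "e \<in> E"
  shows "cd (sm r x) e = r * cd x e"
proof (rule cd_eqI[OF _ _ assms(3)])
  have "comb (\<lambda>e. r * cd x e) = (\<Oplus>\<^bsub>J\<^esub>e\<in>E. sm r (sm (cd x e) e))"
    unfolding comb_def
    by (rule Jd.finsum_cong') (use cd_props assms sm_closed sm_mult E_J in auto)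
  also have "\<dots> = sm r (comb (cd x))"
    unfolding comb_def
    by (rule Jm.finsum_smult_ldistr[symmetric]) (use cd_props assms sm_closed mcoeff_RR finE E_J in auto)
  also have "\<dots> = sm r x" using cd_props(2)[OF assms(2)] by simp
  finally show "sm r x = comb (\<lambda>e. r * cd x e)" by (rule sym)
qed (use cd_props assms S.mult_mem in auto)

lemma cd_zero: "e \<in> E \<Longrightarrow> cd \<zero>\<^bsub>J\<^esub> e = 0"
proof -
  assume "e \<in> E"
  then have "cd (\<zero>\<^bsub>J\<^esub> \<oplus>\<^bsub>J\<^esub> \<zero>\<^bsub>J\<^esub>) e = cd \<zero>\<^bsub>J\<^esub> e + cd \<zero>\<^bsub>J\<^esub> e" by (intro cd_add) auto
  then have "cd \<zero>\<^bsub>J\<^esub> e + 0 = cd \<zero>\<^bsub>J\<^esub> e + cd \<zero>\<^bsub>J\<^esub> e" by (simp only: Jd.l_zero Jd.zero_closed add_0_right)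
  then show ?thesis by (simp only: add_left_cancel)
qed

lemma cd_finsum:
  assumes "\<And>i. i \<in> I \<Longrightarrow> f i \<in> carrier J" "e \<in> E"
  shows "cd (\<Oplus>\<^bsub>J\<^esub>i\<in>I. f i) e = (\<Sum>i\<in>I. cd (f i) e)"
  using assms(1)
proof (induction I rule: infinite_finite_induct)
  case (insert i I)
  have "(\<Oplus>\<^bsub>J\<^esub>i\<in>insert i I. f i) = f i \<oplus>\<^bsub>J\<^esub> (\<Oplus>\<^bsub>J\<^esub>i\<in>I. f i)"
    using insert by (intro Jd.finsum_insert) auto
  moreover have "(\<Oplus>\<^bsub>J\<^esub>i\<in>I. f i) \<in> carrier J" using insert.prems by (intro Jd.finsum_closed) auto
  ultimately show ?case using insert cd_add[OF _ _ assms(2)] by simp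
qed (simp_all add: cd_zero[OF assms(2)])

lemma cd_basis:
  assumes "e \<in> E" "f \<in> E"
  shows "cd f e = (if e = f then 1 else 0)"
proof (rule cd_eqI[OF _ _ assms(1), of _ "\<lambda>e. if e = f then 1 else 0"])
  have "comb (\<lambda>e. if e = f then 1 else 0) = (\<Oplus>\<^bsub>J\<^esub>e\<in>E. if f = e then e else \<zero>\<^bsub>J\<^esub>)"
    unfolding comb_def by (rule Jd.finsum_cong') (use sm_0 sm_1 E_J in auto)
  also have "\<dots> = f" by (rule Jd.finsum_singleton) (use assms finE E_J in auto)
  finally show "f = comb (\<lambda>e. if e = f then 1 else 0)" by (rule sym)
qed auto

lemma cd_mult:
  assumes x: "x \<in> carrier J" and y: "y \<in> carrier J" and e: "e \<in> E"
  shows "cd (x \<otimes>\<^bsub>J\<^esub> y) e = (\<Sum>g\<in>E. cd x g * cd (g \<otimes>\<^bsub>J\<^esub> y) e)"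
proof -
  have EJ: "\<And>g. g \<in> E \<Longrightarrow> g \<in> carrier J" using E_J by blast
  have "x \<otimes>\<^bsub>J\<^esub> y = comb (cd x) \<otimes>\<^bsub>J\<^esub> y" using cd_props(2)[OF x] by simp
  also have "\<dots> = (\<Oplus>\<^bsub>J\<^esub>g\<in>E. sm (cd x g) g \<otimes>\<^bsub>J\<^esub> y)"
    unfolding comb_def by (rule Jd.finsum_ldistr) (use finE y cd_props[OF x] sm_closed EJ in auto)
  also have "\<dots> = (\<Oplus>\<^bsub>J\<^esub>g\<in>E. sm (cd x g) (g \<otimes>\<^bsub>J\<^esub> y))"
    by (rule Jd.finsum_cong')
      (use y cd_props[OF x] sm_closed EJ smult_mult mcoeff_RR in auto)
  finally have "cd (x \<otimes>\<^bsub>J\<^esub> y) e = (\<Sum>g\<in>E. cd (sm (cd x g) (g \<otimes>\<^bsub>J\<^esub> y)) e)"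
    using cd_finsum[of E "\<lambda>g. sm (cd x g) (g \<otimes>\<^bsub>J\<^esub> y)" e] e cd_props[OF x] sm_closed EJ y by simp
  also have "\<dots> = (\<Sum>g\<in>E. cd x g * cd (g \<otimes>\<^bsub>J\<^esub> y) e)"
    by (rule sum.cong) (use cd_sm cd_props[OF x] EJ y e in auto)
  finally show ?thesis .
qed

definition tr :: "'j \<Rightarrow> ('n, 'c) mps" where "tr x = (\<Sum>e\<in>E. cd (x \<otimes>\<^bsub>J\<^esub> e) e)"

lemma tr_S: "x \<in> carrier J \<Longrightarrow> tr x \<in> S"
  unfolding tr_def using E_J cd_props(1) by (intro S.sum_mem) auto

lemma tr_add: "x \<in> carrier J \<Longrightarrow> y \<in> carrier J \<Longrightarrow> tr (x \<oplus>\<^bsub>J\<^esub> y) = tr x + tr y"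
proof -
  assume "x \<in> carrier J" "y \<in> carrier J"
  then have "tr (x \<oplus>\<^bsub>J\<^esub> y) = (\<Sum>e\<in>E. cd (x \<otimes>\<^bsub>J\<^esub> e) e + cd (y \<otimes>\<^bsub>J\<^esub> e) e)"
    unfolding tr_def using E_J by (intro sum.cong) (auto simp: Jd.l_distr cd_add subset_iff)
  then show ?thesis by (simp add: tr_def sum.distrib)
qed

lemma tr_sm: "r \<in> S \<Longrightarrow> x \<in> carrier J \<Longrightarrow> tr (sm r x) = r * tr x"
  unfolding tr_def sum_distrib_left using E_J
  by (intro sum.cong) (auto simp: smult_mult mcoeff_RR cd_sm subset_iff)

lemma tr_one: "tr \<one>\<^bsub>J\<^esub> = of_nat (card E)"
  unfolding tr_def using E_J by (simp add: subset_iff cd_basis)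

lemma tr_zero: "tr \<zero>\<^bsub>J\<^esub> = 0"
proof -
  have "tr (\<zero>\<^bsub>J\<^esub> \<oplus>\<^bsub>J\<^esub> \<zero>\<^bsub>J\<^esub>) = tr \<zero>\<^bsub>J\<^esub> + tr \<zero>\<^bsub>J\<^esub>" by (intro tr_add) auto
  then have "tr \<zero>\<^bsub>J\<^esub> + 0 = tr \<zero>\<^bsub>J\<^esub> + tr \<zero>\<^bsub>J\<^esub>" by (simp only: Jd.l_zero Jd.zero_closed add_0_right)
  then show ?thesis by (simp only: add_left_cancel)
qed

lemma tr_finsum:
  assumes "\<And>i. i \<in> I \<Longrightarrow> f i \<in> carrier J"
  shows "tr (\<Oplus>\<^bsub>J\<^esub>i\<in>I. f i) = (\<Sum>i\<in>I. tr (f i))"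
  using assms
proof (induction I rule: infinite_finite_induct)
  case (insert i I)
  have "(\<Oplus>\<^bsub>J\<^esub>i\<in>insert i I. f i) = f i \<oplus>\<^bsub>J\<^esub> (\<Oplus>\<^bsub>J\<^esub>i\<in>I. f i)"
    using insert by (intro Jd.finsum_insert) auto
  moreover have "(\<Oplus>\<^bsub>J\<^esub>i\<in>I. f i) \<in> carrier J" using insert.prems by (intro Jd.finsum_closed) auto
  ultimately show ?case using insert tr_add by simp
qed (simp_all add: tr_zero)

lemma mps_of_nat: "mcoeff (of_nat k :: ('n, 'c) mps) (\<lambda>_. 0) = of_nat k"
  by (induction k) auto

lemma E_nonempty: "card E \<noteq> 0"
proof
  assume "card E = 0"
  then have "E = {}" using finE by simp
  then have "\<one>\<^bsub>J\<^esub> = \<zero>\<^bsub>J\<^esub>" by (intro cd_inject) auto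
  then show False by simp
qed

lemma mult_cancel_zero:
  assumes x: "x \<in> carrier J" "x \<noteq> \<zero>\<^bsub>J\<^esub>" and c: "\<And>e. e \<in> E \<Longrightarrow> c e \<in> S"
    and z: "\<And>f. f \<in> E \<Longrightarrow> (\<Sum>e\<in>E. c e * cd (x \<otimes>\<^bsub>J\<^esub> e) f) = 0"
  shows "\<forall>e\<in>E. c e = 0"
proof
  fix e assume e: "e \<in> E"
  have y: "comb c \<in> carrier J" by (rule comb_closed[OF c])
  have "cd (comb c \<otimes>\<^bsub>J\<^esub> x) f = 0" if f: "f \<in> E" for f
  proof -
    have "cd (comb c \<otimes>\<^bsub>J\<^esub> x) f = (\<Sum>g\<in>E. c g * cd (x \<otimes>\<^bsub>J\<^esub> g) f)"
      unfolding cd_mult[OF y x(1) f]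
      using E_J x(1) by (intro sum.cong) (auto simp: cd_unique[where c = c, OF c] Jd.m_comm subset_iff)
    then show ?thesis using z[OF f] by simp
  qed
  then have "comb c \<otimes>\<^bsub>J\<^esub> x = \<zero>\<^bsub>J\<^esub>" by (intro cd_inject) (use x y cd_zero in auto)
  then have "comb c = \<zero>\<^bsub>J\<^esub>" using x y Jd.integral by blast
  then show "c e = 0" using cd_unique[where c = c, OF c e] cd_zero[OF e] by simp
qed

text \<open>
  The element \<open>1\<close> and the products of \<open>x\<close> with the basis are \<open>card E + 1\<close> elements of a module of
  rank \<open>card E\<close>. A relation between them must involve \<open>1\<close>, as \<open>x\<close> is not a zero divisor.
\<close>

lemma divides_scalar:
  assumes x: "x \<in> carrier J" "x \<noteq> \<zero>\<^bsub>J\<^esub>"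
  obtains y r where "y \<in> carrier J" "r \<in> S" "r \<noteq> 0" "x \<otimes>\<^bsub>J\<^esub> y = sm r \<one>\<^bsub>J\<^esub>"
proof -
  let ?I = "insert None (Some ` E)"
  define a where "a i f = (case i of None \<Rightarrow> cd \<one>\<^bsub>J\<^esub> f | Some e \<Rightarrow> cd (x \<otimes>\<^bsub>J\<^esub> e) f)" for i f
  have inj: "inj_on Some E" by simp
  have "\<exists>c. (\<forall>i\<in>?I. c i \<in> S) \<and> (\<exists>i\<in>?I. c i \<noteq> 0) \<and> (\<forall>f\<in>E. (\<Sum>i\<in>?I. c i * a i f) = 0)"
  proof (rule S.nontrivial_relation[OF finE])
    show "card E < card ?I" using finE by (subst card_insert_disjoint) (auto simp: card_image)
    show "a i f \<in> S" if "i \<in> ?I" "f \<in> E" for i f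
      using that x(1) cd_props(1) E_J by (auto simp: a_def)
  qed (use finE in auto)
  then obtain c where c: "\<forall>i\<in>?I. c i \<in> S" "\<exists>i\<in>?I. c i \<noteq> 0" "\<forall>f\<in>E. (\<Sum>i\<in>?I. c i * a i f) = 0" by blast
  define d where "d e = c (Some e)" for e
  have dS: "d e \<in> S" if "e \<in> E" for e using c(1) that by (auto simp: d_def)
  have rel: "c None * cd \<one>\<^bsub>J\<^esub> f + (\<Sum>e\<in>E. d e * cd (x \<otimes>\<^bsub>J\<^esub> e) f) = 0" if f: "f \<in> E" for f
  proof -
    have "(\<Sum>i\<in>?I. c i * a i f) = c None * a None f + (\<Sum>i\<in>Some ` E. c i * a i f)"
      using finE by (intro sum.insert) auto
    also have "(\<Sum>i\<in>Some ` E. c i * a i f) = (\<Sum>e\<in>E. d e * cd (x \<otimes>\<^bsub>J\<^esub> e) f)"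
      by (subst sum.reindex[OF inj]) (simp add: a_def d_def)
    finally show ?thesis using c(3) f by (simp add: a_def)
  qed
  have c0: "c None \<noteq> 0"
  proof
    assume z: "c None = 0"
    have "\<forall>e\<in>E. d e = 0" by (rule mult_cancel_zero[OF x dS]) (use rel z in auto)
    then show False using c(2) z by (auto simp: d_def)
  qed
  show thesis
  proof (rule that[of "comb d" "- c None"])
    show y: "comb d \<in> carrier J" by (rule comb_closed[OF dS])
    show r: "- c None \<in> S" using c(1) by (intro S.uminus_mem) simp
    show "- c None \<noteq> 0" using c0 by simp
    show "x \<otimes>\<^bsub>J\<^esub> comb d = sm (- c None) \<one>\<^bsub>J\<^esub>"
    proof (rule cd_inject)
      fix f assume f: "f \<in> E"
      have "cd (x \<otimes>\<^bsub>J\<^esub> comb d) f = cd (comb d \<otimes>\<^bsub>J\<^esub> x) f" using x y by (simp add: Jd.m_comm)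
      also have "\<dots> = (\<Sum>g\<in>E. d g * cd (x \<otimes>\<^bsub>J\<^esub> g) f)"
        unfolding cd_mult[OF y x(1) f]
        using E_J x(1) by (intro sum.cong) (auto simp: cd_unique[where c = d, OF dS] Jd.m_comm subset_iff)
      also have "\<dots> = - c None * cd \<one>\<^bsub>J\<^esub> f" using rel[OF f] by (simp add: eq_neg_iff_add_eq_0 add.commute)
      also have "\<dots> = cd (sm (- c None) \<one>\<^bsub>J\<^esub>) f" using cd_sm[OF r _ f, of "\<one>\<^bsub>J\<^esub>"] by simp
      finally show "cd (x \<otimes>\<^bsub>J\<^esub> comb d) f = cd (sm (- c None) \<one>\<^bsub>J\<^esub>) f" .
    qed (use x y r sm_closed in auto)
  qed
qed

text \<open>
  Some multiple of \<open>x\<close> is a nonzero scalar \<open>r\<close>, and its trace \<open>card E * r\<close> is nonzero in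
  characteristic zero.
\<close>

lemma trace_nondegenerate:
  assumes x: "x \<in> carrier J" "\<And>y. y \<in> carrier J \<Longrightarrow> tr (x \<otimes>\<^bsub>J\<^esub> y) = 0"
  shows "x = \<zero>\<^bsub>J\<^esub>"
proof (rule ccontr)
  assume "x \<noteq> \<zero>\<^bsub>J\<^esub>"
  then obtain y r where yr: "y \<in> carrier J" "r \<in> S" "r \<noteq> 0" "x \<otimes>\<^bsub>J\<^esub> y = sm r \<one>\<^bsub>J\<^esub>"
    using divides_scalar[OF x(1)] by metis
  have "r * of_nat (card E) = 0" using x(2)[OF yr(1)] yr(2,4) by (simp add: tr_sm tr_one)
  then have "of_nat (card E) = (0 :: ('n, 'c) mps)" using yr(3) by simp
  then have "of_nat (card E) = (0 :: 'c)" using mps_of_nat[of "card E"] by simp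
  then show False using E_nonempty by simp
qed

text \<open>
  By nondegeneracy the rows of the Gram matrix of the trace form are independent, so \<open>dual_family\<close>
  inverts it up to the factor \<open>\<delta>\<close>.
\<close>

theorem trace_dual_basis:
  obtains y \<delta> where "\<delta> \<in> S" "\<delta> \<noteq> 0" "\<And>k. k \<in> E \<Longrightarrow> y k \<in> carrier J"
    "\<And>e k. e \<in> E \<Longrightarrow> k \<in> E \<Longrightarrow> tr (e \<otimes>\<^bsub>J\<^esub> y k) = (if e = k then \<delta> else 0)"
proof -
  have EJ: "\<And>g. g \<in> E \<Longrightarrow> g \<in> carrier J" using E_J by blast
  have lin: "tr (x \<otimes>\<^bsub>J\<^esub> comb c) = (\<Sum>e\<in>E. c e * tr (x \<otimes>\<^bsub>J\<^esub> e))"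
    if x: "x \<in> carrier J" and c: "\<And>e. e \<in> E \<Longrightarrow> c e \<in> S" for x c
  proof -
    have "x \<otimes>\<^bsub>J\<^esub> comb c = (\<Oplus>\<^bsub>J\<^esub>e\<in>E. x \<otimes>\<^bsub>J\<^esub> sm (c e) e)"
      unfolding comb_def by (rule Jd.finsum_rdistr) (use finE x c sm_closed EJ in auto)
    then have "tr (x \<otimes>\<^bsub>J\<^esub> comb c) = (\<Sum>e\<in>E. tr (x \<otimes>\<^bsub>J\<^esub> sm (c e) e))"
      using tr_finsum[of E "\<lambda>e. x \<otimes>\<^bsub>J\<^esub> sm (c e) e"] x c sm_closed EJ by simp
    also have "\<dots> = (\<Sum>e\<in>E. c e * tr (x \<otimes>\<^bsub>J\<^esub> e))"
    proof (rule sum.cong)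
      fix e assume e: "e \<in> E"
      have "x \<otimes>\<^bsub>J\<^esub> sm (c e) e = sm (c e) (x \<otimes>\<^bsub>J\<^esub> e)"
        using x c[OF e] EJ[OF e] sm_closed smult_mult[of "mcoeff (c e)" e x] mcoeff_RR
        by (simp add: Jd.m_comm)
      then show "tr (x \<otimes>\<^bsub>J\<^esub> sm (c e) e) = c e * tr (x \<otimes>\<^bsub>J\<^esub> e)"
        using x c[OF e] EJ[OF e] by (simp add: tr_sm)
    qed simp
    finally show ?thesis .
  qed
  have "\<exists>b \<delta>. \<delta> \<in> S \<and> \<delta> \<noteq> 0 \<and> (\<forall>i\<in>E. \<forall>e\<in>E. b i e \<in> S) \<and>
    (\<forall>i\<in>E. \<forall>k\<in>E. (\<Sum>e\<in>E. tr (i \<otimes>\<^bsub>J\<^esub> e) * b k e) = (if i = k then \<delta> else 0))"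
  proof (rule S.dual_family[OF finE finE])
    show "tr (i \<otimes>\<^bsub>J\<^esub> e) \<in> S" if "i \<in> E" "e \<in> E" for i e using that EJ by (intro tr_S) auto
    fix c assume c: "\<And>i. i \<in> E \<Longrightarrow> c i \<in> S" "\<And>e. e \<in> E \<Longrightarrow> (\<Sum>i\<in>E. c i * tr (i \<otimes>\<^bsub>J\<^esub> e)) = 0"
    have cJ: "comb c \<in> carrier J" by (rule comb_closed[OF c(1)])
    have "tr (comb c \<otimes>\<^bsub>J\<^esub> y) = 0" if y: "y \<in> carrier J" for y
    proof -
      have "tr (comb c \<otimes>\<^bsub>J\<^esub> y) = tr (comb c \<otimes>\<^bsub>J\<^esub> comb (cd y))" using cd_props(2)[OF y] by simp
      also have "\<dots> = (\<Sum>e\<in>E. cd y e * tr (comb c \<otimes>\<^bsub>J\<^esub> e))" by (rule lin[OF cJ cd_props(1)[OF y]])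
      also have "\<dots> = (\<Sum>e\<in>E. cd y e * (\<Sum>i\<in>E. c i * tr (i \<otimes>\<^bsub>J\<^esub> e)))"
      proof (rule sum.cong)
        fix e assume e: "e \<in> E"
        have "tr (comb c \<otimes>\<^bsub>J\<^esub> e) = tr (e \<otimes>\<^bsub>J\<^esub> comb c)" using cJ EJ[OF e] by (simp add: Jd.m_comm)
        also have "\<dots> = (\<Sum>i\<in>E. c i * tr (e \<otimes>\<^bsub>J\<^esub> i))" by (rule lin[OF EJ[OF e] c(1)])
        also have "\<dots> = (\<Sum>i\<in>E. c i * tr (i \<otimes>\<^bsub>J\<^esub> e))"
          by (rule sum.cong) (use EJ e in \<open>auto simp: Jd.m_comm\<close>)
        finally show "cd y e * tr (comb c \<otimes>\<^bsub>J\<^esub> e) = cd y e * (\<Sum>i\<in>E. c i * tr (i \<otimes>\<^bsub>J\<^esub> e))" by simp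
      qed simp
      also have "\<dots> = 0" using c(2) by simp
      finally show ?thesis .
    qed
    from trace_nondegenerate[OF cJ this] have "comb c = \<zero>\<^bsub>J\<^esub>" .
    then show "\<forall>i\<in>E. c i = 0" using cd_unique[where c = c, OF c(1)] cd_zero by simp
  qed
  then obtain b \<delta> where b: "\<delta> \<in> S" "\<delta> \<noteq> 0" "\<forall>i\<in>E. \<forall>e\<in>E. b i e \<in> S"
    "\<forall>i\<in>E. \<forall>k\<in>E. (\<Sum>e\<in>E. tr (i \<otimes>\<^bsub>J\<^esub> e) * b k e) = (if i = k then \<delta> else 0)" by blast
  show thesis
  proof (rule that[of \<delta> "\<lambda>k. comb (b k)"])
    show "comb (b k) \<in> carrier J" if "k \<in> E" for k using b(3) that by (intro comb_closed) auto
    show "tr (e \<otimes>\<^bsub>J\<^esub> comb (b k)) = (if e = k then \<delta> else 0)" if "e \<in> E" "k \<in> E" for e k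
      using lin[OF EJ[OF that(1)], of "b k"] b(3,4) that by (simp add: mult.commute)
  qed (use b in auto)
qed

end

section \<open>Characters over a point\<close>

locale algebra_point = free_algebra p ordp K J E + valued_point p ordp b \<beta>
  for p and ordp :: "'c::{alg_closed_field, field_char_0} \<Rightarrow> ereal" and K :: "'c set"
    and J :: "(('n::finite \<Rightarrow> nat) \<Rightarrow> 'c, 'j) module" and E :: "'j set" and b :: "'n \<Rightarrow> 'c" and \<beta> :: real
begin

definition evm :: "('n, 'c) mps \<Rightarrow> 'c" where "evm x = evb (mcoeff x)"

lemma S_integral: "x \<in> S \<Longrightarrow> integral_series (mcoeff x)"
  by (auto simp: S_def integral_series_def OK_iff)

lemma evm_add: "x \<in> S \<Longrightarrow> y \<in> S \<Longrightarrow> evm (x + y) = evm x + evm y"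
  using evb_add[OF S_integral S_integral, of x y] by (simp add: evm_def plus_mps_def)

lemma evm_mult: "x \<in> S \<Longrightarrow> y \<in> S \<Longrightarrow> evm (x * y) = evm x * evm y"
  using evb_mult[OF S_integral S_integral, of x y] by (simp add: evm_def times_mps_def)

lemma evm_1: "evm 1 = 1"
  using evb_const[of 1] by (simp add: evm_def one_mps_def mps_const_def[abs_def])

lemma evm_0: "evm 0 = 0"
  using evb_const[of 0] by (simp add: evm_def zero_mps_def mps_const_def[abs_def])

lemma evm_sum: "(\<And>i. i \<in> I \<Longrightarrow> f i \<in> S) \<Longrightarrow> evm (\<Sum>i\<in>I. f i) = (\<Sum>i\<in>I. evm (f i))"
proof (induction I rule: infinite_finite_induct)
  case (insert i I)
  then have "(\<Sum>i\<in>I. f i) \<in> S" by (intro S.sum_mem) auto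
  then show ?case using insert by (simp add: evm_add)
qed (simp_all add: evm_0)

lemma EJ: "e \<in> E \<Longrightarrow> e \<in> carrier J" using E_J by blast

lemma evm_cd_mult:
  assumes "x \<in> carrier J" "y \<in> carrier J" "f \<in> E"
  shows "evm (cd (x \<otimes>\<^bsub>J\<^esub> y) f) = (\<Sum>g\<in>E. evm (cd x g) * evm (cd (g \<otimes>\<^bsub>J\<^esub> y) f))"
proof -
  have "evm (cd (x \<otimes>\<^bsub>J\<^esub> y) f) = (\<Sum>g\<in>E. evm (cd x g * cd (g \<otimes>\<^bsub>J\<^esub> y) f))"
    unfolding cd_mult[OF assms] by (rule evm_sum) (use assms cd_props(1) EJ S.mult_mem in auto)
  also have "\<dots> = (\<Sum>g\<in>E. evm (cd x g) * evm (cd (g \<otimes>\<^bsub>J\<^esub> y) f))"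
    by (rule sum.cong) (use assms cd_props(1) EJ evm_mult in auto)
  finally show ?thesis .
qed

sublocale SC: structure_constants E "\<lambda>e1 e2 f. evm (cd (e1 \<otimes>\<^bsub>J\<^esub> e2) f)" "\<lambda>g. evm (cd \<one>\<^bsub>J\<^esub> g)"
proof
  show "finite E" by (rule finE)
  show "evm (cd (e1 \<otimes>\<^bsub>J\<^esub> e2) f) = evm (cd (e2 \<otimes>\<^bsub>J\<^esub> e1) f)" if "e1 \<in> E" "e2 \<in> E" for e1 e2 f
    using that EJ by (simp add: Jd.m_comm)
  show "(\<Sum>g\<in>E. evm (cd (e2 \<otimes>\<^bsub>J\<^esub> e3) g) * evm (cd (e1 \<otimes>\<^bsub>J\<^esub> g) f)) =
      (\<Sum>g\<in>E. evm (cd (e1 \<otimes>\<^bsub>J\<^esub> e2) g) * evm (cd (g \<otimes>\<^bsub>J\<^esub> e3) f))"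
    if e: "e1 \<in> E" "e2 \<in> E" "e3 \<in> E" "f \<in> E" for e1 e2 e3 f
  proof -
    have "(\<Sum>g\<in>E. evm (cd (e2 \<otimes>\<^bsub>J\<^esub> e3) g) * evm (cd (e1 \<otimes>\<^bsub>J\<^esub> g) f)) =
        (\<Sum>g\<in>E. evm (cd (e2 \<otimes>\<^bsub>J\<^esub> e3) g) * evm (cd (g \<otimes>\<^bsub>J\<^esub> e1) f))"
      using e EJ by (intro sum.cong) (auto simp: Jd.m_comm)
    also have "\<dots> = evm (cd ((e2 \<otimes>\<^bsub>J\<^esub> e3) \<otimes>\<^bsub>J\<^esub> e1) f)"
      by (rule evm_cd_mult[symmetric]) (use e EJ in auto)
    also have "(e2 \<otimes>\<^bsub>J\<^esub> e3) \<otimes>\<^bsub>J\<^esub> e1 = (e1 \<otimes>\<^bsub>J\<^esub> e2) \<otimes>\<^bsub>J\<^esub> e3"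
      using e EJ by (simp add: Jd.m_ac)
    also have "evm (cd ((e1 \<otimes>\<^bsub>J\<^esub> e2) \<otimes>\<^bsub>J\<^esub> e3) f) =
        (\<Sum>g\<in>E. evm (cd (e1 \<otimes>\<^bsub>J\<^esub> e2) g) * evm (cd (g \<otimes>\<^bsub>J\<^esub> e3) f))"
      by (rule evm_cd_mult) (use e EJ in auto)
    finally show ?thesis .
  qed
  show "(\<Sum>g\<in>E. evm (cd \<one>\<^bsub>J\<^esub> g) * evm (cd (g \<otimes>\<^bsub>J\<^esub> e) f)) = (if e = f then 1 else 0)"
    if e: "e \<in> E" "f \<in> E" for e f
  proof -
    have "(\<Sum>g\<in>E. evm (cd \<one>\<^bsub>J\<^esub> g) * evm (cd (g \<otimes>\<^bsub>J\<^esub> e) f)) = evm (cd (\<one>\<^bsub>J\<^esub> \<otimes>\<^bsub>J\<^esub> e) f)"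
      by (rule evm_cd_mult[symmetric]) (use e EJ in auto)
    then show ?thesis using e EJ by (simp add: cd_basis evm_0 evm_1)
  qed
qed

text \<open>
  The ring homomorphisms from \<open>J\<close> that extend the evaluation of power series at \<open>b\<close>.
\<close>

definition is_char :: "('j \<Rightarrow> 'c) \<Rightarrow> bool" where
  "is_char \<kappa> \<longleftrightarrow> (\<forall>x\<in>carrier J. \<forall>y\<in>carrier J. \<kappa> (x \<oplus>\<^bsub>J\<^esub> y) = \<kappa> x + \<kappa> y \<and> \<kappa> (x \<otimes>\<^bsub>J\<^esub> y) = \<kappa> x * \<kappa> y) \<and>
     \<kappa> \<one>\<^bsub>J\<^esub> = 1 \<and> (\<forall>r\<in>S. \<forall>x\<in>carrier J. \<kappa> (sm r x) = evm r * \<kappa> x)"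

text \<open>
  Evaluating the multiplication table of \<open>J\<close> at \<open>b\<close> gives the fibre of \<open>J\<close> over \<open>b\<close>, whose
  characters are the homomorphisms from \<open>J\<close> lying over \<open>b\<close>.
\<close>

theorem trace_eq_sum_of_chars:
  obtains m :: nat and \<kappa> where "\<And>i. i < m \<Longrightarrow> is_char (\<kappa> i)"
    "\<And>x. x \<in> carrier J \<Longrightarrow> evm (tr x) = (\<Sum>i<m. \<kappa> i x)"
proof -
  let ?\<gamma> = "\<lambda>e1 e2 f. evm (cd (e1 \<otimes>\<^bsub>J\<^esub> e2) f)"
  obtain m :: nat and \<chi> where
    mult: "\<And>i e1 e2. i < m \<Longrightarrow> e1 \<in> E \<Longrightarrow> e2 \<in> E \<Longrightarrow> \<chi> i e1 * \<chi> i e2 = (\<Sum>g\<in>E. ?\<gamma> e1 e2 g * \<chi> i g)"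
    and one: "\<And>i. i < m \<Longrightarrow> (\<Sum>g\<in>E. evm (cd \<one>\<^bsub>J\<^esub> g) * \<chi> i g) = 1"
    and trace: "\<And>e. e \<in> E \<Longrightarrow> (\<Sum>f\<in>E. ?\<gamma> e f f) = (\<Sum>i<m. \<chi> i e)"
    by (rule SC.trace_eq_sum_characters) (rule that)
  define \<kappa> where "\<kappa> i x = (\<Sum>g\<in>E. evm (cd x g) * \<chi> i g)" for i x
  have "is_char (\<kappa> i)" if i: "i < m" for i
    unfolding is_char_def
  proof (intro conjI ballI)
    fix x y assume x: "x \<in> carrier J" and y: "y \<in> carrier J"
    show "\<kappa> i (x \<oplus>\<^bsub>J\<^esub> y) = \<kappa> i x + \<kappa> i y"
      unfolding \<kappa>_def sum.distrib[symmetric]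
      by (rule sum.cong) (use x y cd_props(1) in \<open>auto simp: cd_add evm_add distrib_right\<close>)
    have g: "evm (cd (g \<otimes>\<^bsub>J\<^esub> y) f) = (\<Sum>h\<in>E. evm (cd y h) * ?\<gamma> g h f)" if "g \<in> E" "f \<in> E" for g f
      using evm_cd_mult[OF y EJ[OF that(1)] that(2)] that y EJ
      by (simp add: Jd.m_comm cong: sum.cong)
    have "\<kappa> i (x \<otimes>\<^bsub>J\<^esub> y) = (\<Sum>f\<in>E. (\<Sum>g\<in>E. evm (cd x g) * (\<Sum>h\<in>E. evm (cd y h) * ?\<gamma> g h f)) * \<chi> i f)"
      unfolding \<kappa>_def
    proof (rule sum.cong)
      fix f assume f: "f \<in> E"
      have "evm (cd (x \<otimes>\<^bsub>J\<^esub> y) f) = (\<Sum>g\<in>E. evm (cd x g) * (\<Sum>h\<in>E. evm (cd y h) * ?\<gamma> g h f))"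
        unfolding evm_cd_mult[OF x y f] by (rule sum.cong) (use g f in auto)
      then show "evm (cd (x \<otimes>\<^bsub>J\<^esub> y) f) * \<chi> i f =
          (\<Sum>g\<in>E. evm (cd x g) * (\<Sum>h\<in>E. evm (cd y h) * ?\<gamma> g h f)) * \<chi> i f" by simp
    qed simp
    also have "\<dots> = (\<Sum>f\<in>E. \<Sum>g\<in>E. \<Sum>h\<in>E. evm (cd x g) * evm (cd y h) * (?\<gamma> g h f * \<chi> i f))"
      by (simp add: sum_distrib_left sum_distrib_right mult.assoc)
    also have "\<dots> = (\<Sum>g\<in>E. \<Sum>f\<in>E. \<Sum>h\<in>E. evm (cd x g) * evm (cd y h) * (?\<gamma> g h f * \<chi> i f))"
      by (rule sum.swap)
    also have "\<dots> = (\<Sum>g\<in>E. \<Sum>h\<in>E. \<Sum>f\<in>E. evm (cd x g) * evm (cd y h) * (?\<gamma> g h f * \<chi> i f))"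
      by (rule sum.cong[OF refl], rule sum.swap)
    also have "\<dots> = (\<Sum>g\<in>E. \<Sum>h\<in>E. evm (cd x g) * evm (cd y h) * (\<chi> i g * \<chi> i h))"
      by (intro sum.cong refl) (simp add: mult[OF i] sum_distrib_left)
    also have "\<dots> = \<kappa> i x * \<kappa> i y"
      unfolding \<kappa>_def sum_product by (intro sum.cong refl) (simp add: mult_ac)
    finally show "\<kappa> i (x \<otimes>\<^bsub>J\<^esub> y) = \<kappa> i x * \<kappa> i y" .
  next
    show "\<kappa> i \<one>\<^bsub>J\<^esub> = 1" unfolding \<kappa>_def by (rule one[OF i])
  next
    fix r x assume r: "r \<in> S" and x: "x \<in> carrier J"
    show "\<kappa> i (sm r x) = evm r * \<kappa> i x"
      unfolding \<kappa>_def sum_distrib_left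
      by (rule sum.cong) (use r x cd_props(1) in \<open>auto simp: cd_sm evm_mult mult.assoc\<close>)
  qed
  moreover have "evm (tr x) = (\<Sum>i<m. \<kappa> i x)" if x: "x \<in> carrier J" for x
  proof -
    have "evm (tr x) = (\<Sum>f\<in>E. evm (cd (x \<otimes>\<^bsub>J\<^esub> f) f))"
      unfolding tr_def by (rule evm_sum) (use x EJ cd_props(1) in auto)
    also have "\<dots> = (\<Sum>f\<in>E. \<Sum>g\<in>E. evm (cd x g) * ?\<gamma> g f f)"
      by (rule sum.cong) (use evm_cd_mult x EJ in auto)
    also have "\<dots> = (\<Sum>g\<in>E. evm (cd x g) * (\<Sum>f\<in>E. ?\<gamma> g f f))"
      by (subst sum.swap) (simp add: sum_distrib_left)
    also have "\<dots> = (\<Sum>g\<in>E. \<Sum>i<m. evm (cd x g) * \<chi> i g)"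
      by (rule sum.cong) (use trace in \<open>auto simp: sum_distrib_left\<close>)
    also have "\<dots> = (\<Sum>i<m. \<kappa> i x)" unfolding \<kappa>_def by (rule sum.swap)
    finally show ?thesis .
  qed
  ultimately show thesis using that[of m \<kappa>] by blast
qed

context
  fixes \<kappa> assumes \<kappa>: "is_char \<kappa>"
begin

lemma char_add: "x \<in> carrier J \<Longrightarrow> y \<in> carrier J \<Longrightarrow> \<kappa> (x \<oplus>\<^bsub>J\<^esub> y) = \<kappa> x + \<kappa> y"
  and char_mult: "x \<in> carrier J \<Longrightarrow> y \<in> carrier J \<Longrightarrow> \<kappa> (x \<otimes>\<^bsub>J\<^esub> y) = \<kappa> x * \<kappa> y"
  and char_one: "\<kappa> \<one>\<^bsub>J\<^esub> = 1"
  and char_sm: "r \<in> S \<Longrightarrow> x \<in> carrier J \<Longrightarrow> \<kappa> (sm r x) = evm r * \<kappa> x"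
  using \<kappa> unfolding is_char_def by blast+

lemma char_smult: "r \<in> carrier RR \<Longrightarrow> x \<in> carrier J \<Longrightarrow> \<kappa> (r \<odot>\<^bsub>J\<^esub> x) = evb r * \<kappa> x"
  using char_sm[of "Mps r" x] by (simp add: carrier_RR evm_def)

lemma char_zero: "\<kappa> \<zero>\<^bsub>J\<^esub> = 0"
proof -
  have "\<kappa> (\<zero>\<^bsub>J\<^esub> \<oplus>\<^bsub>J\<^esub> \<zero>\<^bsub>J\<^esub>) = \<kappa> \<zero>\<^bsub>J\<^esub> + \<kappa> \<zero>\<^bsub>J\<^esub>" by (rule char_add) auto
  then show ?thesis by simp
qed

lemma char_minus: "x \<in> carrier J \<Longrightarrow> y \<in> carrier J \<Longrightarrow> \<kappa> (x \<ominus>\<^bsub>J\<^esub> y) = \<kappa> x - \<kappa> y"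
proof -
  assume x: "x \<in> carrier J" and y: "y \<in> carrier J"
  have "\<kappa> ((x \<ominus>\<^bsub>J\<^esub> y) \<oplus>\<^bsub>J\<^esub> y) = \<kappa> (x \<ominus>\<^bsub>J\<^esub> y) + \<kappa> y" by (rule char_add) (use x y in auto)
  moreover have "(x \<ominus>\<^bsub>J\<^esub> y) \<oplus>\<^bsub>J\<^esub> y = x" using x y by (simp add: a_minus_def Jd.a_assoc Jd.l_neg)
  ultimately show ?thesis by simp
qed

lemma char_expand: "x \<in> carrier J \<Longrightarrow> \<kappa> x = (\<Sum>e\<in>E. evm (cd x e) * \<kappa> e)"
proof -
  assume x: "x \<in> carrier J"
  have s: "\<kappa> (\<Oplus>\<^bsub>J\<^esub>e\<in>F. sm (cd x e) e) = (\<Sum>e\<in>F. evm (cd x e) * \<kappa> e)" if "F \<subseteq> E" for F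
    using finite_subset[OF that finE] that
  proof (induction F rule: finite_induct)
    case (insert e F)
    have c: "sm (cd x f) f \<in> carrier J" if "f \<in> insert e F" for f
      using that insert.prems x cd_props(1) EJ sm_closed by (meson subsetD)
    have "(\<Oplus>\<^bsub>J\<^esub>e\<in>insert e F. sm (cd x e) e) = sm (cd x e) e \<oplus>\<^bsub>J\<^esub> (\<Oplus>\<^bsub>J\<^esub>e\<in>F. sm (cd x e) e)"
      using insert c by (intro Jd.finsum_insert) auto
    moreover have "(\<Oplus>\<^bsub>J\<^esub>e\<in>F. sm (cd x e) e) \<in> carrier J" using c by (intro Jd.finsum_closed) auto
    ultimately show ?case
      using insert c char_add char_sm[of "cd x e" e] cd_props(1)[OF x] EJ by simp
  qed (simp add: char_zero)
  show ?thesis using s[of E] cd_props(2)[OF x] by (simp add: comb_def)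
qed

text \<open>
  The values of \<open>\<kappa>\<close> are bounded, as \<open>J\<close> is finite over the power series and these have integral
  values; the powers of a value of negative valuation would be unbounded.
\<close>

lemma char_integral:
  assumes x: "x \<in> carrier J"
  shows "0 \<le> ordp (\<kappa> x)"
proof (rule ccontr)
  assume n: "\<not> 0 \<le> ordp (\<kappa> x)"
  have "\<kappa> x \<noteq> 0"
  proof
    assume "\<kappa> x = 0"
    then have "ordp (\<kappa> x) = \<infinity>" by simp
    then show False using n by simp
  qed
  then obtain s where s: "ordp (\<kappa> x) = ereal s" using ord_finite by blast
  have neg: "s < 0" using n unfolding s by (simp add: zero_ereal_def)
  obtain D where D: "\<And>e. e \<in> E \<Longrightarrow> ereal (- D) \<le> ordp (\<kappa> e)"
    using finite_ord_bound[OF finE, of \<kappa>] by blast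
  have bd: "ereal (- D) \<le> ordp (\<kappa> y)" if y: "y \<in> carrier J" for y
    unfolding char_expand[OF y]
  proof (rule ge_sum)
    fix e assume e: "e \<in> E"
    have "0 \<le> ordp (evm (cd y e))" unfolding evm_def by (rule evb_ord[OF S_integral[OF cd_props(1)[OF y e]]])
    then have "ereal (- D) \<le> ordp (\<kappa> e * evm (cd y e))" using D[OF e] by (intro ge_mult0)
    then show "ereal (- D) \<le> ordp (evm (cd y e) * \<kappa> e)" by (simp add: mult.commute)
  qed
  have pw: "x [^]\<^bsub>J\<^esub> (n::nat) \<in> carrier J \<and> \<kappa> (x [^]\<^bsub>J\<^esub> n) = \<kappa> x ^ n" for n
    by (induction n) (use x char_one char_mult in \<open>auto simp: mult.commute\<close>)
  have neg': "0 < - s" using neg by simp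
  obtain n :: nat where n: "D < real n * (- s)" using reals_Archimedean3[OF neg'] by blast
  have "ereal (- D) \<le> ordp (\<kappa> x ^ n)" using bd pw by metis
  then have "- D \<le> real n * s" unfolding ord_power_eq[OF s] by simp
  then show False using n by simp
qed

lemma mps_const_RR: "c \<in> OK \<Longrightarrow> mps_const c \<in> carrier RR"
  by (auto simp: mps_ring_def mps_const_def)

lemma mps_X_RR: "mps_X i \<in> carrier RR"
  by (auto simp: mps_ring_def mps_X_def)

lemma char_X: "\<kappa> (mps_X i \<odot>\<^bsub>J\<^esub> \<one>\<^bsub>J\<^esub>) = b i"
  using char_smult[OF mps_X_RR, of "\<one>\<^bsub>J\<^esub>" i] by (simp add: evb_X char_one)

lemma char_const: "c \<in> OK \<Longrightarrow> \<kappa> (mps_const c \<odot>\<^bsub>J\<^esub> \<one>\<^bsub>J\<^esub>) = c"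
  using char_smult[OF mps_const_RR, of c "\<one>\<^bsub>J\<^esub>"] evb_const[of c] by (simp add: char_one OK_iff)

text \<open>
  The elements whose value has valuation at least \<open>t\<close> form an ideal, by integrality. The
  generators of the ideal \<open>(p, X\<^sub>1, \<dots>, X\<^sub>k)\<close> have values of valuation at least \<open>min 1 \<beta>\<close>, so the
  values on its \<open>N\<close>-th power have valuation at least \<open>N * min 1 \<beta>\<close>.
\<close>

lemma char_continuous: "pX_continuous p ordp J \<kappa>"
proof -
  \<comment> \<open>a common lower bound for the valuations of \<open>p\<close> and of the coordinates of \<open>b\<close>\<close>
  define \<epsilon> where "\<epsilon> = min 1 \<beta>"
  have \<epsilon>: "\<epsilon> > 0" "\<epsilon> \<le> 1" "\<epsilon> \<le> \<beta>" using \<beta>_pos by (auto simp: \<epsilon>_def)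
  define Z where "Z t = {z \<in> carrier J. ereal t \<le> ordp (\<kappa> z)}" for t :: real
  have ideal: "ideal (Z t) J" for t
  proof (rule idealI)
    show "ring J" by (rule Jd.ring_axioms)
    show "subgroup (Z t) (add_monoid J)"
    proof (rule Jd.add.subgroupI)
      show "Z t \<noteq> {}" using char_zero by (auto simp: Z_def intro!: exI[of _ "\<zero>\<^bsub>J\<^esub>"])
      show "\<ominus>\<^bsub>J\<^esub> a \<in> Z t" if "a \<in> Z t" for a
        using that char_minus[of "\<zero>\<^bsub>J\<^esub>" a] char_zero by (auto simp: Z_def a_minus_def)
      show "a \<oplus>\<^bsub>J\<^esub> a' \<in> Z t" if "a \<in> Z t" "a' \<in> Z t" for a a'
        using that char_add ge_add by (auto simp: Z_def)
    qed (auto simp: Z_def)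
    show "x \<otimes>\<^bsub>J\<^esub> a \<in> Z t" "a \<otimes>\<^bsub>J\<^esub> x \<in> Z t" if "a \<in> Z t" "x \<in> carrier J" for a x
    proof -
      have aJ: "a \<in> carrier J" and at: "ereal t \<le> ordp (\<kappa> a)" using that(1) by (simp_all add: Z_def)
      have ax: "\<kappa> (a \<otimes>\<^bsub>J\<^esub> x) = \<kappa> a * \<kappa> x" by (rule char_mult[OF aJ that(2)])
      have "ereal t \<le> ordp (\<kappa> a * \<kappa> x)" by (rule ge_mult0[OF at char_integral[OF that(2)]])
      then show "a \<otimes>\<^bsub>J\<^esub> x \<in> Z t" using aJ that(2) by (simp add: Z_def ax)
      then show "x \<otimes>\<^bsub>J\<^esub> a \<in> Z t" using Jd.m_comm[OF aJ that(2)] by simp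
    qed
  qed
  have pOK: "of_nat p \<in> OK" using O.of_nat_mem .
  have gens: "insert (mps_const (of_nat p) \<odot>\<^bsub>J\<^esub> \<one>\<^bsub>J\<^esub>) (range (\<lambda>i. mps_X i \<odot>\<^bsub>J\<^esub> \<one>\<^bsub>J\<^esub>)) \<subseteq> Z \<epsilon>"
  proof -
    have "mps_const (of_nat p) \<odot>\<^bsub>J\<^esub> \<one>\<^bsub>J\<^esub> \<in> carrier J"
      by (rule Jm.smult_closed[OF mps_const_RR[OF pOK]]) simp
    moreover have "ereal \<epsilon> \<le> ordp (of_nat p)" using \<epsilon>(2) by (simp add: ord_p one_ereal_def)
    moreover have "mps_X i \<odot>\<^bsub>J\<^esub> \<one>\<^bsub>J\<^esub> \<in> carrier J" for i
      by (rule Jm.smult_closed[OF mps_X_RR]) simp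
    moreover have "ereal \<epsilon> \<le> ordp (b i)" for i
      using b_ord[of i] \<epsilon>(3) by (meson ereal_less_eq(3) order_trans)
    ultimately show ?thesis by (auto simp: Z_def char_X char_const[OF pOK])
  qed
  have I: "pX_ideal p J \<subseteq> Z \<epsilon>" unfolding pX_ideal_def by (rule Jd.genideal_minimal[OF ideal gens])
  have pow: "((\<lambda>I. ideal_prod J I (pX_ideal p J)) ^^ N) (carrier J) \<subseteq> Z (real N * \<epsilon>)" for N
  proof (induction N)
    case 0
    show ?case using char_integral by (auto simp: Z_def zero_ereal_def)
  next
    case (Suc N)
    show ?case
    proof
      fix z assume "z \<in> ((\<lambda>I. ideal_prod J I (pX_ideal p J)) ^^ Suc N) (carrier J)"
      then have "z \<in> ideal_prod J (((\<lambda>I. ideal_prod J I (pX_ideal p J)) ^^ N) (carrier J)) (pX_ideal p J)" by simp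
      then show "z \<in> Z (real (Suc N) * \<epsilon>)"
      proof (induction rule: ideal_prod.induct)
        case (prod i j)
        then have i: "i \<in> Z (real N * \<epsilon>)" and j: "j \<in> Z \<epsilon>" using Suc.IH I by blast+
        have c: "i \<in> carrier J" "j \<in> carrier J" using i j by (simp_all add: Z_def)
        have "ereal (real N * \<epsilon> + \<epsilon>) \<le> ordp (\<kappa> i * \<kappa> j)" by (rule ge_mult) (use i j in \<open>simp_all add: Z_def\<close>)
        then show ?case using c by (simp add: Z_def char_mult algebra_simps)
      next
        case (sum s1 s2)
        then show ?case using char_add ge_add by (auto simp: Z_def)
      qed
    qed
  qed
  show ?thesis
    unfolding pX_continuous_def
  proof (intro ballI allI)
    fix x and C :: real assume x: "x \<in> carrier J"
    obtain N :: nat where N: "C < real N * \<epsilon>" using reals_Archimedean3[OF \<epsilon>(1)] by blast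
    show "\<exists>N. \<forall>y\<in>carrier J. y \<ominus>\<^bsub>J\<^esub> x \<in> ((\<lambda>I. ideal_prod J I (pX_ideal p J)) ^^ N) (carrier J) \<longrightarrow>
        ereal C < ordp (\<kappa> y - \<kappa> x)"
    proof (intro exI[of _ N] ballI impI)
      fix y assume y: "y \<in> carrier J" "y \<ominus>\<^bsub>J\<^esub> x \<in> ((\<lambda>I. ideal_prod J I (pX_ideal p J)) ^^ N) (carrier J)"
      then have "y \<ominus>\<^bsub>J\<^esub> x \<in> Z (real N * \<epsilon>)" using pow by blast
      then have "ereal (real N * \<epsilon>) \<le> ordp (\<kappa> y - \<kappa> x)" using char_minus[OF y(1) x] by (simp add: Z_def)
      moreover have "ereal C < ereal (real N * \<epsilon>)" using N by simp
      ultimately show "ereal C < ordp (\<kappa> y - \<kappa> x)" by (rule less_le_trans[rotated])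
    qed
  qed
qed

text \<open>
  The value of an integral power series at \<open>b\<close> is a limit of elements of \<open>K(b)\<close>, which is closed
  because it has finite dimension. Adjoining the values of the finitely many basis elements gives
  all values.
\<close>

lemma char_in_fdalg:
  assumes alg: "\<And>i. b i \<in> alg_closure_in K"
  obtains L where "fdalg K L" "\<kappa> ` carrier J \<subseteq> L"
proof -
  obtain L0 where L0: "fdalg K L0" "range b \<subseteq> L0"
    by (rule fdalg_finite_subset[of "range b"]) (use alg in auto)
  interpret L0: subring_of L0 by (rule fdalg_subring[OF L0(1)])
  obtain B where B: "finite B" "L0 = fdspan K B" using L0(1) unfolding fdalg_def by blast
  have KL0: "K \<subseteq> L0" by (rule fdalg_superset[OF L0(1)])
  have evL: "evm r \<in> L0" if r: "r \<in> S" for r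
    unfolding B(2)
  proof (rule fdspan_closed[OF B(1)])
    fix C :: real
    obtain N :: nat where N: "C < real N * \<beta>" using reals_Archimedean3[OF \<beta>_pos] by blast
    have "(\<Sum>n | msize n < N. mcoeff r n * mon b n) \<in> L0"
    proof (rule L0.sum_mem, rule L0.mult_mem)
      fix n :: "'n \<Rightarrow> nat"
      show "mcoeff r n \<in> L0" using r KL0 by (auto simp: S_def OK_iff)
      show "mon b n \<in> L0" unfolding mon_def using L0(2) by (intro L0.prod_mem L0.power_mem) auto
    qed
    moreover have "ereal C \<le> ordp (evm r - (\<Sum>n | msize n < N. mcoeff r n * mon b n))"
    proof -
      have "ereal C \<le> ereal (\<beta> * real N)" using N by (simp add: mult.commute)
      also have "\<dots> \<le> ordp (evm r - (\<Sum>n | msize n < N. mcoeff r n * mon b n))"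
        unfolding evm_def by (rule evb_lim[OF S_integral[OF r]])
      finally show ?thesis .
    qed
    ultimately show "\<exists>w\<in>fdspan K B. ereal C \<le> ordp (evm r - w)" using B(2) by blast
  qed
  define G where "G = (\<lambda>(a, c). a * c) ` (B \<times> \<kappa> ` E)"
  have fG: "finite G" unfolding G_def using B(1) finE by simp
  define L where "L = fdspan K G"
  have V: "ksubspace K L" unfolding L_def by (rule ksubspace_fdspan)
  have le: "l * \<kappa> e \<in> L" if "l \<in> L0" "e \<in> E" for l e
    unfolding L_def G_def
    by (rule fdspan_mult) (use that B finE fdspan_superset[of "\<kappa> ` E"] in auto)
  have lx: "l * \<kappa> x \<in> L" if l: "l \<in> L0" and x: "x \<in> carrier J" for l x
  proof -
    have "l * \<kappa> x = (\<Sum>e\<in>E. (l * evm (cd x e)) * \<kappa> e)"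
      unfolding char_expand[OF x] by (simp add: sum_distrib_left mult.assoc)
    also have "\<dots> \<in> L"
      by (rule ksubspace_sum[OF V], rule le) (use l evL cd_props(1)[OF x] L0.mult_mem in auto)
    finally show ?thesis .
  qed
  have kx: "\<kappa> x \<in> L" if "x \<in> carrier J" for x using lx[OF L0.one_mem that] by simp
  have "fdalg K L"
    unfolding fdalg_def
  proof (intro conjI ballI)
    show "\<exists>B. finite B \<and> L = fdspan K B" using fG L_def by blast
    show "1 \<in> L" using kx[of "\<one>\<^bsub>J\<^esub>"] char_one by simp
    fix y z assume yz: "y \<in> L" "z \<in> L"
    have "y * z \<in> fdspan K ((\<lambda>(a, c). a * c) ` (G \<times> G))"
      by (rule fdspan_mult[OF fG fG]) (use yz L_def in auto)
    moreover have "fdspan K ((\<lambda>(a, c). a * c) ` (G \<times> G)) \<subseteq> L"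
    proof (rule fdspan_least[OF V], rule subsetI)
      fix w assume "w \<in> (\<lambda>(a, c). a * c) ` (G \<times> G)"
      then obtain l l' e e' where w: "w = (l * \<kappa> e) * (l' * \<kappa> e')" "l \<in> B" "l' \<in> B" "e \<in> E" "e' \<in> E"
        unfolding G_def by auto
      have ll: "l * l' \<in> L0" using w(2,3) fdspan_superset[OF B(1)] B(2) L0.mult_mem by blast
      have eq: "w = (l * l') * \<kappa> (e \<otimes>\<^bsub>J\<^esub> e')" using w EJ by (simp add: char_mult mult_ac)
      show "w \<in> L" unfolding eq by (rule lx[OF ll]) (use w EJ in auto)
    qed
    ultimately show "y * z \<in> L" by blast
  qed
  then show thesis using that kx by blast
qed

lemma value_field_fdalg:
  assumes "\<And>i. b i \<in> alg_closure_in K"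
  shows "fdalg K (value_field K J \<kappa>)" "\<kappa> ` carrier J \<subseteq> value_field K J \<kappa>"
proof -
  obtain L where L: "fdalg K L" "\<kappa> ` carrier J \<subseteq> L" by (rule char_in_fdalg[OF assms]) (rule that)
  show "fdalg K (value_field K J \<kappa>)" "\<kappa> ` carrier J \<subseteq> value_field K J \<kappa>"
    unfolding value_field_def by (rule fdalg_generate_field[OF L])+
qed

lemma char_specialisation:
  assumes alg: "\<And>i. b i \<in> alg_closure_in K"
    and b: "\<And>i. b i = u i powi w i * \<epsilon> i - 1" "\<And>i. d i \<le> w i" "\<And>i. w i \<le> d' i" "\<And>i. \<epsilon> i \<in> mu_p_inf p"
  shows "\<kappa> \<in> specialisations p ordp K J u d d'"
proof -
  obtain L where L: "fdalg K L" "\<kappa> ` carrier J \<subseteq> L" by (rule char_in_fdalg[OF alg]) (rule that)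
  have "\<kappa> x \<in> alg_closure_in K" if "x \<in> carrier J" for x using fdalg_algebraic[OF L(1)] L(2) that by blast
  then have "\<kappa> \<in> ring_hom J (sub_field_of (alg_closure_in K))"
    by (intro ring_hom_memI) (auto simp: char_add char_mult char_one)
  then show ?thesis
    unfolding specialisations_def using char_const char_continuous char_X b
    by (intro CollectI conjI exI[of _ w] exI[of _ \<epsilon>]) auto
qed

end

end

section \<open>Reduction of monomials modulo a monic polynomial\<close>

text \<open>
  The \<open>j\<close>-th coefficient of the remainder of \<open>X ^ m\<close> modulo the monic polynomial
  \<open>X ^ N + (\<Sum>j<N. \<Omega> j * X ^ j)\<close>.
\<close>

primrec rem_coeff :: "nat \<Rightarrow> (nat \<Rightarrow> 'c::comm_ring_1) \<Rightarrow> nat \<Rightarrow> nat \<Rightarrow> 'c" where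
  "rem_coeff N \<Omega> 0 j = (if j = 0 then 1 else 0)"
| "rem_coeff N \<Omega> (Suc m) j = (if j = 0 then 0 else rem_coeff N \<Omega> m (j - 1)) - rem_coeff N \<Omega> m (N - 1) * \<Omega> j"

lemma rem_coeff_low: "m < N \<Longrightarrow> j < N \<Longrightarrow> rem_coeff N \<Omega> m j = (if j = m then 1 else 0)"
  by (induction m arbitrary: j) auto

lemma rem_coeff_eval:
  assumes "N \<ge> 1" "x ^ N + (\<Sum>j<N. \<Omega> j * x ^ j) = 0"
  shows "(\<Sum>j<N. rem_coeff N \<Omega> m j * x ^ j) = x ^ m"
proof (induction m)
  case 0
  have "(\<Sum>j<N. rem_coeff N \<Omega> 0 j * x ^ j) = (\<Sum>j<N. if j = 0 then 1 else 0)"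
    by (rule sum.cong) auto
  then show ?case using assms(1) by simp
next
  case (Suc m)
  obtain N' where N': "N = Suc N'" using assms(1) by (cases N) auto
  let ?r = "rem_coeff N \<Omega> m"
  have Nm: "N - Suc 0 = N'" using N' by simp
  have "(\<Sum>j<N. rem_coeff N \<Omega> (Suc m) j * x ^ j) =
      (\<Sum>j<N. (if j = 0 then 0 else ?r (j - 1)) * x ^ j) - ?r N' * (\<Sum>j<N. \<Omega> j * x ^ j)"
    by (simp add: Nm left_diff_distrib sum_subtractf sum_distrib_left mult.assoc)
  also have "(\<Sum>j<N. (if j = 0 then 0 else ?r (j - 1)) * x ^ j) = (\<Sum>j<N'. ?r j * x ^ Suc j)"
    by (subst (1) N', subst sum.lessThan_Suc_shift) simp
  also have "(\<Sum>j<N. \<Omega> j * x ^ j) = - (x ^ N)" using assms(2) by (simp add: eq_neg_iff_add_eq_0 add.commute)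
  also have "(\<Sum>j<N'. ?r j * x ^ Suc j) - ?r N' * - (x ^ N) = x * (\<Sum>j<N. ?r j * x ^ j)"
    by (simp add: N' sum_distrib_left algebra_simps)
  finally show ?case using Suc by simp
qed

context valued_field
begin

text \<open>
  Let \<open>X\<close> have weight \<open>\<rho>\<close>. Replacing \<open>X ^ N\<close> by \<open>- (\<Sum>j<N. \<Omega> j * X ^ j)\<close> does not lower the total
  weight, so the remainder of \<open>X ^ m\<close> still has weight at least \<open>m * \<rho>\<close>.
\<close>

lemma rem_coeff_ord:
  assumes N: "N \<ge> 1" and \<rho>: "\<rho> \<ge> 0" and \<Omega>: "\<And>j. j < N \<Longrightarrow> ereal ((real N - real j) * \<rho>) \<le> ordp (\<Omega> j)"
  shows "j < N \<Longrightarrow> ereal ((real m - real j) * \<rho>) \<le> ordp (rem_coeff N \<Omega> m j)"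
proof (induction m arbitrary: j)
  case 0
  then show ?case using \<rho> by (cases "j = 0") (auto simp: zero_ereal_def)
next
  case (Suc m)
  have 1: "ereal ((real (Suc m) - real j) * \<rho>) \<le> ordp (if j = 0 then 0 else rem_coeff N \<Omega> m (j - 1))"
  proof (cases j)
    case (Suc i)
    then have "ereal ((real m - real i) * \<rho>) \<le> ordp (rem_coeff N \<Omega> m i)" using Suc.IH[of i] Suc.prems by simp
    then show ?thesis using Suc by simp
  qed simp
  have "ereal ((real m - real (N - 1)) * \<rho> + (real N - real j) * \<rho>) \<le> ordp (rem_coeff N \<Omega> m (N - 1) * \<Omega> j)"
    by (rule ge_mult[OF Suc.IH \<Omega>]) (use N Suc.prems in auto)
  moreover have "(real m - real (N - 1)) * \<rho> + (real N - real j) * \<rho> = (real (Suc m) - real j) * \<rho>"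
    using N by (simp add: of_nat_diff algebra_simps)
  ultimately have 2: "ereal ((real (Suc m) - real j) * \<rho>) \<le> ordp (rem_coeff N \<Omega> m (N - 1) * \<Omega> j)" by simp
  show ?case unfolding rem_coeff.simps by (rule ge_diff[OF 1 2])
qed

text \<open>
  At degree \<open>N\<close> and above at least one replacement takes place, which contributes the smallness
  \<open>A\<close> of the modulus in addition to the weight.
\<close>

lemma rem_coeff_ord_high:
  assumes N: "N \<ge> 1" and \<rho>: "\<rho> \<ge> 0" and \<Omega>: "\<And>j. j < N \<Longrightarrow> ereal ((real N - real j) * \<rho>) \<le> ordp (\<Omega> j)"
    and A: "\<And>j. j < N \<Longrightarrow> ereal (A - real j) \<le> ordp (\<Omega> j)"
  shows "j < N \<Longrightarrow> ereal ((real k - real j) * \<rho> + A - real j) \<le> ordp (rem_coeff N \<Omega> (N + k) j)"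
proof (induction k arbitrary: j)
  case 0
  obtain N' where N': "N = Suc N'" using N by (cases N) auto
  have "rem_coeff N \<Omega> N j = (if j = 0 then 0 else rem_coeff N \<Omega> N' (j - 1)) - rem_coeff N \<Omega> N' (N - 1) * \<Omega> j"
    unfolding N' by simp
  also have "\<dots> = - \<Omega> j" using 0 rem_coeff_low[of N' N "j - 1" \<Omega>] rem_coeff_low[of N' N "N - 1" \<Omega>] by (auto simp: N')
  finally have e: "rem_coeff N \<Omega> (N + 0) j = - \<Omega> j" by simp
  have "- real j * \<rho> \<le> 0" using \<rho> by simp
  then have "ereal ((real 0 - real j) * \<rho> + A - real j) \<le> ereal (A - real j)" by simp
  also have "\<dots> \<le> ordp (\<Omega> j)" by (rule A[OF 0])
  finally show ?case unfolding e by simp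
next
  case (Suc k)
  have 1: "ereal ((real (Suc k) - real j) * \<rho> + A - real j) \<le> ordp (if j = 0 then 0 else rem_coeff N \<Omega> (N + k) (j - 1))"
  proof (cases j)
    case (Suc i)
    then have "ereal ((real k - real i) * \<rho> + A - real i) \<le> ordp (rem_coeff N \<Omega> (N + k) i)"
      using Suc.IH[of i] Suc.prems by simp
    moreover have "(if j = 0 then 0 else rem_coeff N \<Omega> (N + k) (j - 1)) = rem_coeff N \<Omega> (N + k) i"
      by (simp add: Suc)
    moreover have "ereal ((real (Suc k) - real j) * \<rho> + A - real j) \<le> ereal ((real k - real i) * \<rho> + A - real i)"
      by (simp add: Suc)
    ultimately show ?thesis by (simp only:)
  qed simp
  have "ereal ((real (N + k) - real (N - 1)) * \<rho> + (A - real j)) \<le> ordp (rem_coeff N \<Omega> (N + k) (N - 1) * \<Omega> j)"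
    by (rule ge_mult[OF rem_coeff_ord[OF N \<rho> \<Omega>] A]) (use N Suc.prems in auto)
  moreover have "(real (Suc k) - real j) * \<rho> + A - real j \<le> (real (N + k) - real (N - 1)) * \<rho> + (A - real j)"
  proof -
    have e: "real (N + k) - real (N - 1) = real (Suc k)" using N by (simp add: of_nat_diff)
    have "real j * \<rho> \<ge> 0" using \<rho> by simp
    then show ?thesis unfolding e left_diff_distrib[of "real (Suc k)" "real j"] by linarith
  qed
  ultimately have 2: "ereal ((real (Suc k) - real j) * \<rho> + A - real j) \<le> ordp (rem_coeff N \<Omega> (N + k) (N - 1) * \<Omega> j)"
    by (meson ereal_less_eq(3) order_trans)
  show ?case unfolding add_Suc_right rem_coeff.simps by (rule ge_diff[OF 1 2])
qed

text \<open>
  The Gauss valuation of \<open>f\<close> for the radius at which \<open>X\<close> has valuation \<open>\<rho>\<close> is at least \<open>t\<close>.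
\<close>

definition gauss_ge :: "real \<Rightarrow> real \<Rightarrow> 'c poly \<Rightarrow> bool" where
  "gauss_ge \<rho> t f \<longleftrightarrow> (\<forall>i. ereal (t - real i * \<rho>) \<le> ordp (Polynomial.coeff f i))"

lemma gauss_ge_mult: "gauss_ge \<rho> t f \<Longrightarrow> gauss_ge \<rho> s g \<Longrightarrow> gauss_ge \<rho> (t + s) (f * g)"
  unfolding gauss_ge_def coeff_mult
proof (intro allI ge_sum)
  fix k i :: nat assume a: "\<forall>i. ereal (t - real i * \<rho>) \<le> ordp (Polynomial.coeff f i)"
    "\<forall>i. ereal (s - real i * \<rho>) \<le> ordp (Polynomial.coeff g i)" "i \<in> {..k}"
  have "ereal ((t - real i * \<rho>) + (s - real (k - i) * \<rho>)) \<le> ordp (Polynomial.coeff f i * Polynomial.coeff g (k - i))"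
    by (rule ge_mult[OF a(1)[rule_format] a(2)[rule_format]])
  moreover have "(t - real i * \<rho>) + (s - real (k - i) * \<rho>) = t + s - real k * \<rho>"
    using a(3) by (simp add: of_nat_diff algebra_simps)
  ultimately show "ereal (t + s - real k * \<rho>) \<le> ordp (Polynomial.coeff f i * Polynomial.coeff g (k - i))" by simp
qed

lemma gauss_ge_prod:
  assumes "finite W" "\<And>w. w \<in> W \<Longrightarrow> gauss_ge \<rho> t (f w)"
  shows "gauss_ge \<rho> (real (card W) * t) (\<Prod>w\<in>W. f w)"
  using assms
proof (induction W rule: finite_induct)
  case empty
  show ?case by (auto simp: gauss_ge_def Polynomial.coeff_1 zero_ereal_def)
next
  case (insert w W)
  then have "gauss_ge \<rho> (t + real (card W) * t) (f w * (\<Prod>w\<in>W. f w))" by (intro gauss_ge_mult) auto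
  then show ?case using insert.hyps by (simp add: algebra_simps)
qed

section \<open>Binomial coefficients and principal units\<close>

lemma ord_of_nat_coprime:
  assumes "\<not> p dvd c"
  shows "ordp (of_nat c) = 0"
proof -
  have c0: "(of_nat c :: 'c) \<noteq> 0" using assms by (metis dvd_0_right of_nat_eq_0_iff)
  obtain r where r: "ordp (of_nat c) = ereal r" using ord_finite[OF c0] by blast
  have r0: "r \<ge> 0" using ge_of_nat[of c] r by simp
  have "coprime (int p) (int c)" using assms prime_p by (simp add: prime_imp_coprime)
  then obtain x y where xy: "x * int p + y * int c = 1" using bezout_int[of "int p" "int c"] by auto
  have "of_int x * of_nat p + of_int y * of_nat c = (1 :: 'c)"
    using arg_cong[OF xy, of "of_int :: int \<Rightarrow> 'c"] by simp
  moreover have "ereal (min 1 r) \<le> ordp (of_nat p * of_int x)"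
    by (rule ge_mult0) (simp_all add: ord_p one_ereal_def ge_of_int)
  moreover have "ereal (min 1 r) \<le> ordp (of_nat c * of_int y)"
    by (rule ge_mult0) (simp_all add: r ge_of_int)
  ultimately have "ereal (min 1 r) \<le> ordp 1"
    using ge_add[of "min 1 r" "of_nat p * of_int x" "of_nat c * of_int y"] by (simp add: mult.commute)
  then have "ereal (min 1 r) \<le> ereal 0" by (simp only: ord_1 zero_ereal_def)
  then have "min 1 r \<le> 0" by (simp only: ereal_less_eq)
  then show ?thesis using r r0 by (simp add: zero_ereal_def min_def split: if_splits)
qed

lemma ord_of_nat_le:
  assumes "i \<ge> 1"
  shows "\<exists>k\<le>i. ordp (of_nat i) = ereal (real k)"
proof -
  have "p > 1" using prime_p by (rule prime_gt_1_nat)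
  then obtain c where c: "i = p ^ multiplicity p i * c" "\<not> p dvd c"
    using multiplicity_decompose'[of i p] assms prime_p by (metis not_one_le_zero not_prime_unit)
  let ?k = "multiplicity p i"
  have "ordp (of_nat i) = ordp (of_nat p ^ ?k) + ordp (of_nat c)"
    by (subst c(1)) (simp add: ord_mult)
  also have "ordp (of_nat p ^ ?k) = ereal (real ?k)"
    using ord_power_eq[of "of_nat p" 1 ?k] by (simp add: ord_p one_ereal_def)
  finally have "ordp (of_nat i) = ereal (real ?k)" using ord_of_nat_coprime[OF c(2)] by simp
  moreover have "?k \<le> i"
  proof -
    have "?k < 2 ^ ?k" by (rule less_exp)
    also have "\<dots> \<le> p ^ ?k" using \<open>p > 1\<close> by (intro power_mono) auto
    also have "\<dots> \<le> i" using c(1) assms by (metis dvd_imp_le dvd_triv_left less_eq_Suc_le One_nat_def)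
    finally show ?thesis by simp
  qed
  ultimately show ?thesis by blast
qed

text \<open>
  The identity \<open>i * (P choose i) = P * ((P - 1) choose (i - 1))\<close> for \<open>P = p ^ n\<close>, together with
  \<open>ord i \<le> i\<close>.
\<close>

lemma ord_binomial:
  assumes "i \<ge> 1"
  shows "ereal (real n - real i) \<le> ordp (of_nat (p ^ n choose i))"
proof -
  have P: "p ^ n > 0" using prime_gt_0_nat[OF prime_p] by simp
  obtain k where k: "k \<le> i" "ordp (of_nat i) = ereal (real k)" using ord_of_nat_le[OF assms] by blast
  have "i * (p ^ n choose i) = p ^ n * (p ^ n - 1 choose (i - 1))"
    using assms P by (intro times_binomial_minus1_eq) simp
  then have "(of_nat i * of_nat (p ^ n choose i) :: 'c) = of_nat p ^ n * of_nat (p ^ n - 1 choose (i - 1))"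
    by (metis of_nat_mult of_nat_power)
  then have e: "ordp (of_nat i) + ordp (of_nat (p ^ n choose i)) = ordp (of_nat p ^ n * of_nat (p ^ n - 1 choose (i - 1)))"
    by (metis ord_mult)
  have "ordp (of_nat p ^ n) = ereal (real n)"
    using ord_power_eq[of "of_nat p" 1 n] by (simp add: ord_p one_ereal_def)
  then have "ereal (real n) \<le> ordp (of_nat p ^ n * of_nat (p ^ n - 1 choose (i - 1)))"
    by (intro ge_mult0 ge_of_nat) simp
  then have "ereal (real n) \<le> ordp (of_nat (p ^ n choose i)) + ereal (real k)"
    unfolding e[symmetric] k(2) by (simp add: add.commute)
  then have "ereal (real n - real k) \<le> ordp (of_nat (p ^ n choose i))" by (simp only: ereal_le_add_iff)
  then show ?thesis by (rule order_trans[rotated]) (use k in simp)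
qed

lemma ord_binomial_ge_1:
  assumes "0 < i" "i < p ^ n"
  shows "1 \<le> ordp (of_nat (p ^ n choose i))"
proof -
  have "i * (p ^ n choose i) = p ^ n * (p ^ n - 1 choose (i - 1))"
    using assms by (intro times_binomial_minus1_eq) simp
  then have d: "p ^ n dvd i * (p ^ n choose i)" by simp
  have "p dvd (p ^ n choose i)"
  proof (rule ccontr)
    assume "\<not> p dvd (p ^ n choose i)"
    then have "coprime (p ^ n) (p ^ n choose i)" using prime_p by (simp add: prime_imp_coprime)
    then have "p ^ n dvd i" using d by (simp add: coprime_dvd_mult_left_iff)
    then show False using assms by (simp add: nat_dvd_not_less)
  qed
  then obtain k where "(p ^ n choose i) = p * k" by (elim dvdE)
  then have e: "(of_nat (p ^ n choose i) :: 'c) = of_nat p * of_nat k" by simp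
  have "ereal 1 \<le> ordp (of_nat p * of_nat k)"
    by (rule ge_mult0) (simp_all add: ord_p one_ereal_def ge_of_nat)
  then show ?thesis unfolding e by (simp add: one_ereal_def)
qed

lemma unit_power_minus_1:
  assumes "t \<ge> 0" "ereal t \<le> ordp (x - 1)"
  shows "ereal t \<le> ordp (x ^ k - 1)"
proof -
  have "ereal 0 \<le> ordp (x - 1)" using assms by (meson ereal_less_eq(3) order_trans)
  from ge_add[OF this, of 1] have x: "ereal 0 \<le> ordp x" by (simp add: zero_ereal_def)
  have "ereal 0 \<le> ordp (\<Sum>i<k. x ^ i)"
  proof (rule ge_sum)
    fix i show "ereal 0 \<le> ordp (x ^ i)" using ge_power[OF x, of i] by simp
  qed
  then show ?thesis
    unfolding power_diff_1_eq by (intro ge_mult0 assms) (simp add: zero_ereal_def)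
qed

text \<open>
  In \<open>x ^ p - 1 = (x - 1) * (\<Sum>i<p. x ^ i)\<close> the second factor is a sum of \<open>p\<close> terms congruent to
  \<open>1\<close> modulo \<open>p\<close>.
\<close>

lemma unit_power_p_minus_1:
  assumes "t \<ge> 1" "ereal t \<le> ordp (x - 1)"
  shows "ereal (t + 1) \<le> ordp (x ^ p - 1)"
proof -
  have "(\<Sum>i<p. x ^ i) = of_nat p + (\<Sum>i<p. x ^ i - 1)" by (simp add: sum_subtractf)
  moreover have "ereal 1 \<le> ordp (\<Sum>i<p. x ^ i - 1)"
  proof (rule ge_sum)
    fix i show "ereal 1 \<le> ordp (x ^ i - 1)"
      using unit_power_minus_1[of t x i] assms by (meson ereal_less_eq(3) order_trans zero_le_one)
  qed
  ultimately have "ereal 1 \<le> ordp (\<Sum>i<p. x ^ i)"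
    using ge_add[of 1 "of_nat p"] by (simp add: ord_p one_ereal_def)
  then show ?thesis unfolding power_diff_1_eq by (intro ge_mult assms)
qed

lemma unit_power_p_power_minus_1:
  assumes "ereal 1 \<le> ordp (x - 1)"
  shows "ereal (real n + 1) \<le> ordp (x ^ (p ^ n) - 1)"
proof (induction n)
  case 0
  then show ?case using assms by simp
next
  case (Suc n)
  have "ereal (real n + 1 + 1) \<le> ordp ((x ^ (p ^ n)) ^ p - 1)"
    by (rule unit_power_p_minus_1) (use Suc in auto)
  then show ?case by (simp add: power_mult[symmetric] mult.commute add.commute)
qed

lemma val_closure_finite: "finite F \<Longrightarrow> val_closure ordp F \<subseteq> F"
proof
  fix x assume F: "finite F" and x: "x \<in> val_closure ordp F"
  show "x \<in> F"
  proof (rule ccontr)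
    assume n: "x \<notin> F"
    have "\<exists>C::real. \<forall>y\<in>F. ordp (x - y) \<le> ereal C"
      using F n
    proof (induction F rule: finite_induct)
      case (insert y F)
      then obtain C where C: "\<forall>y\<in>F. ordp (x - y) \<le> ereal C" by auto
      obtain r where r: "ordp (x - y) = ereal r" using ord_finite[of "x - y"] insert.prems by auto
      have "\<forall>z\<in>insert y F. ordp (x - z) \<le> ereal (max C r)"
        using C r by (auto simp: le_max_iff_disj)
      then show ?case by blast
    qed auto
    then obtain C :: real where C: "\<forall>y\<in>F. ordp (x - y) \<le> ereal C" by blast
    obtain y where "y \<in> F" "ereal C < ordp (x - y)" using x unfolding val_closure_def by blast
    then show False using C leD by blast
  qed
qed

lemma val_closure_Ints_ord:
  assumes "z \<in> val_closure ordp \<int>" shows "0 \<le> ordp z"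
proof -
  obtain y where y: "y \<in> \<int>" "ordp (z - y) > ereal 0" using assms unfolding val_closure_def by blast
  obtain k where k: "y = of_int k" using y(1) by (elim Ints_cases)
  have "ereal 0 \<le> ordp y" unfolding k using ge_of_int by (simp add: zero_ereal_def)
  from ge_add[OF _ this, of "z - y"] y(2) show ?thesis by (simp add: zero_ereal_def)
qed

context
  fixes u :: 'c assumes u: "top_generator p ordp u"
begin

lemma u_minus_1: "ereal 1 \<le> ordp (u - 1)"
proof -
  obtain z where z: "z \<in> val_closure ordp \<int>" "u = 1 + 2 * of_nat p * z"
    using u unfolding top_generator_def Let_def by blast
  have "0 \<le> ordp (of_nat 2 * z)"
    using ge_mult0[of 0 "of_nat 2" z] ge_of_nat[of 2] val_closure_Ints_ord[OF z(1)] by (simp add: zero_ereal_def)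
  then have "ereal 1 \<le> ordp (of_nat p * (of_nat 2 * z))"
    by (intro ge_mult0) (simp_all add: ord_p one_ereal_def)
  then show ?thesis unfolding z(2) by (simp add: mult_ac)
qed

lemma ord_u: "ordp u = 0"
proof -
  have 1: "ereal 0 \<le> ordp (u - 1)" using u_minus_1 by (meson ereal_less_eq(3) order_trans zero_le_one)
  from ge_add[OF this, of 1] have ge: "0 \<le> ordp u" by (simp add: zero_ereal_def)
  have "u \<noteq> 0"
  proof
    assume "u = 0"
    then show False using u_minus_1 by (simp add: one_ereal_def zero_ereal_def)
  qed
  then obtain r where r: "ordp u = ereal r" using ord_finite by blast
  have "u - (u - 1) = 1" by simp
  moreover have "ereal (min 1 r) \<le> ordp (u - (u - 1))"
  proof (rule ge_diff)
    show "ereal (min 1 r) \<le> ordp u" using r by simp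
    show "ereal (min 1 r) \<le> ordp (u - 1)" by (rule order_trans[OF _ u_minus_1]) simp
  qed
  ultimately have "ereal (min 1 r) \<le> ordp 1" by simp
  then have "ereal (min 1 r) \<le> ereal 0" by (simp only: ord_1 zero_ereal_def)
  then have "min 1 r \<le> 0" by (simp only: ereal_less_eq)
  then show ?thesis using r ge by (simp add: zero_ereal_def min_def split: if_splits)
qed

lemma u_nonzero: "u \<noteq> 0" using ord_u by (auto simp: zero_ereal_def)

lemma u_powi_minus_1: "ereal 1 \<le> ordp (u powi w - 1)"
proof (cases "w \<ge> 0")
  case True
  then show ?thesis using unit_power_minus_1[OF _ u_minus_1, of "nat w"] by (simp add: power_int_def)
next
  case False
  let ?k = "nat (- w)"
  have e: "u powi w - 1 = (u ^ ?k - 1) * - inverse (u ^ ?k)"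
    using False u_nonzero by (simp add: power_int_def power_inverse field_simps)
  have "ordp (u ^ ?k) = ereal (real ?k * 0)" by (rule ord_power_eq) (simp add: ord_u zero_ereal_def)
  then have "ordp (inverse (u ^ ?k)) = ereal (- 0)" by (intro ord_inverse) simp
  then show ?thesis
    unfolding e using unit_power_minus_1[OF _ u_minus_1, of ?k] by (intro ge_mult0) (simp_all add: zero_ereal_def)
qed

text \<open>
  The powers of a root of unity would form a finite set, which is its own closure, but the closure
  of the powers of \<open>u\<close> contains the infinite set \<open>1 + 2 p \<int>\<close>.
\<close>

lemma u_power_ne_1: "k > 0 \<Longrightarrow> u ^ k \<noteq> 1"
proof
  assume k: "k > 0" and e: "u ^ k = 1"
  let ?U = "(\<lambda>z. 1 + 2 * of_nat p * z) ` val_closure ordp \<int>"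
  have "range (\<lambda>n::int. u powi n) \<subseteq> (\<lambda>j. u ^ j) ` {..<k}"
  proof
    fix x assume "x \<in> range (\<lambda>n::int. u powi n)"
    then obtain n :: int where n: "x = u powi n" by blast
    have "n = int k * (n div int k) + n mod int k" by simp
    then have "u powi n = (u powi int k) powi (n div int k) * u powi (n mod int k)"
      using u_nonzero by (metis power_int_add power_int_mult)
    also have "\<dots> = u ^ nat (n mod int k)" using e k by (simp add: power_int_def)
    finally have "x = u ^ nat (n mod int k)" using n by simp
    moreover have "nat (n mod int k) < k" using k by (simp add: nat_less_iff)
    ultimately show "x \<in> (\<lambda>j. u ^ j) ` {..<k}" by blast
  qed
  then have fin: "finite (range (\<lambda>n::int. u powi n))" by (rule finite_subset) simp
  have "?U \<subseteq> range (\<lambda>n::int. u powi n)"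
    using u val_closure_finite[OF fin] unfolding top_generator_def Let_def by blast
  then have "finite ?U" using fin finite_subset by blast
  moreover have "range (\<lambda>n::int. 1 + 2 * of_nat p * of_int n) \<subseteq> ?U"
  proof
    fix x :: 'c assume "x \<in> range (\<lambda>n::int. 1 + 2 * of_nat p * of_int n)"
    then obtain n :: int where n: "x = 1 + 2 * of_nat p * of_int n" by blast
    have "of_int n \<in> val_closure ordp \<int>"
      unfolding val_closure_def by (intro CollectI allI bexI[of _ "of_int n"]) simp_all
    then show "x \<in> ?U" unfolding n by (rule imageI)
  qed
  ultimately have "finite (range (\<lambda>n::int. 1 + 2 * of_nat p * (of_int n :: 'c)))" using finite_subset by blast
  moreover have "inj (\<lambda>n::int. 1 + 2 * of_nat p * (of_int n :: 'c))"
    using prime_gt_0_nat[OF prime_p] by (auto simp: inj_def)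
  ultimately show False using finite_imageD[of _ "UNIV :: int set"] infinite_UNIV_int by blast
qed

lemma u_powi_inj:
  assumes "P > 0" "(u powi w) ^ P = (u powi w') ^ P"
  shows "w = w'"
proof -
  have main: "\<not> w < w'" if "(u powi w) ^ P = (u powi w') ^ P" for w w' :: int
  proof
    assume "w < w'"
    then obtain k where k: "w' = w + int k" "k > 0" by (metis zless_iff_Suc_zadd zero_less_Suc)
    have "(u powi w') ^ P = (u powi w) ^ P * u ^ (k * P)"
      unfolding k(1) using u_nonzero by (simp add: power_int_add power_mult_distrib power_mult)
    then have "u ^ (k * P) = 1" using that u_nonzero by simp
    then show False using u_power_ne_1[of "k * P"] k(2) assms(1) by simp
  qed
  show ?thesis using main[OF assms(2)] main[OF assms(2)[symmetric]] by linarith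
qed

end

text \<open>
  A double factor would be a common root of \<open>f\<close> and its derivative.
\<close>

lemma card_roots_if_squarefree:
  fixes f :: "'c poly"
  assumes "f \<noteq> 0" "\<And>x. Polynomial.poly f x = 0 \<Longrightarrow> Polynomial.poly (pderiv f) x \<noteq> 0"
  shows "card {x. Polynomial.poly f x = 0} = Polynomial.degree f"
proof -
  obtain A where A: "size A = Polynomial.degree f"
    "f = Polynomial.smult (Polynomial.lead_coeff f) (\<Prod>x\<in>#A. [:- x, 1:])"
    using alg_closed_imp_factorization[OF assms(1)] by blast
  have roots: "{x. Polynomial.poly f x = 0} = set_mset A"
  proof -
    have "Polynomial.poly f x = Polynomial.lead_coeff f * (\<Prod>y\<in>#A. x - y)" for x
      by (subst A(2)) (simp add: poly_prod_mset image_mset.compositionality o_def)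
    then show ?thesis using assms(1) by (auto simp: prod_mset_zero_iff)
  qed
  have one: "count A x = 1" if x: "x \<in># A" for x
  proof (rule ccontr)
    assume "count A x \<noteq> 1"
    moreover have "count A x > 0" using x by simp
    ultimately have "count A x \<ge> 2" by linarith
    then obtain B where B: "A = add_mset x (add_mset x B)"
      by (metis x insert_DiffM count_add_mset count_greater_zero_iff one_add_one Suc_eq_plus1
          Suc_le_mono less_eq_Suc_le numeral_2_eq_2)
    have "f = [:- x, 1:] * ([:- x, 1:] * Polynomial.smult (Polynomial.lead_coeff f) (\<Prod>x\<in>#B. [:- x, 1:]))"
      by (subst A(2)) (simp add: B)
    moreover define a where "a = [:- x, 1:]"
    ultimately obtain g where g: "f = a * (a * g)" by blast
    have a: "Polynomial.poly a x = 0" by (simp add: a_def)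
    have "Polynomial.poly f x = 0" "Polynomial.poly (pderiv f) x = 0"
      unfolding g by (simp_all add: pderiv_mult a)
    then show False using assms(2) by blast
  qed
  have "size A = (\<Sum>x\<in>set_mset A. count A x)" by (rule size_multiset_overloaded_eq)
  also have "\<dots> = card (set_mset A)" using one by simp
  finally show ?thesis using A(1) roots by simp
qed

end

section \<open>Interpolation at arithmetic points\<close>

text \<open>
  If \<open>\<ell>(m) = n + k + 1\<close>, then \<open>m \<ge> p ^ (n + k)\<close>, so that \<open>m / p ^ n\<close> is at least \<open>2 ^ k\<close> and
  exceeds \<open>h * k\<close> up to a constant, which is independent of \<open>n\<close>.
\<close>

lemma linear_le_power_bound:
  fixes h :: real
  assumes "p \<ge> 2" "h \<ge> 0"
  obtains c where "\<And>n m. h * real (ell p m) \<le> real m / real (p ^ n) + h * real n + c"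
proof -
  have "1 / (h + 1) > 0" using assms(2) by simp
  obtain c0 where c0: "c0 \<ge> 0" "\<And>t. real t \<le> 1 / (h + 1) * 2 ^ t + c0"
    by (rule linear_le_power2[OF \<open>1 / (h + 1) > 0\<close>]) (rule that)
  have lin: "h * real t \<le> 2 ^ t + h * c0" for t :: nat
  proof -
    have "h * real t \<le> h * (1 / (h + 1) * 2 ^ t + c0)" using c0(2)[of t] assms(2) by (intro mult_left_mono)
    also have "\<dots> = h / (h + 1) * 2 ^ t + h * c0" by (simp add: algebra_simps)
    also have "h / (h + 1) * 2 ^ t \<le> 1 * (2 ^ t :: real)" using assms(2) by (intro mult_right_mono) (auto simp: field_simps)
    finally show ?thesis by simp
  qed
  have hc: "h * c0 \<ge> 0" using assms(2) c0(1) by simp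
  show thesis
  proof (rule that[of "h * c0 + h"])
    fix n m :: nat
    have mP: "real m / real (p ^ n) \<ge> 0" by simp
    show "h * real (ell p m) \<le> real m / real (p ^ n) + h * real n + (h * c0 + h)"
    proof (cases "ell p m \<le> n")
      case True
      then have "h * real (ell p m) \<le> h * real n" using assms(2) by (intro mult_left_mono) auto
      then show ?thesis using mP hc assms(2) by linarith
    next
      case False
      then obtain t where t: "ell p m = Suc t" by (cases "ell p m") auto
      then have nt: "n \<le> t" using False by simp
      define k where "k = t - n"
      have "(2::nat) ^ k * p ^ n \<le> p ^ k * p ^ n" using assms(1) by (intro mult_right_mono power_mono) auto
      also have "\<dots> = p ^ t" using nt by (simp add: k_def flip: power_add)
      also have "\<dots> \<le> m" by (rule ell_props(4)[OF assms(1) t])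
      finally have "real (2 ^ k * p ^ n) \<le> real m" by (simp only: of_nat_le_iff)
      then have "2 ^ k * real (p ^ n) \<le> real m" by simp
      moreover have "real (p ^ n) > 0" using assms(1) by simp
      ultimately have "2 ^ k \<le> real m / real (p ^ n)" by (simp add: field_simps)
      moreover have "h * real (ell p m) = h * real k + h * real n + h"
        using nt by (simp add: t k_def of_nat_diff algebra_simps)
      ultimately show ?thesis using lin[of k] by linarith
    qed
  qed
qed

context complete_subfield
begin

lemma of_int_mem: "of_int k \<in> K"
  using of_nat_mem[of "nat k"] uminus_mem[OF of_nat_mem[of "nat (- k)"]] by (cases "k \<ge> 0") auto

lemma val_closure_Ints_mem: "z \<in> val_closure ordp \<int> \<Longrightarrow> z \<in> K"
proof -
  assume z: "z \<in> val_closure ordp \<int>"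
  have K1: "fdspan K {1} = K" by (auto simp: fdspan_def)
  have "z \<in> fdspan K {1}"
  proof (rule fdspan_closed)
    fix C :: real
    obtain y where y: "y \<in> \<int>" "ereal C < ordp (z - y)" using z unfolding val_closure_def by blast
    then have "y \<in> K" by (auto elim!: Ints_cases intro: of_int_mem)
    then show "\<exists>w\<in>fdspan K {1}. ereal C \<le> ordp (z - w)" using y(2) unfolding K1 by (meson less_imp_le)
  qed simp
  then show ?thesis unfolding K1 .
qed

lemma top_generator_mem: "top_generator p ordp u \<Longrightarrow> u \<in> K"
proof -
  assume "top_generator p ordp u"
  then obtain z where "z \<in> val_closure ordp \<int>" "u = 1 + 2 * of_nat p * z"
    unfolding top_generator_def Let_def by blast
  then have "u = 1 + of_nat (2 * p) * z" "z \<in> K" using val_closure_Ints_mem by auto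
  then show ?thesis using one_mem of_nat_mem by (auto intro!: add_mem mult_mem simp del: of_nat_mult)
qed

lemma powi_mem: "x \<in> K \<Longrightarrow> x powi w \<in> K"
  by (auto simp: power_int_def power_inverse intro!: power_mem inverse_mem)

definition coeffs_in :: "'c poly \<Rightarrow> bool" where "coeffs_in f \<longleftrightarrow> (\<forall>i. Polynomial.coeff f i \<in> K)"

lemma coeffs_in_prod: "(\<And>w. w \<in> W \<Longrightarrow> coeffs_in (f w)) \<Longrightarrow> coeffs_in (\<Prod>w\<in>W. f w)"
proof (induction W rule: infinite_finite_induct)
  case (insert w W)
  then have "coeffs_in (f w)" "coeffs_in (\<Prod>w\<in>W. f w)" by auto
  then have "coeffs_in (f w * (\<Prod>w\<in>W. f w))"
    unfolding coeffs_in_def coeff_mult by (intro allI sum_mem mult_mem) auto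
  then show ?case using insert.hyps by simp
qed (simp_all add: coeffs_in_def Polynomial.coeff_1)

lemma rem_coeff_mem: "(\<And>j. \<Omega> j \<in> K) \<Longrightarrow> rem_coeff N \<Omega> m j \<in> K"
  by (induction m arbitrary: j) (auto intro!: diff_mem uminus_mem mult_mem)

text \<open>
  A relation between the rows \<open>b ^ k\<close>, for \<open>k < N\<close>, of the Vandermonde matrix is a polynomial of
  degree below \<open>N\<close> with \<open>N\<close> roots.
\<close>

lemma vandermonde_dual:
  assumes L: "fdalg K L" and B: "finite B" "B \<subseteq> L" "card B = N"
  obtains c where "\<And>j b. j < N \<Longrightarrow> b \<in> B \<Longrightarrow> c j b \<in> L"
    "\<And>j k. j < N \<Longrightarrow> k < N \<Longrightarrow> (\<Sum>b\<in>B. c j b * b ^ k) = (if j = k then 1 else 0)"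
proof -
  interpret L: subring_of L by (rule fdalg_subring[OF L])
  have "\<exists>c \<delta>. \<delta> \<in> L \<and> \<delta> \<noteq> 0 \<and> (\<forall>i\<in>{..<N}. \<forall>e\<in>B. c i e \<in> L) \<and>
    (\<forall>i\<in>{..<N}. \<forall>k\<in>{..<N}. (\<Sum>e\<in>B. e ^ i * c k e) = (if i = k then \<delta> else 0))"
  proof (rule L.dual_family[OF _ B(1)])
    show "e ^ i \<in> L" if "e \<in> B" for e and i :: nat using that B(2) by (intro L.power_mem) auto
    fix a assume a: "\<And>e. e \<in> B \<Longrightarrow> (\<Sum>i\<in>{..<N}. a i * e ^ i) = 0"
    define q where "q = (\<Sum>i<N. Polynomial.monom (a i) i)"
    have cq: "Polynomial.coeff q n = (if n < N then a n else 0)" for n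
      by (simp add: q_def coeff_sum if_distrib cong: if_cong)
    have "q = 0"
    proof (rule ccontr)
      assume q: "q \<noteq> 0"
      have "B \<subseteq> {x. Polynomial.poly q x = 0}" using a by (auto simp: q_def poly_sum poly_monom)
      then have "card B \<le> card {x. Polynomial.poly q x = 0}" using poly_roots_finite[OF q] by (rule card_mono[rotated])
      also have "\<dots> \<le> Polynomial.degree q" by (rule card_poly_roots_bound[OF q])
      also have "\<dots> < N"
      proof (rule ccontr)
        assume "\<not> Polynomial.degree q < N"
        then have "Polynomial.coeff q (Polynomial.degree q) = 0" by (simp add: cq)
        then show False using q by simp
      qed
      finally show False using B(3) by simp
    qed
    then have "Polynomial.coeff q n = 0" for n by simp
    then show "\<forall>i\<in>{..<N}. a i = 0" using cq by (metis lessThan_iff)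
  qed simp
  then obtain c \<delta> where c: "\<delta> \<in> L" "\<delta> \<noteq> 0" "\<forall>i\<in>{..<N}. \<forall>e\<in>B. c i e \<in> L"
    "\<forall>i\<in>{..<N}. \<forall>k\<in>{..<N}. (\<Sum>e\<in>B. e ^ i * c k e) = (if i = k then \<delta> else 0)" by blast
  show thesis
  proof (rule that[of "\<lambda>j b. inverse \<delta> * c j b"])
    show "inverse \<delta> * c j b \<in> L" if "j < N" "b \<in> B" for j b
      using c(3) that fdalg_inverse[OF L c(1)] by (intro L.mult_mem) auto
    show "(\<Sum>b\<in>B. inverse \<delta> * c j b * b ^ k) = (if j = k then 1 else 0)" if "j < N" "k < N" for j k
    proof -
      have "(\<Sum>b\<in>B. inverse \<delta> * c j b * b ^ k) = inverse \<delta> * (\<Sum>b\<in>B. b ^ k * c j b)"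
        by (simp add: sum_distrib_left mult_ac)
      also have "(\<Sum>b\<in>B. b ^ k * c j b) = (if k = j then \<delta> else 0)" using c(4) that by simp
      finally show ?thesis using c(2) by auto
    qed
  qed
qed

context
  fixes u :: 'c and n :: nat
  assumes u: "top_generator p ordp u"
begin

abbreviation "P \<equiv> p ^ n"

text \<open>
  The polynomial whose roots are the points \<open>u powi w * \<epsilon> - 1\<close> with \<open>\<epsilon> ^ P = 1\<close>.
\<close>

definition fac :: "int \<Rightarrow> 'c poly" where "fac w = [:1, 1:] ^ P - [:(u powi w) ^ P:]"

lemma P_pos: "P > 0" using prime_gt_0_nat[OF prime_p] by simp

lemma coeff_fac: "Polynomial.coeff (fac w) i = of_nat (P choose i) - (if i = 0 then (u powi w) ^ P else 0)"
proof -
  have "Polynomial.coeff ([:1, 1:] ^ P :: 'c poly) i = of_nat (P choose i)"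
  proof (cases "i \<le> P")
    case True
    then show ?thesis using coeff_linear_poly_power[OF True, of "1::'c" 1] by simp
  next
    case False
    then have "Polynomial.coeff ([:1, 1:] ^ P :: 'c poly) i = 0"
      by (intro coeff_eq_0) (simp add: degree_linear_power)
    then show ?thesis using False by (simp add: binomial_eq_0)
  qed
  then show ?thesis by (simp add: fac_def coeff_pCons split: nat.split)
qed

lemma degree_fac: "Polynomial.degree (fac w) = P" and lead_fac: "Polynomial.coeff (fac w) P = 1"
proof -
  show 1: "Polynomial.coeff (fac w) P = 1" using P_pos by (simp add: coeff_fac)
  have "Polynomial.degree (fac w) \<le> P" by (rule degree_le) (auto simp: coeff_fac binomial_eq_0)
  moreover have "P \<le> Polynomial.degree (fac w)" by (rule le_degree) (simp add: 1)
  ultimately show "Polynomial.degree (fac w) = P" by simp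
qed

lemma fac_nonzero: "fac w \<noteq> 0" using lead_fac[of w] by auto

lemma coeff_fac_0_ord: "ereal (real n + 1) \<le> ordp (Polynomial.coeff (fac w) 0)"
proof -
  have "ereal (real n + 1) \<le> ordp ((u powi w) ^ P - 1)"
    by (rule unit_power_p_power_minus_1[OF u_powi_minus_1[OF u]])
  also have "(u powi w) ^ P - 1 = - Polynomial.coeff (fac w) 0" by (simp add: coeff_fac)
  finally show ?thesis by simp
qed

text \<open>
  This estimate measures the gain from each factor: it is as small as \<open>p ^ n\<close>, apart from the loss
  of one unit per degree.
\<close>

lemma gauss_fac_1: "gauss_ge 1 (real n) (fac w)"
  unfolding gauss_ge_def
proof
  fix i :: nat
  show "ereal (real n - real i * 1) \<le> ordp (Polynomial.coeff (fac w) i)"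
  proof (cases "i = 0")
    case True
    then show ?thesis using coeff_fac_0_ord[of w] by (simp add: order_trans[rotated])
  next
    case False
    then show ?thesis using ord_binomial[of i n] by (simp add: coeff_fac)
  qed
qed

text \<open>
  For \<open>\<rho> = 1 / P\<close> the factor is no larger than its leading term \<open>X ^ P\<close>, as the intermediate
  binomial coefficients are divisible by \<open>p\<close>; so reduction modulo it preserves weights.
\<close>

lemma gauss_fac_P: "gauss_ge (1 / real P) 1 (fac w)"
  unfolding gauss_ge_def
proof
  fix i :: nat
  consider "i = 0" | "0 < i" "i < P" | "i \<ge> P" "i > 0" by linarith
  then show "ereal (1 - real i * (1 / real P)) \<le> ordp (Polynomial.coeff (fac w) i)"
  proof cases
    case 1
    have "ereal (1 - real i * (1 / real P)) \<le> ereal (real n + 1)" using 1 by simp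
    also have "\<dots> \<le> ordp (Polynomial.coeff (fac w) i)" unfolding 1 by (rule coeff_fac_0_ord)
    finally show ?thesis .
  next
    case 2
    have "ereal (1 - real i * (1 / real P)) \<le> 1" by (simp add: one_ereal_def)
    also have "\<dots> \<le> ordp (Polynomial.coeff (fac w) i)" using ord_binomial_ge_1[OF 2] 2 by (simp add: coeff_fac)
    finally show ?thesis .
  next
    case 3
    have "real P \<le> real i" using 3(1) by (simp only: of_nat_le_iff)
    moreover have "real P > 0" using P_pos by (simp only: of_nat_0_less_iff)
    ultimately have "1 \<le> real i * (1 / real P)" by (simp add: field_simps)
    then have "ereal (1 - real i * (1 / real P)) \<le> 0" by (simp add: zero_ereal_def)
    also have "0 \<le> ordp (Polynomial.coeff (fac w) i)" using 3 ge_of_nat by (simp add: coeff_fac)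
    finally show ?thesis .
  qed
qed

lemma coeffs_fac: "coeffs_in (fac w)"
  unfolding coeffs_in_def coeff_fac
  using top_generator_mem[OF u] by (auto intro!: diff_mem of_nat_mem power_mem powi_mem)

lemma poly_fac: "Polynomial.poly (fac w) x = (1 + x) ^ P - (u powi w) ^ P"
  by (simp add: fac_def add.commute)

lemma card_roots_fac: "card {x. Polynomial.poly (fac w) x = 0} = P"
proof -
  have "card {x. Polynomial.poly (fac w) x = 0} = Polynomial.degree (fac w)"
  proof (rule card_roots_if_squarefree[OF fac_nonzero])
    fix x assume "Polynomial.poly (fac w) x = 0"
    then have "(1 + x) ^ P = (u powi w) ^ P" by (simp add: poly_fac)
    then have "1 + x \<noteq> 0" using u_nonzero[OF u] P_pos by (metis power_int_eq_0_iff power_eq_0_iff)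
    moreover have "Polynomial.poly (pderiv (fac w)) x = of_nat P * (1 + x) ^ (P - 1)"
      by (simp add: fac_def pderiv_diff pderiv_power pderiv_pCons add.commute)
    moreover have "(of_nat P :: 'c) \<noteq> 0" using P_pos by (simp only: of_nat_eq_0_iff)
    ultimately show "Polynomial.poly (pderiv (fac w)) x \<noteq> 0" by simp
  qed
  then show ?thesis by (simp add: degree_fac)
qed

lemma root_fac:
  assumes x: "Polynomial.poly (fac w) x = 0"
  shows "\<exists>\<epsilon>\<in>mu_p_inf p. x = u powi w * \<epsilon> - 1"
    and "x \<in> alg_closure_in K"
    and "ereal (1 / real P) \<le> ordp x"
proof -
  have eq: "(1 + x) ^ P = (u powi w) ^ P" using x by (simp add: poly_fac)
  have u0: "u powi w \<noteq> 0" using u_nonzero[OF u] by simp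
  let ?e = "(1 + x) / u powi w"
  have "?e ^ P = 1" unfolding power_divide eq using u0 by simp
  then have "?e \<in> mu_p_inf p" unfolding mu_p_inf_def by blast
  moreover have "x = u powi w * ?e - 1" using u0 by simp
  ultimately show "\<exists>\<epsilon>\<in>mu_p_inf p. x = u powi w * \<epsilon> - 1" by blast
  show "x \<in> alg_closure_in K"
    unfolding alg_closure_in_def using fac_nonzero[of w] coeffs_fac[of w] x unfolding coeffs_in_def by blast
  show "ereal (1 / real P) \<le> ordp x"
  proof (rule ccontr)
    assume n: "\<not> ereal (1 / real P) \<le> ordp x"
    have "x \<noteq> 0"
    proof
      assume "x = 0"
      then have "ordp x = \<infinity>" by simp
      then show False using n by simp
    qed
    then obtain r where r: "ordp x = ereal r" using ord_finite by blast
    have rP: "r < 1 / real P" using n unfolding r by simp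
    have P0: "real P > 0" using P_pos by (simp only: of_nat_0_less_iff)
    define \<delta> where "\<delta> = 1 / real P - r"
    have \<delta>: "\<delta> > 0" using rP by (simp add: \<delta>_def)
    have "0 = (\<Sum>i\<le>P. Polynomial.coeff (fac w) i * x ^ i)" using x by (simp add: poly_altdef degree_fac)
    also have "\<dots> = (\<Sum>i<P. Polynomial.coeff (fac w) i * x ^ i) + x ^ P"
      by (simp add: lessThan_Suc_atMost[symmetric] lead_fac)
    finally have xP: "x ^ P = - (\<Sum>i<P. Polynomial.coeff (fac w) i * x ^ i)"
      by (simp add: eq_neg_iff_add_eq_0 add.commute)
    have "ereal (real P * r + \<delta>) \<le> ordp (\<Sum>i<P. Polynomial.coeff (fac w) i * x ^ i)"
    proof (rule ge_sum)
      fix i assume "i \<in> {..<P}"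
      then have iP: "i < P" by simp
      have "ereal ((1 - real i * (1 / real P)) + real i * r) \<le> ordp (Polynomial.coeff (fac w) i * x ^ i)"
      proof (rule ge_mult)
        show "ereal (1 - real i * (1 / real P)) \<le> ordp (Polynomial.coeff (fac w) i)"
          using gauss_fac_P[of w] unfolding gauss_ge_def by blast
        show "ereal (real i * r) \<le> ordp (x ^ i)" using ord_power_eq[OF r, of i] by simp
      qed
      moreover have "real P * r + \<delta> \<le> (1 - real i * (1 / real P)) + real i * r"
      proof -
        have "real i + 1 \<le> real P" using iP by (metis Suc_leI of_nat_Suc of_nat_le_iff add.commute)
        then have "1 * \<delta> \<le> (real P - real i) * \<delta>" using \<delta> by (intro mult_right_mono) auto
        moreover have "(real P - real i) * \<delta> = 1 - real i * (1 / real P) - real P * r + real i * r"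
          using P0 by (simp add: \<delta>_def algebra_simps)
        ultimately show ?thesis by linarith
      qed
      ultimately show "ereal (real P * r + \<delta>) \<le> ordp (Polynomial.coeff (fac w) i * x ^ i)"
        by (meson ereal_less_eq(3) order_trans)
    qed
    then have "ereal (real P * r + \<delta>) \<le> ordp (x ^ P)" unfolding xP by simp
    then show False unfolding ord_power_eq[OF r] using \<delta> by simp
  qed
qed

text \<open>
  The modulus is the product of the factors for \<open>s\<close> consecutive weights. The two estimates of the
  factors give the two hypotheses of \<open>rem_coeff_ord_high\<close>, with \<open>\<rho> = 1 / P\<close> and \<open>A = s * n\<close>.
\<close>

theorem interpolation_points:
  fixes s :: nat and d :: int
  assumes s: "s \<ge> 1"
  obtains B r where "finite B" "card B = s * P"
    "\<And>x. x \<in> B \<Longrightarrow> \<exists>w \<epsilon>. d \<le> w \<and> w < d + int s \<and> \<epsilon> \<in> mu_p_inf p \<and> x = u powi w * \<epsilon> - 1"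
    "\<And>x. x \<in> B \<Longrightarrow> x \<in> alg_closure_in K" "\<And>x. x \<in> B \<Longrightarrow> ereal (1 / real P) \<le> ordp x"
    "\<And>m j. r m j \<in> K" "\<And>m j. m < s * P \<Longrightarrow> j < s * P \<Longrightarrow> r m j = (if j = m then 1 else 0)"
    "\<And>x m. x \<in> B \<Longrightarrow> (\<Sum>j<s * P. r m j * x ^ j) = x ^ m"
    "\<And>m j. s * P \<le> m \<Longrightarrow> j < s * P \<Longrightarrow>
       ereal ((real m - real (s * P) - real j) * (1 / real P) + real s * real n - real j) \<le> ordp (r m j)"
proof -
  let ?W = "{d..<d + int s}"
  let ?N = "s * P"
  define Q where "Q = (\<Prod>w\<in>?W. fac w)"
  define B where "B = (\<Union>w\<in>?W. {x. Polynomial.poly (fac w) x = 0})"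
  define r where "r = rem_coeff ?N (Polynomial.coeff Q)"
  have cW: "card ?W = s" by simp
  have N1: "?N \<ge> 1" using s P_pos by (simp add: Suc_le_eq)
  have P0: "real P > 0" using P_pos by (simp only: of_nat_0_less_iff)
  have degQ: "Polynomial.degree Q = ?N"
    unfolding Q_def using fac_nonzero by (subst degree_prod_eq_sum_degree) (auto simp: degree_fac cW)
  have leadQ: "Polynomial.coeff Q ?N = 1"
    using lead_coeff_prod[of fac ?W] lead_fac by (simp add: degree_fac degQ[symmetric]) (simp add: Q_def)
  have fB: "finite B" unfolding B_def using poly_roots_finite[OF fac_nonzero] by blast
  have "card B = (\<Sum>w\<in>?W. card {x. Polynomial.poly (fac w) x = 0})"
    unfolding B_def
  proof (rule card_UN_disjoint)
    show "\<forall>i\<in>?W. \<forall>j\<in>?W. i \<noteq> j \<longrightarrow> {x. Polynomial.poly (fac i) x = 0} \<inter> {x. Polynomial.poly (fac j) x = 0} = {}"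
    proof (intro ballI impI)
      fix i j :: int assume ij: "i \<noteq> j"
      show "{x. Polynomial.poly (fac i) x = 0} \<inter> {x. Polynomial.poly (fac j) x = 0} = {}"
      proof (rule ccontr)
        assume "{x. Polynomial.poly (fac i) x = 0} \<inter> {x. Polynomial.poly (fac j) x = 0} \<noteq> {}"
        then obtain x where "Polynomial.poly (fac i) x = 0" "Polynomial.poly (fac j) x = 0" by blast
        then have "(u powi i) ^ P = (u powi j) ^ P" by (simp add: poly_fac)
        then show False using u_powi_inj[OF u P_pos] ij by blast
      qed
    qed
  qed (use poly_roots_finite[OF fac_nonzero] in auto)
  then have cB: "card B = ?N" by (simp add: card_roots_fac)
  have gP: "gauss_ge (1 / real P) (real s * 1) Q" and g1: "gauss_ge 1 (real s * real n) Q"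
    using gauss_ge_prod[of ?W "1 / real P" 1 fac] gauss_ge_prod[of ?W 1 "real n" fac] gauss_fac_P gauss_fac_1
    by (simp_all add: Q_def)
  have \<Omega>: "ereal ((real ?N - real j) * (1 / real P)) \<le> ordp (Polynomial.coeff Q j)" for j
  proof -
    have "(real ?N - real j) * (1 / real P) = real s * 1 - real j * (1 / real P)"
      using P0 by (simp add: field_simps)
    then show ?thesis using gP unfolding gauss_ge_def by simp
  qed
  have A: "ereal (real s * real n - real j) \<le> ordp (Polynomial.coeff Q j)" for j
    using g1 unfolding gauss_ge_def by simp
  show thesis
  proof (rule that[of B r])
    show "finite B" "card B = ?N" by fact+
    fix x assume x: "x \<in> B"
    then obtain w where w: "w \<in> ?W" "Polynomial.poly (fac w) x = 0" unfolding B_def by blast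
    show "\<exists>w \<epsilon>. d \<le> w \<and> w < d + int s \<and> \<epsilon> \<in> mu_p_inf p \<and> x = u powi w * \<epsilon> - 1"
      using root_fac(1)[OF w(2)] w(1) by auto
    show "x \<in> alg_closure_in K" by (rule root_fac(2)[OF w(2)])
    show "ereal (1 / real P) \<le> ordp x" by (rule root_fac(3)[OF w(2)])
    fix m :: nat
    have "Polynomial.poly Q x = 0" unfolding Q_def poly_prod using w by (intro prod_zero) auto
    then have "(\<Sum>i\<le>?N. Polynomial.coeff Q i * x ^ i) = 0" by (simp add: poly_altdef degQ)
    then have "x ^ ?N + (\<Sum>j<?N. Polynomial.coeff Q j * x ^ j) = 0"
      using leadQ by (simp add: lessThan_Suc_atMost[symmetric] add.commute)
    then show "(\<Sum>j<?N. r m j * x ^ j) = x ^ m" unfolding r_def by (rule rem_coeff_eval[OF N1])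
  next
    have "coeffs_in Q" unfolding Q_def by (rule coeffs_in_prod) (rule coeffs_fac)
    then show "r m j \<in> K" for m j unfolding r_def by (intro rem_coeff_mem) (simp add: coeffs_in_def)
    show "r m j = (if j = m then 1 else 0)" if "m < ?N" "j < ?N" for m j
      unfolding r_def by (rule rem_coeff_low[OF that])
    fix m j assume mj: "?N \<le> m" "j < ?N"
    have "ereal ((real (m - ?N) - real j) * (1 / real P) + real s * real n - real j) \<le> ordp (rem_coeff ?N (Polynomial.coeff Q) (?N + (m - ?N)) j)"
      by (rule rem_coeff_ord_high[OF N1 _ \<Omega> A mj(2)]) simp
    then show "ereal ((real m - real ?N - real j) * (1 / real P) + real s * real n - real j) \<le> ordp (r m j)"
      using mj(1) by (simp add: r_def of_nat_diff)
  qed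
qed

end

end

section \<open>Uniqueness: a bounded-growth series vanishing at all arithmetic points is zero\<close>

context complete_subfield
begin

text \<open>
  Some coordinate of \<open>1\<close> in a basis of \<open>L\<close> is nonzero; the corresponding coordinate function is
  rescaled.
\<close>

lemma ex_normalised_functional:
  assumes L: "fdalg K L"
  obtains \<nu> where "klinear K L \<nu>" "\<And>x. x \<in> K \<Longrightarrow> \<nu> x = x"
proof -
  obtain B where B: "finite B" "L = fdspan K B" "1 \<in> L" using L unfolding fdalg_def by blast
  obtain A where A: "finite A" "kindep K A" "fdspan K A = fdspan K B" by (rule fdspan_basis[OF B(1)]) (rule that)
  have LA: "L = fdspan K A" using A B by simp
  obtain co where co': "\<And>b. b \<in> A \<Longrightarrow> klinear K (fdspan K A) (co b)"
    "\<And>x. x \<in> fdspan K A \<Longrightarrow> x = (\<Sum>b\<in>A. co b x * b)"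
    by (rule kindep_coords[OF A(1,2)]) (rule that)
  note co = co'[folded LA]
  have "\<exists>b\<in>A. co b 1 \<noteq> 0"
  proof (rule ccontr)
    assume "\<not> ?thesis"
    then have "(\<Sum>b\<in>A. co b 1 * b) = 0" by (intro sum.neutral) auto
    then show False using co(2)[OF B(3)] by simp
  qed
  then obtain b where b: "b \<in> A" "co b 1 \<noteq> 0" by blast
  note kl = co(1)[OF b(1)]
  have c1: "co b 1 \<in> K" using kl B(3) unfolding klinear_def by blast
  show thesis
  proof (rule that)
    show "klinear K L (\<lambda>x. inverse (co b 1) * co b x)"
      using kl inverse_mem[OF c1] mult_mem unfolding klinear_def
      by (simp add: distrib_left mult.left_commute)
    fix x assume x: "x \<in> K"
    have "co b (x * 1) = x * co b 1" using kl x B(3) unfolding klinear_def by blast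
    then show "inverse (co b 1) * co b x = x" using b(2) by simp
  qed
qed

end

context valued_module
begin

text \<open>
  Vanishing of \<open>g(b)\<close> in terms of functionals. It is demanded over all sufficiently large finite
  extensions \<open>L\<close>, so that finitely many points can be treated over a common one.
\<close>

definition vanishes_at :: "('n::finite \<Rightarrow> 'c) \<Rightarrow> (('n \<Rightarrow> nat) \<Rightarrow> 'm) \<Rightarrow> bool" where
  "vanishes_at b g \<longleftrightarrow> (\<exists>G. finite G \<and> G \<subseteq> alg_closure_in K \<and>
     (\<forall>L \<mu>. fdalg K L \<longrightarrow> G \<subseteq> L \<longrightarrow> range b \<subseteq> L \<longrightarrow> klinear K L \<mu> \<longrightarrow>
        has_vsum (\<lambda>n. \<mu> (mon b n) \<odot> g n) \<zero>))"

lemma has_vsum_zero_combination: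
  assumes A: "finite A" and L: "fdalg K L" and \<mu>: "klinear K L \<mu>" and g: "\<And>n. g n \<in> carrier M"
    and wL: "\<And>b n. b \<in> A \<Longrightarrow> w b n \<in> L"
    and z: "\<And>b. b \<in> A \<Longrightarrow> has_vsum (\<lambda>n. \<mu> (w b n) \<odot> g n) \<zero>"
  shows "has_vsum (\<lambda>n. \<mu> (\<Sum>b\<in>A. w b n) \<odot> g n) \<zero>"
  using A wL z
proof (induction A rule: finite_induct)
  case empty
  interpret L: subring_of L by (rule fdalg_subring[OF L])
  have "\<mu> (0 * 0) = 0 * \<mu> 0" using \<mu> L.zero_mem zero_mem unfolding klinear_def by blast
  then have z: "\<mu> 0 = 0" by simp
  have "\<mu> 0 \<odot> g n = \<zero>" for n using Mod.smult_l_null[OF g[of n]] unfolding z by simp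
  then show ?case using has_vsum_zero by simp
next
  case (insert b A)
  interpret L: subring_of L by (rule fdalg_subring[OF L])
  have sL: "(\<Sum>b\<in>A. w b n) \<in> L" for n by (rule L.sum_mem) (use insert.prems in blast)
  have bL: "w b n \<in> L" for n using insert.prems by blast
  have K: "\<mu> (w b n) \<in> K" "\<mu> (\<Sum>b\<in>A. w b n) \<in> K" for n using \<mu> sL bL unfolding klinear_def by blast+
  have "has_vsum (\<lambda>n. \<mu> (w b n) \<odot> g n \<oplus> \<mu> (\<Sum>b\<in>A. w b n) \<odot> g n) (\<zero> \<oplus> \<zero>)"
  proof (rule has_vsum_add)
    show "has_vsum (\<lambda>n. \<mu> (w b n) \<odot> g n) \<zero>" using insert.prems(2) by blast
    show "has_vsum (\<lambda>n. \<mu> (\<Sum>b\<in>A. w b n) \<odot> g n) \<zero>" by (rule insert.IH) (use insert.prems in blast)+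
  qed (use K g in auto)
  moreover have "\<mu> (w b n) \<odot> g n \<oplus> \<mu> (\<Sum>b\<in>A. w b n) \<odot> g n = \<mu> (\<Sum>b\<in>insert b A. w b n) \<odot> g n" for n
  proof -
    have "\<mu> (\<Sum>b\<in>insert b A. w b n) = \<mu> (w b n) + \<mu> (\<Sum>b\<in>A. w b n)"
      using \<mu> bL sL insert.hyps unfolding klinear_def by simp
    then show ?thesis using Mod.smult_l_distr[of "\<mu> (w b n)" "\<mu> (\<Sum>b\<in>A. w b n)" "g n"] K g by simp
  qed
  ultimately show ?case by simp
qed

text \<open>
  The equations \<open>\<Sum>m. b\<^sup>m g\<^sub>m = 0\<close> for the points \<open>b\<close> of a grid are combined with the products of
  the weights from \<open>vandermonde_dual\<close>. The weights lie in an extension of \<open>K\<close>, but the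
  coefficients of the combination lie in \<open>K\<close>, where the normalised functional is the identity.
\<close>

lemma interpolated_relation:
  fixes g :: "('n::finite \<Rightarrow> nat) \<Rightarrow> 'm" and B :: "'n \<Rightarrow> 'c set" and N :: "'n \<Rightarrow> nat"
  assumes g: "\<And>n. g n \<in> carrier M"
    and B: "\<And>i. finite (B i)" "\<And>i. card (B i) = N i" "\<And>i. B i \<subseteq> alg_closure_in K"
    and r: "\<And>i m j. r i m j \<in> K" "\<And>i m x. x \<in> B i \<Longrightarrow> (\<Sum>j<N i. r i m j * x ^ j) = x ^ m"
    and van: "\<And>b. (\<And>i. b i \<in> B i) \<Longrightarrow> vanishes_at b g"
    and j: "\<And>i. j i < N i"
  shows "has_vsum (\<lambda>m. (\<Prod>i\<in>UNIV. r i (m i) (j i)) \<odot> g m) \<zero>"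
proof -
  let ?A = "PiE UNIV B"
  have fA: "finite ?A" by (rule finite_PiE) (use B in auto)
  define Q where "Q b G \<longleftrightarrow> finite G \<and> G \<subseteq> alg_closure_in K \<and>
     (\<forall>L \<mu>. fdalg K L \<longrightarrow> G \<subseteq> L \<longrightarrow> range b \<subseteq> L \<longrightarrow> klinear K L \<mu> \<longrightarrow>
        has_vsum (\<lambda>n. \<mu> (mon b n) \<odot> g n) \<zero>)" for b G
  have "\<forall>b\<in>?A. \<exists>G. Q b G"
  proof
    fix b assume "b \<in> ?A"
    then have "vanishes_at b g" by (intro van) (simp add: PiE_iff)
    then show "\<exists>G. Q b G" unfolding vanishes_at_def Q_def .
  qed
  from bchoice[OF this] obtain G where QG: "\<forall>b\<in>?A. Q b (G b)" by (rule exE)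
  have G: "finite (G b)" "G b \<subseteq> alg_closure_in K"
     "fdalg K L \<Longrightarrow> G b \<subseteq> L \<Longrightarrow> range b \<subseteq> L \<Longrightarrow> klinear K L \<mu> \<Longrightarrow>
        has_vsum (\<lambda>n. \<mu> (mon b n) \<odot> g n) \<zero>" if "b \<in> ?A" for b L \<mu>
    using bspec[OF QG that] unfolding Q_def by simp_all
  have fin: "finite ((\<Union>b\<in>?A. G b) \<union> (\<Union>i. B i))" using fA B(1) G(1) by simp
  have sub: "(\<Union>b\<in>?A. G b) \<union> (\<Union>i. B i) \<subseteq> alg_closure_in K" using G(2) B(3) by (intro Un_least UN_least) simp_all
  obtain L where L: "fdalg K L" "(\<Union>b\<in>?A. G b) \<union> (\<Union>i. B i) \<subseteq> L"
    by (rule fdalg_finite_subset[OF fin sub]) (rule that)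
  interpret L: subring_of L by (rule fdalg_subring[OF L(1)])
  obtain \<nu> where \<nu>: "klinear K L \<nu>" "\<And>x. x \<in> K \<Longrightarrow> \<nu> x = x"
    by (rule ex_normalised_functional[OF L(1)]) (rule that)
  have ex: "\<exists>c. (\<forall>b\<in>B i. c b \<in> L) \<and> (\<forall>k<N i. (\<Sum>b\<in>B i. c b * b ^ k) = (if j i = k then 1 else 0))" for i
  proof -
    have BL: "B i \<subseteq> L" using L(2) by blast
    obtain c where c: "\<And>j b. j < N i \<Longrightarrow> b \<in> B i \<Longrightarrow> c j b \<in> L"
      "\<And>j k. j < N i \<Longrightarrow> k < N i \<Longrightarrow> (\<Sum>b\<in>B i. c j b * b ^ k) = (if j = k then 1 else 0)"
      by (rule vandermonde_dual[OF L(1) B(1) BL B(2)]) (rule that)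
    show "\<exists>c. (\<forall>b\<in>B i. c b \<in> L) \<and> (\<forall>k<N i. (\<Sum>b\<in>B i. c b * b ^ k) = (if j i = k then 1 else 0))"
      by (rule exI[of _ "c (j i)"]) (use c j in auto)
  qed
  have "\<exists>c. \<forall>i. (\<forall>b\<in>B i. c i b \<in> L) \<and> (\<forall>k<N i. (\<Sum>b\<in>B i. c i b * b ^ k) = (if j i = k then 1 else 0))"
    by (rule choice) (use ex in blast)
  then obtain c where c: "\<And>i b. b \<in> B i \<Longrightarrow> c i b \<in> L"
    "\<And>i k. k < N i \<Longrightarrow> (\<Sum>b\<in>B i. c i b * b ^ k) = (if j i = k then 1 else 0)" by blast
  have c_r: "(\<Sum>x\<in>B i. c i x * x ^ m) = r i m (j i)" for i m
  proof -
    have "(\<Sum>x\<in>B i. c i x * x ^ m) = (\<Sum>x\<in>B i. \<Sum>k<N i. r i m k * (c i x * x ^ k))"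
      by (rule sum.cong) (simp_all add: r(2)[symmetric] sum_distrib_left mult.left_commute)
    also have "\<dots> = (\<Sum>k<N i. r i m k * (\<Sum>x\<in>B i. c i x * x ^ k))"
      by (subst sum.swap) (simp add: sum_distrib_left)
    also have "\<dots> = (\<Sum>k<N i. if j i = k then r i m k else 0)"
      by (rule sum.cong) (auto simp: c(2))
    also have "\<dots> = r i m (j i)" using j[of i] by simp
    finally show ?thesis .
  qed
  define w where "w b m = (\<Prod>i\<in>UNIV. c i (b i)) * mon b m" for b :: "'n \<Rightarrow> 'c" and m
  have bB: "b i \<in> B i" if "b \<in> ?A" for b i using that by (auto simp: PiE_iff)
  have bL: "range b \<subseteq> L" if "b \<in> ?A" for b using bB[OF that] L(2) by blast
  have cL: "(\<Prod>i\<in>UNIV. c i (b i)) \<in> L" if "b \<in> ?A" for b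
    by (rule L.prod_mem) (use bB[OF that] c(1) in blast)
  have mL: "mon b m \<in> L" if "b \<in> ?A" for b m
    unfolding mon_def by (intro L.prod_mem L.power_mem) (use bL[OF that] in blast)
  have "has_vsum (\<lambda>m. \<nu> (\<Sum>b\<in>?A. w b m) \<odot> g m) \<zero>"
  proof (rule has_vsum_zero_combination[OF fA L(1) \<nu>(1) g])
    fix b assume b: "b \<in> ?A"
    show "w b m \<in> L" for m unfolding w_def using cL[OF b] mL[OF b] by (rule L.mult_mem)
    have "klinear K L (\<lambda>x. \<nu> ((\<Prod>i\<in>UNIV. c i (b i)) * x))"
      using \<nu>(1) cL[OF b] L.mult_mem fdalg_superset[OF L(1)] unfolding klinear_def
      by (auto simp: distrib_left mult.left_commute subset_iff)
    then show "has_vsum (\<lambda>m. \<nu> (w b m) \<odot> g m) \<zero>"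
      unfolding w_def by (intro G(3)[OF b L(1) _ bL[OF b], of "\<lambda>x. \<nu> ((\<Prod>i\<in>UNIV. c i (b i)) * x)"]) (use L(2) b in auto)
  qed
  moreover have "\<nu> (\<Sum>b\<in>?A. w b m) = (\<Prod>i\<in>UNIV. r i (m i) (j i))" for m
  proof -
    have "(\<Sum>b\<in>?A. w b m) = (\<Sum>b\<in>?A. \<Prod>i\<in>UNIV. c i (b i) * b i ^ m i)"
      unfolding w_def mon_def by (simp add: prod.distrib)
    also have "\<dots> = (\<Prod>i\<in>UNIV. \<Sum>x\<in>B i. c i x * x ^ m i)"
      by (rule prod_sum_PiE[symmetric]) (use B in auto)
    also have "\<dots> = (\<Prod>i\<in>UNIV. r i (m i) (j i))" unfolding c_r ..
    finally have e: "(\<Sum>b\<in>?A. w b m) = (\<Prod>i\<in>UNIV. r i (m i) (j i))" .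
    show ?thesis unfolding e by (rule \<nu>(2)) (intro prod_mem r(1))
  qed
  ultimately show ?thesis by simp
qed

lemma has_vsum_zero_isolate:
  assumes f: "has_vsum f \<zero>" "\<And>m. f m \<in> carrier M" and others: "\<And>m. m \<noteq> j \<Longrightarrow> ereal Z \<le> v (f m)"
  shows "ereal Z \<le> v (f j)"
proof -
  obtain F0 where F0: "finite F0"
    "\<And>F. finite F \<Longrightarrow> F0 \<subseteq> F \<Longrightarrow> ereal Z \<le> v ((\<Oplus>m\<in>F. f m) \<ominus> \<zero>)"
    by (rule has_vsumD[OF f(1), where C = Z]) (rule that)
  let ?F = "insert j F0"
  let ?S = "\<Oplus>m\<in>F0 - {j}. f m"
  have S: "?S \<in> carrier M" by (rule Mod.M.finsum_closed) (use f(2) in auto)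
  have "(\<Oplus>m\<in>insert j (F0 - {j}). f m) = f j \<oplus> ?S"
    by (rule Mod.M.finsum_insert) (use f(2) F0(1) in auto)
  moreover have "insert j (F0 - {j}) = ?F" by blast
  moreover have mz: "x \<ominus> \<zero> = x" if "x \<in> carrier M" for x using that by (simp add: a_minus_def)
  moreover have "ereal Z \<le> v ((\<Oplus>m\<in>?F. f m) \<ominus> \<zero>)" by (rule F0(2)) (use F0(1) in auto)
  ultimately have "ereal Z \<le> v (f j \<oplus> ?S)" using f(2)[of j] S by (simp only: mz Mod.M.a_closed)
  moreover have "ereal Z \<le> v ?S" by (rule v_ge_finsum) (use f(2) others in auto)
  ultimately have "ereal Z \<le> v ((f j \<oplus> ?S) \<ominus> ?S)" using f(2) S by (intro v_ge_minus) auto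
  also have "(f j \<oplus> ?S) \<ominus> ?S = f j"
    using f(2)[of j] S by (simp add: a_minus_def Mod.M.a_assoc Mod.M.r_neg)
  finally show ?thesis .
qed

text \<open>
  In the relation for \<open>j\<close> at depth \<open>n\<close>, the coefficient of \<open>g j\<close> is \<open>1\<close>. Every other nonzero
  coefficient belongs to an \<open>m\<close> with \<open>m i \<ge> s i * p ^ n\<close> for at least one \<open>i\<close> and \<open>m i = j i\<close> for
  the others; there the interpolation coefficients outweigh the growth of \<open>g m\<close> by any prescribed
  amount when \<open>n\<close> is large.
\<close>

theorem vanishing_imp_zero:
  fixes g :: "('n::finite \<Rightarrow> nat) \<Rightarrow> 'm" and u :: "'n \<Rightarrow> 'c" and h :: "'n \<Rightarrow> real" and d :: "'n \<Rightarrow> int"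
  assumes g: "in_H h C g" and u: "\<And>i. top_generator p ordp (u i)" and h: "\<And>i. h i \<ge> 0"
    and van: "\<And>b w \<epsilon> \<beta>. (\<And>i. d i \<le> w i) \<Longrightarrow> (\<And>i. w i \<le> d i + \<lfloor>h i\<rfloor>) \<Longrightarrow> (\<And>i. \<epsilon> i \<in> mu_p_inf p) \<Longrightarrow>
      (\<And>i. b i = u i powi w i * \<epsilon> i - 1) \<Longrightarrow> (\<And>i. b i \<in> alg_closure_in K) \<Longrightarrow>
      \<beta> > 0 \<Longrightarrow> (\<And>i. ereal \<beta> \<le> ordp (b i)) \<Longrightarrow> vanishes_at b g"
  shows "g j = \<zero>"
proof (rule v_all_ge_zero)
  have gM: "g n \<in> carrier M" and gb: "ereal (C - hell p h n) \<le> v (g n)" for n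
    using g by (auto simp: in_H_def)
  show "g j \<in> carrier M" by (rule gM)
  fix Z :: real
  \<comment> \<open>the amount by which the trivial bound for \<open>v (g j)\<close> falls short of \<open>Z\<close>\<close>
  define W where "W = max 0 (Z - (C - hell p h j))"
  define s where "s i = nat (\<lfloor>h i\<rfloor> + 1)" for i
  have s_int: "int (s i) = \<lfloor>h i\<rfloor> + 1" for i using h[of i] by (simp add: s_def)
  have s1: "s i \<ge> 1" for i using s_int[of i] h[of i] by linarith
  have sh: "real (s i) > h i" for i
  proof -
    have "real (s i) = real_of_int (int (s i))" by simp
    also have "\<dots> = real_of_int \<lfloor>h i\<rfloor> + 1" unfolding s_int by simp
    finally show ?thesis by linarith
  qed
  have "\<exists>c. \<forall>n m. h i * real (ell p m) \<le> real m / real (p ^ n) + h i * real n + c" for i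
    by (rule linear_le_power_bound[OF p_ge_2 h[of i]]) blast
  then obtain c where c: "\<And>i n m. h i * real (ell p m) \<le> real m / real (p ^ n) + h i * real n + c i"
    by metis
  \<comment> \<open>the gap between the number of weights and the growth rate eventually beats all constants\<close>
  have "\<exists>n. \<forall>n'\<ge>n. (real (s i) - h i) * real n' - real (s i) - 2 * real (j i) - c i \<ge> W \<and> j i < n'" for i
  proof -
    have sp: "real (s i) - h i > 0" using sh[of i] by simp
    obtain n0 :: nat where n0: "W + real (s i) + 2 * real (j i) + c i < real n0 * (real (s i) - h i)"
      using reals_Archimedean3[OF sp] by blast
    show ?thesis
    proof (intro exI[of _ "max n0 (Suc (j i))"] allI impI conjI)
      fix n' assume n': "max n0 (Suc (j i)) \<le> n'"
      then show "j i < n'" by simp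
      have "real n0 * (real (s i) - h i) \<le> real n' * (real (s i) - h i)"
        using n' sp by (intro mult_right_mono) auto
      then show "W \<le> (real (s i) - h i) * real n' - real (s i) - 2 * real (j i) - c i"
        using n0 by (simp add: mult.commute)
    qed
  qed
  then obtain n0 where n0: "\<And>i n'. n0 i \<le> n' \<Longrightarrow>
      W \<le> (real (s i) - h i) * real n' - real (s i) - 2 * real (j i) - c i \<and> j i < n'" by metis
  define n where "n = Max (range n0)"
  have "n0 i \<le> n" for i unfolding n_def by (rule Max_ge) auto
  note n = n0[OF this]
  let ?P = "p ^ n"
  have "n < 2 ^ n" by simp
  also have "(2::nat) ^ n \<le> ?P" using p_ge_2 by (rule power_mono) simp
  finally have nP: "n < ?P" .
  then have "?P \<ge> 1" by linarith
  then have P1: "real ?P \<ge> 1" by (metis of_nat_1 of_nat_le_iff)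
  have "\<exists>Br. finite (fst Br) \<and> card (fst Br) = s i * ?P \<and>
    (\<forall>x\<in>fst Br. \<exists>w \<epsilon>. d i \<le> w \<and> w < d i + int (s i) \<and> \<epsilon> \<in> mu_p_inf p \<and> x = u i powi w * \<epsilon> - 1) \<and>
    fst Br \<subseteq> alg_closure_in K \<and> (\<forall>x\<in>fst Br. ereal (1 / real ?P) \<le> ordp x) \<and>
    (\<forall>m j. snd Br m j \<in> K) \<and> (\<forall>m<s i * ?P. \<forall>j<s i * ?P. snd Br m j = (if j = m then 1 else 0)) \<and>
    (\<forall>x\<in>fst Br. \<forall>m. (\<Sum>j<s i * ?P. snd Br m j * x ^ j) = x ^ m) \<and>
    (\<forall>m j. s i * ?P \<le> m \<longrightarrow> j < s i * ?P \<longrightarrow>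
       ereal ((real m - real (s i * ?P) - real j) * (1 / real ?P) + real (s i) * real n - real j) \<le> ordp (snd Br m j))" for i
  proof -
    obtain B r where "finite B" "card B = s i * ?P"
      "\<And>x. x \<in> B \<Longrightarrow> \<exists>w \<epsilon>. d i \<le> w \<and> w < d i + int (s i) \<and> \<epsilon> \<in> mu_p_inf p \<and> x = u i powi w * \<epsilon> - 1"
      "\<And>x. x \<in> B \<Longrightarrow> x \<in> alg_closure_in K" "\<And>x. x \<in> B \<Longrightarrow> ereal (1 / real ?P) \<le> ordp x"
      "\<And>m j. r m j \<in> K" "\<And>m j. m < s i * ?P \<Longrightarrow> j < s i * ?P \<Longrightarrow> r m j = (if j = m then 1 else 0)"
      "\<And>x m. x \<in> B \<Longrightarrow> (\<Sum>j<s i * ?P. r m j * x ^ j) = x ^ m"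
      "\<And>m j. s i * ?P \<le> m \<Longrightarrow> j < s i * ?P \<Longrightarrow>
         ereal ((real m - real (s i * ?P) - real j) * (1 / real ?P) + real (s i) * real n - real j) \<le> ordp (r m j)"
      by (rule interpolation_points[OF u[of i] s1[of i], where d = "d i" and n = n]) (rule that)
    then show ?thesis by (intro exI[of _ "(B, r)"]) auto
  qed
  from choice[OF allI, OF this] obtain Br where Br: "\<forall>i. finite (fst (Br i)) \<and> card (fst (Br i)) = s i * ?P \<and>
    (\<forall>x\<in>fst (Br i). \<exists>w \<epsilon>. d i \<le> w \<and> w < d i + int (s i) \<and> \<epsilon> \<in> mu_p_inf p \<and> x = u i powi w * \<epsilon> - 1) \<and>
    fst (Br i) \<subseteq> alg_closure_in K \<and> (\<forall>x\<in>fst (Br i). ereal (1 / real ?P) \<le> ordp x) \<and>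
    (\<forall>m j. snd (Br i) m j \<in> K) \<and> (\<forall>m<s i * ?P. \<forall>j<s i * ?P. snd (Br i) m j = (if j = m then 1 else 0)) \<and>
    (\<forall>x\<in>fst (Br i). \<forall>m. (\<Sum>j<s i * ?P. snd (Br i) m j * x ^ j) = x ^ m) \<and>
    (\<forall>m j. s i * ?P \<le> m \<longrightarrow> j < s i * ?P \<longrightarrow>
       ereal ((real m - real (s i * ?P) - real j) * (1 / real ?P) + real (s i) * real n - real j) \<le> ordp (snd (Br i) m j))"
    by (rule exE)
  define B where "B i = fst (Br i)" for i
  define r where "r i = snd (Br i)" for i
  have B: "\<And>i. finite (B i)" "\<And>i. card (B i) = s i * ?P" "\<And>i. B i \<subseteq> alg_closure_in K"
    and pts: "\<And>i x. x \<in> B i \<Longrightarrow> \<exists>w \<epsilon>. d i \<le> w \<and> w < d i + int (s i) \<and> \<epsilon> \<in> mu_p_inf p \<and> x = u i powi w * \<epsilon> - 1"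
    and ordB: "\<And>i x. x \<in> B i \<Longrightarrow> ereal (1 / real ?P) \<le> ordp x"
    and rK: "\<And>i m j. r i m j \<in> K"
    and r_low: "\<And>i m j. m < s i * ?P \<Longrightarrow> j < s i * ?P \<Longrightarrow> r i m j = (if j = m then 1 else 0)"
    and r_eval: "\<And>i m x. x \<in> B i \<Longrightarrow> (\<Sum>j<s i * ?P. r i m j * x ^ j) = x ^ m"
    and r_high: "\<And>i m j. s i * ?P \<le> m \<Longrightarrow> j < s i * ?P \<Longrightarrow>
       ereal ((real m - real (s i * ?P) - real j) * (1 / real ?P) + real (s i) * real n - real j) \<le> ordp (r i m j)"
    using Br unfolding B_def r_def by blast+
  have jN: "j i < s i * ?P" for i
  proof -
    have "j i < ?P" using n[of i] nP by (simp add: less_trans)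
    also have "\<dots> \<le> s i * ?P" using s1[of i] by simp
    finally show ?thesis .
  qed
  let ?\<rho> = "\<lambda>m. \<Prod>i\<in>UNIV. r i (m i) (j i)"
  have \<rho>K: "?\<rho> m \<in> K" for m by (intro prod_mem rK)
  have rel: "has_vsum (\<lambda>m. ?\<rho> m \<odot> g m) \<zero>"
  proof (rule interpolated_relation[OF gM B rK r_eval _ jN])
    fix b :: "'n \<Rightarrow> 'c" assume b: "\<And>i. b i \<in> B i"
    have "\<exists>w. \<forall>i. \<exists>\<epsilon>. d i \<le> w i \<and> w i < d i + int (s i) \<and> \<epsilon> \<in> mu_p_inf p \<and> b i = u i powi w i * \<epsilon> - 1"
      by (rule choice) (use pts[OF b] in blast)
    then obtain w where "\<forall>i. \<exists>\<epsilon>. d i \<le> w i \<and> w i < d i + int (s i) \<and> \<epsilon> \<in> mu_p_inf p \<and> b i = u i powi w i * \<epsilon> - 1"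
      by (rule exE)
    from choice[OF this] obtain \<epsilon> where w: "\<forall>i. d i \<le> w i \<and> w i < d i + int (s i) \<and> \<epsilon> i \<in> mu_p_inf p \<and> b i = u i powi w i * \<epsilon> i - 1"
      by (rule exE)
    show "vanishes_at b g"
    proof (rule van[of w \<epsilon> b "1 / real ?P"])
      show "w i \<le> d i + \<lfloor>h i\<rfloor>" for i using spec[OF w, of i] s_int[of i] by linarith
      show "1 / real ?P > 0" using P1 by (intro divide_pos_pos) linarith+
    qed (use w B(3) b ordB in blast)+
  qed
  have "ereal (C - hell p h j + W) \<le> v (?\<rho> j \<odot> g j)"
  proof (rule has_vsum_zero_isolate[OF rel])
    show "?\<rho> m \<odot> g m \<in> carrier M" for m using \<rho>K gM by simp
    fix m :: "'n \<Rightarrow> nat" assume mj: "m \<noteq> j"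
    show "ereal (C - hell p h j + W) \<le> v (?\<rho> m \<odot> g m)"
    proof (cases "\<exists>i. m i < s i * ?P \<and> m i \<noteq> j i")
      case True
      then obtain i where "m i < s i * ?P" "m i \<noteq> j i" by blast
      then have "r i (m i) (j i) = 0" using r_low[OF _ jN] by simp
      then have z: "?\<rho> m = 0" by (intro prod_zero) auto
      show ?thesis unfolding z using v_smult[OF zero_mem gM] by (simp add: ord_0)
    next
      case False
      define T where "T = {i. s i * ?P \<le> m i}"
      have mT: "m i = j i" if "i \<notin> T" for i using False that unfolding T_def by force
      have Tne: "T \<noteq> {}" using mT mj by blast
      then obtain i0 where i0: "i0 \<in> T" by blast
      \<comment> \<open>the index \<open>i0\<close> supplies the gain \<open>W\<close>, the other indices at least compensate the growth of \<open>g m\<close>\<close>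
      define q where "q i = h i * real (ell p (m i)) - h i * real (ell p (j i)) + (if i = i0 then W else 0)" for i
      have "ereal (q i) \<le> ordp (r i (m i) (j i))" for i
      proof (cases "i \<in> T")
        case True
        then have mi: "s i * ?P \<le> m i" by (simp add: T_def)
        have "(x - y * Q - z) * (1 / Q) = x / Q - y - z / Q" if "Q \<ge> 1" for x y z Q :: real
          using that by (simp add: field_simps)
        from this[OF P1] have "(real (m i) - real (s i * ?P) - real (j i)) * (1 / real ?P)
            = real (m i) / real ?P - real (s i) - real (j i) / real ?P" unfolding of_nat_mult .
        moreover have "real (j i) / real ?P \<le> real (j i)" using P1 by (simp add: divide_le_eq mult_left_le_one_le mult_le_cancel_left1 del: of_nat_power)
        moreover have "0 \<le> h i * real (ell p (j i))" using h by simp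
        moreover have "0 \<le> W" by (simp add: W_def)
        moreover have "q i \<le> h i * real (ell p (m i)) - h i * real (ell p (j i)) + W"
          using \<open>0 \<le> W\<close> by (simp add: q_def)
        moreover have "(real (s i) - h i) * real n = real (s i) * real n - h i * real n" by (simp add: left_diff_distrib)
        ultimately have "q i \<le> (real (m i) - real (s i * ?P) - real (j i)) * (1 / real ?P) + real (s i) * real n - real (j i)"
          using c[of i "m i" n] n[of i] by linarith
        then show ?thesis using r_high[OF mi jN] by (meson ereal_less_eq(3) order_trans)
      next
        case False
        then have "q i = 0" "r i (m i) (j i) = 1" using mT[OF False] i0 r_low[OF jN jN] by (auto simp: q_def)
        then show ?thesis by (simp add: ord_1 zero_ereal_def)
      qed
      then have "ereal (\<Sum>i\<in>UNIV. q i) \<le> ordp (?\<rho> m)" by (intro ge_prod)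
      then have "ereal ((\<Sum>i\<in>UNIV. q i) + (C - hell p h m)) \<le> v (?\<rho> m \<odot> g m)"
        by (intro v_ge_smult \<rho>K gM gb)
      moreover have "(\<Sum>i\<in>UNIV. q i) = hell p h m - hell p h j + W"
        unfolding q_def hell_def by (simp add: sum.distrib sum_subtractf)
      ultimately show ?thesis by (simp add: algebra_simps)
    qed
  qed
  moreover have "?\<rho> j = 1" using r_low[OF jN jN] by simp
  ultimately have "ereal (C - hell p h j + W) \<le> v (g j)" using Mod.smult_one[OF gM] by simp
  moreover have "Z \<le> C - hell p h j + W" unfolding W_def by simp
  ultimately show "ereal Z \<le> v (g j)" by (meson ereal_less_eq(3) order_trans)
qed

end

section \<open>Finite sums of series and of functionals\<close>

context valued_module
begin

lemma in_H_zero: "in_H h 0 (\<lambda>n. \<zero>)"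
proof -
  have "v \<zero> = \<infinity>" using banach unfolding banach_space_def is_valuation_def by simp
  then show ?thesis by (simp add: in_H_def)
qed

lemma in_H_finsum:
  assumes "\<And>e. e \<in> F \<Longrightarrow> \<exists>C. in_H h C (\<phi> e)"
  shows "\<exists>C. in_H h C (\<lambda>n. \<Oplus>e\<in>F. \<phi> e n)"
  using assms
proof (induction F rule: infinite_finite_induct)
  case (insert e F)
  obtain C where C: "in_H h C (\<phi> e)" using insert.prems by blast
  obtain C' where C': "in_H h C' (\<lambda>n. \<Oplus>e\<in>F. \<phi> e n)" using insert by blast
  have "(\<Oplus>e\<in>insert e F. \<phi> e n) = \<phi> e n \<oplus> (\<Oplus>e\<in>F. \<phi> e n)" for n
    using insert by (intro Mod.M.finsum_insert) (auto simp: in_H_def)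
  then show ?case using in_H_add[OF C C'] by auto
qed (use in_H_zero in auto)

lemma conv_zero_imp_zero:
  assumes a: "\<And>n. a n \<in> K" "a \<noteq> (\<lambda>n. 0)" and g: "\<And>n. g n \<in> carrier M"
    and z: "\<And>n. conv a g n = \<zero>"
  shows "g n = \<zero>"
proof (rule ccontr)
  assume "g n \<noteq> \<zero>"
  then have ne: "{n. a n \<noteq> 0} \<noteq> {}" "{n. g n \<noteq> \<zero>} \<noteq> {}" using a(2) by auto
  obtain i k where ik: "i \<in> {n. a n \<noteq> 0}" "k \<in> {n. g n \<noteq> \<zero>}"
    "\<And>l. l \<le> (\<lambda>j. i j + k j) \<Longrightarrow> l \<in> {n. a n \<noteq> 0} \<Longrightarrow> (\<lambda>j. i j + k j) - l \<in> {n. g n \<noteq> \<zero>} \<Longrightarrow> l = i"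
    by (rule minimal_monomials[OF ne], rule that)
  let ?n = "\<lambda>j. i j + k j"
  have t: "a l \<odot> g (?n - l) = (if i = l then a i \<odot> g k else \<zero>)" if "l \<in> {..?n}" for l
  proof (cases "i = l")
    case True
    show ?thesis unfolding True[symmetric] fun_diff_cancel(4) by simp
  next
    case False
    then have "a l = 0 \<or> g (?n - l) = \<zero>" using ik(3)[of l] that by (auto simp del: minus_apply)
    then show ?thesis
    proof
      assume al: "a l = 0"
      show ?thesis unfolding al using False Mod.smult_l_null[OF g] by simp
    next
      assume gl: "g (?n - l) = \<zero>"
      show ?thesis unfolding gl using False Mod.smult_r_null[of "a l"] a(1) by simp
    qed
  qed
  have "conv a g ?n = (\<Oplus>l\<in>{..?n}. if i = l then a i \<odot> g k else \<zero>)"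
    unfolding conv_def by (rule Mod.M.finsum_cong') (use t a g in \<open>auto simp del: minus_apply\<close>)
  also have "\<dots> = a i \<odot> g k"
    by (rule Mod.M.finsum_singleton) (use a g finite_atMost_fun fun_diff_cancel(7)[of i k] in auto)
  finally have "a i \<odot> g k = \<zero>" unfolding z by (rule sym)
  moreover have "inverse (a i) \<odot> (a i \<odot> g k) = (inverse (a i) * a i) \<odot> g k"
    using Mod.smult_assoc1[of "inverse (a i)" "a i" "g k"] a(1) g inverse_mem by simp
  moreover have "inverse (a i) * a i = 1" using ik(1) by simp
  ultimately have "inverse (a i) \<odot> \<zero> = 1 \<odot> g k" by simp
  then have "g k = \<zero>"
    using Mod.smult_one[OF g[of k]] Mod.smult_r_null[of "inverse (a i)"] a(1) inverse_mem by simp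
  then show False using ik(2) by simp
qed

end

context eval_point
begin

lemma Ev_zero: "klinear K L \<mu> \<Longrightarrow> Ev \<mu> (\<lambda>n. \<zero>) = \<zero>"
proof (rule Ev_eqI)
  assume \<mu>: "klinear K L \<mu>"
  have "\<mu> (mon b n) \<odot> \<zero> = \<zero>" for n
    using klinear_K[OF \<mu> mon_L] by (intro Mod.smult_r_null) simp
  then show "has_vsum (\<lambda>n. \<mu> (mon b n) \<odot> \<zero>) \<zero>" using has_vsum_zero by simp
qed auto

lemma Ev_finsum:
  assumes \<mu>: "klinear K L \<mu>" and "\<And>e. e \<in> F \<Longrightarrow> \<exists>C. in_H h C (\<phi> e)"
  shows "Ev \<mu> (\<lambda>n. \<Oplus>e\<in>F. \<phi> e n) = (\<Oplus>e\<in>F. Ev \<mu> (\<phi> e))"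
  using assms(2)
proof (induction F rule: infinite_finite_induct)
  case (insert e F)
  obtain C where C: "in_H h C (\<phi> e)" using insert.prems by blast
  obtain C' where C': "in_H h C' (\<lambda>n. \<Oplus>e\<in>F. \<phi> e n)" using insert.prems in_H_finsum[of F h \<phi>] by blast
  have cl: "Ev \<mu> (\<phi> x) \<in> carrier M" if "x \<in> insert e F" for x
    using insert.prems[OF that] Ev_closed[OF \<mu>] by blast
  have "(\<lambda>n. \<Oplus>e\<in>insert e F. \<phi> e n) = (\<lambda>n. \<phi> e n \<oplus> (\<Oplus>e\<in>F. \<phi> e n))"
    using insert by (intro ext Mod.M.finsum_insert) (auto simp: in_H_def)
  then have "Ev \<mu> (\<lambda>n. \<Oplus>e\<in>insert e F. \<phi> e n) = Ev \<mu> (\<phi> e) \<oplus> Ev \<mu> (\<lambda>n. \<Oplus>e\<in>F. \<phi> e n)"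
    using Ev_add[OF \<mu> C C'] by simp
  also have "\<dots> = Ev \<mu> (\<phi> e) \<oplus> (\<Oplus>e\<in>F. Ev \<mu> (\<phi> e))" using insert by simp
  also have "\<dots> = (\<Oplus>e\<in>insert e F. Ev \<mu> (\<phi> e))"
    by (rule Mod.M.finsum_insert[symmetric]) (use insert.hyps cl in auto)
  finally show ?case .
qed (simp_all add: Ev_zero[OF \<mu>])

lemma klinear_zero: "klinear K L (\<lambda>x. 0)"
  unfolding klinear_def using zero_mem by simp

lemma Ev_zero_functional:
  assumes g: "in_H h C g" shows "Ev (\<lambda>x. 0) g = \<zero>"
proof (rule Ev_eqI)
  have c: "\<And>n. g n \<in> carrier M" using g by (auto simp: in_H_def)
  show "has_vsum (\<lambda>n. 0 \<odot> g n) \<zero>" using has_vsum_zero Mod.smult_l_null[OF c] by simp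
qed (use g klinear_zero in \<open>auto simp: in_H_def\<close>)

text \<open>
  Evaluation is additive in the functional, so the sum over \<open>i\<close> can be taken out of the sum over
  \<open>E\<close>.
\<close>

lemma finsum_Ev_sum_zero:
  fixes m :: nat
  assumes k: "\<And>i e. i < m \<Longrightarrow> e \<in> E \<Longrightarrow> klinear K L (\<nu> i e)" and \<phi>: "\<And>e. e \<in> E \<Longrightarrow> \<exists>C. in_H h C (\<phi> e)"
    and z: "\<And>i. i < m \<Longrightarrow> (\<Oplus>e\<in>E. Ev (\<nu> i e) (\<phi> e)) = \<zero>"
  shows "(\<forall>e\<in>E. klinear K L (\<lambda>x. \<Sum>i<m. \<nu> i e x)) \<and> (\<Oplus>e\<in>E. Ev (\<lambda>x. \<Sum>i<m. \<nu> i e x) (\<phi> e)) = \<zero>"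
  using k z
proof (induction m)
  case 0
  have "Ev (\<lambda>x. 0) (\<phi> e) = \<zero>" if "e \<in> E" for e using \<phi>[OF that] Ev_zero_functional by blast
  then have "(\<Oplus>e\<in>E. Ev (\<lambda>x. 0) (\<phi> e)) = (\<Oplus>e\<in>E. \<zero>)" by (intro Mod.M.finsum_cong') auto
  then show ?case using klinear_zero by simp
next
  case (Suc m)
  have IH: "\<And>e. e \<in> E \<Longrightarrow> klinear K L (\<lambda>x. \<Sum>i<m. \<nu> i e x)"
    "(\<Oplus>e\<in>E. Ev (\<lambda>x. \<Sum>i<m. \<nu> i e x) (\<phi> e)) = \<zero>"
    using Suc.IH Suc.prems by auto
  have km: "klinear K L (\<nu> m e)" if "e \<in> E" for e by (rule Suc.prems(1)) (use that in auto)
  have cl: "Ev (\<lambda>x. \<Sum>i<m. \<nu> i e x) (\<phi> e) \<in> carrier M" "Ev (\<nu> m e) (\<phi> e) \<in> carrier M" if "e \<in> E" for e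
    using \<phi>[OF that] Ev_closed[OF IH(1)[OF that]] Ev_closed[OF km[OF that]] by blast+
  have add: "Ev (\<lambda>x. \<Sum>i<Suc m. \<nu> i e x) (\<phi> e) = Ev (\<lambda>x. \<Sum>i<m. \<nu> i e x) (\<phi> e) \<oplus> Ev (\<nu> m e) (\<phi> e)"
    if "e \<in> E" for e using \<phi>[OF that] Ev_add_functional[OF IH(1)[OF that] km[OF that]] by auto
  have "(\<Oplus>e\<in>E. Ev (\<lambda>x. \<Sum>i<Suc m. \<nu> i e x) (\<phi> e))
      = (\<Oplus>e\<in>E. Ev (\<lambda>x. \<Sum>i<m. \<nu> i e x) (\<phi> e) \<oplus> Ev (\<nu> m e) (\<phi> e))"
    by (rule Mod.M.finsum_cong') (use add cl in auto)
  also have "\<dots> = (\<Oplus>e\<in>E. Ev (\<lambda>x. \<Sum>i<m. \<nu> i e x) (\<phi> e)) \<oplus> (\<Oplus>e\<in>E. Ev (\<nu> m e) (\<phi> e))"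
    by (rule Mod.M.finsum_addf) (use cl in auto)
  also have "\<dots> = \<zero>" unfolding IH(2) using Suc.prems(2)[of m] by simp
  finally show ?case using klinear_add[OF IH(1) km] by simp
qed

end

section \<open>Specialisations determine the elements of the tensor product\<close>

locale tensor_with_algebra = valued_module p ordp K M v + free_algebra p ordp K J E
  for p and ordp :: "'c::{alg_closed_field, field_char_0} \<Rightarrow> ereal" and K :: "'c set"
    and M :: "('c, 'm) module" (structure) and v :: "'m \<Rightarrow> ereal"
    and J :: "(('n::finite \<Rightarrow> nat) \<Rightarrow> 'c, 'j) module" and E :: "'j set" +
  fixes h :: "'n \<Rightarrow> real"
  assumes h_nonneg: "\<And>i. h i \<ge> 0"
begin

abbreviation "HH \<equiv> H_space p h M v"

lemma RR_iff: "r \<in> carrier RR \<longleftrightarrow> (\<forall>n. r n \<in> K \<and> 0 \<le> ordp (r n))"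
  by (auto simp: mps_ring_def ring_of_integers_def)

sublocale TJ: tensor_pair RR HH J
proof
  show "a \<oplus>\<^bsub>HH\<^esub> a' \<in> carrier HH" if "a \<in> carrier HH" "a' \<in> carrier HH" for a a'
    using that in_H_add unfolding H_space_iff H_space_simps by blast
  show "r \<odot>\<^bsub>HH\<^esub> a \<in> carrier HH" if "r \<in> carrier RR" "a \<in> carrier HH" for r a
    using that in_H_conv[where h = h and a = r and g = a, OF h_nonneg]
    unfolding H_space_iff H_space_simps RR_iff by blast
qed auto

lemma pt_zero_left: "c \<in> carrier J \<Longrightarrow> TJ.pt \<zero>\<^bsub>HH\<^esub> c = \<zero>\<^bsub>TJ.T\<^esub>"
proof -
  assume c: "c \<in> carrier J"
  have z: "\<zero>\<^bsub>HH\<^esub> \<in> carrier HH" unfolding H_space_iff H_space_simps using in_H_zero by blast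
  have "\<zero>\<^bsub>HH\<^esub> \<oplus>\<^bsub>HH\<^esub> \<zero>\<^bsub>HH\<^esub> = \<zero>\<^bsub>HH\<^esub>" unfolding H_space_simps by simp
  then show ?thesis using TJ.pt_add_left[OF z z c] TJ.pt_closed[OF z c] by (intro TJ.T.double_eq_self) simp_all
qed

lemma pt_zero_right: "g \<in> carrier HH \<Longrightarrow> TJ.pt g \<zero>\<^bsub>J\<^esub> = \<zero>\<^bsub>TJ.T\<^esub>"
proof -
  assume g: "g \<in> carrier HH"
  have "TJ.pt g (\<zero>\<^bsub>J\<^esub> \<oplus>\<^bsub>J\<^esub> \<zero>\<^bsub>J\<^esub>) = TJ.pt g \<zero>\<^bsub>J\<^esub> \<oplus>\<^bsub>TJ.T\<^esub> TJ.pt g \<zero>\<^bsub>J\<^esub>"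
    by (rule TJ.pt_add_right) (use g in auto)
  then show ?thesis using g by (intro TJ.T.double_eq_self) (simp_all add: TJ.pt_closed)
qed

lemma pt_finsum_right:
  assumes g: "g \<in> carrier HH" and f: "\<And>i. i \<in> I \<Longrightarrow> f i \<in> carrier J"
  shows "TJ.pt g (\<Oplus>\<^bsub>J\<^esub>i\<in>I. f i) = (\<Oplus>\<^bsub>TJ.T\<^esub>i\<in>I. TJ.pt g (f i))"
  using f
proof (induction I rule: infinite_finite_induct)
  case (insert x I)
  have f: "f \<in> I \<rightarrow> carrier J" "f x \<in> carrier J" using insert.prems by auto
  have "TJ.pt g (\<Oplus>\<^bsub>J\<^esub>i\<in>insert x I. f i) = TJ.pt g (f x \<oplus>\<^bsub>J\<^esub> (\<Oplus>\<^bsub>J\<^esub>i\<in>I. f i))"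
    using insert.hyps f by (simp add: Jd.finsum_insert)
  also have "\<dots> = TJ.pt g (f x) \<oplus>\<^bsub>TJ.T\<^esub> TJ.pt g (\<Oplus>\<^bsub>J\<^esub>i\<in>I. f i)"
    by (rule TJ.pt_add_right[OF g f(2) Jd.finsum_closed[OF f(1)]])
  also have "TJ.pt g (\<Oplus>\<^bsub>J\<^esub>i\<in>I. f i) = (\<Oplus>\<^bsub>TJ.T\<^esub>i\<in>I. TJ.pt g (f i))" using insert by simp
  also have "TJ.pt g (f x) \<oplus>\<^bsub>TJ.T\<^esub> \<dots> = (\<Oplus>\<^bsub>TJ.T\<^esub>i\<in>insert x I. TJ.pt g (f i))"
    by (rule TJ.T.finsum_insert[symmetric]) (use insert.hyps insert.prems TJ.pt_closed[OF g] in auto)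
  finally show ?case .
qed (simp_all add: pt_zero_right[OF g])

text \<open>
  Since \<open>E\<close> spans \<open>J\<close>, the coordinates of the right factor of a pure tensor can be moved to the
  left factor.
\<close>

lemma tensor_expansion:
  assumes "f \<in> carrier TJ.T"
  shows "\<exists>\<phi>. (\<forall>e\<in>E. \<phi> e \<in> carrier HH) \<and> f = (\<Oplus>\<^bsub>TJ.T\<^esub>e\<in>E. TJ.pt (\<phi> e) e)"
  using assms
proof (induction rule: TJ.T_induct)
  case zero
  have EJ: "\<And>e. e \<in> E \<Longrightarrow> e \<in> carrier J" using E_J by blast
  have "(\<Oplus>\<^bsub>TJ.T\<^esub>e\<in>E. TJ.pt \<zero>\<^bsub>HH\<^esub> e) = (\<Oplus>\<^bsub>TJ.T\<^esub>e\<in>E. \<zero>\<^bsub>TJ.T\<^esub>)"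
    by (rule TJ.T.finsum_cong') (use pt_zero_left EJ in auto)
  moreover have "\<zero>\<^bsub>HH\<^esub> \<in> carrier HH" unfolding H_space_iff H_space_simps using in_H_zero by blast
  ultimately show ?case by (intro exI[of _ "\<lambda>_. \<zero>\<^bsub>HH\<^esub>"]) simp
next
  case (minus x y)
  have EJ: "\<And>e. e \<in> E \<Longrightarrow> e \<in> carrier J" using E_J by blast
  obtain \<phi> \<psi> where \<phi>: "\<forall>e\<in>E. \<phi> e \<in> carrier HH" "x = (\<Oplus>\<^bsub>TJ.T\<^esub>e\<in>E. TJ.pt (\<phi> e) e)"
    and \<psi>: "\<forall>e\<in>E. \<psi> e \<in> carrier HH" "y = (\<Oplus>\<^bsub>TJ.T\<^esub>e\<in>E. TJ.pt (\<psi> e) e)" using minus.IH by (elim exE conjE)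
  define neg where "neg g = (\<lambda>n. \<ominus> g n)" for g :: "('n \<Rightarrow> nat) \<Rightarrow> 'm"
  have neg: "neg g \<in> carrier HH" if "g \<in> carrier HH" for g
  proof -
    obtain C where C: "in_H h C g" using \<open>g \<in> carrier HH\<close> unfolding H_space_iff by (rule exE)
    then have "v (\<ominus> g n) = v (g n)" for n by (intro v_uminus) (simp add: in_H_def)
    then have "in_H h C (neg g)" using C by (simp add: in_H_def neg_def)
    then show ?thesis unfolding H_space_iff by blast
  qed
  have pneg: "TJ.pt (neg g) e = \<ominus>\<^bsub>TJ.T\<^esub> TJ.pt g e" if g: "g \<in> carrier HH" and e: "e \<in> E" for g e
  proof (rule TJ.T.minus_equality[symmetric])
    have "neg g \<oplus>\<^bsub>HH\<^esub> g = \<zero>\<^bsub>HH\<^esub>" using g unfolding H_space_simps H_space_iff in_H_def neg_def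
      by (auto simp: Mod.M.l_neg)
    then show "TJ.pt (neg g) e \<oplus>\<^bsub>TJ.T\<^esub> TJ.pt g e = \<zero>\<^bsub>TJ.T\<^esub>"
      using TJ.pt_add_left[OF neg[OF g] g EJ[OF e]] pt_zero_left[OF EJ[OF e]] by simp
  qed (use g e neg EJ TJ.pt_closed in auto)
  have "x \<ominus>\<^bsub>TJ.T\<^esub> y = (\<Oplus>\<^bsub>TJ.T\<^esub>e\<in>E. TJ.pt (\<phi> e) e \<ominus>\<^bsub>TJ.T\<^esub> TJ.pt (\<psi> e) e)"
    unfolding \<phi>(2) \<psi>(2) by (rule TJ.T.finsum_minus[symmetric]) (use \<phi>(1) \<psi>(1) EJ TJ.pt_closed in auto)
  also have "\<dots> = (\<Oplus>\<^bsub>TJ.T\<^esub>e\<in>E. TJ.pt (\<phi> e \<oplus>\<^bsub>HH\<^esub> neg (\<psi> e)) e)"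
  proof (rule TJ.T.finsum_cong')
    fix e assume e: "e \<in> E"
    show "TJ.pt (\<phi> e) e \<ominus>\<^bsub>TJ.T\<^esub> TJ.pt (\<psi> e) e = TJ.pt (\<phi> e \<oplus>\<^bsub>HH\<^esub> neg (\<psi> e)) e"
      unfolding a_minus_def using TJ.pt_add_left[of "\<phi> e" "neg (\<psi> e)" e] pneg[of "\<psi> e" e] neg \<phi>(1) \<psi>(1) EJ e by simp
  qed (use \<phi>(1) \<psi>(1) EJ TJ.pt_closed TJ.A_add neg in auto)
  finally show ?case using \<phi>(1) \<psi>(1) neg TJ.A_add by (intro exI[of _ "\<lambda>e. \<phi> e \<oplus>\<^bsub>HH\<^esub> neg (\<psi> e)"]) simp
next
  case (pure g c)
  have EJ: "\<And>e. e \<in> E \<Longrightarrow> e \<in> carrier J" using E_J by blast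
  have r: "mcoeff (cd c e) \<in> carrier RR" if "e \<in> E" for e using cd_props(1)[OF pure(2) that] by (rule mcoeff_RR)
  have "TJ.pt g c = TJ.pt g (\<Oplus>\<^bsub>J\<^esub>e\<in>E. sm (cd c e) e)"
    using cd_props(2)[OF pure(2)] unfolding comb_def by simp
  also have "\<dots> = (\<Oplus>\<^bsub>TJ.T\<^esub>e\<in>E. TJ.pt g (sm (cd c e) e))"
    by (rule pt_finsum_right[OF pure(1)]) (use r EJ in auto)
  also have "\<dots> = (\<Oplus>\<^bsub>TJ.T\<^esub>e\<in>E. TJ.pt (mcoeff (cd c e) \<odot>\<^bsub>HH\<^esub> g) e)"
    by (rule TJ.T.finsum_cong') (use r EJ pure TJ.pt_balanced TJ.pt_closed TJ.A_smult in auto)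
  finally show ?case using r pure TJ.A_smult by (intro exI[of _ "\<lambda>e. mcoeff (cd c e) \<odot>\<^bsub>HH\<^esub> g"]) simp
qed

text \<open>
  The image of \<open>(\<Sum>e\<in>E. \<phi> e \<otimes> e) * c\<close> under \<open>id \<otimes> tr\<close>.
\<close>

definition trace_series :: "('j \<Rightarrow> ('n \<Rightarrow> nat) \<Rightarrow> 'm) \<Rightarrow> 'j \<Rightarrow> ('n \<Rightarrow> nat) \<Rightarrow> 'm" where
  "trace_series \<phi> c n = (\<Oplus>e\<in>E. conv (mcoeff (tr (e \<otimes>\<^bsub>J\<^esub> c))) (\<phi> e) n)"

lemma tr_mcoeff: "e \<in> E \<Longrightarrow> c \<in> carrier J \<Longrightarrow> mcoeff (tr (e \<otimes>\<^bsub>J\<^esub> c)) \<in> carrier RR"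
  using E_J by (intro mcoeff_RR tr_S) auto

lemma trace_term_in_H:
  assumes "e \<in> E" "c \<in> carrier J" "\<phi> e \<in> carrier HH"
  shows "\<exists>C. in_H h C (conv (mcoeff (tr (e \<otimes>\<^bsub>J\<^esub> c))) (\<phi> e))"
proof -
  obtain C where C: "in_H h C (\<phi> e)" using assms(3) unfolding H_space_iff by (rule exE)
  have "in_H h C (conv (mcoeff (tr (e \<otimes>\<^bsub>J\<^esub> c))) (\<phi> e))"
    by (rule in_H_conv[OF h_nonneg _ _ C]) (use tr_mcoeff[OF assms(1,2)] in \<open>simp_all add: RR_iff\<close>)
  then show ?thesis by (rule exI)
qed

lemma trace_series_in_H:
  assumes "c \<in> carrier J" "\<And>e. e \<in> E \<Longrightarrow> \<phi> e \<in> carrier HH"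
  shows "\<exists>C. in_H h C (trace_series \<phi> c)"
  unfolding trace_series_def[abs_def] by (rule in_H_finsum) (use trace_term_in_H assms in blast)

text \<open>
  The trace at \<open>b\<close> is the sum of the characters \<open>\<kappa>\<close> of \<open>J\<close> over \<open>b\<close>, so the value of the series is
  the sum of \<open>\<kappa>(c) * \<kappa>(f)\<close>. The value fields of these finitely many characters have to be
  contained in the field over which the value is tested.
\<close>

lemma trace_series_vanishes:
  assumes \<phi>: "\<And>e. e \<in> E \<Longrightarrow> \<phi> e \<in> carrier HH" and f: "f = (\<Oplus>\<^bsub>TJ.T\<^esub>e\<in>E. TJ.pt (\<phi> e) e)"
    and spec: "\<And>\<kappa>. \<kappa> \<in> specialisations p ordp K J u d d' \<Longrightarrow>
      specialise p ordp K M v J h \<kappa> f = \<zero>\<^bsub>base_change K M (value_field K J \<kappa>)\<^esub>"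
    and b: "\<And>i. b i = u i powi w i * \<epsilon> i - 1" "\<And>i. d i \<le> w i" "\<And>i. w i \<le> d' i" "\<And>i. \<epsilon> i \<in> mu_p_inf p"
    and alg_b: "\<And>i. b i \<in> alg_closure_in K" and \<beta>: "\<beta> > 0" "\<And>i. ereal \<beta> \<le> ordp (b i)"
    and c: "c \<in> carrier J"
  shows "vanishes_at b (trace_series \<phi> c)"
proof -
  interpret AP: algebra_point p ordp K J E b \<beta> by unfold_locales (use \<beta> in auto)
  have EJ: "\<And>e. e \<in> E \<Longrightarrow> e \<in> carrier J" using E_J by blast
  obtain m :: nat and \<kappa> where \<kappa>: "\<And>i. i < m \<Longrightarrow> AP.is_char (\<kappa> i)"
    and tr: "\<And>x. x \<in> carrier J \<Longrightarrow> AP.evm (tr x) = (\<Sum>i<m. \<kappa> i x)"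
    by (rule AP.trace_eq_sum_of_chars) (rule that)
  define Lf where "Lf i = value_field K J (\<kappa> i)" for i
  have Lf: "fdalg K (Lf i)" "\<And>x. x \<in> carrier J \<Longrightarrow> \<kappa> i x \<in> Lf i" if "i < m" for i
    using AP.value_field_fdalg[OF \<kappa>[OF that] alg_b] unfolding Lf_def by blast+
  have "\<forall>i\<in>{..<m}. \<exists>B. finite B \<and> Lf i = fdspan K B" using Lf(1) unfolding fdalg_def by blast
  from bchoice[OF this] obtain Bs where Bs: "\<forall>i\<in>{..<m}. finite (Bs i) \<and> Lf i = fdspan K (Bs i)" by (rule exE)
  define G where "G = (\<Union>i<m. Bs i)"
  have "finite G" unfolding G_def using Bs by blast
  moreover have "G \<subseteq> alg_closure_in K"
  proof
    fix x assume "x \<in> G"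
    then obtain i where i: "i < m" "x \<in> Bs i" unfolding G_def by blast
    then have "x \<in> Lf i" using Bs fdspan_superset[of "Bs i"] by blast
    then show "x \<in> alg_closure_in K" using fdalg_algebraic[OF Lf(1)[OF i(1)]] by blast
  qed
  moreover have "has_vsum (\<lambda>n. \<mu> (mon b n) \<odot> trace_series \<phi> c n) \<zero>"
    if L: "fdalg K L" and GL: "G \<subseteq> L" and bL: "range b \<subseteq> L" and \<mu>: "klinear K L \<mu>" for L \<mu>
  proof -
    interpret EP: eval_point p ordp K M v h L b \<beta> by unfold_locales (use L bL \<beta> h_nonneg in auto)
    have LfL: "Lf i \<subseteq> L" if "i < m" for i
    proof -
      have "Bs i \<subseteq> L" using that GL unfolding G_def by blast
      then show ?thesis using Bs that fdspan_least[OF fdalg_ksubspace[OF L]] by simp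
    qed
    have \<kappa>L: "\<kappa> i x \<in> L" if "i < m" "x \<in> carrier J" for i x using Lf(2)[OF that] LfL[OF that(1)] by blast
    have \<phi>H: "\<exists>C. in_H h C (\<phi> e)" if "e \<in> E" for e using \<phi>[OF that] unfolding H_space_iff .
    \<comment> \<open>the functional that tests \<open>\<kappa>\<^sub>i(c) * \<kappa>\<^sub>i(e) * \<phi> e (b)\<close>\<close>
    define \<nu> where "\<nu> i e x = \<mu> (\<kappa> i c * (\<kappa> i e * x))" for i e x
    have k\<nu>: "klinear K L (\<nu> i e)" if "i < m" "e \<in> E" for i e
      unfolding \<nu>_def by (intro EP.klinear_mult[of "\<lambda>x. \<mu> (\<kappa> i c * x)"] EP.klinear_mult[OF \<mu>] \<kappa>L c EJ that)
    have z\<nu>: "(\<Oplus>e\<in>E. EP.Ev (\<nu> i e) (\<phi> e)) = \<zero>" if i: "i < m" for i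
    proof -
      note ch = \<kappa>[OF i]
      have bX: "\<kappa> i (mps_X j \<odot>\<^bsub>J\<^esub> \<one>\<^bsub>J\<^esub>) = b j" for j by (rule AP.char_X[OF ch])
      have ev: "AP.evb r = \<kappa> i (r \<odot>\<^bsub>J\<^esub> \<one>\<^bsub>J\<^esub>)" if "r \<in> carrier RR" for r
        using AP.char_smult[OF ch that, of "\<one>\<^bsub>J\<^esub>"] AP.char_one[OF ch] by simp
      interpret SP: spec_point p ordp K M v h "Lf i" b \<beta> J "\<kappa> i" AP.evb
      proof unfold_locales
        show "b j \<in> Lf i" for j using Lf(2)[OF i, of "mps_X j \<odot>\<^bsub>J\<^esub> \<one>\<^bsub>J\<^esub>"] bX[of j] AP.mps_X_RR[OF ch, of j] by simp
        show "AP.evb r \<in> Lf i" if "r \<in> carrier RR" for r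
          unfolding ev[OF that] by (rule Lf(2)[OF i]) (use that in simp)
        show "ereal (\<beta> * real N) \<le> ordp (AP.evb r - (\<Sum>n | msize n < N. r n * mon b n))" if "r \<in> carrier RR" for r N
          by (rule AP.evb_lim) (use that in \<open>simp add: RR_iff AP.integral_series_def\<close>)
        show "b = (\<lambda>j. \<kappa> i (mps_X j \<odot>\<^bsub>J\<^esub> \<one>\<^bsub>J\<^esub>))" using bX by simp
        show "\<kappa> i (x \<oplus>\<^bsub>J\<^esub> y) = \<kappa> i x + \<kappa> i y" if "x \<in> carrier J" "y \<in> carrier J" for x y
          by (rule AP.char_add[OF ch that])
        show "\<kappa> i (r \<odot>\<^bsub>J\<^esub> x) = AP.evb r * \<kappa> i x" if "r \<in> carrier RR" "x \<in> carrier J" for r x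
          by (rule AP.char_smult[OF ch that])
      qed (use Lf[OF i] Lf_def h_nonneg \<beta> in auto)
      have "\<kappa> i \<in> specialisations p ordp K J u d d'" by (rule AP.char_specialisation[OF ch alg_b b])
      from spec[OF this] have zero: "specialise p ordp K M v J h (\<kappa> i) f = \<zero>\<^bsub>SP.V\<^esub>" unfolding Lf_def .
      have "klinear K (Lf i) (\<lambda>x. \<mu> (\<kappa> i c * x))"
        using EP.klinear_mult[OF \<mu> \<kappa>L[OF i c]] LfL[OF i] unfolding klinear_def by blast
      from SP.specialise_zero_imp[OF finE E_J \<phi> f zero this] show ?thesis unfolding \<nu>_def .
    qed
    note sum = EP.finsum_Ev_sum_zero[where \<nu> = \<nu> and m = m and E = E and \<phi> = \<phi>, OF k\<nu> \<phi>H z\<nu>]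
    have tm: "EP.Ev \<mu> (conv (mcoeff (tr (e \<otimes>\<^bsub>J\<^esub> c))) (\<phi> e)) = EP.Ev (\<lambda>x. \<Sum>i<m. \<nu> i e x) (\<phi> e)" if e: "e \<in> E" for e
    proof -
      obtain C where C: "in_H h C (\<phi> e)" using \<phi>H[OF e] by (rule exE)
      have ec: "e \<otimes>\<^bsub>J\<^esub> c \<in> carrier J" using EJ[OF e] c by simp
      let ?z = "AP.evm (tr (e \<otimes>\<^bsub>J\<^esub> c))"
      have zs: "?z = (\<Sum>i<m. \<kappa> i c * \<kappa> i e)"
        unfolding tr[OF ec] by (rule sum.cong) (use AP.char_mult[OF \<kappa> EJ[OF e] c] in \<open>simp_all add: mult.commute\<close>)
      have zL: "?z \<in> L" unfolding tr[OF ec] by (rule EP.LL.sum_mem) (use \<kappa>L ec in auto)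
      have "EP.Ev \<mu> (conv (mcoeff (tr (e \<otimes>\<^bsub>J\<^esub> c))) (\<phi> e)) = EP.Ev (\<lambda>x. \<mu> (?z * x)) (\<phi> e)"
      proof (rule EP.Ev_conv[OF \<mu> C _ _ zL])
        show "ereal (\<beta> * real N) \<le> ordp (?z - (\<Sum>n | msize n < N. mcoeff (tr (e \<otimes>\<^bsub>J\<^esub> c)) n * mon b n))" for N
          unfolding AP.evm_def by (rule AP.evb_lim) (rule AP.S_integral[OF tr_S[OF ec]])
      qed (use tr_mcoeff[OF e c] in \<open>simp_all add: RR_iff\<close>)
      also have "\<dots> = EP.Ev (\<lambda>x. \<Sum>i<m. \<nu> i e x) (\<phi> e)"
      proof (rule EP.Ev_cong)
        fix x assume x: "x \<in> L"
        have "\<mu> (\<Sum>i<m. \<kappa> i c * (\<kappa> i e * x)) = (\<Sum>i<m. \<mu> (\<kappa> i c * (\<kappa> i e * x)))"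
          by (rule klinear_sum[OF fdalg_ksubspace[OF L] \<mu>])
            (use \<kappa>L c EJ[OF e] x EP.LL.mult_mem in auto)
        then show "\<mu> (?z * x) = (\<Sum>i<m. \<nu> i e x)"
          unfolding zs \<nu>_def by (simp add: sum_distrib_right mult.assoc)
      qed
      finally show ?thesis .
    qed
    obtain C where C: "in_H h C (trace_series \<phi> c)" using trace_series_in_H[OF c \<phi>] by (rule exE)
    have "EP.Ev \<mu> (trace_series \<phi> c) = (\<Oplus>e\<in>E. EP.Ev \<mu> (conv (mcoeff (tr (e \<otimes>\<^bsub>J\<^esub> c))) (\<phi> e)))"
      unfolding trace_series_def[abs_def] by (rule EP.Ev_finsum[OF \<mu>]) (rule trace_term_in_H[OF _ c \<phi>])
    also have "\<dots> = (\<Oplus>e\<in>E. EP.Ev (\<lambda>x. \<Sum>i<m. \<nu> i e x) (\<phi> e))"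
    proof (rule Mod.M.finsum_cong')
      show "(\<lambda>e. EP.Ev (\<lambda>x. \<Sum>i<m. \<nu> i e x) (\<phi> e)) \<in> E \<rightarrow> carrier M"
        using conjunct1[OF sum] \<phi>H EP.Ev_closed by blast
    qed (use tm in auto)
    also have "\<dots> = \<zero>" by (rule conjunct2[OF sum])
    finally show ?thesis using EP.has_vsum_Ev[OF \<mu> C] by simp
  qed
  ultimately show ?thesis unfolding vanishes_at_def by (intro exI[of _ G]) blast
qed

text \<open>
  All trace pairings of \<open>f\<close> vanish by \<open>vanishing_imp_zero\<close>. Pairing with the \<open>k\<close>-th vector of a
  trace-dual basis isolates \<open>\<delta> * \<phi> k\<close>.
\<close>

theorem specialisations_determine:
  assumes f: "f \<in> carrier TJ.T" and u: "\<And>i. top_generator p ordp (u i)"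
    and spec: "\<And>\<kappa>. \<kappa> \<in> specialisations p ordp K J u d (\<lambda>i. d i + \<lfloor>h i\<rfloor>) \<Longrightarrow>
      specialise p ordp K M v J h \<kappa> f = \<zero>\<^bsub>base_change K M (value_field K J \<kappa>)\<^esub>"
  shows "f = \<zero>\<^bsub>TJ.T\<^esub>"
proof -
  have EJ: "\<And>e. e \<in> E \<Longrightarrow> e \<in> carrier J" using E_J by blast
  obtain \<phi> where \<phi>: "\<And>e. e \<in> E \<Longrightarrow> \<phi> e \<in> carrier HH" and f_eq: "f = (\<Oplus>\<^bsub>TJ.T\<^esub>e\<in>E. TJ.pt (\<phi> e) e)"
    using tensor_expansion[OF f] by blast
  obtain y \<delta> where \<delta>: "\<delta> \<in> S" "\<delta> \<noteq> 0" and y: "\<And>k. k \<in> E \<Longrightarrow> y k \<in> carrier J"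
    and dual: "\<And>e k. e \<in> E \<Longrightarrow> k \<in> E \<Longrightarrow> tr (e \<otimes>\<^bsub>J\<^esub> y k) = (if e = k then \<delta> else 0)"
    by (rule trace_dual_basis) (rule that)
  have \<delta>K: "mcoeff \<delta> n \<in> K" for n using mcoeff_RR[OF \<delta>(1)] by (simp add: RR_iff)
  have \<phi>0: "\<phi> k = \<zero>\<^bsub>HH\<^esub>" if k: "k \<in> E" for k
  proof -
    have \<phi>M: "\<phi> e n \<in> carrier M" if "e \<in> E" for e n using \<phi>[OF that] by (auto simp: H_space_iff in_H_def)
    obtain C where C: "in_H h C (trace_series \<phi> (y k))" using trace_series_in_H[OF y[OF k] \<phi>] by (rule exE)
    have z: "trace_series \<phi> (y k) n = \<zero>" for n
    proof (rule vanishing_imp_zero[OF C u h_nonneg, where d = d])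
      fix b w \<epsilon> \<beta>
      assume "\<And>i. d i \<le> w i" "\<And>i. w i \<le> d i + \<lfloor>h i\<rfloor>" "\<And>i. \<epsilon> i \<in> mu_p_inf p" "\<And>i. b i = u i powi w i * \<epsilon> i - 1"
        "\<And>i. b i \<in> alg_closure_in K" "\<beta> > 0" "\<And>i. ereal \<beta> \<le> ordp (b i)"
      then show "vanishes_at b (trace_series \<phi> (y k))"
        by (intro trace_series_vanishes[OF \<phi> f_eq spec _ _ _ _ _ _ _ y[OF k], where \<beta> = \<beta>])
    qed
    have conv0: "conv (mcoeff 0) (\<phi> e) n = \<zero>" if e: "e \<in> E" for e n
    proof -
      have "conv (mcoeff 0) (\<phi> e) n = (\<Oplus>i\<in>{..n}. \<zero>)"
        unfolding conv_def by (rule Mod.M.finsum_cong') (use Mod.smult_l_null[OF \<phi>M[OF e]] in auto)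
      then show ?thesis by simp
    qed
    have conv\<delta>: "conv (mcoeff \<delta>) (\<phi> k) n = \<zero>" for n
    proof -
      have cl: "conv (mcoeff \<delta>) (\<phi> k) n \<in> carrier M" by (rule conv_closed) (use \<delta>K \<phi>M k in auto)
      have "trace_series \<phi> (y k) n = (\<Oplus>e\<in>E. if k = e then conv (mcoeff \<delta>) (\<phi> k) n else \<zero>)"
        unfolding trace_series_def by (rule Mod.M.finsum_cong') (use dual[OF _ k] conv0 cl in auto)
      also have "\<dots> = conv (mcoeff \<delta>) (\<phi> k) n"
        by (rule Mod.M.finsum_singleton) (use k finE cl in auto)
      finally show ?thesis using z by simp
    qed
    have "\<phi> k n = \<zero>" for n
    proof (rule conv_zero_imp_zero[where a = "mcoeff \<delta>" and g = "\<phi> k"])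
      show "mcoeff \<delta> \<noteq> (\<lambda>n. 0)"
      proof
        assume "mcoeff \<delta> = (\<lambda>n. 0)"
        then have "\<delta> = 0" by (intro mps_eqI) simp
        then show False using \<delta>(2) by blast
      qed
    qed (use \<delta>K \<phi>M k conv\<delta> in auto)
    then show ?thesis unfolding H_space_simps by (rule ext)
  qed
  have "f = (\<Oplus>\<^bsub>TJ.T\<^esub>e\<in>E. \<zero>\<^bsub>TJ.T\<^esub>)"
    unfolding f_eq by (rule TJ.T.finsum_cong') (use \<phi>0 pt_zero_left EJ in auto)
  then show ?thesis by simp
qed

end

theorem theorem5p1:
  fixes p :: nat
    and ordp :: "'c::{alg_closed_field, field_char_0} \<Rightarrow> ereal"
    and K :: "'c set"
    and M :: "('c, 'm) module" and v :: "'m \<Rightarrow> ereal"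
    and J :: "(('n::finite \<Rightarrow> nat) \<Rightarrow> 'c, 'j) module"
    and u :: "'n \<Rightarrow> 'c" and h :: "'n \<Rightarrow> real" and d :: "'n \<Rightarrow> int"
    and f :: "((('n \<Rightarrow> nat) \<Rightarrow> 'm) \<times> 'j \<Rightarrow>\<^sub>0 int) set"
  defines "R \<equiv> mps_ring (ring_of_integers ordp K)"
    and "H \<equiv> H_space p h M v"
  assumes "Factorial_Ring.prime p"
    and "is_Cp p ordp"
    and "subfield K (sub_field_of UNIV)"
    and "val_complete (sub_field_of K) ordp"
    and "\<forall>i. top_generator p ordp (u i)"
    and "\<forall>i. \<exists>x\<in>ring_of_integers ordp K - {0}. ordp x = ereal (h i)"
    and "banach_space ordp K M v"
    and "Module.algebra R J" and "domain J" and "finite_free R J"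
    and "f \<in> carrier (tensor R H J)"
    and "\<forall>\<kappa>\<in>specialisations p ordp K J u d (\<lambda>i. d i + \<lfloor>h i\<rfloor>).
           specialise p ordp K M v J h \<kappa> f =
             \<zero>\<^bsub>base_change K M (value_field K J \<kappa>)\<^esub>"
  shows "f = \<zero>\<^bsub>tensor R H J\<^esub>"
proof -
  note hyps = assms(3-)
  have KF: "subfield K (sub_field_of (UNIV :: 'c set))" by (rule hyps(3))
  have K: "subring_of K"
  proof
    have SK: "Subrings.subring K (sub_field_of (UNIV :: 'c set))" by (rule subfieldE(1)[OF KF])
    show "0 \<in> K" using subringE(2)[OF SK] by simp
    show "1 \<in> K" using subringE(3)[OF SK] by simp
    show "x + y \<in> K" if "x \<in> K" "y \<in> K" for x y using subringE(7)[OF SK that] by simp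
    show "x - y \<in> K" if "x \<in> K" "y \<in> K" for x y
      using subringE(7)[OF SK that(1) subringE(5)[OF SK that(2)]] by (simp add: sub_field_of_inv[OF subring_of_UNIV])
    show "x * y \<in> K" if "x \<in> K" "y \<in> K" for x y using subringE(6)[OF SK that] by simp
  qed
  have inv: "inverse x \<in> K" if x: "x \<in> K" for x
  proof (cases "x = 0")
    case False
    then have "x \<in> Units (sub_field_of (UNIV :: 'c set) \<lparr> carrier := K \<rparr>)"
      using subfield.subfield_Units[OF KF] x by simp
    then obtain y where "y \<in> K" "y * x = 1" by (auto simp: Units_def)
    then have "inverse x = y" by (intro inverse_unique) (simp add: mult.commute)
    then show ?thesis using \<open>y \<in> K\<close> by simp
  qed (use x in simp)
  interpret complete_subfield p ordp K
  proof -
    interpret K: subring_of K by (rule K)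
    show "complete_subfield p ordp K"
      by unfold_locales (fact hyps inv)+
  qed
  obtain E where fE: "finite E \<and> E \<subseteq> carrier J \<and>
      (\<forall>x\<in>carrier J. \<exists>!a. a \<in> E \<rightarrow>\<^sub>E carrier R \<and> x = (\<Oplus>\<^bsub>J\<^esub>e\<in>E. a e \<odot>\<^bsub>J\<^esub> e))"
    using hyps(10) unfolding finite_free_def by (rule exE)
  note E = conjunct1[OF fE] conjunct1[OF conjunct2[OF fE]] bspec[OF conjunct2[OF conjunct2[OF fE]]]
  have h: "h i \<ge> 0" for i
  proof -
    obtain x where "x \<in> ring_of_integers ordp K" "ordp x = ereal (h i)" using hyps(6) by blast
    then show ?thesis by (simp add: ring_of_integers_def zero_ereal_def)
  qed
  interpret tensor_with_algebra p ordp K M v J E h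
  proof (intro tensor_with_algebra.intro tensor_with_algebra_axioms.intro)
    show "valued_module p ordp K M v"
      by (intro valued_module.intro valued_module_axioms.intro complete_subfield_axioms hyps(7))
    show "free_algebra p ordp K J E"
      by (intro free_algebra.intro free_algebra_axioms.intro complete_subfield_axioms
          hyps(8)[unfolded R_def] hyps(9) E(1,2) E(3)[unfolded R_def])
  qed (rule h)
  show ?thesis unfolding R_def H_def
  proof (rule specialisations_determine[where u = u and d = d])
    show "f \<in> carrier TJ.T" using hyps(11) unfolding R_def H_def .
  qed (use hyps(5,12) in blast)+
qed

end
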